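(* Let $n\ge 2$, let $\phi$ be a root of $\mathfrak{sl}(n,\mathbb{R})$, $\mathfrak{v}\in\mathfrak{u}_\phi\cap\mathfrak{G}^1$ and $\mathfrak{a}\in\mathfrak{u}_{-\phi}\cap\mathfrak{G}^1$. For any $s\ge 0$, any $\sigma\in[0,s+1/2)$ and any $C>0$ there exists $\delta>0$ such that for every $t\in\mathbb{R}$ with $|t|\ge\delta$ and each choice of sign $\pm$, there are smooth vectors $f,g$ in $\mathrm{Ind}_P^{SL(n,\mathbb{R})}(\lambda_t^{\pm})$ with $\pi(\exp\mathfrak{v})f-f=g$ and $$\|(I-\mathfrak{a}^2)^{s/2}f\|>C\|g\|_{s+\sigma}.$$
   Context: $\mathfrak{G}=\mathfrak{sl}(n,\mathbb{R})$ with a fixed inner product; $\mathfrak{G}^1$ is its set of unit vectors; $\mathfrak{u}_\psi$ denotes the root space of a root $\psi$ (relative to the diagonal Cartan subalgebra). $P$ is the maximal parabolic subgroup of $SL(n,\mathbb{R})$ stabilizing the line $\mathbb{R}e_1$, i.e. matrices $\begin{pmatrix}a&v\\0&\mathcal{A}\end{pmatrix}$ with $a\in\mathbb{R}\setminus\{0\}$, $v^\tau\in\mathbb{R}^{n-1}$, $\mathcal{A}\in GL(n-1,\mathbb{R})$. For $t\in\mathbb{R}$, $\lambda_t^{\pm}$ is the unitary character of $P$ given by $\lambda_t^\pm\begin{pmatrix}a&v\\0&\mathcal{A}\end{pmatrix}=\varepsilon^\pm(a)|a|^{t\sqrt{-1}}$, with $\varepsilon^+(a)=1$, $\varepsilon^-(a)=\mathrm{sgn}(a)$.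 $\mathrm{Ind}_P^{SL(n,\mathbb{R})}(\lambda_t^\pm)$ is the (normalized) unitarily induced representation, denoted $\pi$. Sobolev norms $\|\cdot\|_r$ are defined with respect to a fixed basis $\{Y_j\}$ of $\mathfrak{G}$: $\|v\|_k^2=\|v\|^2+\sum_{1\le m\le k}\sum\|Y_{j_1}\cdots Y_{j_m}v\|^2$ for integer $k$, interpolation for non-integer orders; smooth vectors are those in all Sobolev spaces. $\mathfrak{a}$ acts by the (skew-adjoint) derived representation, so $I-\mathfrak{a}^2$ is a positive operator. *)

theory Defs
  imports "HOL-Analysis.Analysis"
begin

type_synonym 'n mat = "real^'n^'n"

definition sl :: "'n::finite mat set" where
  "sl = {X. trace X = 0}"

definition cartan :: "'n::finite mat set" where
  "cartan = {H. H \<in> sl \<and> (\<forall>i j. i \<noteq> j \<longrightarrow> H$i$j = 0)}"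

definition root_space :: "('n::finite mat \<Rightarrow> real) \<Rightarrow> 'n mat set" where
  "root_space \<phi> = {X \<in> sl. \<forall>H\<in>cartan. H ** X - X ** H = \<phi> H *\<^sub>R X}"

definition is_root :: "('n::finite mat \<Rightarrow> real) \<Rightarrow> bool" where
  "is_root \<phi> \<longleftrightarrow>
     (\<forall>H\<in>cartan. \<forall>K\<in>cartan. \<forall>c. \<phi> (H + K) = \<phi> H + \<phi> K \<and> \<phi> (c *\<^sub>R H) = c * \<phi> H)
     \<and> (\<exists>H\<in>cartan. \<phi> H \<noteq> 0) \<and> (\<exists>X\<in>root_space \<phi>. X \<noteq> 0)"

definition sl_inner :: "('n::finite mat \<Rightarrow> 'n mat \<Rightarrow> real) \<Rightarrow> bool" where
  "sl_inner ip \<longleftrightarrow>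
     (\<forall>X\<in>sl. \<forall>Y\<in>sl. ip X Y = ip Y X) \<and>
     (\<forall>X\<in>sl. \<forall>Y\<in>sl. \<forall>Z\<in>sl. \<forall>c. ip (X + Y) Z = ip X Z + ip Y Z \<and> ip (c *\<^sub>R X) Z = c * ip X Z) \<and>
     (\<forall>X\<in>sl. X \<noteq> 0 \<longrightarrow> ip X X > 0)"

definition sl_basis :: "'n::finite mat set \<Rightarrow> bool" where
  "sl_basis B \<longleftrightarrow> B \<subseteq> sl \<and> independent B \<and> span B = sl"

fun mpow :: "'n::finite mat \<Rightarrow> nat \<Rightarrow> 'n mat" where
  "mpow X 0 = mat 1"
| "mpow X (Suc k) = X ** mpow X k"

definition mexp :: "'n::finite mat \<Rightarrow> 'n mat" where
  "mexp X = (\<Sum>k. (1 / fact k) *\<^sub>R mpow X k)"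

text \<open>Model: sections of the induced bundle are identified (via g \<mapsto> g e_1) with functions
  f on R^n - {0} with f(c x) = eps(c) |c|^(-n/2) |c|^(-i t) f(x); the group acts by
  (pi(g) f)(x) = f(g^{-1} x). The Hilbert norm is the L^2 norm over the unit sphere,
  written as a weighted integral over R^n (weight 2|x|^2 e^{-|x|^2}, whose radial part
  integrates to 1 against dr/r).  The boolean pm = True means the sign +.\<close>

definition eps_sign :: "bool \<Rightarrow> real \<Rightarrow> real" where
  "eps_sign pm c = (if pm then 1 else sgn c)"

definition wt :: "real^'n::finite \<Rightarrow> real" where
  "wt x = 2 * (norm x)\<^sup>2 * exp (- (norm x)\<^sup>2)"

definition hnorm2 :: "(real^'n::finite \<Rightarrow> complex) \<Rightarrow> ennreal" where
  "hnorm2 f = (\<integral>\<^sup>+ x. ennreal ((cmod (f x))\<^sup>2 * wt x) \<partial>lborel)"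

definition ind_space :: "bool \<Rightarrow> real \<Rightarrow> (real^'n::finite \<Rightarrow> complex) set" where
  "ind_space pm t = {f. f \<in> borel_measurable borel \<and>
     (\<forall>c x. c \<noteq> 0 \<longrightarrow> x \<noteq> 0 \<longrightarrow>
        f (c *\<^sub>R x) = complex_of_real (eps_sign pm c * \<bar>c\<bar> powr (- real CARD('n) / 2))
                        * cis (- t * ln \<bar>c\<bar>) * f x) \<and>
     hnorm2 f < \<infinity>}"

definition pi_exp :: "'n::finite mat \<Rightarrow> (real^'n \<Rightarrow> complex) \<Rightarrow> (real^'n \<Rightarrow> complex)" where
  "pi_exp X f = (\<lambda>x. f (mexp (- X) *v x))"

definition lie_deriv :: "'n::finite mat \<Rightarrow> (real^'n \<Rightarrow> complex) \<Rightarrow> (real^'n \<Rightarrow> complex) \<Rightarrow> bool" where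
  "lie_deriv X f h \<longleftrightarrow> h \<in> borel_measurable borel \<and>
     ((\<lambda>r. hnorm2 (\<lambda>x. (pi_exp (r *\<^sub>R X) f x - f x) / complex_of_real r - h x)) \<longlongrightarrow> 0) (at 0)"

inductive iter_deriv :: "'n::finite mat list \<Rightarrow> (real^'n \<Rightarrow> complex) \<Rightarrow> (real^'n \<Rightarrow> complex) \<Rightarrow> bool" where
  "iter_deriv [] f f"
| "iter_deriv Ys f h' \<Longrightarrow> lie_deriv Y h' h \<Longrightarrow> iter_deriv (Y # Ys) f h"

definition sob_int2 :: "bool \<Rightarrow> real \<Rightarrow> 'n::finite mat set \<Rightarrow> nat \<Rightarrow> (real^'n \<Rightarrow> complex) \<Rightarrow> ennreal" where
  "sob_int2 pm t B k v =
     (if v \<in> ind_space pm t \<and>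
         (\<forall>Ys. length Ys \<le> k \<and> set Ys \<subseteq> B \<longrightarrow> (\<exists>h. iter_deriv Ys v h \<and> hnorm2 h < \<infinity>))
      then hnorm2 v + (\<Sum>Ys\<in>{Ys. 1 \<le> length Ys \<and> length Ys \<le> k \<and> set Ys \<subseteq> B}.
                          hnorm2 (SOME h. iter_deriv Ys v h))
      else \<infinity>)"

text \<open>Non-integer orders: real interpolation (K-method with exponent 2, quadratic K-functional)
  between consecutive integer orders.\<close>
definition K2 :: "bool \<Rightarrow> real \<Rightarrow> 'n::finite mat set \<Rightarrow> nat \<Rightarrow> real \<Rightarrow> (real^'n \<Rightarrow> complex) \<Rightarrow> ennreal" where
  "K2 pm t B k \<tau> v = Inf {sob_int2 pm t B k v0 + ennreal (\<tau>\<^sup>2) * sob_int2 pm t B (Suc k) v1 | v0 v1.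
        v0 \<in> ind_space pm t \<and> v1 \<in> ind_space pm t \<and> hnorm2 (\<lambda>x. v x - (v0 x + v1 x)) = 0}"

definition sob2 :: "bool \<Rightarrow> real \<Rightarrow> 'n::finite mat set \<Rightarrow> real \<Rightarrow> (real^'n \<Rightarrow> complex) \<Rightarrow> ennreal" where
  "sob2 pm t B r v =
     (if r = of_int \<lfloor>r\<rfloor> then sob_int2 pm t B (nat \<lfloor>r\<rfloor>) v
      else (\<integral>\<^sup>+ \<tau>. indicator {0<..} \<tau> *
               ennreal (\<tau> powr (- 2 * (r - of_int \<lfloor>r\<rfloor>) - 1)) * K2 pm t B (nat \<lfloor>r\<rfloor>) \<tau> v \<partial>lborel))"

definition smooth_vec :: "bool \<Rightarrow> real \<Rightarrow> 'n::finite mat set \<Rightarrow> (real^'n \<Rightarrow> complex) \<Rightarrow> bool" where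
  "smooth_vec pm t B v \<longleftrightarrow> v \<in> ind_space pm t \<and> (\<forall>k. sob_int2 pm t B k v < \<infinity>)"

text \<open>For s > 0, (I - a^2)^{-s/2} = integral of G_s(r) pi(exp(r a)) dr with the Bessel kernel
  G_s(r) = 1/Gamma(s/2) * int_0^oo u^(s/2-1) e^{-u} (4 pi u)^{-1/2} e^{-r^2/(4u)} du.\<close>
definition bessel_kernel :: "real \<Rightarrow> real \<Rightarrow> real" where
  "bessel_kernel s r = (1 / Gamma (s / 2)) *
     enn2real (\<integral>\<^sup>+ u. indicator {0<..} u *
        ennreal (u powr (s / 2 - 1) * exp (- u) * (4 * pi * u) powr (- 1 / 2) * exp (- r\<^sup>2 / (4 * u))) \<partial>lborel)"

definition bessel_op :: "real \<Rightarrow> 'n::finite mat \<Rightarrow> (real^'n \<Rightarrow> complex) \<Rightarrow> (real^'n \<Rightarrow> complex)" where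
  "bessel_op s a h = (\<lambda>x. \<integral> r. complex_of_real (bessel_kernel s r) * pi_exp (r *\<^sub>R a) h x \<partial>lborel)"

text \<open>apow_norm pm t s a f N  means  N = norm of (I - a^2)^{s/2} f  (f in its domain).\<close>
definition apow_norm :: "bool \<Rightarrow> real \<Rightarrow> real \<Rightarrow> 'n::finite mat \<Rightarrow> (real^'n \<Rightarrow> complex) \<Rightarrow> real \<Rightarrow> bool" where
  "apow_norm pm t s a f N \<longleftrightarrow>
     (if s = 0 then ennreal (N\<^sup>2) = hnorm2 f \<and> N \<ge> 0
      else (\<exists>h\<in>ind_space pm t. hnorm2 (\<lambda>x. f x - bessel_op s a h x) = 0 \<and>
                               ennreal (N\<^sup>2) = hnorm2 h \<and> N \<ge> 0))"

end

theory Submission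
  imports Defs "HOL-Probability.Distributions" "HOL-Probability.Distribution_Functions" "HOL-Real_Asymp.Real_Asymp"
begin

text \<open>Write \<open>v = \<alpha> E\<^sub>i\<^sub>j\<close> and \<open>a = \<beta> E\<^sub>j\<^sub>i\<close>. In the chart \<open>x\<^sub>j = 1\<close> with \<open>w = x\<^sub>i\<close>, \<open>exp v\<close> acts by the
  translation \<open>w \<mapsto> w - \<alpha>\<close>, so \<open>f = cis(- sgn t \<omega> w) H(w)\<close> with \<open>\<omega> = 2\<pi>/\<bar>\<alpha>\<bar>\<close> has a coboundary that only involves \<open>H'\<close>.
  Take \<open>H' = c b - k\<close> with \<open>b\<close> a fixed bump and \<open>k\<close> a resonant chirp at \<open>w \<sim> \<bar>t\<bar>\<close> of total integral \<open>c\<close>, which stationary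
  phase bounds away from \<open>0\<close>. Then \<open>H = c\<close> on an interval of length of order \<open>\<bar>t\<bar>\<close>. Every Lie derivative of \<open>g\<close> costs only
  a factor \<open>\<bar>t\<bar>\<close>, because \<open>b\<close> is fixed and the chirp is nearly invariant under \<open>w d/dw + it\<close>, whereas \<open>a\<close> acts
  on \<open>f\<close> in the plateau of \<open>H\<close> with size \<open>\<bar>t\<bar>\<^sup>2\<close>. The lower bound for \<open>(I - a\<^sup>2)\<^sup>s\<^sup>/\<^sup>2 f\<close> follows by testing \<open>f\<close> against
  \<open>(I - a\<^sup>2)\<^sup>p K\<close> with \<open>K\<close> supported in the plateau, where \<open>m\<close> applications of Cauchy-Schwarz reduce
  \<open>(I - a\<^sup>2)\<^sup>p\<^sup>-\<^sup>s\<^sup>/\<^sup>2 K\<close> to integral powers.\<close>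

section \<open>Roots, root vectors and the matrix exponential\<close>

text \<open>What shapes the construction is that \<open>H\<close> has compact support only if the
  integral of \<open>H'\<close> vanishes, so the mass of the bump must be given back at the far end
  of the plateau, where w is of order |t|. A slowly varying profile with the phase
  \<open>cis (- (sgn t * \<omega>) * w)\<close> would lose |t|^2 there under w (w d/dw + i t), the
  part of the action that comes from the entry (j, i). The phase \<open>cis (- t * ln w)\<close> is
  exempt: together with the radial factor it is a function of x_i alone, and a does not move x_i. It
  carries mass against the other phase only through the resonance at w = |t| / \<omega>. Count of
  exponents, with T = |t|, L = 2^m and h = (I - a^2)^(s/2) f: T^(1/2) for K, T^(4 p + 1/2) for (I -
  a^2)^p K and at least T^(4 p + 1) for its pairing with f leave T^(4 p + L / 2) as lower bound for
  the L-th power of the norm of h. When 2 p comes close to L s, this is nearly T^(2 s + 1/2) for h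
  itself, against T^(s + \<sigma>) for g; hence the condition on \<sigma>.\<close>

definition eunit :: "'n::finite \<Rightarrow> 'n \<Rightarrow> 'n mat" where
  "eunit a b = (\<chi> p q. if p = a \<and> q = b then 1 else 0)"

lemma eunit_nth [simp]: "eunit a b $ p $ q = (if p = a \<and> q = b then 1 else 0)"
  by (simp add: eunit_def)

lemma eunit_mult_vec: "eunit a b *v x = x $ b *\<^sub>R axis a 1"
proof -
  have "(eunit a b *v x) $ p = (x $ b *\<^sub>R axis a 1) $ p" for p
  proof (cases "p = a")
    case True
    then show ?thesis
      by (simp add: matrix_vector_mult_def axis_def if_distrib[of "\<lambda>z. z * _"] cong: if_cong)
  next
    case False
    then show ?thesis by (simp add: matrix_vector_mult_def axis_def)
  qed
  then show ?thesis by (simp add: vec_eq_iff)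
qed

lemma diag_commutator:
  fixes H X :: "'n::finite mat"
  assumes "\<forall>i j. i \<noteq> j \<longrightarrow> H$i$j = 0"
  shows "(H ** X - X ** H) $ a $ b = (H$a$a - H$b$b) * X$a$b"
proof -
  have "(\<Sum>k\<in>UNIV. H$a$k * X$k$b) = H$a$a * X$a$b"
    using assms by (subst sum.remove[of _ a]) (auto intro!: sum.neutral)
  moreover have "(\<Sum>k\<in>UNIV. X$a$k * H$k$b) = X$a$b * H$b$b"
    using assms by (subst sum.remove[of _ b]) (auto intro!: sum.neutral)
  ultimately show ?thesis
    by (simp add: matrix_matrix_mult_def algebra_simps)
qed

lemma root_space_entry:
  assumes "X \<in> root_space \<phi>" "X$a$b \<noteq> 0" "H \<in> cartan"
  shows "\<phi> H = H$a$a - H$b$b"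
proof -
  have "H ** X - X ** H = \<phi> H *\<^sub>R X" "\<forall>i j. i \<noteq> j \<longrightarrow> H$i$j = 0"
    using assms by (auto simp: root_space_def cartan_def)
  then have "(H$a$a - H$b$b) * X$a$b = \<phi> H * X$a$b"
    using diag_commutator[of H X a b] by (metis vector_scaleR_component real_scaleR_def)
  then show ?thesis using assms(2) by (metis mult_right_cancel)
qed

lemma coroot_in_cartan:
  assumes "i \<noteq> j"
  shows "eunit i i - eunit j j \<in> cartan"
  using assms by (auto simp: cartan_def sl_def trace_def sum_subtractf)

text \<open>A nonzero entry (i, j) of v forces \<phi> H = H_ii - H_jj on the Cartan subalgebra, and
  i = j is impossible because \<phi> does not vanish there. On the coroot
  \<open>eunit i i - eunit j j\<close> the root then takes the value 2, and H_kk - H_ll = 2 holds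
  for this element only when k = i and l = j. A single test element thus excludes every other entry
  of v and, with the value - 2, every entry of a except (j, i).\<close>

lemma root_vectors:
  fixes v a :: "'n::finite mat"
  assumes "is_root \<phi>" "v \<in> root_space \<phi>" "v \<noteq> 0"
    and "a \<in> root_space (\<lambda>H. - \<phi> H)" "a \<noteq> 0"
  obtains i j \<alpha> \<beta> where "i \<noteq> j" "\<alpha> \<noteq> 0" "\<beta> \<noteq> 0" "v = \<alpha> *\<^sub>R eunit i j" "a = \<beta> *\<^sub>R eunit j i"
proof -
  obtain i j where ij: "v$i$j \<noteq> 0"
    using assms(3) by (auto simp: vec_eq_iff)
  have ne: "i \<noteq> j"
  proof
    assume "i = j"
    then have "\<phi> H = 0" if "H \<in> cartan" for H
      using root_space_entry[OF assms(2) ij that] by simp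
    then show False using assms(1) by (auto simp: is_root_def)
  qed
  let ?H = "eunit i i - eunit j j"
  have \<phi>H: "\<phi> ?H = 2"
    using root_space_entry[OF assms(2) ij coroot_in_cartan[OF ne]] ne by simp
  have v: "v$k$l = 0" if "\<not> (k = i \<and> l = j)" for k l
  proof (rule ccontr)
    assume "v$k$l \<noteq> 0"
    from root_space_entry[OF assms(2) this coroot_in_cartan[OF ne]] show False
      using that \<phi>H ne by (simp split: if_splits)
  qed
  have a: "a$k$l = 0" if "\<not> (k = j \<and> l = i)" for k l
  proof (rule ccontr)
    assume "a$k$l \<noteq> 0"
    from root_space_entry[OF assms(4) this coroot_in_cartan[OF ne]] show False
      using that \<phi>H ne by (simp split: if_splits)
  qed
  have "v = v$i$j *\<^sub>R eunit i j" "a = a$j$i *\<^sub>R eunit j i"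
    using v a by (auto simp: vec_eq_iff)
  moreover from this have "a$j$i \<noteq> 0" using assms(5) by auto
  ultimately show ?thesis using that ne ij by blast
qed

lemma sl_inner_unit_nonzero:
  fixes v :: "'n::finite mat"
  assumes "sl_inner ip" "v \<in> sl" "ip v v = 1"
  shows "v \<noteq> 0"
proof
  assume "v = 0"
  have "(0::'n mat) \<in> sl" by (simp add: sl_def trace_def)
  then have "ip (0 *\<^sub>R 0) 0 = 0 * ip (0::'n mat) 0"
    using assms(1) unfolding sl_inner_def by blast
  then show False using assms(3) \<open>v = 0\<close> by simp
qed

section \<open>The matrix exponential through its entries\<close>

lemma mpow_bound: "\<exists>K\<ge>0. \<forall>k a b. \<bar>mpow X k $ a $ b\<bar> \<le> K ^ k" for X :: "'n::finite mat"
proof -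
  define K where "K = (\<Sum>a\<in>UNIV. \<Sum>b\<in>UNIV. \<bar>X$a$b\<bar>)"
  have K0: "K \<ge> 0" by (simp add: K_def sum_nonneg)
  have row: "(\<Sum>b\<in>UNIV. \<bar>X$a$b\<bar>) \<le> K" for a
    unfolding K_def by (rule member_le_sum[of a UNIV "\<lambda>a. \<Sum>b\<in>UNIV. \<bar>X$a$b\<bar>"]) (auto simp: sum_nonneg)
  have "\<forall>a b. \<bar>mpow X k $ a $ b\<bar> \<le> K ^ k" for k
  proof (induction k)
    case 0
    then show ?case by (simp add: mat_def)
  next
    case (Suc k)
    have "\<bar>mpow X (Suc k) $ a $ b\<bar> \<le> K ^ Suc k" for a b
    proof -
      have "\<bar>mpow X (Suc k) $ a $ b\<bar> \<le> (\<Sum>c\<in>UNIV. \<bar>X$a$c\<bar> * \<bar>mpow X k $ c $ b\<bar>)"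
        by (simp add: matrix_matrix_mult_def abs_mult[symmetric] sum_abs)
      also have "\<dots> \<le> (\<Sum>c\<in>UNIV. \<bar>X$a$c\<bar> * K ^ k)"
        using Suc by (intro sum_mono mult_left_mono) auto
      also have "\<dots> \<le> K * K ^ k"
        unfolding sum_distrib_right[symmetric] using row K0 by (intro mult_right_mono) auto
      finally show ?thesis by simp
    qed
    then show ?case by blast
  qed
  then show ?thesis using K0 by blast
qed

lemma mpow_scale: "mpow (r *\<^sub>R X) k = r ^ k *\<^sub>R mpow X k"
  by (induction k) (simp_all add: matrix_scalar_ac scalar_matrix_assoc[symmetric] mult.commute)

lemma mexp_summable: "summable (\<lambda>k. mpow X k $ a $ b / fact k * r ^ k)" for X :: "'n::finite mat" and r :: real
proof -
  obtain K where K: "K \<ge> 0" "\<And>k a b. \<bar>mpow X k $ a $ b\<bar> \<le> K ^ k" using mpow_bound by metis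
  show ?thesis
  proof (rule summable_comparison_test')
    show "summable (\<lambda>k. (K * \<bar>r\<bar>) ^ k /\<^sub>R fact k)"
      using summable_exp_generic[of "K * \<bar>r\<bar>"] by simp
    show "norm (mpow X k $ a $ b / fact k * r ^ k) \<le> (K * \<bar>r\<bar>) ^ k /\<^sub>R fact k" for k
      using mult_right_mono[OF K(2)[of k a b], of "\<bar>r\<bar> ^ k / fact k"]
      by (simp add: abs_mult power_mult_distrib power_abs field_simps)
  qed
qed

text \<open>Reduces the series of matrices to one scalar power series in r per entry, so that the
  termwise differentiation in \<open>mexp_entry_deriv\<close> is the classical one.\<close>

lemma mexp_nth: "mexp (r *\<^sub>R X) $ a $ b = (\<Sum>k. mpow X k $ a $ b / fact k * r ^ k)"
proof -
  have "(\<lambda>k. (1 / fact k) *\<^sub>R mpow (r *\<^sub>R X) k) sums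
      (\<chi> a b. \<Sum>k. mpow X k $ a $ b / fact k * r ^ k)"
    unfolding sums_def
  proof (intro vec_tendstoI)
    fix p q
    have "(\<lambda>n. \<Sum>k<n. mpow X k $ p $ q / fact k * r ^ k) \<longlonglongrightarrow> (\<Sum>k. mpow X k $ p $ q / fact k * r ^ k)"
      by (rule summable_LIMSEQ[OF mexp_summable])
    then show "(\<lambda>n. (\<Sum>k<n. (1 / fact k) *\<^sub>R mpow (r *\<^sub>R X) k) $ p $ q) \<longlonglongrightarrow>
        (\<chi> a b. \<Sum>k. mpow X k $ a $ b / fact k * r ^ k) $ p $ q"
      by (simp add: mpow_scale mult.commute)
  qed
  then show ?thesis by (simp add: mexp_def sums_iff)
qed

lemma mexp_0 [simp]: "mexp 0 = mat 1"
proof -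
  have "mexp (0 *\<^sub>R X) $ a $ b = mat 1 $ a $ b" for a b :: "'n::finite" and X :: "'n mat"
    unfolding mexp_nth by (subst suminf_finite[of "{0}"]) auto
  then have "mexp (0::'n mat) $ a $ b = mat 1 $ a $ b" for a b :: "'n::finite" by simp
  then show ?thesis by (subst vec_eq_iff, subst vec_eq_iff) blast
qed

lemma mexp_entry_deriv:
  "((\<lambda>r. mexp (r *\<^sub>R X) $ a $ b) has_real_derivative (X ** mexp (r *\<^sub>R X)) $ a $ b) (at r)"
proof -
  let ?c = "\<lambda>k. mpow X k $ a $ b / fact k"
  have "((\<lambda>r. \<Sum>k. ?c k * r ^ k) has_real_derivative (\<Sum>k. diffs ?c k * r ^ k)) (at r)"
    by (rule termdiffs_strong_converges_everywhere) (rule mexp_summable)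
  moreover have "(\<Sum>k. diffs ?c k * r ^ k) = (X ** mexp (r *\<^sub>R X)) $ a $ b"
  proof -
    have "diffs ?c k * r ^ k = (\<Sum>c\<in>UNIV. X$a$c * (mpow X k $ c $ b / fact k * r ^ k))" for k
    proof -
      have "diffs ?c k = mpow X (Suc k) $ a $ b / fact k"
        unfolding diffs_def fact_Suc by (simp del: mpow.simps)
      then show ?thesis
        by (simp add: matrix_matrix_mult_def sum_divide_distrib sum_distrib_right mult.assoc)
    qed
    then show ?thesis
      by (simp add: matrix_matrix_mult_def mexp_nth suminf_sum summable_mult mexp_summable suminf_mult
          del: times_divide_eq_right times_divide_eq_left)
  qed
  ultimately show ?thesis by (simp add: mexp_nth)
qed

lemma mexp_curve_deriv:
  "((\<lambda>r. mexp (r *\<^sub>R X) *v x) has_vector_derivative X *v (mexp (r *\<^sub>R X) *v x)) (at r)"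
proof -
  have "((\<lambda>r. (mexp (r *\<^sub>R X) *v x) $ a) has_real_derivative ((X ** mexp (r *\<^sub>R X)) *v x) $ a) (at r)" for a
    unfolding matrix_vector_mult_def vec_lambda_beta
    by (intro DERIV_sum DERIV_cmult_right mexp_entry_deriv)
  then have *: "((\<lambda>r. (mexp (r *\<^sub>R X) *v x) $ a) has_derivative
      (\<lambda>h. (h *\<^sub>R (X *v (mexp (r *\<^sub>R X) *v x))) $ a)) (at r)" for a
    by (simp add: has_field_derivative_def matrix_vector_mul_assoc mult.commute[of _ "_ $ _"])
  show ?thesis
    unfolding has_vector_derivative_def
    by (subst has_derivative_componentwise_within) (use * in \<open>auto simp: Basis_vec_def inner_axis\<close>)
qed

text \<open>For small r no orbit comes closer to 0 than half the norm of its starting point,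
  uniformly in x. This yields the common majorant of the difference quotients in
  \<open>V_lie_deriv\<close> and the injectivity of exp in \<open>lie_deriv_unique\<close>.\<close>

lemma mexp_small:
  fixes X :: "'n::finite mat"
  obtains \<epsilon> where "\<epsilon> > 0" "\<And>r x. \<bar>r\<bar> < \<epsilon> \<Longrightarrow> norm (mexp (r *\<^sub>R X) *v x) \<ge> norm x / 2"
proof -
  \<comment> \<open>A matrix whose entries are bounded by c has operator norm at most n * n * c = 1
    / 2.\<close>
  define c where "c = 1 / (2 * real (CARD('n)) * real (CARD('n)))"
  have c: "c > 0" by (simp add: c_def)
  have "\<exists>\<epsilon>>0. \<forall>r. \<bar>r\<bar> < \<epsilon> \<longrightarrow> \<bar>(mexp (r *\<^sub>R X) - mat 1) $ a $ b\<bar> \<le> c" for a b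
  proof -
    have "isCont (\<lambda>r. mexp (r *\<^sub>R X) $ a $ b) 0"
      using mexp_entry_deriv DERIV_isCont by blast
    then show ?thesis
      unfolding continuous_at_eps_delta using c
      by (fastforce simp: dist_real_def intro: less_imp_le dest: spec[of _ c])
  qed
  then obtain \<epsilon> where \<epsilon>: "\<epsilon> a b > 0" "\<And>r. \<bar>r\<bar> < \<epsilon> a b \<Longrightarrow> \<bar>(mexp (r *\<^sub>R X) - mat 1) $ a $ b\<bar> \<le> c" for a b
    by metis
  define e where "e = Min (range (\<lambda>(a, b). \<epsilon> a b))"
  have e: "e > 0" "e \<le> \<epsilon> a b" for a b
    unfolding e_def using \<epsilon>(1) by (auto simp: image_iff intro!: Min_le)
  show ?thesis
  proof
    show "e > 0" by (rule e)
    fix r x assume r: "\<bar>r\<bar> < e"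
    let ?E = "mexp (r *\<^sub>R X) - mat 1"
    have "onorm ((*v) ?E) \<le> real (CARD('n)) * real (CARD('n)) * c"
      by (rule onorm_le_matrix_component) (use e r \<epsilon>(2) in \<open>meson less_le_trans\<close>)
    also have "\<dots> = 1 / 2" by (simp add: c_def)
    finally have "norm (?E *v x) \<le> 1 / 2 * norm x"
      using onorm[OF matrix_vector_mul_bounded_linear, of ?E x] by (meson mult_right_mono norm_ge_zero order_trans)
    moreover have "mexp (r *\<^sub>R X) *v x = x + ?E *v x"
      by (simp add: matrix_vector_mult_diff_rdistrib)
    ultimately show "norm (mexp (r *\<^sub>R X) *v x) \<ge> norm x / 2"
      using norm_triangle_ineq2[of x "- (?E *v x)"] by simp
  qed
qed

lemma mexp_nilpotent:
  fixes x :: "real^'n::finite"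
  assumes "i \<noteq> j"
  shows "mexp (c *\<^sub>R eunit i j) *v x = x + (c * x$j) *\<^sub>R axis i 1"
proof -
  have sq: "eunit i j ** eunit i j = (0 :: 'n mat)"
    using assms by (auto simp: vec_eq_iff matrix_matrix_mult_def intro!: sum.neutral)
  have big: "mpow (eunit i j) (Suc (Suc k)) = (0 :: 'n mat)" for k
    by (simp add: matrix_mul_assoc sq)
  have "mexp (c *\<^sub>R eunit i j) $ a $ b = (mat 1 + c *\<^sub>R eunit i j :: 'n mat) $ a $ b" for a b
    unfolding mexp_nth
  proof (subst suminf_finite[of "{0, 1}"])
    fix k :: nat assume "k \<notin> {0, 1}"
    then obtain m where "k = Suc (Suc m)" by (metis insertCI nat.exhaust One_nat_def)
    then show "mpow (eunit i j) k $ a $ b / fact k * c ^ k = 0" by (simp only: big) simp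
  qed auto
  then have "mexp (c *\<^sub>R eunit i j) = (mat 1 + c *\<^sub>R eunit i j :: 'n mat)"
    by (subst vec_eq_iff, subst vec_eq_iff) blast
  then show ?thesis
    by (simp add: matrix_vector_mult_add_rdistrib eunit_mult_vec flip: scaleR_matrix_vector_assoc)
qed

section \<open>The Hilbert norm as an integral over an annulus\<close>

lemma nn_integral_dilation:
  fixes q :: "real^'n::finite \<Rightarrow> ennreal"
  assumes [measurable]: "q \<in> borel_measurable borel" and c: "c > 0"
  shows "(\<integral>\<^sup>+x. q x \<partial>lborel) = ennreal (c powr real CARD('n)) * (\<integral>\<^sup>+x. q (c *\<^sub>R x) \<partial>lborel)"
proof -
  have "(\<integral>\<^sup>+x. q x \<partial>lborel) = (\<integral>\<^sup>+x. q x \<partial>density (distr lborel borel (\<lambda>x. 0 + c *\<^sub>R x)) (\<lambda>_. ennreal (\<bar>c\<bar> ^ DIM(real^'n))))"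
    using c by (subst lborel_affine[of c 0]) auto
  also have "\<dots> = ennreal (c powr real CARD('n)) * (\<integral>\<^sup>+x. q (c *\<^sub>R x) \<partial>lborel)"
    using c by (simp add: nn_integral_density nn_integral_distr nn_integral_cmult powr_realpow)
  finally show ?thesis .
qed

text \<open>For radial p this is a fundamental domain, up to a null set, for the dilations by powers
  of e: almost every ray meets it in a set of measure 1 for dr / r.\<close>

definition annulus :: "(real^'n::finite \<Rightarrow> real) \<Rightarrow> (real^'n) set" where
  "annulus p = {x. 1 \<le> p x \<and> p x < exp 1}"

definition radial :: "(real^'n::finite \<Rightarrow> real) \<Rightarrow> bool" where
  "radial p \<longleftrightarrow> p \<in> borel_measurable borel \<and> (\<forall>c>0. \<forall>x. p (c *\<^sub>R x) = c * p x) \<and> (AE x in lborel. p x > 0)"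

text \<open>The degree - n compensates the Jacobian of a dilation, so that Q dx is invariant under
  dilations and lives on the space of rays.\<close>

definition density_hom :: "(real^'n::finite \<Rightarrow> ennreal) \<Rightarrow> bool" where
  "density_hom Q \<longleftrightarrow> Q \<in> borel_measurable borel \<and>
     (\<forall>c>0. \<forall>x. x \<noteq> 0 \<longrightarrow> Q (c *\<^sub>R x) = ennreal (c powr (- real CARD('n))) * Q x)"

lemma annulus_measurable [measurable]: "radial p \<Longrightarrow> annulus p \<in> sets borel"
proof -
  assume "radial p"
  then have [measurable]: "p \<in> borel_measurable borel" by (simp add: radial_def)
  show ?thesis unfolding annulus_def by measurable
qed

text \<open>The condition p (x / r) \<in> [1, e) says p x / e < r \<le> p x, an interval of length
  ln e = 1 for dr / r.\<close>

lemma nn_integral_annulus_inverse: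
  assumes "radial p" "p x > 0"
  shows "(\<integral>\<^sup>+r. indicator {0<..} r * ennreal (1 / r) * indicator (annulus p) ((1 / r) *\<^sub>R x) \<partial>lborel) = 1"
proof -
  let ?P = "p x"
  have "(\<integral>\<^sup>+r. indicator {0<..} r * ennreal (1 / r) * indicator (annulus p) ((1 / r) *\<^sub>R x) \<partial>lborel) =
      (\<integral>\<^sup>+r. ennreal (1 / r) * indicator {?P / exp 1..?P} r \<partial>lborel)"
  proof (rule nn_integral_cong_AE)
    have "AE r in lborel. r \<noteq> ?P / exp 1" by (rule AE_lborel_singleton)
    then show "AE r in lborel. indicator {0<..} r * ennreal (1 / r) * indicator (annulus p) ((1 / r) *\<^sub>R x) =
        ennreal (1 / r) * indicator {?P / exp 1..?P} r"
    proof eventually_elim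
      fix r assume r: "r \<noteq> ?P / exp 1"
      show "indicator {0<..} r * ennreal (1 / r) * indicator (annulus p) ((1 / r) *\<^sub>R x) =
        ennreal (1 / r) * indicator {?P / exp 1..?P} r"
      proof (cases "r > 0")
        case True
        then have "p ((1 / r) *\<^sub>R x) = ?P / r" using assms(1) by (simp add: radial_def)
        moreover have "1 \<le> ?P / r \<longleftrightarrow> r \<le> ?P" "?P / r < exp 1 \<longleftrightarrow> ?P / exp 1 < r"
          using True by (auto simp: field_simps)
        ultimately show ?thesis using True r by (auto simp: annulus_def indicator_def)
      next
        case False
        have "?P / exp 1 > 0" using assms by simp
        then show ?thesis using False by (auto simp: indicator_def)
      qed
    qed
  qed
  also have "\<dots> = ln ?P - ln (?P / exp 1)"
  proof (rule nn_integral_FTC_Icc)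
    fix r assume "r \<in> {?P / exp 1..?P}"
    then have "?P / exp 1 \<le> r" by simp
    moreover have "0 < ?P / exp 1" using assms by simp
    ultimately have "0 < r" by linarith
    then show "(ln has_real_derivative 1 / r) (at r)" "0 \<le> 1 / r" by (auto intro!: derivative_eq_intros)
  qed (use assms in \<open>auto simp: field_simps\<close>)
  also have "\<dots> = 1" using assms by (simp add: ln_div)
  finally show ?thesis .
qed

text \<open>Both sides integrate the measure that Q defines on the space of rays. Insert 1 as the
  integral of \<phi> (r x) dr / r, exchange the integrals and substitute x / r for x: the
  homogeneity of Q absorbs the Jacobian, and the dilation moves from \<phi> to the annulus, whose
  own integral over r is 1.\<close>

lemma nn_integral_annulus_eq:
  fixes Q \<phi> :: "real^'n::finite \<Rightarrow> ennreal"
  assumes Q: "density_hom Q" and p: "radial p" and [measurable]: "\<phi> \<in> borel_measurable borel"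
    and \<phi>: "AE x in lborel. (\<integral>\<^sup>+r. indicator {0<..} r * ennreal (1 / r) * \<phi> (r *\<^sub>R x) \<partial>lborel) = 1"
  shows "(\<integral>\<^sup>+x. Q x * indicator (annulus p) x \<partial>lborel) = (\<integral>\<^sup>+x. Q x * \<phi> x \<partial>lborel)"
proof -
  let ?A = "indicator (annulus p) :: _ \<Rightarrow> ennreal"
  have [measurable]: "Q \<in> borel_measurable borel" "?A \<in> borel_measurable borel"
    using Q p by (auto simp: density_hom_def)
  let ?d = "\<lambda>r::real. indicator {0<..} r * ennreal (1 / r)"
  have nz: "AE x in lborel. x \<noteq> (0::real^'n)" by (rule AE_lborel_singleton)
  have "(\<integral>\<^sup>+x. Q x * ?A x \<partial>lborel) = (\<integral>\<^sup>+x. \<integral>\<^sup>+r. (Q x * ?A x) * (?d r * \<phi> (r *\<^sub>R x)) \<partial>lborel \<partial>lborel)"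
    by (rule nn_integral_cong_AE, use \<phi> in eventually_elim, subst nn_integral_cmult) auto
  also have "\<dots> = (\<integral>\<^sup>+r. \<integral>\<^sup>+x. (Q x * ?A x) * (?d r * \<phi> (r *\<^sub>R x)) \<partial>lborel \<partial>lborel)"
    by (rule lborel_pair.Fubini') measurable
  also have "\<dots> = (\<integral>\<^sup>+r. \<integral>\<^sup>+x. (Q x * \<phi> x) * (?d r * ?A ((1 / r) *\<^sub>R x)) \<partial>lborel \<partial>lborel)"
  proof (rule nn_integral_cong)
    fix r :: real
    show "(\<integral>\<^sup>+x. (Q x * ?A x) * (?d r * \<phi> (r *\<^sub>R x)) \<partial>lborel) = (\<integral>\<^sup>+x. (Q x * \<phi> x) * (?d r * ?A ((1 / r) *\<^sub>R x)) \<partial>lborel)"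
    proof (cases "r > 0")
      case True
      have "(\<integral>\<^sup>+x. (Q x * \<phi> x) * (?d r * ?A ((1 / r) *\<^sub>R x)) \<partial>lborel) =
          ennreal (r powr real CARD('n)) * (\<integral>\<^sup>+x. (Q (r *\<^sub>R x) * \<phi> (r *\<^sub>R x)) * (?d r * ?A x) \<partial>lborel)"
        using True by (subst nn_integral_dilation[OF _ True]) auto
      also have "\<dots> = (\<integral>\<^sup>+x. ennreal (r powr real CARD('n)) * ((Q (r *\<^sub>R x) * \<phi> (r *\<^sub>R x)) * (?d r * ?A x)) \<partial>lborel)"
        by (rule nn_integral_cmult[symmetric]) measurable
      also have "\<dots> = (\<integral>\<^sup>+x. (Q x * ?A x) * (?d r * \<phi> (r *\<^sub>R x)) \<partial>lborel)"
      proof (rule nn_integral_cong_AE, use nz in eventually_elim)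
        fix x :: "real^'n" assume "x \<noteq> 0"
        then have "ennreal (r powr real CARD('n)) * Q (r *\<^sub>R x) = Q x"
          using Q True by (simp add: density_hom_def mult.assoc[symmetric] ennreal_mult[symmetric] powr_minus)
        then show "ennreal (r powr real CARD('n)) * ((Q (r *\<^sub>R x) * \<phi> (r *\<^sub>R x)) * (?d r * ?A x)) =
            (Q x * ?A x) * (?d r * \<phi> (r *\<^sub>R x))"
          by (simp add: mult.assoc[symmetric]) (simp add: mult_ac)
      qed
      finally show ?thesis by simp
    qed (auto simp: indicator_def)
  qed
  also have "\<dots> = (\<integral>\<^sup>+x. \<integral>\<^sup>+r. (Q x * \<phi> x) * (?d r * ?A ((1 / r) *\<^sub>R x)) \<partial>lborel \<partial>lborel)"
    by (rule lborel_pair.Fubini') measurable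
  also have "\<dots> = (\<integral>\<^sup>+x. Q x * \<phi> x \<partial>lborel)"
  proof (rule nn_integral_cong_AE)
    have "AE x in lborel. p x > 0" using p by (simp add: radial_def)
    then show "AE x in lborel. (\<integral>\<^sup>+r. (Q x * \<phi> x) * (?d r * ?A ((1 / r) *\<^sub>R x)) \<partial>lborel) = Q x * \<phi> x"
      by eventually_elim (subst nn_integral_cmult, use nn_integral_annulus_inverse[OF p] in auto)
  qed
  finally show ?thesis .
qed

lemma nn_integral_wt_radial:
  fixes x :: "real^'n::finite"
  assumes "x \<noteq> 0"
  shows "(\<integral>\<^sup>+r. indicator {0<..} r * ennreal (1 / r) * ennreal (wt (r *\<^sub>R x)) \<partial>lborel) = 1"
proof -
  let ?k = "(norm x)\<^sup>2"
  have "(\<integral>\<^sup>+r. indicator {0<..} r * ennreal (1 / r) * ennreal (wt (r *\<^sub>R x)) \<partial>lborel) =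
    (\<integral>\<^sup>+r. ennreal (2 * r * ?k * exp (- (r\<^sup>2 * ?k))) * indicator {0..} r \<partial>lborel)"
  proof (rule nn_integral_cong)
    fix r :: real
    show "indicator {0<..} r * ennreal (1 / r) * ennreal (wt (r *\<^sub>R x)) = ennreal (2 * r * ?k * exp (- (r\<^sup>2 * ?k))) * indicator {0..} r"
      by (cases "r > 0") (auto simp: wt_def indicator_def power_mult_distrib power2_eq_square simp flip: ennreal_mult')
  qed
  also have "\<dots> = ennreal (0 - (- exp (- (0\<^sup>2 * ?k))))"
  proof (rule nn_integral_FTC_atLeast)
    show "((\<lambda>r. - exp (- (r\<^sup>2 * ?k))) has_real_derivative 2 * r * ?k * exp (- (r\<^sup>2 * ?k))) (at r)" for r
      by (auto intro!: derivative_eq_intros)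
    have "filterlim (\<lambda>r::real. r\<^sup>2 * ?k) at_top at_top"
      using assms by (intro filterlim_at_top_mult_tendsto_pos[OF tendsto_const] filterlim_pow_at_top filterlim_ident) auto
    then have "((\<lambda>r. exp (- (r\<^sup>2 * ?k))) \<longlongrightarrow> 0) at_top"
      by (intro filterlim_compose[OF exp_at_bot] filterlim_compose[OF filterlim_uminus_at_bot_at_top])
    from tendsto_minus[OF this] show "((\<lambda>r. - exp (- (r\<^sup>2 * ?k))) \<longlongrightarrow> 0) at_top" by simp
  qed auto
  finally show ?thesis by simp
qed

lemma wt_measurable [measurable]: "wt \<in> borel_measurable borel"
  unfolding wt_def by measurable

lemma wt_nonneg: "wt x \<ge> 0" by (simp add: wt_def)

text \<open>The Gaussian weight of the Hilbert norm is one admissible cut-off among others, so the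
  norm may be computed on whichever annulus is convenient: the one of |x_j| is adapted to the chart,
  the one of |x_i| is invariant under the flow of a.\<close>

lemma annulus_wt:
  assumes "density_hom Q" "radial p"
  shows "(\<integral>\<^sup>+x. Q x * indicator (annulus p) x \<partial>lborel) = (\<integral>\<^sup>+x. Q x * ennreal (wt x) \<partial>lborel)"
proof (rule nn_integral_annulus_eq[OF assms])
  have "AE x in lborel. x \<noteq> (0::real^'n)" by (rule AE_lborel_singleton)
  then show "AE x::real^'n in lborel. (\<integral>\<^sup>+r. indicator {0<..} r * ennreal (1 / r) * ennreal (wt (r *\<^sub>R x)) \<partial>lborel) = 1"
    by eventually_elim (rule nn_integral_wt_radial)
qed measurable

text \<open>Only the modulus is recorded, so one notion serves every t and both signs. The product
  of two such moduli has degree - n, which is what the annulus formulas require.\<close>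

definition half_hom :: "(real^'n::finite \<Rightarrow> complex) \<Rightarrow> bool" where
  "half_hom f \<longleftrightarrow> f \<in> borel_measurable borel \<and>
     (\<forall>c>0. \<forall>x. x \<noteq> 0 \<longrightarrow> cmod (f (c *\<^sub>R x)) = c powr (- real CARD('n) / 2) * cmod (f x))"

lemma density_hom_mult:
  fixes f g :: "real^'n::finite \<Rightarrow> complex"
  assumes "half_hom f" "half_hom g"
  shows "density_hom (\<lambda>x. ennreal (cmod (f x) * cmod (g x)))"
  unfolding density_hom_def
proof (intro conjI allI impI)
  show "(\<lambda>x. ennreal (cmod (f x) * cmod (g x))) \<in> borel_measurable borel"
    using assms by (auto simp: half_hom_def)
  fix c :: real and x :: "real^'n" assume c: "c > 0" "x \<noteq> 0"
  have "c powr (- real CARD('n) / 2) * c powr (- real CARD('n) / 2) = c powr (- real CARD('n))"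
    by (simp flip: powr_add)
  then show "ennreal (cmod (f (c *\<^sub>R x)) * cmod (g (c *\<^sub>R x))) = ennreal (c powr (- real CARD('n))) * ennreal (cmod (f x) * cmod (g x))"
    using assms c unfolding half_hom_def
    by (simp add: ennreal_mult'[symmetric] mult_ac)
qed

lemma hnorm2_annulus:
  assumes "half_hom f" "radial p"
  shows "hnorm2 f = (\<integral>\<^sup>+x. ennreal ((cmod (f x))\<^sup>2) * indicator (annulus p) x \<partial>lborel)"
  using annulus_wt[OF density_hom_mult[OF assms(1) assms(1)] assms(2)]
  by (simp add: hnorm2_def power2_eq_square ennreal_mult' wt_nonneg)

lemma radial_norm: "radial norm"
proof -
  have "AE x in lborel. x \<noteq> (0::real^'n)" by (rule AE_lborel_singleton)
  then show ?thesis unfolding radial_def by (auto elim!: eventually_mono)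
qed

lemma AE_coordinate_nonzero: "AE x in lborel. x $ i \<noteq> (0 :: real)" for i :: "'n::finite"
proof -
  have "negligible {x :: real^'n. axis i 1 \<bullet> x = 0}"
    by (rule negligible_hyperplane) (simp add: axis_eq_0_iff)
  then have "{x. x $ i = (0::real)} \<in> null_sets lebesgue"
    by (simp add: negligible_iff_null_sets inner_axis inner_commute[of "axis i 1"])
  moreover have "{x. x $ i = (0::real)} \<in> sets lborel" by simp
  ultimately have "{x. x $ i = (0::real)} \<in> null_sets lborel"
    by (simp add: null_sets_completion_iff)
  then show ?thesis by (rule AE_I') auto
qed

lemma radial_coordinate: "radial (\<lambda>x. \<bar>x $ i\<bar>)"
  using AE_coordinate_nonzero[of i] unfolding radial_def by (auto simp: abs_mult)

section \<open>Shears and the invariance of Lebesgue measure\<close>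

definition shear :: "'n::finite \<Rightarrow> 'n \<Rightarrow> real \<Rightarrow> real^'n \<Rightarrow> real^'n" where
  "shear i j r x = x + (r * x $ i) *\<^sub>R axis j 1"

lemma shear_nth: "shear i j r x $ k = (if k = j then x $ j + r * x $ i else x $ k)"
  by (simp add: shear_def axis_def)

lemma shear_shear: "i \<noteq> j \<Longrightarrow> shear i j r (shear i j q x) = shear i j (r + q) x"
  by (simp add: vec_eq_iff shear_nth algebra_simps)

lemma shear_0 [simp]: "shear i j 0 x = x" by (simp add: shear_def)

lemma shear_measurable [measurable]:
  "f \<in> borel_measurable M \<Longrightarrow> g \<in> borel_measurable M \<Longrightarrow> (\<lambda>x. shear i j (f x) (g x)) \<in> borel_measurable M"
proof -
  assume [measurable]: "f \<in> borel_measurable M" "g \<in> borel_measurable M"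
  have [measurable]: "(\<lambda>x. g x $ i) \<in> borel_measurable M"
    by (rule measurable_compose[of g M borel "\<lambda>x. x $ i"]) auto
  show ?thesis unfolding shear_def by measurable
qed

text \<open>Fubini in direction j: by \<open>inv\<close> the displacement c is constant along that
  direction, where the claim is translation invariance on the line. A displacement proportional to
  another coordinate gives the shears.\<close>

lemma nn_integral_coordinate_translate:
  fixes q :: "real^'n::finite \<Rightarrow> ennreal"
  assumes [measurable]: "q \<in> borel_measurable borel" and c: "c \<in> borel_measurable borel"
    and inv: "\<And>x y. c (x + y *\<^sub>R axis j 1) = c x"
  shows "(\<integral>\<^sup>+x. q (x + c x *\<^sub>R axis j 1) \<partial>lborel) = (\<integral>\<^sup>+x. q x \<partial>lborel)"
proof -
  let ?e = "axis j 1 :: real^'n" and ?J = "Basis - {axis j 1 :: real^'n}"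
  let ?s = "\<lambda>I f. \<Sum>b\<in>I. f b *\<^sub>R (b :: real^'n)"
  have B: "Basis = insert ?e ?J" by (auto simp: axis_in_Basis_iff)
  interpret product_sigma_finite "\<lambda>b :: real^'n. lborel :: real measure" by standard
  have [measurable]: "c \<in> borel_measurable borel" by (rule c)
  have m: "(\<lambda>f. \<Sum>b\<in>insert ?e ?J. f b *\<^sub>R b) \<in> borel_measurable (Pi\<^sub>M (insert ?e ?J) (\<lambda>b. lborel))"
    by measurable
  have split: "(\<integral>\<^sup>+x. p x \<partial>lborel) =
     (\<integral>\<^sup>+f. (\<integral>\<^sup>+y. p (?s ?J f + y *\<^sub>R ?e) \<partial>lborel) \<partial>Pi\<^sub>M ?J (\<lambda>b. lborel))"
    if [measurable]: "p \<in> borel_measurable borel" for p :: "real^'n \<Rightarrow> ennreal"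
  proof -
    have e: "?s (insert ?e ?J) (f(?e := y)) = ?s ?J f + y *\<^sub>R ?e" for f y
      by (subst sum.insert) (auto simp: add.commute intro!: sum.cong)
    have "(\<integral>\<^sup>+x. p x \<partial>lborel) = (\<integral>\<^sup>+f. p (?s (insert ?e ?J) f) \<partial>Pi\<^sub>M (insert ?e ?J) (\<lambda>b. lborel))"
      using m by (subst lborel_eq, subst B, subst (2) B, subst nn_integral_distr) auto
    also have "\<dots> = (\<integral>\<^sup>+f. (\<integral>\<^sup>+y. p (?s (insert ?e ?J) (f(?e := y))) \<partial>lborel) \<partial>Pi\<^sub>M ?J (\<lambda>b. lborel))"
      by (rule product_nn_integral_insert) (use m in measurable)
    finally show ?thesis unfolding e .
  qed
  have [measurable]: "(\<lambda>x. q (x + c x *\<^sub>R ?e)) \<in> borel_measurable borel" by measurable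
  show ?thesis
  proof (subst (1 2) split; (measurable; fail)?; rule nn_integral_cong)
    fix f
    show "(\<integral>\<^sup>+y. q (?s ?J f + y *\<^sub>R ?e + c (?s ?J f + y *\<^sub>R ?e) *\<^sub>R ?e) \<partial>lborel) = (\<integral>\<^sup>+y. q (?s ?J f + y *\<^sub>R ?e) \<partial>lborel)"
      unfolding inv
      by (subst (2) nn_integral_real_affine[where c = 1 and t = "c (?s ?J f)"])
        (auto simp: algebra_simps)
  qed
qed

lemma lborel_shear:
  fixes i j :: "'n::finite"
  assumes "i \<noteq> j"
  shows "distr lborel borel (shear i j r) = lborel"
proof (rule measure_eqI)
  fix A assume "A \<in> sets (distr lborel borel (shear i j r))"
  then have [measurable]: "A \<in> sets borel" by simp
  have "emeasure (distr lborel borel (shear i j r)) A = (\<integral>\<^sup>+x. indicator A (x + (r * x $ i) *\<^sub>R axis j 1) \<partial>lborel)"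
    by (subst nn_integral_indicator[symmetric], simp, subst nn_integral_distr) (auto simp: shear_def)
  also have "\<dots> = (\<integral>\<^sup>+x. indicator A x \<partial>lborel)"
    using assms by (intro nn_integral_coordinate_translate) (auto simp: axis_def)
  finally show "emeasure (distr lborel borel (shear i j r)) A = emeasure lborel A" by simp
qed simp

lemma nn_integral_shear:
  assumes "i \<noteq> j" "q \<in> borel_measurable borel"
  shows "(\<integral>\<^sup>+x. q (shear i j r x) \<partial>lborel) = (\<integral>\<^sup>+x. q x \<partial>lborel)"
  using assms by (subst (2) lborel_shear[OF assms(1), of r, symmetric], subst nn_integral_distr) auto

lemma integral_shear:
  fixes q :: "_ \<Rightarrow> complex"
  assumes "i \<noteq> j" "q \<in> borel_measurable borel"
  shows "(\<integral>x. q (shear i j r x) \<partial>lborel) = (\<integral>x. q x \<partial>lborel)"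
  using assms by (subst (2) lborel_shear[OF assms(1), of r, symmetric], subst integral_distr) auto

section \<open>Compactly supported functions in an affine chart\<close>

definition vd :: "(real \<Rightarrow> complex) \<Rightarrow> real \<Rightarrow> complex" where
  "vd f x = vector_derivative f (at x)"

text \<open>Recursion through the total function \<open>vd\<close> lets smoothness be proved by
  induction on k over a whole family: it suffices to exhibit a derivative that is built from members
  of the same family.\<close>

primrec Ck :: "nat \<Rightarrow> (real \<Rightarrow> complex) \<Rightarrow> bool" where
  "Ck 0 f \<longleftrightarrow> continuous_on UNIV f"
| "Ck (Suc k) f \<longleftrightarrow> (\<forall>x. f differentiable (at x)) \<and> Ck k (vd f)"

definition smooth :: "(real \<Rightarrow> complex) \<Rightarrow> bool" where
  "smooth f \<longleftrightarrow> (\<forall>k. Ck k f)"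

lemma vd_eq: "(f has_vector_derivative f') (at x) \<Longrightarrow> vd f x = f'"
  by (simp add: vd_def vector_derivative_at)

lemma Ck_SucI:
  assumes "\<And>x. (f has_vector_derivative f' x) (at x)" "Ck k f'"
  shows "Ck (Suc k) f"
proof -
  have "vd f = f'" using assms(1) vd_eq by blast
  then show ?thesis using assms by (auto intro: differentiableI_vector)
qed

lemma Ck_deriv: "Ck (Suc k) f \<Longrightarrow> (f has_vector_derivative vd f x) (at x)"
  by (simp add: vd_def vector_derivative_works[symmetric])

lemma Ck_less: "Ck (Suc k) f \<Longrightarrow> Ck k f"
proof (induction k arbitrary: f)
  case 0
  then show ?case
    by (auto simp: continuous_on_eq_continuous_within intro: differentiable_imp_continuous_within)
qed auto

lemma smooth_deriv: "smooth f \<Longrightarrow> (f has_vector_derivative vd f x) (at x)"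
  unfolding smooth_def using Ck_deriv by blast

lemma smooth_vd: "smooth f \<Longrightarrow> smooth (vd f)"
  unfolding smooth_def by (metis Ck.simps(2))

lemma smooth_continuous: "smooth f \<Longrightarrow> continuous_on UNIV f"
  unfolding smooth_def by (metis Ck.simps(1))

lemma smoothI:
  assumes "\<And>x. (f has_vector_derivative f' x) (at x)" "smooth f'"
  shows "smooth f"
  unfolding smooth_def
proof
  show "Ck k f" for k
    using assms Ck_less[OF Ck_SucI[of f f' k]] by (simp add: smooth_def)
qed

lemma Ck_const: "Ck k (\<lambda>_. c)"
proof (induction k arbitrary: c)
  case (Suc k)
  then show ?case by (intro Ck_SucI[of _ "\<lambda>_. 0"]) auto
qed auto

lemma smooth_const: "smooth (\<lambda>_. c)" by (simp add: smooth_def Ck_const)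

lemma smooth_of_real: "smooth of_real"
  by (rule smoothI[OF _ smooth_const[of 1]]) (auto intro!: derivative_eq_intros simp: has_vector_derivative_def scaleR_conv_of_real)

lemma Ck_add: "Ck k f \<Longrightarrow> Ck k g \<Longrightarrow> Ck k (\<lambda>x. f x + g x)"
proof (induction k arbitrary: f g)
  case 0 then show ?case by (auto intro: continuous_intros)
next
  case (Suc k)
  show ?case
    by (rule Ck_SucI[of _ "\<lambda>x. vd f x + vd g x"])
      (use Suc in \<open>auto intro!: has_vector_derivative_add Ck_deriv simp del: Ck.simps intro: Ck.simps(2)[THEN iffD1, THEN conjunct2]\<close>)
qed

lemma smooth_add: "smooth f \<Longrightarrow> smooth g \<Longrightarrow> smooth (\<lambda>x. f x + g x)"
  by (simp add: smooth_def Ck_add)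

lemma Ck_mult: "Ck k f \<Longrightarrow> Ck k g \<Longrightarrow> Ck k (\<lambda>x. f x * g x)"
proof (induction k arbitrary: f g)
  case 0 then show ?case by (auto intro: continuous_intros)
next
  case (Suc k)
  have "Ck k (\<lambda>x. f x * vd g x + vd f x * g x)"
    using Suc Ck_less[OF Suc(2)] Ck_less[OF Suc(3)] by (intro Ck_add Suc.IH) auto
  then show ?case
    by (intro Ck_SucI[of _ "\<lambda>x. f x * vd g x + vd f x * g x"] has_vector_derivative_mult Ck_deriv[OF Suc(2)] Ck_deriv[OF Suc(3)])
qed

lemma smooth_mult: "smooth f \<Longrightarrow> smooth g \<Longrightarrow> smooth (\<lambda>x. f x * g x)"
  by (simp add: smooth_def Ck_mult)

lemma smooth_cmult: "smooth f \<Longrightarrow> smooth (\<lambda>x. c * f x)"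
  by (rule smooth_mult[OF smooth_const])

lemma affine_deriv:
  assumes "\<And>x. (f has_vector_derivative f' x) (at x)"
  shows "((\<lambda>x. f (c * x + d)) has_vector_derivative of_real c * f' (c * x + d)) (at x)"
proof -
  have "((\<lambda>x. c * x + d) has_vector_derivative c) (at x)"
    unfolding has_real_derivative_iff_has_vector_derivative[symmetric] by (auto intro!: derivative_eq_intros)
  from vector_diff_chain_at[OF this assms] show ?thesis by (simp add: o_def scaleR_conv_of_real)
qed

lemma Ck_affine: "Ck k f \<Longrightarrow> Ck k (\<lambda>x. f (c * x + d))"
proof (induction k arbitrary: f)
  case 0 then show ?case by (auto intro!: continuous_intros continuous_on_compose2[of UNIV f])
next
  case (Suc k)
  have "Ck k (\<lambda>x. of_real c * vd f (c * x + d))"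
    using Suc by (intro Ck_mult Ck_const) auto
  then show ?case by (rule Ck_SucI[OF affine_deriv[OF Ck_deriv[OF Suc(2)]]])
qed

lemma smooth_affine: "smooth f \<Longrightarrow> smooth (\<lambda>x. f (c * x + d))"
  by (simp add: smooth_def Ck_affine)

definition test :: "(real \<Rightarrow> complex) \<Rightarrow> bool" where
  "test f \<longleftrightarrow> smooth f \<and> (\<exists>R. \<forall>x. f x \<noteq> 0 \<longrightarrow> \<bar>x\<bar> \<le> R)"

text \<open>The lower bound c > 0 matters for the slot i: such a section vanishes on x_i = 0, and
  its restriction to an orbit of the flow of a has compact support in time.\<close>

definition test_pos :: "(real \<Rightarrow> complex) \<Rightarrow> bool" where
  "test_pos f \<longleftrightarrow> smooth f \<and> (\<exists>c>0. \<exists>R. \<forall>x. f x \<noteq> 0 \<longrightarrow> c \<le> x \<and> x \<le> R)"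

lemma test_pos_test: "test_pos f \<Longrightarrow> test f"
  unfolding test_pos_def test_def
  by (metis abs_of_pos less_le_trans)

lemma vd_zero_off_support:
  assumes "smooth f" "closed S" "\<And>x. f x \<noteq> 0 \<Longrightarrow> x \<in> S" "x \<notin> S"
  shows "vd f x = 0"
proof (rule vd_eq)
  show "(f has_vector_derivative 0) (at x)"
    by (rule has_vector_derivative_transform_within_open[OF has_vector_derivative_const[of 0], of "- S"])
      (use assms in auto)
qed

lemma test_vd: "test f \<Longrightarrow> test (vd f)"
proof -
  assume f: "test f"
  then obtain R where R: "\<And>x. f x \<noteq> 0 \<Longrightarrow> \<bar>x\<bar> \<le> R" by (auto simp: test_def)
  have "vd f x = 0" if "\<not> \<bar>x\<bar> \<le> R" for x
    using vd_zero_off_support[of f "{-R..R}" x] f R that by (force simp: test_def abs_le_iff)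
  then show ?thesis using f by (auto simp: test_def smooth_vd)
qed

lemma test_pos_vd: "test_pos f \<Longrightarrow> test_pos (vd f)"
proof -
  assume f: "test_pos f"
  then obtain c R where c: "c > 0" and R: "\<And>x. f x \<noteq> 0 \<Longrightarrow> c \<le> x \<and> x \<le> R" by (auto simp: test_pos_def)
  have "vd f x = 0" if "\<not> (c \<le> x \<and> x \<le> R)" for x
    using vd_zero_off_support[of f "{c..R}" x] f R that by (force simp: test_pos_def)
  then show ?thesis using f c by (auto simp: test_pos_def smooth_vd)
qed

lemma test_mult: "test f \<Longrightarrow> smooth g \<Longrightarrow> test (\<lambda>x. g x * f x)"
  by (auto simp: test_def smooth_mult)

lemma test_pos_mult: "test_pos f \<Longrightarrow> smooth g \<Longrightarrow> test_pos (\<lambda>x. g x * f x)"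
  by (auto simp: test_pos_def smooth_mult)

text \<open>On sections this is multiplication by the chart function x_b / x_j, which is 1 for b = j
  (\<open>sec_mulX\<close>).\<close>

definition mulX :: "'n \<Rightarrow> 'n \<Rightarrow> ('n \<Rightarrow> real \<Rightarrow> complex) \<Rightarrow> 'n \<Rightarrow> real \<Rightarrow> complex" where
  "mulX j b \<Phi> = (if b = j then \<Phi> else \<Phi>(b := \<lambda>y. of_real y * \<Phi> b y))"

definition dslot :: "'n \<Rightarrow> ('n \<Rightarrow> real \<Rightarrow> complex) \<Rightarrow> 'n \<Rightarrow> real \<Rightarrow> complex" where
  "dslot a \<Phi> = \<Phi>(a := vd (\<Phi> a))"

definition slots :: "'n \<Rightarrow> ('n \<Rightarrow> real \<Rightarrow> complex) \<Rightarrow> bool" where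
  "slots i \<Phi> \<longleftrightarrow> (\<forall>a. test (\<Phi> a)) \<and> test_pos (\<Phi> i)"

lemma slots_mulX: "slots i \<Phi> \<Longrightarrow> slots i (mulX j b \<Phi>)"
  by (auto simp: slots_def mulX_def intro: test_mult test_pos_mult smooth_of_real)

lemma slots_dslot: "slots i \<Phi> \<Longrightarrow> slots i (dslot a \<Phi>)"
  by (auto simp: slots_def dslot_def intro: test_vd test_pos_vd)

section \<open>Product sections over the affine chart\<close>

definition radial_char :: "bool \<Rightarrow> real \<Rightarrow> real \<Rightarrow> real \<Rightarrow> complex" where
  "radial_char pm t m y = complex_of_real (eps_sign pm y * \<bar>y\<bar> powr (- m)) * cis (- t * ln \<bar>y\<bar>)"

text \<open>A product of one-variable functions of the chart coordinates, continued homogeneously.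
  The default 0 on x_j = 0 is the smooth continuation away from the origin when the slots have
  bounded support, by \<open>sec_zero_near\<close>.\<close>

definition sec :: "bool \<Rightarrow> real \<Rightarrow> 'n::finite \<Rightarrow> ('n \<Rightarrow> real \<Rightarrow> complex) \<Rightarrow> real^'n \<Rightarrow> complex" where
  "sec pm t j \<Phi> x = (if x $ j = 0 then 0 else
     radial_char pm t (real CARD('n) / 2) (x $ j) * (\<Prod>a\<in>UNIV - {j}. \<Phi> a (x $ a / x $ j)))"

lemma radial_char_mult:
  assumes "c \<noteq> 0" "y \<noteq> 0"
  shows "radial_char pm t m (c * y) = radial_char pm t m c * radial_char pm t m y"
  using assms
  by (simp add: radial_char_def eps_sign_def abs_mult powr_mult ln_mult sgn_mult cis_mult algebra_simps)

lemma sec_hom: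
  fixes x :: "real^'n::finite"
  assumes "c \<noteq> 0"
  shows "sec pm t j \<Phi> (c *\<^sub>R x) = radial_char pm t (real CARD('n) / 2) c * sec pm t j \<Phi> x"
  using assms by (simp add: sec_def radial_char_mult)

lemma radial_char_deriv:
  assumes "y \<noteq> 0"
  shows "(radial_char pm t m has_vector_derivative - (of_real m + \<i> * of_real t) / of_real y * radial_char pm t m y) (at y)"
proof -
  \<comment> \<open>With s fixed, s * z equals |z| near y on either half line, so one formula with
    ln (s * z) covers both signs of y.\<close>
  define s where "s = sgn y"
  have s: "s * s = 1" "s * y > 0" "\<bar>y\<bar> = s * y" using assms by (auto simp: s_def sgn_if)
  define e where "e = eps_sign pm y"
  let ?q = "\<lambda>z. complex_of_real e * exp (- (of_real m + \<i> * of_real t) * complex_of_real (ln (s * z)))"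
  have eq: "radial_char pm t m z = ?q z" if "z \<in> {z. s * z > 0}" for z
  proof -
    have z: "\<bar>z\<bar> = s * z" "sgn z = s" using that assms by (auto simp: s_def sgn_if split: if_splits)
    then have "eps_sign pm z = e" using assms by (simp add: e_def eps_sign_def s_def)
    moreover have "\<bar>z\<bar> powr (- m) = exp (- m * ln (s * z))"
      using that z by (auto simp: powr_def)
    moreover have "exp (- (of_real m + \<i> * of_real t) * complex_of_real (ln (s * z))) =
        of_real (exp (- m * ln (s * z))) * cis (- t * ln (s * z))"
    proof -
      have "- (of_real m + \<i> * of_real t) * complex_of_real (ln (s * z)) =
          of_real (- m * ln (s * z)) + \<i> * of_real (- t * ln (s * z))"
        by (simp add: algebra_simps)
      then show ?thesis by (simp only: exp_add cis_conv_exp exp_of_real)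
    qed
    ultimately show ?thesis using z by (simp add: radial_char_def)
  qed
  have "((\<lambda>z. ln (s * z)) has_real_derivative 1 / y) (at y)"
    using s by (auto intro!: derivative_eq_intros simp: divide_simps)
  then have "((\<lambda>z. complex_of_real (ln (s * z))) has_vector_derivative of_real (1 / y)) (at y)"
    by (intro has_vector_derivative_of_real) (simp add: has_real_derivative_iff_has_vector_derivative)
  then have "((\<lambda>z. - (of_real m + \<i> * of_real t) * complex_of_real (ln (s * z))) has_vector_derivative
      - (of_real m + \<i> * of_real t) * of_real (1 / y)) (at y)"
    by (rule has_vector_derivative_mult_right)
  then have "((exp \<circ> (\<lambda>z. - (of_real m + \<i> * of_real t) * complex_of_real (ln (s * z)))) has_vector_derivative
      - (of_real m + \<i> * of_real t) * of_real (1 / y) * exp (- (of_real m + \<i> * of_real t) * complex_of_real (ln (s * y)))) (at y)"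
    by (rule field_vector_diff_chain_at) (rule DERIV_exp)
  then have d1: "(?q has_vector_derivative of_real e * (- (of_real m + \<i> * of_real t) * of_real (1 / y) *
      exp (- (of_real m + \<i> * of_real t) * complex_of_real (ln (s * y))))) (at y)"
    by (intro has_vector_derivative_mult_right) (simp add: o_def)
  have d2: "of_real e * (- (of_real m + \<i> * of_real t) * of_real (1 / y) *
      exp (- (of_real m + \<i> * of_real t) * complex_of_real (ln (s * y)))) =
      - (of_real m + \<i> * of_real t) / of_real y * radial_char pm t m y"
    using eq[of y] s by (simp add: mult_ac)
  have "open {z. s * z > 0}" by (intro open_Collect_less continuous_intros)
  with d1[unfolded d2] show ?thesis
    by (rule has_vector_derivative_transform_within_open) (use s eq in auto)
qed

lemma sec_mulX:
  "x $ j \<noteq> 0 \<Longrightarrow> sec pm t j (mulX j b \<Phi>) x = of_real (x $ b / x $ j) * sec pm t j \<Phi> x"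
proof (cases "b = j")
  case False
  assume "x $ j \<noteq> 0"
  have "(\<Prod>a\<in>UNIV - {j}. (mulX j b \<Phi>) a (x $ a / x $ j)) =
     of_real (x $ b / x $ j) * \<Phi> b (x $ b / x $ j) * (\<Prod>a\<in>UNIV - {j} - {b}. \<Phi> a (x $ a / x $ j))"
    using False by (subst prod.remove[of _ b]) (auto simp: mulX_def intro!: prod.cong)
  moreover have "(\<Prod>a\<in>UNIV - {j}. \<Phi> a (x $ a / x $ j)) =
     \<Phi> b (x $ b / x $ j) * (\<Prod>a\<in>UNIV - {j} - {b}. \<Phi> a (x $ a / x $ j))"
    using False by (subst prod.remove[of _ b]) auto
  ultimately show ?thesis by (simp add: sec_def)
qed (simp add: mulX_def)

text \<open>Since x is not 0, another coordinate x_a is nonzero, and close to x the modulus of the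
  ratio of the coordinates a and j exceeds the support radius of slot a.\<close>

lemma sec_zero_near:
  fixes x :: "real^'n::finite"
  assumes "\<And>a. test (\<Phi> a)" "x \<noteq> 0" "x $ j = 0"
  shows "\<exists>U. open U \<and> x \<in> U \<and> (\<forall>y\<in>U. sec pm t j \<Phi> y = 0)"
proof -
  obtain a where a: "x $ a \<noteq> 0" using assms(2) by (auto simp: vec_eq_iff)
  then have aj: "a \<noteq> j" using assms(3) by auto
  obtain R where R: "\<And>z. \<Phi> a z \<noteq> 0 \<Longrightarrow> \<bar>z\<bar> \<le> R" using assms(1)[of a] by (auto simp: test_def)
  let ?U = "{y :: real^'n. R * \<bar>y $ j\<bar> < \<bar>y $ a\<bar>}"
  have "sec pm t j \<Phi> y = 0" if "y \<in> ?U" for y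
  proof (cases "y $ j = 0")
    case False
    then have "\<not> \<bar>y $ a / y $ j\<bar> \<le> R" using that by (simp add: abs_divide field_simps)
    then have "\<Phi> a (y $ a / y $ j) = 0" using R by blast
    then show ?thesis using aj by (auto simp: sec_def)
  qed (simp add: sec_def)
  moreover have "open ?U" by (intro open_Collect_less continuous_intros)
  ultimately show ?thesis using a assms(3) by (intro exI[of _ ?U]) auto
qed

definition sec_diff :: "bool \<Rightarrow> real \<Rightarrow> 'n::finite \<Rightarrow> ('n \<Rightarrow> real \<Rightarrow> complex) \<Rightarrow> real^'n \<Rightarrow> real^'n \<Rightarrow> complex" where
  "sec_diff pm t j \<Phi> x h =
     (\<Sum>a\<in>UNIV - {j}. of_real (h $ a / x $ j - x $ a * h $ j / (x $ j * x $ j)) * sec pm t j (dslot a \<Phi>) x)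
     - of_real (h $ j / x $ j) * (of_real (real CARD('n) / 2) + \<i> * of_real t) * sec pm t j \<Phi> x"

lemma sec_has_derivative:
  fixes x :: "real^'n::finite"
  assumes test: "\<And>a. test (\<Phi> a)" and x: "x \<noteq> 0"
  shows "(sec pm t j \<Phi> has_derivative sec_diff pm t j \<Phi> x) (at x)"
proof (cases "x $ j = 0")
  case True
  obtain U where U: "open U" "x \<in> U" "\<And>y. y \<in> U \<Longrightarrow> sec pm t j \<Phi> y = 0"
    using sec_zero_near[of \<Phi> x j pm t, OF test x True] by auto
  have "(sec pm t j \<Phi> has_derivative (\<lambda>h. 0)) (at x)"
    by (rule has_derivative_transform_within_open[OF has_derivative_const[of 0] U(1,2)]) (simp add: U(3))
  moreover have "sec_diff pm t j \<Phi> x = (\<lambda>h. 0)"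
    by (rule ext) (simp add: sec_diff_def sec_def True)
  ultimately show ?thesis by simp
next
  case False
  let ?m = "real CARD('n) / 2" and ?y = "x $ j" and ?I = "UNIV - {j}"
  let ?P = "radial_char pm t ?m"
  have dj: "((\<lambda>x. x $ j) has_derivative (\<lambda>h. h $ j)) (at x)" for j
    by (rule bounded_linear_imp_has_derivative) (rule bounded_linear_vec_nth)
  have P: "((\<lambda>x. ?P (x $ j)) has_derivative (\<lambda>h. h $ j *\<^sub>R (- (of_real ?m + \<i> * of_real t) / of_real ?y * ?P ?y))) (at x)"
    by (rule has_derivative_compose[OF dj radial_char_deriv[OF False, unfolded has_vector_derivative_def]])
  have q: "((\<lambda>x. x $ a / x $ j) has_derivative (\<lambda>h. h $ a / ?y - x $ a * h $ j / (?y * ?y))) (at x)" for a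
    by (rule has_derivative_eq_rhs[OF has_derivative_divide[OF dj dj False]])
      (use False in \<open>simp add: fun_eq_iff divide_simps\<close>)
  have s: "(\<Phi> a has_derivative (\<lambda>h. h *\<^sub>R vd (\<Phi> a) z)) (at z)" for a z
    using smooth_deriv[of "\<Phi> a" z] test[of a] by (simp add: test_def has_vector_derivative_def)
  have f: "((\<lambda>x. \<Phi> a (x $ a / x $ j)) has_derivative
      (\<lambda>h. (h $ a / ?y - x $ a * h $ j / (?y * ?y)) *\<^sub>R vd (\<Phi> a) (x $ a / ?y))) (at x)" for a
    by (rule has_derivative_compose[OF q s])
  let ?g = "\<lambda>x. ?P (x $ j) * (\<Prod>a\<in>?I. \<Phi> a (x $ a / x $ j))"
  have "(?g has_derivative (\<lambda>h. ?P ?y *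
       (\<Sum>a\<in>?I. (h $ a / ?y - x $ a * h $ j / (?y * ?y)) *\<^sub>R vd (\<Phi> a) (x $ a / ?y) * (\<Prod>b\<in>?I - {a}. \<Phi> b (x $ b / ?y))) +
       h $ j *\<^sub>R (- (of_real ?m + \<i> * of_real t) / of_real ?y * ?P ?y) * (\<Prod>a\<in>?I. \<Phi> a (x $ a / ?y)))) (at x)"
    by (intro has_derivative_mult P has_derivative_prod f)
  moreover have "(\<lambda>h. ?P ?y *
       (\<Sum>a\<in>?I. (h $ a / ?y - x $ a * h $ j / (?y * ?y)) *\<^sub>R vd (\<Phi> a) (x $ a / ?y) * (\<Prod>b\<in>?I - {a}. \<Phi> b (x $ b / ?y))) +
       h $ j *\<^sub>R (- (of_real ?m + \<i> * of_real t) / of_real ?y * ?P ?y) * (\<Prod>a\<in>?I. \<Phi> a (x $ a / ?y))) =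
       sec_diff pm t j \<Phi> x"
  proof
    fix h :: "real^'n"
    have d: "sec pm t j (dslot a \<Phi>) x = ?P ?y * (vd (\<Phi> a) (x $ a / ?y) * (\<Prod>b\<in>?I - {a}. \<Phi> b (x $ b / ?y)))" if "a \<in> ?I" for a
      using False that unfolding sec_def
      by (subst prod.remove[of _ a]) (auto simp: dslot_def intro!: prod.cong)
    have "(\<Sum>a\<in>?I. of_real (h $ a / ?y - x $ a * h $ j / (?y * ?y)) * sec pm t j (dslot a \<Phi>) x) =
        ?P ?y * (\<Sum>a\<in>?I. (h $ a / ?y - x $ a * h $ j / (?y * ?y)) *\<^sub>R vd (\<Phi> a) (x $ a / ?y) * (\<Prod>b\<in>?I - {a}. \<Phi> b (x $ b / ?y)))"
      unfolding sum_distrib_left by (intro sum.cong refl) (simp only: d scaleR_conv_of_real mult_ac)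
    then show "?P ?y *
       (\<Sum>a\<in>?I. (h $ a / ?y - x $ a * h $ j / (?y * ?y)) *\<^sub>R vd (\<Phi> a) (x $ a / ?y) * (\<Prod>b\<in>?I - {a}. \<Phi> b (x $ b / ?y))) +
       h $ j *\<^sub>R (- (of_real ?m + \<i> * of_real t) / of_real ?y * ?P ?y) * (\<Prod>a\<in>?I. \<Phi> a (x $ a / ?y)) = sec_diff pm t j \<Phi> x h"
      using False unfolding sec_diff_def by (simp add: sec_def scaleR_conv_of_real field_simps)
  qed
  ultimately have "(?g has_derivative sec_diff pm t j \<Phi> x) (at x)" by simp
  moreover have "open {x :: real^'n. x $ j \<noteq> 0}" by (intro open_Collect_neq continuous_intros)
  ultimately show ?thesis
    by (rule has_derivative_transform_within_open[where s = "{x. x $ j \<noteq> 0}"]) (use False in \<open>auto simp: sec_def\<close>)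
qed

text \<open>The sign comes from (pi (exp (r Y)) f) x = f (exp (- r Y) x). The value 0 at the origin
  agrees with the members of V, all of which vanish there.\<close>

definition LY :: "'n::finite mat \<Rightarrow> (real^'n \<Rightarrow> complex) \<Rightarrow> real^'n \<Rightarrow> complex" where
  "LY Y f x = (if x = 0 then 0 else - frechet_derivative f (at x) (Y *v x))"

lemma LY_eq: "(f has_derivative D) (at x) \<Longrightarrow> x \<noteq> 0 \<Longrightarrow> LY Y f x = - D (Y *v x)"
  by (simp add: LY_def frechet_derivative_at[symmetric])

text \<open>The rows of Y other than j contribute an affine vector field in the chart. Row j
  contributes x_b / x_j times the Euler operator plus n/2 + i t; it is the only place where t
  enters, so the growth in t is decided by the action of w d/dw + i t on slot i.\<close>

lemma LY_sec:
  fixes Y :: "'n::finite mat"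
  assumes test: "\<And>a. test (\<Phi> a)"
  shows "LY Y (sec pm t j \<Phi>) = (\<lambda>x.
     (\<Sum>b\<in>UNIV. \<Sum>a\<in>UNIV - {j}. of_real (- Y$a$b) * sec pm t j (mulX j b (dslot a \<Phi>)) x) +
     (\<Sum>b\<in>UNIV. of_real (Y$j$b) * ((\<Sum>a\<in>UNIV - {j}. sec pm t j (mulX j b (mulX j a (dslot a \<Phi>))) x) +
        (of_real (real CARD('n) / 2) + \<i> * of_real t) * sec pm t j (mulX j b \<Phi>) x)))"
proof
  fix x :: "real^'n"
  show "LY Y (sec pm t j \<Phi>) x =
     (\<Sum>b\<in>UNIV. \<Sum>a\<in>UNIV - {j}. of_real (- Y$a$b) * sec pm t j (mulX j b (dslot a \<Phi>)) x) +
     (\<Sum>b\<in>UNIV. of_real (Y$j$b) * ((\<Sum>a\<in>UNIV - {j}. sec pm t j (mulX j b (mulX j a (dslot a \<Phi>))) x) +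
        (of_real (real CARD('n) / 2) + \<i> * of_real t) * sec pm t j (mulX j b \<Phi>) x))"
  proof (cases "x $ j = 0")
    case True
    then show ?thesis
      using LY_eq[OF sec_has_derivative[of \<Phi> x pm t j, OF test], of Y]
      by (cases "x = 0") (simp_all add: LY_def[of Y _ 0] sec_diff_def sec_def)
  next
    case False
    then have x: "x \<noteq> 0" by auto
    let ?y = "x $ j"
    define S where "S a = sec pm t j (dslot a \<Phi>) x" for a
    define S0 where "S0 = (of_real (real CARD('n) / 2) + \<i> * of_real t) * sec pm t j \<Phi> x"
    define X where "X b = complex_of_real (x $ b / ?y)" for b
    have Yx: "complex_of_real ((Y *v x) $ a / ?y) = (\<Sum>b\<in>UNIV. of_real (Y$a$b) * X b)" for a
      by (simp add: matrix_vector_mult_def X_def sum_divide_distrib)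
    have c: "complex_of_real ((Y *v x) $ a / ?y - x $ a * (Y *v x) $ j / (?y * ?y)) =
        (\<Sum>b\<in>UNIV. of_real (Y$a$b) * X b) - X a * (\<Sum>b\<in>UNIV. of_real (Y$j$b) * X b)" for a
    proof -
      have "complex_of_real ((Y *v x) $ a / ?y - x $ a * (Y *v x) $ j / (?y * ?y)) =
          complex_of_real ((Y *v x) $ a / ?y) - X a * complex_of_real ((Y *v x) $ j / ?y)"
        by (simp add: X_def)
      then show ?thesis unfolding Yx .
    qed
    have "LY Y (sec pm t j \<Phi>) x = - ((\<Sum>a\<in>UNIV - {j}. ((\<Sum>b\<in>UNIV. of_real (Y$a$b) * X b) - X a * (\<Sum>b\<in>UNIV. of_real (Y$j$b) * X b)) * S a)
        - (\<Sum>b\<in>UNIV. of_real (Y$j$b) * X b) * S0)"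
      unfolding LY_eq[OF sec_has_derivative[OF test x] x] sec_diff_def c Yx S_def S0_def by simp
    also have "\<dots> = (\<Sum>a\<in>UNIV - {j}. \<Sum>b\<in>UNIV. of_real (- Y$a$b) * (X b * S a)) +
       (\<Sum>b\<in>UNIV. of_real (Y$j$b) * ((\<Sum>a\<in>UNIV - {j}. X b * (X a * S a)) + X b * S0))"
      by (simp add: sum_distrib_left sum_distrib_right sum_subtractf sum.distrib sum_negf algebra_simps
          sum.swap[of _ "UNIV - {j}" UNIV])
    also have "\<dots> = (\<Sum>b\<in>UNIV. \<Sum>a\<in>UNIV - {j}. of_real (- Y$a$b) * sec pm t j (mulX j b (dslot a \<Phi>)) x) +
     (\<Sum>b\<in>UNIV. of_real (Y$j$b) * ((\<Sum>a\<in>UNIV - {j}. sec pm t j (mulX j b (mulX j a (dslot a \<Phi>))) x) +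
        (of_real (real CARD('n) / 2) + \<i> * of_real t) * sec pm t j (mulX j b \<Phi>) x))"
      using False by (simp add: sec_mulX S_def S0_def X_def sum.swap[of _ "UNIV - {j}" UNIV] mult_ac)
    finally show ?thesis .
  qed
qed

section \<open>Differentiation along Lie algebra elements\<close>

text \<open>Linear combinations of sections for a fixed t. Differentiability off the origin,
  homogeneity, finite norm and vanishing on x_i = 0 all pass to combinations, and by
  \<open>V_LY\<close> iterated Lie derivatives stay in the class.\<close>

inductive_set V :: "bool \<Rightarrow> real \<Rightarrow> 'n::finite \<Rightarrow> 'n \<Rightarrow> (real^'n \<Rightarrow> complex) set"
  for pm t i j where
  sec: "slots i \<Phi> \<Longrightarrow> sec pm t j \<Phi> \<in> V pm t i j"
| add: "f \<in> V pm t i j \<Longrightarrow> g \<in> V pm t i j \<Longrightarrow> (\<lambda>x. f x + g x) \<in> V pm t i j"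
| cmult: "f \<in> V pm t i j \<Longrightarrow> (\<lambda>x. c * f x) \<in> V pm t i j"

lemma V_diff: "f \<in> V pm t i j \<Longrightarrow> g \<in> V pm t i j \<Longrightarrow> (\<lambda>x. f x - g x) \<in> V pm t i j"
  using V.add[OF _ V.cmult[of g pm t i j "-1"]] by fastforce

lemma test_zero: "test_pos (\<lambda>_. 0)" "test (\<lambda>_. 0)"
  by (auto simp: test_pos_def test_def smooth_const intro!: exI[of _ "1::real"])

lemma V_zero: "i \<noteq> j \<Longrightarrow> (\<lambda>x. 0) \<in> V pm t i j"
  using V.cmult[OF V.sec[of i "\<lambda>_ _. 0" pm t j], of 0] test_zero by (simp add: slots_def)

lemma V_sum:
  assumes "i \<noteq> j" "finite I" "\<And>k. k \<in> I \<Longrightarrow> f k \<in> V pm t i j"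
  shows "(\<lambda>x. \<Sum>k\<in>I. f k x) \<in> V pm t i j"
  using assms(2,3) by (induction I rule: finite_induct) (auto intro: V.add V_zero[OF assms(1)])

lemma V_hom:
  "f \<in> V pm t i j \<Longrightarrow> c \<noteq> 0 \<Longrightarrow> f (c *\<^sub>R x) = radial_char pm t (real CARD('n) / 2) c * f (x :: real^'n::finite)"
  by (induction rule: V.induct) (simp_all add: sec_hom algebra_simps)

lemma V_0: "f \<in> V pm t i j \<Longrightarrow> f 0 = 0"
  by (induction rule: V.induct) (simp_all add: sec_def)

lemma V_coordinate_zero: "f \<in> V pm t i j \<Longrightarrow> i \<noteq> j \<Longrightarrow> x $ i = 0 \<Longrightarrow> f x = 0"
proof (induction rule: V.induct)
  case (sec \<Phi>)
  then have "\<Phi> i 0 = 0" by (force simp: slots_def test_pos_def)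
  then have "(\<Prod>a\<in>UNIV - {j}. \<Phi> a (x $ a / x $ j)) = 0" using sec by (intro prod_zero bexI[of _ i]) auto
  then show ?case by (simp add: sec_def)
qed auto

lemma V_differentiable: "f \<in> V pm t i j \<Longrightarrow> x \<noteq> 0 \<Longrightarrow> f differentiable (at x)"
proof (induction rule: V.induct)
  case (sec \<Phi>)
  then show ?case using sec_has_derivative[of \<Phi> x pm t j] by (auto simp: slots_def differentiable_def)
qed auto

lemma LY_add:
  assumes "f \<in> V pm t i j" "g \<in> V pm t i j"
  shows "LY Y (\<lambda>x. f x + g x) = (\<lambda>x. LY Y f x + LY Y g x)"
proof
  fix x show "LY Y (\<lambda>x. f x + g x) x = LY Y f x + LY Y g x"
  proof (cases "x = 0")
    case False
    then have "(f has_derivative frechet_derivative f (at x)) (at x)" "(g has_derivative frechet_derivative g (at x)) (at x)"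
      using assms V_differentiable frechet_derivative_works by blast+
    from LY_eq[OF has_derivative_add[OF this] False] show ?thesis using False by (simp add: LY_def)
  qed (simp add: LY_def)
qed

lemma LY_cmult:
  assumes "f \<in> V pm t i j"
  shows "LY Y (\<lambda>x. c * f x) = (\<lambda>x. c * LY Y f x)"
proof
  fix x show "LY Y (\<lambda>x. c * f x) x = c * LY Y f x"
  proof (cases "x = 0")
    case False
    then have "(f has_derivative frechet_derivative f (at x)) (at x)"
      using assms V_differentiable frechet_derivative_works by blast
    from LY_eq[OF has_derivative_mult_right[OF this] False] show ?thesis using False by (simp add: LY_def)
  qed (simp add: LY_def)
qed

lemma V_LY:
  fixes f :: "real^'n::finite \<Rightarrow> complex"
  assumes "i \<noteq> j" "f \<in> V pm t i j"
  shows "LY Y f \<in> V pm t i j"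
  using assms(2)
proof (induction rule: V.induct)
  case (sec \<Phi>)
  have "LY Y (sec pm t j \<Phi>) = (\<lambda>x.
     (\<Sum>b\<in>UNIV. \<Sum>a\<in>UNIV - {j}. of_real (- Y$a$b) * sec pm t j (mulX j b (dslot a \<Phi>)) x) +
     (\<Sum>b\<in>UNIV. of_real (Y$j$b) * ((\<Sum>a\<in>UNIV - {j}. sec pm t j (mulX j b (mulX j a (dslot a \<Phi>))) x) +
        (of_real (real CARD('n) / 2) + \<i> * of_real t) * sec pm t j (mulX j b \<Phi>) x)))"
    using sec by (intro LY_sec) (simp add: slots_def)
  moreover have "\<dots> \<in> V pm t i j"
    using sec
    by (intro V.add V_sum[OF assms(1)] V.cmult V.sec slots_mulX slots_dslot) auto
  ultimately show ?case by simp
next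
  case (add f g) then show ?case by (simp add: LY_add V.add)
next
  case (cmult f c) then show ?case by (simp add: LY_cmult V.cmult)
qed

lemma V_continuous: "f \<in> V pm t i j \<Longrightarrow> continuous_on (- {0}) f"
  by (intro continuous_at_imp_continuous_on ballI differentiable_imp_continuous_within V_differentiable) auto

lemma V_measurable: "f \<in> V pm t i j \<Longrightarrow> f \<in> borel_measurable borel"
proof -
  assume f: "f \<in> V pm t i j"
  have "(\<lambda>x. if x \<in> - {0} then f x else 0) \<in> borel_measurable borel"
    by (intro borel_measurable_continuous_on_if V_continuous[OF f] continuous_on_const) auto
  moreover have "(\<lambda>x. if x \<in> - {0} then f x else 0) = f"
    using V_0[OF f] by auto
  ultimately show ?thesis by simp
qed

lemma cmod_radial_char: "c > 0 \<Longrightarrow> cmod (radial_char pm t m c) = c powr (- m)"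
  by (simp add: radial_char_def norm_mult eps_sign_def)

lemma V_half_hom: "f \<in> V pm t i j \<Longrightarrow> half_hom f"
  unfolding half_hom_def by (auto simp: V_hom V_measurable norm_mult cmod_radial_char)

lemma V_bound:
  fixes f :: "real^'n::finite \<Rightarrow> complex"
  assumes f: "f \<in> V pm t i j"
  obtains C where "C \<ge> 0" "\<And>x. x \<noteq> 0 \<Longrightarrow> cmod (f x) \<le> C * norm x powr (- real CARD('n) / 2)"
proof -
  have "compact (sphere (0 :: real^'n) 1)" by simp
  moreover have "continuous_on (sphere (0 :: real^'n) 1) f"
    by (rule continuous_on_subset[OF V_continuous[OF f]]) auto
  ultimately have "bounded (f ` sphere 0 1)"
    by (intro compact_imp_bounded compact_continuous_image)
  then obtain C where C: "C > 0" "\<And>x. x \<in> sphere 0 1 \<Longrightarrow> cmod (f x) \<le> C"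
    by (auto simp: bounded_pos)
  show ?thesis
  proof (rule that[of C])
    fix x :: "real^'n" assume x: "x \<noteq> 0"
    let ?u = "x /\<^sub>R norm x"
    have "f x = f (norm x *\<^sub>R ?u)" using x by simp
    also have "cmod \<dots> = norm x powr (- real CARD('n) / 2) * cmod (f ?u)"
      using V_half_hom[OF f] x unfolding half_hom_def by (metis divideR_right inverse_nonzero_iff_nonzero norm_eq_zero scaleR_eq_0_iff zero_less_norm_iff)
    also have "cmod (f ?u) \<le> C" using x by (intro C(2)) simp
    finally show "cmod (f x) \<le> C * norm x powr (- real CARD('n) / 2)"
      by (simp add: mult.commute mult_right_mono)
  qed (use C in simp)
qed

lemma hnorm2_power_finite:
  "hnorm2 (\<lambda>x :: real^'n::finite. complex_of_real (C * norm x powr (- real CARD('n) / 2))) < \<infinity>"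
proof -
  let ?f = "\<lambda>x :: real^'n. complex_of_real (C * norm x powr (- real CARD('n) / 2))"
  have hh: "half_hom ?f"
    unfolding half_hom_def
  proof (intro conjI allI impI)
    show "?f \<in> borel_measurable borel" by measurable
    show "cmod (?f (c *\<^sub>R x)) = c powr (- real CARD('n) / 2) * cmod (?f x)" if "c > 0" for c x
      using that by (simp add: norm_mult powr_mult)
  qed
  have "hnorm2 ?f = (\<integral>\<^sup>+x. ennreal ((cmod (?f x))\<^sup>2) * indicator (annulus norm) x \<partial>lborel)"
    by (rule hnorm2_annulus[OF hh radial_norm])
  also have "\<dots> \<le> (\<integral>\<^sup>+x. ennreal (C\<^sup>2) * indicator (cball (0 :: real^'n) (exp 1)) x \<partial>lborel)"
  proof (rule nn_integral_mono)
    fix x :: "real^'n"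
    have "ennreal ((cmod (?f x))\<^sup>2) \<le> ennreal (C\<^sup>2)" if "1 \<le> norm x"
    proof -
      have "norm x powr (- real CARD('n) / 2) \<le> norm x powr 0" using that by (intro powr_mono) auto
      then have "norm x powr (- real CARD('n) / 2) \<le> 1" using that by (cases "x = 0") auto
      then have "\<bar>C\<bar> * norm x powr (- real CARD('n) / 2) \<le> \<bar>C\<bar>" by (simp add: mult_left_le)
      then have "cmod (?f x) \<le> \<bar>C\<bar>" by (simp add: norm_mult)
      then show ?thesis by (intro ennreal_leI) (metis abs_le_square_iff abs_norm_cancel)
    qed
    then show "ennreal ((cmod (?f x))\<^sup>2) * indicator (annulus norm) x \<le> ennreal (C\<^sup>2) * indicator (cball 0 (exp 1)) x"
      by (auto simp: annulus_def indicator_def)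
  qed
  also have "\<dots> = ennreal (C\<^sup>2) * emeasure lborel (cball (0 :: real^'n) (exp 1))"
    by (simp add: nn_integral_cmult_indicator)
  also have "\<dots> < \<infinity>"
    using emeasure_bounded_finite[of "cball (0 :: real^'n) (exp 1)"] by (simp add: ennreal_mult_less_top)
  finally show ?thesis .
qed

lemma hnorm2_mono: "(\<And>x. x \<noteq> 0 \<Longrightarrow> cmod (f x) \<le> cmod (g x)) \<Longrightarrow> hnorm2 f \<le> hnorm2 g"
  unfolding hnorm2_def
proof (rule nn_integral_mono)
  fix x assume *: "\<And>x. x \<noteq> 0 \<Longrightarrow> cmod (f x) \<le> cmod (g x)"
  show "ennreal ((cmod (f x))\<^sup>2 * wt x) \<le> ennreal ((cmod (g x))\<^sup>2 * wt x)"
    by (cases "x = 0") (auto simp: wt_def[of 0] wt_nonneg intro!: ennreal_leI mult_right_mono power_mono *)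
qed

lemma V_hnorm2_finite:
  fixes f :: "real^'n::finite \<Rightarrow> complex"
  assumes "f \<in> V pm t i j"
  shows "hnorm2 f < \<infinity>"
proof -
  obtain C where C: "C \<ge> 0" "\<And>x. x \<noteq> 0 \<Longrightarrow> cmod (f x) \<le> C * norm x powr (- real CARD('n) / 2)"
    using V_bound[OF assms] by blast
  have "hnorm2 f \<le> hnorm2 (\<lambda>x :: real^'n. complex_of_real (C * norm x powr (- real CARD('n) / 2)))"
    by (rule hnorm2_mono) (use C in \<open>simp add: norm_mult\<close>)
  also have "\<dots> < \<infinity>" by (rule hnorm2_power_finite)
  finally show ?thesis .
qed

lemma V_ind_space: "f \<in> V pm t i j \<Longrightarrow> f \<in> ind_space pm t"
  unfolding ind_space_def
  by (auto simp: V_measurable V_hnorm2_finite[unfolded infinity_ennreal_def] V_hom radial_char_def)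

lemma ind_space_half_hom: "f \<in> ind_space pm t \<Longrightarrow> half_hom f"
  unfolding ind_space_def half_hom_def by (auto simp: norm_mult eps_sign_def)

lemma wt_pos: "x \<noteq> 0 \<Longrightarrow> wt x > 0" by (simp add: wt_def)

lemma hnorm2_eq_0_iff:
  fixes f :: "real^'n::finite \<Rightarrow> complex"
  assumes "f \<in> borel_measurable borel"
  shows "hnorm2 f = 0 \<longleftrightarrow> (AE x in lborel. f x = 0)"
proof -
  have [measurable]: "f \<in> borel_measurable borel" by (rule assms)
  have nz: "AE x in lborel. x \<noteq> (0::real^'n)" by (rule AE_lborel_singleton)
  have "hnorm2 f = 0 \<longleftrightarrow> (AE x in lborel. ennreal ((cmod (f x))\<^sup>2 * wt x) = 0)"
    unfolding hnorm2_def by (rule nn_integral_0_iff_AE) measurable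
  also have "\<dots> \<longleftrightarrow> (AE x in lborel. f x = 0)"
  proof
    assume "AE x in lborel. ennreal ((cmod (f x))\<^sup>2 * wt x) = 0"
    with nz show "AE x in lborel. f x = 0"
      by eventually_elim (use wt_pos in \<open>force simp: ennreal_eq_0_iff mult_le_0_iff\<close>)
  qed (auto elim: eventually_mono)
  finally show ?thesis .
qed

lemma hnorm2_cong_AE: "(AE x in lborel. f x = g x) \<Longrightarrow> hnorm2 f = hnorm2 g"
  unfolding hnorm2_def by (rule nn_integral_cong_AE) (auto elim: eventually_mono)

lemma hnorm2_add_le:
  assumes "f \<in> borel_measurable borel" "g \<in> borel_measurable borel"
  shows "hnorm2 (\<lambda>x. f x + g x) \<le> 2 * hnorm2 f + 2 * hnorm2 g"
proof -
  have [measurable]: "f \<in> borel_measurable borel" "g \<in> borel_measurable borel" by (rule assms)+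
  have "hnorm2 (\<lambda>x. f x + g x) \<le> (\<integral>\<^sup>+x. 2 * ennreal ((cmod (f x))\<^sup>2 * wt x) + 2 * ennreal ((cmod (g x))\<^sup>2 * wt x) \<partial>lborel)"
    unfolding hnorm2_def
  proof (rule nn_integral_mono)
    fix x
    have "(cmod (f x + g x))\<^sup>2 \<le> (cmod (f x) + cmod (g x))\<^sup>2"
      by (intro power_mono norm_triangle_ineq) simp
    also have "\<dots> \<le> 2 * (cmod (f x))\<^sup>2 + 2 * (cmod (g x))\<^sup>2"
      using zero_le_power2[of "cmod (f x) - cmod (g x)"] by (simp add: power2_sum power2_diff)
    finally have "(cmod (f x + g x))\<^sup>2 * wt x \<le> 2 * ((cmod (f x))\<^sup>2 * wt x) + 2 * ((cmod (g x))\<^sup>2 * wt x)"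
      using mult_right_mono[OF _ wt_nonneg[of x]] by (fastforce simp: algebra_simps)
    from ennreal_leI[OF this] show "ennreal ((cmod (f x + g x))\<^sup>2 * wt x) \<le> 2 * ennreal ((cmod (f x))\<^sup>2 * wt x) + 2 * ennreal ((cmod (g x))\<^sup>2 * wt x)"
      by (simp add: wt_nonneg ennreal_mult')
  qed
  also have "\<dots> = 2 * hnorm2 f + 2 * hnorm2 g"
    unfolding hnorm2_def by (subst nn_integral_add) (auto simp: nn_integral_cmult)
  finally show ?thesis .
qed

lemma hnorm2_cmult: "f \<in> borel_measurable borel \<Longrightarrow> hnorm2 (\<lambda>x. c * f x) = ennreal ((cmod c)\<^sup>2) * hnorm2 f"
proof -
  assume [measurable]: "f \<in> borel_measurable borel"
  show ?thesis unfolding hnorm2_def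
    by (subst nn_integral_cmult[symmetric]) (auto simp: norm_mult power_mult_distrib ennreal_mult'[symmetric] mult_ac)
qed

lemma V_curve_deriv:
  assumes "f \<in> V pm t i j" "mexp (- (r *\<^sub>R X)) *v x \<noteq> 0"
  shows "((\<lambda>r. f (mexp (- (r *\<^sub>R X)) *v x)) has_vector_derivative LY X f (mexp (- (r *\<^sub>R X)) *v x)) (at r)"
proof -
  have eq: "- (r *\<^sub>R X) = r *\<^sub>R (- X)" for r by simp
  have "((\<lambda>r. mexp (r *\<^sub>R (- X)) *v x) has_derivative (\<lambda>h. h *\<^sub>R ((- X) *v (mexp (r *\<^sub>R (- X)) *v x)))) (at r)"
    using mexp_curve_deriv[of "- X" x r] by (simp only: has_vector_derivative_def)
  moreover have "(f has_derivative frechet_derivative f (at (mexp (r *\<^sub>R (- X)) *v x))) (at (mexp (r *\<^sub>R (- X)) *v x))"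
    using assms V_differentiable frechet_derivative_works unfolding eq by blast
  ultimately have "((\<lambda>r. f (mexp (r *\<^sub>R (- X)) *v x)) has_derivative
     (\<lambda>h. frechet_derivative f (at (mexp (r *\<^sub>R (- X)) *v x)) (h *\<^sub>R ((- X) *v (mexp (r *\<^sub>R (- X)) *v x))))) (at r)"
    by (rule has_derivative_compose)
  moreover have "linear (frechet_derivative f (at (mexp (r *\<^sub>R (- X)) *v x)))"
    using assms V_differentiable unfolding eq by (intro linear_frechet_derivative)
  moreover have "(- X) *v z = - (X *v z)" for z
    by (simp add: vec_eq_iff matrix_vector_mult_def sum_negf)
  ultimately show ?thesis
    using assms(2) unfolding eq has_vector_derivative_def LY_def
    by (simp add: linear_cmul linear_neg)
qed

text \<open>Dominated convergence. By the mean value inequality along the curve r \<mapsto> exp (- r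
  X) x, the difference quotients for small r are bounded by a constant times |x|^(- n/2), a function
  of finite norm, and they converge pointwise off the origin.\<close>

lemma V_lie_deriv:
  fixes X :: "'n::finite mat"
  assumes ij: "i \<noteq> j" and f: "f \<in> V pm t i j"
  shows "lie_deriv X f (LY X f)"
  unfolding lie_deriv_def
proof
  have L: "LY X f \<in> V pm t i j" by (rule V_LY[OF ij f])
  show "LY X f \<in> borel_measurable borel" by (rule V_measurable[OF L])
  let ?q = "\<lambda>r x. (pi_exp (r *\<^sub>R X) f x - f x) / complex_of_real r - LY X f x"
  let ?n = "real CARD('n) / 2"
  obtain \<epsilon> where \<epsilon>: "\<epsilon> > 0" "\<And>r x. \<bar>r\<bar> < \<epsilon> \<Longrightarrow> norm (mexp (r *\<^sub>R X) *v x) \<ge> norm x / 2"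
    using mexp_small by blast
  have lower: "norm (mexp (- (r *\<^sub>R X)) *v x) \<ge> norm x / 2" if "\<bar>r\<bar> < \<epsilon>" for r x
    using \<epsilon>(2)[of "- r" x] that by simp
  obtain C where C: "C \<ge> 0" "\<And>x. x \<noteq> 0 \<Longrightarrow> cmod (LY X f x) \<le> C * norm x powr (- real CARD('n) / 2)"
    using V_bound[OF L] by blast
  \<comment> \<open>Quotient and limit are bounded separately. The factor 2^(n/2) pays for orbit
    points whose norm is only half of that of x.\<close>
  define D where "D = C * 2 powr ?n + C"
  have D: "cmod (?q r x) \<le> D * norm x powr (- real CARD('n) / 2)" if r: "r \<noteq> 0" "\<bar>r\<bar> < \<epsilon>" and x: "x \<noteq> 0" for r x
  proof -
    let ?\<phi> = "\<lambda>r. f (mexp (- (r *\<^sub>R X)) *v x)"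
    have nz: "mexp (- (q *\<^sub>R X)) *v x \<noteq> 0" if "\<bar>q\<bar> < \<epsilon>" for q
      using lower[OF that, of x] x by auto
    have bd: "cmod (LY X f (mexp (- (q *\<^sub>R X)) *v x)) \<le> C * 2 powr ?n * norm x powr (- ?n)" if "\<bar>q\<bar> < \<epsilon>" for q
    proof -
      have "norm (mexp (- (q *\<^sub>R X)) *v x) powr (- ?n) \<le> (norm x / 2) powr (- ?n)"
        using lower[OF that, of x] x by (intro powr_mono2') auto
      also have "\<dots> = 2 powr ?n * norm x powr (- ?n)"
        using x by (simp add: powr_divide powr_minus field_simps)
      finally show ?thesis
        using C(2)[OF nz[OF that]] C(1) by (simp add: mult.assoc) (meson mult_left_mono order_trans)
    qed
    have "cmod (?\<phi> r - ?\<phi> 0) \<le> (C * 2 powr ?n * norm x powr (- ?n)) * norm (r - 0)"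
    proof (rule differentiable_bound[of "{-\<bar>r\<bar>..\<bar>r\<bar>}" ?\<phi> "\<lambda>q h. h *\<^sub>R LY X f (mexp (- (q *\<^sub>R X)) *v x)"])
      fix q assume q: "q \<in> {-\<bar>r\<bar>..\<bar>r\<bar>}"
      then have q': "\<bar>q\<bar> < \<epsilon>" using r by auto
      show "(?\<phi> has_derivative (\<lambda>h. h *\<^sub>R LY X f (mexp (- (q *\<^sub>R X)) *v x))) (at q within {-\<bar>r\<bar>..\<bar>r\<bar>})"
        using V_curve_deriv[OF f nz[OF q']] unfolding has_vector_derivative_def
        by (rule has_derivative_at_withinI)
      show "onorm (\<lambda>h. h *\<^sub>R LY X f (mexp (- (q *\<^sub>R X)) *v x)) \<le> C * 2 powr ?n * norm x powr (- ?n)"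
        using bd[OF q'] by (intro onorm_le) (simp add: mult.commute mult_left_mono)
    qed auto
    then have "cmod ((pi_exp (r *\<^sub>R X) f x - f x) / complex_of_real r) \<le> C * 2 powr ?n * norm x powr (- ?n)"
      using r by (simp add: pi_exp_def norm_divide divide_le_eq)
    then show ?thesis
      using C(2)[OF x] norm_triangle_ineq4[of "(pi_exp (r *\<^sub>R X) f x - f x) / complex_of_real r" "LY X f x"]
      by (simp add: D_def algebra_simps)
  qed
  show "((\<lambda>r. hnorm2 (?q r)) \<longlongrightarrow> 0) (at 0)"
    unfolding tendsto_at_iff_sequentially o_def
  proof (intro allI impI)
    fix S :: "nat \<Rightarrow> real" assume S: "\<forall>k. S k \<in> UNIV - {0}" "S \<longlonglongrightarrow> 0"
    have ev: "eventually (\<lambda>k. \<bar>S k\<bar> < \<epsilon>) sequentially"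
      using tendstoD[OF S(2) \<epsilon>(1)] by (simp add: dist_real_def)
    then obtain N where N: "\<And>k. k \<ge> N \<Longrightarrow> \<bar>S k\<bar> < \<epsilon>" by (auto simp: eventually_sequentially)
    have [measurable]: "(\<lambda>x. mexp Z *v x) \<in> borel_measurable borel" for Z :: "'n mat"
      by (intro borel_measurable_continuous_onI linear_continuous_on matrix_vector_mul_bounded_linear)
    have [measurable]: "f \<in> borel_measurable borel" "LY X f \<in> borel_measurable borel"
      using V_measurable[OF f] V_measurable[OF L] .
    have "(\<lambda>k. \<integral>\<^sup>+x. ennreal ((cmod (?q (S (k + N)) x))\<^sup>2 * wt x) \<partial>lborel) \<longlonglongrightarrow> (\<integral>\<^sup>+(x::real^'n). 0 \<partial>lborel)"
    proof (rule nn_integral_dominated_convergence)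
      show "AE x in lborel. ennreal ((cmod (?q (S (k + N)) x))\<^sup>2 * wt x) \<le>
          ennreal ((cmod (complex_of_real (D * norm x powr (- real CARD('n) / 2))))\<^sup>2 * wt x)" for k
      proof (rule AE_I2)
        fix x :: "real^'n"
        show "ennreal ((cmod (?q (S (k + N)) x))\<^sup>2 * wt x) \<le>
          ennreal ((cmod (complex_of_real (D * norm x powr (- real CARD('n) / 2))))\<^sup>2 * wt x)"
        proof (cases "x = 0")
          case False
          have "cmod (?q (S (k + N)) x) \<le> cmod (complex_of_real (D * norm x powr (- real CARD('n) / 2)))"
            using D[OF _ N[of "k + N"] False] S(1) by (simp add: norm_mult) (meson abs_ge_self mult_right_mono order_trans powr_ge_zero)
          then show ?thesis by (intro ennreal_leI mult_right_mono power_mono) (auto simp: wt_nonneg)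
        qed (simp add: wt_def)
      qed
      show "(\<integral>\<^sup>+(x::real^'n). ennreal ((cmod (complex_of_real (D * norm x powr (- real CARD('n) / 2))))\<^sup>2 * wt x) \<partial>lborel) < \<infinity>"
        using hnorm2_power_finite[where 'n = 'n, of D] unfolding hnorm2_def .
      show "AE x in lborel. (\<lambda>k. ennreal ((cmod (?q (S (k + N)) x))\<^sup>2 * wt x)) \<longlonglongrightarrow> 0"
      proof (rule AE_I2)
        fix x :: "real^'n"
        show "(\<lambda>k. ennreal ((cmod (?q (S (k + N)) x))\<^sup>2 * wt x)) \<longlonglongrightarrow> 0"
        proof (cases "x = 0")
          case False
          have "((\<lambda>r. f (mexp (- (r *\<^sub>R X)) *v x)) has_vector_derivative LY X f x) (at 0)"
            using V_curve_deriv[OF f, of 0 X x] False by simp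
          then have "((\<lambda>r. ?q r x) \<longlongrightarrow> 0) (at 0)"
          proof -
            assume "((\<lambda>r. f (mexp (- (r *\<^sub>R X)) *v x)) has_vector_derivative LY X f x) (at 0)"
            then have "((\<lambda>r. f (mexp (- (r *\<^sub>R X)) *v x)) has_derivative (\<lambda>h. h *\<^sub>R LY X f x)) (at 0)"
              by (simp only: has_vector_derivative_def)
            then have l: "((\<lambda>r. norm (f (mexp (- (r *\<^sub>R X)) *v x) - f x - r *\<^sub>R LY X f x) / norm r) \<longlongrightarrow> 0) (at 0)"
              by (simp add: has_derivative_iff_norm)
            have e: "norm (f (mexp (- (r *\<^sub>R X)) *v x) - f x - r *\<^sub>R LY X f x) / norm r = norm (?q r x)"
              if "r \<noteq> 0" for r
            proof -
              have "?q r x = (f (mexp (- (r *\<^sub>R X)) *v x) - f x - r *\<^sub>R LY X f x) / complex_of_real r"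
                using that by (simp add: pi_exp_def scaleR_conv_of_real field_simps)
              then show ?thesis by (simp add: norm_divide)
            qed
            have "((\<lambda>r. norm (?q r x)) \<longlongrightarrow> 0) (at 0)"
              by (rule Lim_transform_eventually[OF l], unfold eventually_at_filter, rule always_eventually, intro allI impI, erule e)
            then show ?thesis by (simp add: tendsto_norm_zero_iff)
          qed
          then have "(\<lambda>k. ?q (S (k + N)) x) \<longlonglongrightarrow> 0"
          proof (rule filterlim_compose[where g = "\<lambda>r. ?q r x"])
            show "filterlim (\<lambda>k. S (k + N)) (at 0) sequentially"
              using S LIMSEQ_ignore_initial_segment[OF S(2), of N] by (simp add: filterlim_at)
          qed
          then have "(\<lambda>k. (cmod (?q (S (k + N)) x))\<^sup>2 * wt x) \<longlonglongrightarrow> (cmod 0)\<^sup>2 * wt x"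
            by (intro tendsto_intros)
          from tendsto_ennrealI[OF this] show ?thesis by simp
        qed (simp add: wt_def)
      qed
    qed (simp_all add: pi_exp_def)
    then have "(\<lambda>k. hnorm2 (?q (S (k + N)))) \<longlonglongrightarrow> 0" by (simp add: hnorm2_def)
    then show "(\<lambda>k. hnorm2 (?q (S k))) \<longlonglongrightarrow> 0" by (rule LIMSEQ_offset)
  qed
qed

section \<open>Sobolev norms of smooth sections\<close>

text \<open>Lie derivatives are determined only almost everywhere, so a change of f on a null set
  has to remain a change on a null set after composition with exp (- r X).\<close>

lemma AE_linear_preimage:
  fixes E :: "real^'n::finite \<Rightarrow> real^'n"
  assumes "linear E" "inj E" "AE x in lborel. P x"
  shows "AE x in lborel. P (E x)"
proof -
  obtain N where N: "N \<in> null_sets lborel" "{x. \<not> P x} \<subseteq> N"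
    using assms(3) unfolding eventually_ae_filter by auto
  obtain g where g: "linear g" "\<And>x. g (E x) = x" "\<And>x. E (g x) = x"
    using linear_injective_isomorphism[OF assms(1,2)] by blast
  have "negligible N" using N(1) by (simp add: negligible_iff_null_sets null_sets_completionI)
  then have "negligible (g ` N)"
    by (intro negligible_differentiable_image_negligible) (auto intro: linear_imp_differentiable_on g(1))
  moreover have "g ` N = {x. E x \<in> N}"
  proof (intro set_eqI iffI)
    show "x \<in> {x. E x \<in> N}" if "x \<in> g ` N" for x using that g(3) by auto
    show "x \<in> g ` N" if "x \<in> {x. E x \<in> N}" for x
      using that g(2)[of x] by (intro image_eqI[of _ _ "E x"]) auto
  qed
  ultimately have n: "{x. E x \<in> N} \<in> null_sets lebesgue" by (simp add: negligible_iff_null_sets)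
  have "E \<in> borel_measurable borel"
    by (intro borel_measurable_continuous_onI linear_continuous_on) (use assms(1) in \<open>simp add: linear_conv_bounded_linear\<close>)
  then have "{x. E x \<in> N} \<in> sets lborel"
    using N(1) measurable_sets[of E borel borel N] by (auto simp: null_sets_def vimage_def)
  then have "{x. E x \<in> N} \<in> null_sets lborel" using n by (simp add: null_sets_completion_iff)
  then show ?thesis by (rule AE_I') (use N(2) in auto)
qed

text \<open>\<open>sob_int2\<close> selects its derivatives by \<open>SOME\<close>. Uniqueness up to
  null sets, valid also when the function to be differentiated was itself only determined almost
  everywhere by the earlier letters of the word, is what allows the selection to be replaced by
  \<open>LY\<close>.\<close>

lemma lie_deriv_unique:
  fixes f :: "real^'n::finite \<Rightarrow> complex"
  assumes ij: "i \<noteq> j" and f: "f \<in> V pm t i j" and f': "f' \<in> borel_measurable borel"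
    and eq: "AE x in lborel. f' x = f x" and L: "lie_deriv X f' h"
  shows "h \<in> borel_measurable borel" "AE x in lborel. h x = LY X f x"
proof -
  show h: "h \<in> borel_measurable borel" using L by (simp add: lie_deriv_def)
  have [measurable]: "f \<in> borel_measurable borel" "h \<in> borel_measurable borel" "LY X f \<in> borel_measurable borel" "f' \<in> borel_measurable borel"
    using V_measurable[OF f] V_measurable[OF V_LY[OF ij f]] h f' by auto
  have [measurable]: "(\<lambda>x. mexp Z *v x) \<in> borel_measurable borel" for Z :: "'n mat"
    by (intro borel_measurable_continuous_onI linear_continuous_on matrix_vector_mul_bounded_linear)
  obtain \<epsilon> where \<epsilon>: "\<epsilon> > 0" "\<And>r x. \<bar>r\<bar> < \<epsilon> \<Longrightarrow> norm (mexp (r *\<^sub>R X) *v x) \<ge> norm x / 2"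
    using mexp_small by blast
  let ?q = "\<lambda>f h r x. (pi_exp (r *\<^sub>R X) f x - f x) / complex_of_real r - h x"
  have 1: "((\<lambda>r. hnorm2 (?q f' h r)) \<longlongrightarrow> 0) (at 0)" using L by (simp add: lie_deriv_def)
  have 2: "((\<lambda>r. hnorm2 (?q f (LY X f) r)) \<longlongrightarrow> 0) (at 0)"
    using V_lie_deriv[OF ij f] by (simp add: lie_deriv_def)
  have bd: "hnorm2 (\<lambda>x. h x - LY X f x) \<le> 2 * hnorm2 (?q f (LY X f) r) + 2 * hnorm2 (?q f' h r)" if r: "\<bar>r\<bar> < \<epsilon>" for r
  proof -
    have "inj ((*v) (mexp (- (r *\<^sub>R X))))"
    proof (rule injI)
      fix x y assume "mexp (- (r *\<^sub>R X)) *v x = mexp (- (r *\<^sub>R X)) *v y"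
      then have "mexp ((- r) *\<^sub>R X) *v (x - y) = 0" by (simp add: matrix_vector_mult_diff_distrib)
      then show "x = y" using \<epsilon>(2)[of "- r" "x - y"] r by simp
    qed
    from AE_linear_preimage[OF matrix_vector_mul_linear this eq]
    have "AE x in lborel. pi_exp (r *\<^sub>R X) f' x = pi_exp (r *\<^sub>R X) f x" by (simp add: pi_exp_def)
    with eq have "AE x in lborel. h x - LY X f x = ?q f (LY X f) r x + - 1 * ?q f' h r x"
      by eventually_elim simp
    then have "hnorm2 (\<lambda>x. h x - LY X f x) = hnorm2 (\<lambda>x. ?q f (LY X f) r x + - 1 * ?q f' h r x)"
      by (rule hnorm2_cong_AE)
    also have "\<dots> \<le> 2 * hnorm2 (?q f (LY X f) r) + 2 * hnorm2 (\<lambda>x. - 1 * ?q f' h r x)"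
      by (rule hnorm2_add_le) (simp_all add: pi_exp_def)
    also have "hnorm2 (\<lambda>x. - 1 * ?q f' h r x) = hnorm2 (?q f' h r)"
      by (subst hnorm2_cmult) (simp_all add: pi_exp_def)
    finally show ?thesis .
  qed
  have "((\<lambda>r. 2 * hnorm2 (?q f (LY X f) r) + 2 * hnorm2 (?q f' h r)) \<longlongrightarrow> 2 * 0 + 2 * 0) (at 0)"
    by (intro tendsto_add ennreal_tendsto_cmult 1 2) simp_all
  then have "hnorm2 (\<lambda>x. h x - LY X f x) \<le> 2 * 0 + 2 * 0"
    by (rule tendsto_lowerbound) (use \<epsilon>(1) bd in \<open>auto simp: eventually_at intro!: exI[of _ \<epsilon>]\<close>)
  then have "hnorm2 (\<lambda>x. h x - LY X f x) = 0" by simp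
  then show "AE x in lborel. h x = LY X f x"
    by (subst (asm) hnorm2_eq_0_iff) auto
qed

lemma V_foldr_LY: "i \<noteq> j \<Longrightarrow> f \<in> V pm t i j \<Longrightarrow> foldr LY Ys f \<in> V pm t i j"
  by (induction Ys) (auto intro: V_LY)

lemma iter_deriv_foldr: "i \<noteq> j \<Longrightarrow> f \<in> V pm t i j \<Longrightarrow> iter_deriv Ys f (foldr LY Ys f)"
proof (induction Ys)
  case (Cons Y Ys)
  then show ?case
    using iter_deriv.intros(2)[of Ys f "foldr LY Ys f" Y] V_lie_deriv[OF Cons(2) V_foldr_LY[OF Cons(2,3), of Ys]] by simp
qed (simp add: iter_deriv.intros)

lemma iter_deriv_unique:
  assumes "iter_deriv Ys f h" "i \<noteq> j" "f \<in> V pm t i j"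
  shows "h \<in> borel_measurable borel \<and> (AE x in lborel. h x = foldr LY Ys f x)"
  using assms
proof (induction rule: iter_deriv.induct)
  case (1 f) then show ?case by (simp add: V_measurable)
next
  case (2 Ys f h' Y h)
  then show ?case using lie_deriv_unique[OF 2(4) V_foldr_LY[OF 2(4,5), of Ys], of h' Y h] by simp
qed

lemma sob_int2_V:
  assumes "i \<noteq> j" "f \<in> V pm t i j"
  shows "sob_int2 pm t B k f = hnorm2 f +
     (\<Sum>Ys\<in>{Ys. 1 \<le> length Ys \<and> length Ys \<le> k \<and> set Ys \<subseteq> B}. hnorm2 (foldr LY Ys f))"
proof -
  have "hnorm2 (SOME h. iter_deriv Ys f h) = hnorm2 (foldr LY Ys f)" for Ys
    using iter_deriv_unique[OF someI[of "iter_deriv Ys f", OF iter_deriv_foldr[OF assms]] assms]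
    by (intro hnorm2_cong_AE) simp
  moreover have "\<exists>h. iter_deriv Ys f h \<and> hnorm2 h < \<infinity>" for Ys
    using iter_deriv_foldr[OF assms] V_hnorm2_finite[OF V_foldr_LY[OF assms]] by blast
  ultimately show ?thesis
    unfolding sob_int2_def using V_ind_space[OF assms(2)] by simp
qed

lemma V_smooth_vec:
  assumes "i \<noteq> j" "f \<in> V pm t i j"
  shows "smooth_vec pm t B f"
  unfolding smooth_vec_def sob_int2_V[OF assms]
proof (intro conjI allI)
  fix k
  let ?W = "{Ys. 1 \<le> length Ys \<and> length Ys \<le> k \<and> set Ys \<subseteq> B}"
  show "hnorm2 f + (\<Sum>Ys\<in>?W. hnorm2 (foldr LY Ys f)) < \<infinity>"
    using V_hnorm2_finite[OF assms(2)] V_hnorm2_finite[OF V_foldr_LY[OF assms]]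
    by (cases "finite ?W") (auto simp: less_top)
qed (rule V_ind_space[OF assms(2)])

lemma LY_zero: "i \<noteq> (j :: 'n::finite) \<Longrightarrow> LY Y (\<lambda>x :: real^'n. 0) = (\<lambda>x. 0)"
  using LY_cmult[where c = 0, OF V_zero[of i j undefined undefined]] by simp

lemma sob_int2_zero:
  assumes "i \<noteq> (j :: 'n::finite)"
  shows "sob_int2 pm t B k (\<lambda>x :: real^'n. 0) = 0"
proof -
  have "foldr LY Ys (\<lambda>x :: real^'n. 0) = (\<lambda>x. 0)" for Ys
    by (induction Ys) (simp_all add: LY_zero[OF assms])
  then show ?thesis using assms by (simp add: sob_int2_V[OF assms V_zero[OF assms]] hnorm2_def)
qed

section \<open>Interpolation between consecutive integer orders\<close>

definition interp_const :: "(nat \<Rightarrow> real) \<Rightarrow> real \<Rightarrow> real" where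
  "interp_const A r = (let k = nat \<lfloor>r\<rfloor>; \<theta> = r - of_int \<lfloor>r\<rfloor> in
     if \<theta> = 0 then A k else A k / (2 * \<theta>) + A (Suc k) / (2 - 2 * \<theta>))"

text \<open>The trivial splittings f = f + 0 and f = 0 + f bound the K-functional by A_k T^(2k) and
  by \<tau>^2 A_(k+1) T^(2k+2). Using the second up to \<tau> = 1 / T and the first beyond makes
  both parts of the integral multiples of T^(2r); their factors 1 / (2 - 2 \<theta>) and 1 / (2
  \<theta>) are those of \<open>interp_const\<close>.\<close>

lemma sob2_le:
  fixes f :: "real^'n::finite \<Rightarrow> complex"
  assumes ij: "i \<noteq> j" and f: "f \<in> V pm t i j" and T: "T > 0" and r: "r \<ge> 0" and A: "\<And>k. A k \<ge> 0"
    and bd: "\<And>k. sob_int2 pm t B k f \<le> ennreal (A k * T powr (2 * real k))"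
  shows "sob2 pm t B r f \<le> ennreal (interp_const A r * T powr (2 * r))"
proof -
  define k \<theta> where "k = nat \<lfloor>r\<rfloor>" and "\<theta> = r - of_int \<lfloor>r\<rfloor>"
  have rk: "r = real k + \<theta>" "\<theta> \<ge> 0" "\<theta> < 1" using r unfolding k_def \<theta>_def by linarith+
  show ?thesis
  proof (cases "\<theta> = 0")
    case True
    then have "r = of_int \<lfloor>r\<rfloor>" by (simp add: \<theta>_def)
    then have "sob2 pm t B r f = sob_int2 pm t B k f" unfolding sob2_def k_def by (rule if_P)
    also have "\<dots> \<le> ennreal (A k * T powr (2 * real k))" by (rule bd)
    finally show ?thesis using True rk by (simp add: interp_const_def Let_def k_def[symmetric] \<theta>_def[symmetric])
  next
    case False
    then have \<theta>: "0 < \<theta>" "\<theta> < 1" using rk by auto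
    let ?K = "\<lambda>\<tau>. K2 pm t B k \<tau> f"
    have z: "(\<lambda>x :: real^'n. 0) \<in> ind_space pm t" using V_ind_space[OF V_zero[OF ij]] .
    have fi: "f \<in> ind_space pm t" using V_ind_space[OF f] .
    have K0: "?K \<tau> \<le> ennreal (A k * T powr (2 * real k))" for \<tau>
    proof -
      have "?K \<tau> \<le> sob_int2 pm t B k f + ennreal (\<tau>\<^sup>2) * sob_int2 pm t B (Suc k) (\<lambda>x. 0)"
        unfolding K2_def by (rule Inf_lower) (use z fi in \<open>force simp: hnorm2_def\<close>)
      then show ?thesis using bd[of k] by (simp add: sob_int2_zero[OF ij])
    qed
    have K1: "?K \<tau> \<le> ennreal (\<tau>\<^sup>2) * ennreal (A (Suc k) * T powr (2 * real k + 2))" for \<tau>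
    proof -
      have "?K \<tau> \<le> sob_int2 pm t B k (\<lambda>x. 0) + ennreal (\<tau>\<^sup>2) * sob_int2 pm t B (Suc k) f"
        unfolding K2_def by (rule Inf_lower) (use z fi in \<open>force simp: hnorm2_def\<close>)
      then show ?thesis using mult_left_mono[OF bd[of "Suc k"], of "ennreal (\<tau>\<^sup>2)"]
        by (simp add: sob_int2_zero[OF ij] add.commute)
    qed
    let ?a = "A (Suc k) * T powr (2 * real k + 2)" and ?b = "A k * T powr (2 * real k)"
    have "sob2 pm t B r f = (\<integral>\<^sup>+ \<tau>. indicator {0<..} \<tau> * ennreal (\<tau> powr (- 2 * \<theta> - 1)) * ?K \<tau> \<partial>lborel)"
      using False by (simp add: sob2_def k_def \<theta>_def)
    also have "\<dots> \<le> (\<integral>\<^sup>+ \<tau>. ennreal ?a * ennreal (indicator {0..1/T} \<tau> * \<tau> powr (1 - 2 * \<theta>)) +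
        ennreal ?b * ennreal (indicator {1/T..} \<tau> * \<tau> powr (- 2 * \<theta> - 1)) \<partial>lborel)"
    proof (rule nn_integral_mono)
      fix \<tau> :: real
      show "indicator {0<..} \<tau> * ennreal (\<tau> powr (- 2 * \<theta> - 1)) * ?K \<tau> \<le>
        ennreal ?a * ennreal (indicator {0..1/T} \<tau> * \<tau> powr (1 - 2 * \<theta>)) +
        ennreal ?b * ennreal (indicator {1/T..} \<tau> * \<tau> powr (- 2 * \<theta> - 1))"
      proof (cases "0 < \<tau> \<and> \<tau> \<le> 1/T")
        case True
        have "\<tau> powr (- 2 * \<theta> - 1) * \<tau>\<^sup>2 = \<tau> powr (1 - 2 * \<theta>)"
        proof -
          have "\<tau>\<^sup>2 = \<tau> powr 2" using True by simp
          then show ?thesis by (simp only: powr_add[symmetric]) (simp add: algebra_simps)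
        qed
        then have "ennreal (\<tau> powr (- 2 * \<theta> - 1)) * (ennreal (\<tau>\<^sup>2) * ennreal ?a) = ennreal ?a * ennreal (\<tau> powr (1 - 2 * \<theta>))"
          by (simp add: mult_ac ennreal_mult'[symmetric] A)
        moreover have "ennreal (\<tau> powr (- 2 * \<theta> - 1)) * ?K \<tau> \<le> ennreal (\<tau> powr (- 2 * \<theta> - 1)) * (ennreal (\<tau>\<^sup>2) * ennreal ?a)"
          by (intro mult_left_mono K1) simp
        ultimately show ?thesis using True by (simp add: add_increasing2)
      next
        case False
        show ?thesis
        proof (cases "\<tau> > 0")
          case True
          then have "\<tau> \<ge> 1 / T" using False by auto
          moreover have "ennreal (\<tau> powr (- 2 * \<theta> - 1)) * ?K \<tau> \<le> ennreal (\<tau> powr (- 2 * \<theta> - 1)) * ennreal ?b"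
            by (intro mult_left_mono K0) simp
          ultimately show ?thesis using True by (simp add: add_increasing mult.commute)
        qed simp
      qed
    qed
    also have "\<dots> = ennreal ?a * ennreal ((1/T) powr (2 - 2 * \<theta>) / (2 - 2 * \<theta>)) + ennreal ?b * ennreal ((1/T) powr (- 2 * \<theta>) / (2 * \<theta>))"
    proof -
      have "((\<lambda>\<tau>. \<tau> powr (1 - 2 * \<theta>)) has_integral ((1/T) powr (1 - 2 * \<theta> + 1) / (1 - 2 * \<theta> + 1))) {0..1/T}"
        using \<theta> T by (intro has_integral_powr_from_0) auto
      from nn_integral_has_integral_lebesgue[OF _ this]
      have i1: "(\<integral>\<^sup>+ \<tau>. ennreal (indicator {0..1/T} \<tau> * \<tau> powr (1 - 2 * \<theta>)) \<partial>lborel) = ennreal ((1/T) powr (2 - 2 * \<theta>) / (2 - 2 * \<theta>))"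
        by simp
      have "((\<lambda>\<tau>. \<tau> powr (- 2 * \<theta> - 1)) has_integral (- ((1/T) powr (- 2 * \<theta> - 1 + 1)) / (- 2 * \<theta> - 1 + 1))) {1/T..}"
        using \<theta> T by (intro has_integral_powr_to_inf) auto
      from nn_integral_has_integral_lebesgue[OF _ this]
      have i2: "(\<integral>\<^sup>+ \<tau>. ennreal (indicator {1/T..} \<tau> * \<tau> powr (- 2 * \<theta> - 1)) \<partial>lborel) = ennreal ((1/T) powr (- 2 * \<theta>) / (2 * \<theta>))"
        by simp
      show ?thesis
        by (subst nn_integral_add) (simp_all add: nn_integral_cmult i1[simplified] i2[simplified])
    qed
    also have "\<dots> = ennreal (?a * ((1/T) powr (2 - 2 * \<theta>) / (2 - 2 * \<theta>)) + ?b * ((1/T) powr (- 2 * \<theta>) / (2 * \<theta>)))"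
      using \<theta> A by (simp add: ennreal_mult'[symmetric] ennreal_plus[symmetric] del: ennreal_plus)
    also have "?a * ((1/T) powr (2 - 2 * \<theta>) / (2 - 2 * \<theta>)) + ?b * ((1/T) powr (- 2 * \<theta>) / (2 * \<theta>)) =
        interp_const A r * T powr (2 * r)"
    proof -
      have "T powr (2 * real k + 2) * (1/T) powr (2 - 2 * \<theta>) = T powr (2 * r)"
        "T powr (2 * real k) * (1/T) powr (- 2 * \<theta>) = T powr (2 * r)"
      proof -
        have inv: "(1/T) powr c = T powr (- c)" for c using T by (simp add: powr_divide powr_minus_divide)
        show "T powr (2 * real k + 2) * (1/T) powr (2 - 2 * \<theta>) = T powr (2 * r)"
          "T powr (2 * real k) * (1/T) powr (- 2 * \<theta>) = T powr (2 * r)"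
          unfolding inv by (simp_all add: rk(1) algebra_simps flip: powr_add)
      qed
      then have e: "?a * ((1/T) powr (2 - 2 * \<theta>) / (2 - 2 * \<theta>)) = A (Suc k) / (2 - 2 * \<theta>) * T powr (2 * r)"
        "?b * ((1/T) powr (- 2 * \<theta>) / (2 * \<theta>)) = A k / (2 * \<theta>) * T powr (2 * r)"
        by (simp_all add: mult.assoc)
      show ?thesis
        unfolding e using False
        by (simp add: interp_const_def Let_def k_def[symmetric] \<theta>_def[symmetric] distrib_right)
    qed
    finally show ?thesis .
  qed
qed

section \<open>Families of oscillating functions\<close>

definition test_on :: "real \<Rightarrow> real \<Rightarrow> (real \<Rightarrow> complex) \<Rightarrow> bool" where
  "test_on l u f \<longleftrightarrow> smooth f \<and> (\<forall>x. f x \<noteq> 0 \<longrightarrow> l \<le> x \<and> x \<le> u)"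

lemma test_on_test: "test_on l u f \<Longrightarrow> test f"
  unfolding test_on_def test_def by (auto simp: abs_le_iff intro!: exI[of _ "max \<bar>l\<bar> \<bar>u\<bar>"] dest!: spec)

lemma test_on_pos: "l > 0 \<Longrightarrow> test_on l u f \<Longrightarrow> test_pos f"
  unfolding test_on_def test_pos_def by blast

lemma test_on_vd: "test_on l u f \<Longrightarrow> test_on l u (vd f)"
proof -
  assume f: "test_on l u f"
  have "vd f x = 0" if "\<not> (l \<le> x \<and> x \<le> u)" for x
    using vd_zero_off_support[of f "{l..u}" x] f that by (force simp: test_on_def)
  then show ?thesis using f by (auto simp: test_on_def smooth_vd)
qed

lemma test_on_mult: "test_on l u f \<Longrightarrow> smooth g \<Longrightarrow> test_on l u (\<lambda>x. g x * f x)"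
  by (auto simp: test_on_def smooth_mult)

lemma test_on_mult_id: "test_on l u f \<Longrightarrow> test_on l u (\<lambda>x. of_real x * f x)"
  by (rule test_on_mult[OF _ smooth_of_real])

lemma test_on_bounded:
  assumes "test_on l u f"
  obtains M where "M \<ge> 0" "\<And>x. cmod (f x) \<le> M"
proof -
  have "compact (f ` {l..u})"
    using assms by (intro compact_continuous_image continuous_on_subset[OF smooth_continuous]) (auto simp: test_on_def)
  then obtain M where M: "M > 0" "\<And>x. x \<in> {l..u} \<Longrightarrow> cmod (f x) \<le> M"
    using compact_imp_bounded bounded_pos by (metis imageI)
  have "cmod (f x) \<le> M" for x
    using assms M by (cases "f x = 0") (auto simp: test_on_def)
  then show ?thesis using that[of M] M(1) by simp
qed

text \<open>Differentiating a quotient raises the power of 1 / x, so the induction is over all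
  powers m and all f supported in [l, u] at once. To the left of l every function involved vanishes,
  which removes the singularity at 0.\<close>

lemma test_on_div:
  assumes l: "l > 0" and f: "test_on l u f"
  shows "test_on l u (\<lambda>x. f x / of_real x)"
proof -
  have Ck: "Ck k (\<lambda>x. f x * inverse (of_real x) ^ m)" if "test_on l u f" for k m f
    using that
  proof (induction k arbitrary: f m)
    case (Suc k)
    have f: "smooth f" "\<And>x. x < l \<Longrightarrow> f x = 0" using Suc(2) by (force simp: test_on_def)+
    have v: "\<And>x. x < l \<Longrightarrow> vd f x = 0" using test_on_vd[OF Suc(2)] by (force simp: test_on_def)
    have "((\<lambda>x. f x * inverse (of_real x) ^ m) has_vector_derivative
        (vd f x * inverse (of_real x) ^ m + (- of_nat m) * (f x * inverse (of_real x) ^ Suc m))) (at x)" for x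
    proof (cases "x < l")
      case True
      have "((\<lambda>x. f x * inverse (of_real x) ^ m) has_vector_derivative 0) (at x)"
        by (rule has_vector_derivative_transform_within_open[OF has_vector_derivative_const[of 0], of "{..<l}"])
          (use True f in auto)
      then show ?thesis using True f v by simp
    next
      case False
      then have x: "x \<noteq> 0" using l by auto
      have "((\<lambda>x. inverse (of_real x :: complex) ^ m) has_vector_derivative - of_nat m * inverse (of_real x) ^ Suc m) (at x)"
      proof -
        have "((\<lambda>z::complex. inverse z ^ m) has_field_derivative - of_nat m * inverse (of_real x) ^ Suc m) (at (of_real x))"
          by (rule DERIV_cong[OF DERIV_power[OF DERIV_inverse]]) (use x in \<open>cases m; simp add: algebra_simps\<close>)+
        from field_vector_diff_chain_at[OF has_vector_derivative_of_real[OF DERIV_ident] this, simplified]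
        show ?thesis by (simp add: o_def)
      qed
      from has_vector_derivative_mult[OF smooth_deriv[OF f(1)] this]
      show ?thesis by (simp add: algebra_simps)
    qed
    moreover have "Ck k (\<lambda>x. vd f x * inverse (of_real x) ^ m + (- of_nat m) * (f x * inverse (of_real x) ^ Suc m))"
      by (intro Ck_add Ck_mult[OF Ck_const] Suc.IH test_on_vd Suc.prems)
    ultimately show ?case by (rule Ck_SucI)
  next
    case 0
    have f: "smooth f" "\<And>x. x < l \<Longrightarrow> f x = 0" using 0 by (force simp: test_on_def)+
    have "continuous (at x) (\<lambda>x. f x * inverse (of_real x) ^ m)" for x
    proof (cases "x < l")
      case True
      have "((\<lambda>x. f x * inverse (of_real x) ^ m) has_vector_derivative 0) (at x)"
        by (rule has_vector_derivative_transform_within_open[OF has_vector_derivative_const[of 0], of "{..<l}"])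
          (use True f in auto)
      then show ?thesis by (rule has_vector_derivative_continuous)
    next
      case False
      then have "x \<noteq> 0" using l by auto
      moreover have "isCont f x" using smooth_continuous[OF f(1)] by (simp add: continuous_on_eq_continuous_at)
      ultimately show ?thesis by (intro continuous_intros) auto
    qed
    then show ?case by (simp add: continuous_on_eq_continuous_at)
  qed
  have "smooth (\<lambda>x. f x / of_real x)"
    unfolding smooth_def using Ck[OF f, of _ 1] by (simp add: divide_inverse)
  then show ?thesis using f by (auto simp: test_on_def)
qed

lemma cis_deriv: "((\<lambda>x. cis (c * x)) has_vector_derivative \<i> * of_real c * cis (c * x)) (at x)"
proof -
  have "((\<lambda>z. exp (\<i> * of_real c * z)) has_field_derivative exp (\<i> * of_real c * of_real x) * (\<i> * of_real c * 1)) (at (of_real x))"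
    by (intro DERIV_chain2[OF DERIV_exp] DERIV_cmult DERIV_ident)
  from field_vector_diff_chain_at[OF has_vector_derivative_of_real[OF DERIV_ident] this]
  show ?thesis by (simp add: o_def cis_conv_exp mult_ac)
qed

lemma smooth_cis: "smooth (\<lambda>x. cis (c * x))"
proof -
  note d = cis_deriv[of c]
  have "Ck k (\<lambda>x. cis (c * x))" for k
  proof (induction k)
    case 0 then show ?case using d by (auto simp: continuous_on_eq_continuous_at intro: has_vector_derivative_continuous)
  next
    case (Suc k) then show ?case by (intro Ck_SucI[OF d] Ck_mult Ck_const)
  qed
  then show ?thesis by (simp add: smooth_def)
qed

text \<open>The factor |t|^(-1/2) gives norm of order 1 on a support of length of order |t|. In a
  section the phase - t ln w with w = x_i / x_j changes the radial phase - t ln |x_j| into - t ln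
  |x_i|.\<close>

definition chirp :: "(real \<Rightarrow> complex) \<Rightarrow> real \<Rightarrow> real \<Rightarrow> complex" where
  "chirp \<psi> t w = of_real (\<bar>t\<bar> powr (- 1 / 2)) * cis (- t * ln w) * \<psi> (w / \<bar>t\<bar>)"

text \<open>With sgn t in the frequency, the difference of the phases of \<open>chirp\<close> and
  \<open>osc\<close> is stationary at w = |t| / \<omega> > 0 for either sign of t.\<close>

definition osc :: "real \<Rightarrow> (real \<Rightarrow> complex) \<Rightarrow> real \<Rightarrow> real \<Rightarrow> complex" where
  "osc \<omega> b t w = cis (- (sgn t * \<omega>) * w) * b w"

lemma chirp_deriv:
  assumes l: "l > 0" and t: "t \<noteq> 0" and \<psi>: "test_on l u \<psi>"
  shows "(chirp \<psi> t has_vector_derivative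
      (of_real (1 / \<bar>t\<bar>) * chirp (vd \<psi>) t w + (- \<i> * of_real (sgn t)) * chirp (\<lambda>y. \<psi> y / of_real y) t w)) (at w)"
proof (cases "w < l * \<bar>t\<bar>")
  case True
  have z: "\<psi> (x / \<bar>t\<bar>) = 0" if "x < l * \<bar>t\<bar>" for x
    using \<psi> that t by (force simp: test_on_def field_simps)
  have v: "vd \<psi> (w / \<bar>t\<bar>) = 0"
    using test_on_vd[OF \<psi>] True t by (force simp: test_on_def field_simps)
  have "(chirp \<psi> t has_vector_derivative 0) (at w)"
    by (rule has_vector_derivative_transform_within_open[OF has_vector_derivative_const[of 0], of "{..<l * \<bar>t\<bar>}"])
      (use True z in \<open>auto simp: chirp_def\<close>)
  then show ?thesis using z[OF True] v by (simp add: chirp_def)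
next
  case False
  then have w: "w > 0" using l t by (meson less_le_trans mult_pos_pos not_less zero_less_abs_iff)
  have "((\<lambda>w. - t * ln w) has_real_derivative - t / w) (at w)"
    using w by (auto intro!: derivative_eq_intros)
  then have "((\<lambda>w. - t * ln w) has_vector_derivative - t / w) (at w)"
    by (simp add: has_real_derivative_iff_has_vector_derivative)
  from vector_diff_chain_at[OF this cis_deriv[of 1, simplified]]
  have c: "((\<lambda>w. cis (- t * ln w)) has_vector_derivative of_real (- t / w) * (\<i> * cis (- t * ln w))) (at w)"
    by (simp add: o_def scaleR_conv_of_real)
  have "((\<lambda>w. \<psi> ((1 / \<bar>t\<bar>) * w + 0)) has_vector_derivative of_real (1 / \<bar>t\<bar>) * vd \<psi> ((1 / \<bar>t\<bar>) * w + 0)) (at w)"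
    by (rule affine_deriv) (use \<psi> in \<open>auto simp: test_on_def intro: smooth_deriv\<close>)
  then have p: "((\<lambda>w. \<psi> (w / \<bar>t\<bar>)) has_vector_derivative of_real (1 / \<bar>t\<bar>) * vd \<psi> (w / \<bar>t\<bar>)) (at w)" by simp
  have ts: "t = sgn t * \<bar>t\<bar>" by (simp add: sgn_mult_abs)
  have q: "complex_of_real (- t / w) = - of_real (sgn t) / of_real (w / \<bar>t\<bar>)"
  proof -
    have "- t / w = - sgn t / (w / \<bar>t\<bar>)" using t w by (subst ts) (simp add: field_simps)
    then show ?thesis by (metis of_real_divide of_real_minus)
  qed
  have chirp: "chirp f t = (\<lambda>w. of_real (\<bar>t\<bar> powr (- 1 / 2)) * (cis (- t * ln w) * f (w / \<bar>t\<bar>)))" for f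
    by (simp add: chirp_def fun_eq_iff mult.assoc)
  show ?thesis
    unfolding chirp
    by (rule has_vector_derivative_eq_rhs[OF has_vector_derivative_mult_right[OF has_vector_derivative_mult[OF c p]]], unfold q)
      (simp add: algebra_simps)
qed

lemma smooth_chirp:
  assumes l: "l > 0" and t: "t \<noteq> 0" and \<psi>: "test_on l u \<psi>"
  shows "smooth (chirp \<psi> t)"
  unfolding smooth_def
proof
  show "Ck k (chirp \<psi> t)" for k
    using \<psi>
  proof (induction k arbitrary: \<psi>)
    case 0
    then show ?case
      by (auto simp: continuous_on_eq_continuous_at intro: has_vector_derivative_continuous chirp_deriv[OF l t])
  next
    case (Suc k)
    show ?case
      by (rule Ck_SucI[OF chirp_deriv[OF l t Suc(2)]])
        (intro Ck_add Ck_mult[OF Ck_const] Suc.IH test_on_vd test_on_div l Suc.prems)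
  qed
qed

lemma chirp_support:
  assumes "t \<noteq> 0" "test_on l u \<psi>" "chirp \<psi> t w \<noteq> 0"
  shows "l * \<bar>t\<bar> \<le> w" "w \<le> u * \<bar>t\<bar>"
proof -
  have "\<psi> (w / \<bar>t\<bar>) \<noteq> 0" using assms(3) by (auto simp: chirp_def)
  then show "l * \<bar>t\<bar> \<le> w" "w \<le> u * \<bar>t\<bar>" using assms(1,2) by (auto simp: test_on_def field_simps)
qed

lemma chirp_mult: "t \<noteq> 0 \<Longrightarrow> of_real w * chirp \<psi> t w = of_real \<bar>t\<bar> * chirp (\<lambda>y. of_real y * \<psi> y) t w"
  by (simp add: chirp_def)

text \<open>Applied to the phase alone, w d/dw gives - i t, which cancels the added i t exactly;
  what is left differentiates the slow amplitude and carries no power of t.\<close>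

lemma chirp_euler:
  assumes "l > 0" "t \<noteq> 0" "test_on l u \<psi>"
  shows "of_real w * vd (chirp \<psi> t) w + \<i> * of_real t * chirp \<psi> t w = chirp (\<lambda>y. of_real y * vd \<psi> y) t w"
proof -
  have "t = sgn t * \<bar>t\<bar>" by (simp add: sgn_mult_abs)
  then have ts: "complex_of_real t = of_real (sgn t) * of_real \<bar>t\<bar>" by (metis of_real_mult)
  show ?thesis
  proof (cases "w = 0")
    case True
    have "\<psi> 0 = 0" using assms by (force simp: test_on_def)
    then show ?thesis using True by (simp add: chirp_def)
  next
    case False
    then show ?thesis
      using assms(2) unfolding vd_eq[OF chirp_deriv[OF assms]] ts
      by (simp add: chirp_def field_simps)
  qed
qed

lemma osc_deriv:
  assumes "smooth b"
  shows "(osc \<omega> b t has_vector_derivative (- \<i> * of_real (sgn t * \<omega>)) * osc \<omega> b t w + osc \<omega> (vd b) t w) (at w)"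
  unfolding osc_def[abs_def]
  by (rule has_vector_derivative_eq_rhs[OF has_vector_derivative_mult[OF cis_deriv smooth_deriv[OF assms]]])
    (simp add: algebra_simps)

lemma smooth_osc: "smooth b \<Longrightarrow> smooth (osc \<omega> b t)"
  unfolding osc_def[abs_def] by (intro smooth_mult smooth_cis)

definition bdd_from :: "real \<Rightarrow> (real \<Rightarrow> complex) \<Rightarrow> bool" where
  "bdd_from T0 c \<longleftrightarrow> (\<exists>M. \<forall>t. \<bar>t\<bar> \<ge> T0 \<longrightarrow> cmod (c t) \<le> M)"

lemma bdd_const [simp]: "bdd_from T0 (\<lambda>t. c)" by (auto simp: bdd_from_def)

lemma bdd_mult: "bdd_from T0 c \<Longrightarrow> bdd_from T0 d \<Longrightarrow> bdd_from T0 (\<lambda>t. c t * d t)"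
  unfolding bdd_from_def
proof (elim exE)
  fix M N assume "\<forall>t. \<bar>t\<bar> \<ge> T0 \<longrightarrow> cmod (c t) \<le> M" "\<forall>t. \<bar>t\<bar> \<ge> T0 \<longrightarrow> cmod (d t) \<le> N"
  then have "\<forall>t. \<bar>t\<bar> \<ge> T0 \<longrightarrow> cmod (c t * d t) \<le> M * N"
    by (auto simp: norm_mult intro!: mult_mono intro: order_trans[OF norm_ge_zero])
  then show "\<exists>M. \<forall>t. \<bar>t\<bar> \<ge> T0 \<longrightarrow> cmod (c t * d t) \<le> M" by blast
qed

lemma bdd_inverse: "T0 \<ge> 1 \<Longrightarrow> bdd_from T0 (\<lambda>t. of_real (1 / \<bar>t\<bar>))"
  unfolding bdd_from_def by (auto intro!: exI[of _ 1] simp: divide_le_eq norm_divide)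

lemma bdd_sgn: "bdd_from T0 (\<lambda>t. of_real (sgn t))"
  unfolding bdd_from_def by (auto intro!: exI[of _ 1] simp: sgn_if)

lemma bdd_quotient: "T0 \<ge> 1 \<Longrightarrow> bdd_from T0 (\<lambda>t. of_real (t / \<bar>t\<bar>))"
  unfolding bdd_from_def by (auto intro!: exI[of _ 1] simp: norm_divide)

text \<open>Families in t whose coefficients are bounded uniformly for |t| \<ge> T0, so that a bound
  on the generators passes to the whole span. Rule \<open>cong\<close> identifies families that
  agree for |t| \<ge> T0, the range on which the bounds are asserted.\<close>

inductive_set fspan :: "real \<Rightarrow> (real \<Rightarrow> 'x \<Rightarrow> complex) set \<Rightarrow> (real \<Rightarrow> 'x \<Rightarrow> complex) set"
  for T0 S where
  base: "F \<in> S \<Longrightarrow> F \<in> fspan T0 S"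
| add: "F \<in> fspan T0 S \<Longrightarrow> G \<in> fspan T0 S \<Longrightarrow> (\<lambda>t x. F t x + G t x) \<in> fspan T0 S"
| cmult: "F \<in> fspan T0 S \<Longrightarrow> bdd_from T0 c \<Longrightarrow> (\<lambda>t x. c t * F t x) \<in> fspan T0 S"
| cong: "F \<in> fspan T0 S \<Longrightarrow> (\<And>t x. \<bar>t\<bar> \<ge> T0 \<Longrightarrow> G t x = F t x) \<Longrightarrow> G \<in> fspan T0 S"

lemma fspan_scale: "F \<in> fspan T0 S \<Longrightarrow> (\<lambda>t x. c * F t x) \<in> fspan T0 S"
  by (rule fspan.cmult) auto

lemma fspan_zero: "F \<in> fspan T0 S \<Longrightarrow> (\<lambda>t x. 0) \<in> fspan T0 S"
  using fspan_scale[of F T0 S 0] by simp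

lemma fspan_sum:
  assumes "finite I" "\<And>k. k \<in> I \<Longrightarrow> F k \<in> fspan T0 S" "F0 \<in> fspan T0 S"
  shows "(\<lambda>t x. \<Sum>k\<in>I. F k t x) \<in> fspan T0 S"
  using assms(1,2) by (induction I rule: finite_induct) (auto intro: fspan.add fspan_zero[OF assms(3)])

text \<open>The operators L t are linear only on a subspace described by N t, namely the smooth
  functions or V at parameter t. Membership in that subspace is therefore proved in the same
  induction.\<close>

lemma fspan_linear:
  assumes "F \<in> fspan T0 S"
    and "\<And>F. F \<in> S \<Longrightarrow> (\<lambda>t. L t (F t)) \<in> fspan T0 S'"
    and N: "\<And>F t. F \<in> S \<Longrightarrow> \<bar>t\<bar> \<ge> T0 \<Longrightarrow> N t (F t)"
    and Nadd: "\<And>t f g. N t f \<Longrightarrow> N t g \<Longrightarrow> N t (\<lambda>x. f x + g x)"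
    and Nscale: "\<And>t f c. N t f \<Longrightarrow> N t (\<lambda>x. c * f x)"
    and Ladd: "\<And>t f g x. \<bar>t\<bar> \<ge> T0 \<Longrightarrow> N t f \<Longrightarrow> N t g \<Longrightarrow> L t (\<lambda>x. f x + g x) x = L t f x + L t g x"
    and Lscale: "\<And>t f c x. \<bar>t\<bar> \<ge> T0 \<Longrightarrow> N t f \<Longrightarrow> L t (\<lambda>x. c * f x) x = c * L t f x"
  shows "(\<lambda>t. L t (F t)) \<in> fspan T0 S' \<and> (\<forall>t. \<bar>t\<bar> \<ge> T0 \<longrightarrow> N t (F t))"
  using assms(1)
proof (induction rule: fspan.induct)
  case (base F)
  then show ?case using assms(2) N by blast
next
  case (add F G)
  then show ?case
    using fspan.cong[OF fspan.add, of "\<lambda>t. L t (F t)" T0 S' "\<lambda>t. L t (G t)" "\<lambda>t. L t (\<lambda>x. F t x + G t x)"]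
    by (simp add: Ladd Nadd)
next
  case (cmult F c)
  then show ?case
    using fspan.cong[OF fspan.cmult, of "\<lambda>t. L t (F t)" T0 S' c "\<lambda>t. L t (\<lambda>x. c t * F t x)"]
    by (simp add: Lscale Nscale)
next
  case (cong F G)
  then have eq: "G t = F t" if "\<bar>t\<bar> \<ge> T0" for t using that by blast
  show ?case
    using cong(3) fspan.cong[of "\<lambda>t. L t (F t)" T0 S' "\<lambda>t. L t (G t)"] by (simp add: eq)
qed

text \<open>For a step \<alpha> that is a full period of the oscillation, the increment of an
  oscillating primitive over the step is such an average with k = 0 (\<open>osc_H_diff\<close>).
  Writing w = (w - \<alpha> \<tau>) + \<alpha> \<tau>, multiplication by w passes under the integral
  at the price of an average with exponent k + 1; this is why k is a parameter.\<close>

definition avg :: "real \<Rightarrow> real \<Rightarrow> nat \<Rightarrow> (real \<Rightarrow> complex) \<Rightarrow> real \<Rightarrow> real \<Rightarrow> complex" where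
  "avg \<alpha> \<omega> k \<eta> t w = integral {0..1} (\<lambda>\<tau>. cis (- (sgn t * \<omega>) * (\<alpha> * \<tau>)) * of_real \<tau> ^ k * \<eta> (w - \<alpha> * \<tau>))"

lemma avg_integrable:
  assumes "continuous_on UNIV \<eta>"
  shows "(\<lambda>\<tau>. cis (- (sgn t * \<omega>) * (\<alpha> * \<tau>)) * of_real \<tau> ^ k * \<eta> (w - \<alpha> * \<tau>)) integrable_on {0..1}"
  by (intro integrable_continuous_interval continuous_intros continuous_on_compose2[OF assms]) auto

lemma avg_add:
  "continuous_on UNIV \<eta> \<Longrightarrow> continuous_on UNIV \<eta>' \<Longrightarrow>
    avg \<alpha> \<omega> k (\<lambda>x. \<eta> x + \<eta>' x) t w = avg \<alpha> \<omega> k \<eta> t w + avg \<alpha> \<omega> k \<eta>' t w"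
  unfolding avg_def distrib_left
  by (rule Henstock_Kurzweil_Integration.integral_add) (rule avg_integrable; assumption)+

lemma avg_scale: "avg \<alpha> \<omega> k (\<lambda>x. c * \<eta> x) t w = c * avg \<alpha> \<omega> k \<eta> t w"
proof -
  have "(\<lambda>\<tau>. cis (- (sgn t * \<omega>) * (\<alpha> * \<tau>)) * of_real \<tau> ^ k * (c * \<eta> (w - \<alpha> * \<tau>))) =
     (\<lambda>\<tau>. c * (cis (- (sgn t * \<omega>) * (\<alpha> * \<tau>)) * of_real \<tau> ^ k * \<eta> (w - \<alpha> * \<tau>)))"
    by (simp add: mult_ac)
  then show ?thesis unfolding avg_def by (simp only: integral_mult_right)
qed

lemma avg_deriv:
  assumes "smooth \<eta>"
  shows "(avg \<alpha> \<omega> k \<eta> t has_vector_derivative avg \<alpha> \<omega> k (vd \<eta>) t w) (at w)"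
proof -
  let ?e = "\<lambda>\<tau>. cis (- (sgn t * \<omega>) * (\<alpha> * \<tau>)) * of_real \<tau> ^ k"
  have c: "continuous_on UNIV \<eta>" "continuous_on UNIV (vd \<eta>)"
    using assms smooth_continuous smooth_vd by auto
  have "((\<lambda>w. integral (cbox 0 1) (\<lambda>\<tau>. ?e \<tau> * \<eta> (w - \<alpha> * \<tau>))) has_vector_derivative
      integral (cbox 0 1) (\<lambda>\<tau>. ?e \<tau> * vd \<eta> (w - \<alpha> * \<tau>))) (at w within UNIV)"
  proof (rule leibniz_rule_vector_derivative)
    fix w \<tau> :: real
    have "((\<lambda>w. \<eta> (1 * w + - \<alpha> * \<tau>)) has_vector_derivative of_real 1 * vd \<eta> (1 * w + - \<alpha> * \<tau>)) (at w)"
      by (rule affine_deriv[OF smooth_deriv[OF assms]])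
    then show "((\<lambda>w. ?e \<tau> * \<eta> (w - \<alpha> * \<tau>)) has_vector_derivative ?e \<tau> * vd \<eta> (w - \<alpha> * \<tau>)) (at w within UNIV)"
      by (intro has_vector_derivative_mult_right) simp
    show "(\<lambda>\<tau>. ?e \<tau> * \<eta> (w - \<alpha> * \<tau>)) integrable_on cbox 0 1"
      using avg_integrable[OF c(1)] by simp
  next
    show "continuous_on (UNIV \<times> cbox 0 1) (\<lambda>(w, \<tau>). ?e \<tau> * vd \<eta> (w - \<alpha> * \<tau>))"
      unfolding case_prod_beta by (intro continuous_intros continuous_on_compose2[OF c(2)]) auto
  qed auto
  then show ?thesis unfolding avg_def[abs_def] by simp
qed

lemma smooth_avg:
  assumes "smooth \<eta>"
  shows "smooth (avg \<alpha> \<omega> k \<eta> t)"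
  unfolding smooth_def
proof
  show "Ck m (avg \<alpha> \<omega> k \<eta> t)" for m
    using assms
  proof (induction m arbitrary: \<eta>)
    case 0
    then show ?case
      by (auto simp: continuous_on_eq_continuous_at intro: has_vector_derivative_continuous avg_deriv)
  next
    case (Suc m)
    show ?case by (rule Ck_SucI[OF avg_deriv[OF Suc(2)]]) (intro Suc smooth_vd)
  qed
qed

lemma vd_avg: "smooth \<eta> \<Longrightarrow> vd (avg \<alpha> \<omega> k \<eta> t) = avg \<alpha> \<omega> k (vd \<eta>) t"
  using vd_eq[OF avg_deriv] by blast

lemma avg_bound:
  assumes "continuous_on UNIV \<eta>" "\<And>w. cmod (\<eta> w) \<le> M"
  shows "cmod (avg \<alpha> \<omega> k \<eta> t w) \<le> M"
proof -
  have M: "M \<ge> 0" using assms(2)[of 0] norm_ge_zero order_trans by blast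
  have "cmod (avg \<alpha> \<omega> k \<eta> t w) \<le> M * (1 - 0)"
    unfolding avg_def
  proof (rule integral_bound)
    show "continuous_on {0..1} (\<lambda>\<tau>. cis (- (sgn t * \<omega>) * (\<alpha> * \<tau>)) * of_real \<tau> ^ k * \<eta> (w - \<alpha> * \<tau>))"
      by (intro continuous_intros continuous_on_compose2[OF assms(1)]) auto
    fix \<tau> :: real assume \<tau>: "\<tau> \<in> {0..1}"
    have "\<bar>\<tau>\<bar> ^ k \<le> 1" using \<tau> by (intro power_le_one) auto
    then show "cmod (cis (- (sgn t * \<omega>) * (\<alpha> * \<tau>)) * of_real \<tau> ^ k * \<eta> (w - \<alpha> * \<tau>)) \<le> M"
      using mult_mono[OF _ assms(2)[of "w - \<alpha> * \<tau>"], of "\<bar>\<tau>\<bar> ^ k" 1] by (simp add: norm_mult norm_power)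
  qed simp
  then show ?thesis by simp
qed

lemma avg_support:
  assumes "\<And>w. \<eta> w \<noteq> 0 \<Longrightarrow> L \<le> w \<and> w \<le> U" "avg \<alpha> \<omega> k \<eta> t w \<noteq> 0"
  shows "L - \<bar>\<alpha>\<bar> \<le> w \<and> w \<le> U + \<bar>\<alpha>\<bar>"
proof (rule ccontr)
  assume n: "\<not> (L - \<bar>\<alpha>\<bar> \<le> w \<and> w \<le> U + \<bar>\<alpha>\<bar>)"
  have "\<eta> (w - \<alpha> * \<tau>) = 0" if "\<tau> \<in> {0..1}" for \<tau>
  proof (rule ccontr)
    assume "\<eta> (w - \<alpha> * \<tau>) \<noteq> 0"
    moreover have "\<bar>\<alpha> * \<tau>\<bar> \<le> \<bar>\<alpha>\<bar>" using that by (simp add: abs_mult mult_left_le)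
    ultimately show False using assms(1)[of "w - \<alpha> * \<tau>"] n by linarith
  qed
  then have "avg \<alpha> \<omega> k \<eta> t w = 0"
    unfolding avg_def by (intro integral_unique has_integral_is_0) simp
  then show False using assms(2) by simp
qed

lemma avg_mult:
  assumes "continuous_on UNIV \<eta>"
  shows "of_real w * avg \<alpha> \<omega> k \<eta> t w = avg \<alpha> \<omega> k (\<lambda>y. of_real y * \<eta> y) t w + of_real \<alpha> * avg \<alpha> \<omega> (Suc k) \<eta> t w"
proof -
  have c: "continuous_on UNIV (\<lambda>y. of_real y * \<eta> y)" by (intro continuous_intros assms)
  let ?e = "\<lambda>\<tau>. cis (- (sgn t * \<omega>) * (\<alpha> * \<tau>))" and ?\<eta> = "\<lambda>\<tau>. \<eta> (w - \<alpha> * \<tau>)"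
  have "of_real w * avg \<alpha> \<omega> k \<eta> t w = integral {0..1} (\<lambda>\<tau>. of_real w * (?e \<tau> * of_real \<tau> ^ k * ?\<eta> \<tau>))"
    unfolding avg_def by (rule integral_mult_right[symmetric])
  also have "\<dots> = integral {0..1} (\<lambda>\<tau>. ?e \<tau> * of_real \<tau> ^ k * (of_real (w - \<alpha> * \<tau>) * ?\<eta> \<tau>) +
      of_real \<alpha> * (?e \<tau> * of_real \<tau> ^ Suc k * ?\<eta> \<tau>))"
    by (simp add: algebra_simps)
  also have "\<dots> = avg \<alpha> \<omega> k (\<lambda>y. of_real y * \<eta> y) t w + of_real \<alpha> * avg \<alpha> \<omega> (Suc k) \<eta> t w"
    unfolding avg_def integral_mult_right[symmetric]
    by (rule Henstock_Kurzweil_Integration.integral_add)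
      (rule avg_integrable[OF c] integrable_on_mult_right avg_integrable[OF assms])+
  finally show ?thesis .
qed

text \<open>The two strict inequalities against |\<alpha>| place the supports of the profiles,
  chirps starting at l * |t| and bumps at lb, so far to the right that after averaging over a step
  of length |\<alpha>| they are still bounded away from 0.\<close>

locale chart_params =
  fixes i j :: "'n::finite" and \<alpha> \<omega> l u lb ub T0 :: real and pm :: bool
  assumes ij: "i \<noteq> j" and l: "l > 0" and T0: "T0 \<ge> 1" and lT0: "l * T0 > \<bar>\<alpha>\<bar>" and lb: "lb > \<bar>\<alpha>\<bar>"
begin

definition X0 :: "(real \<Rightarrow> real \<Rightarrow> complex) set" where
  "X0 = {chirp \<psi> |\<psi>. test_on l u \<psi>} \<union> {osc \<omega> b |b. test_on lb ub b}"

definition G0 :: "(real \<Rightarrow> real \<Rightarrow> complex) set" where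
  "G0 = {\<lambda>t. avg \<alpha> \<omega> k (\<eta> t) t |\<eta> k. \<eta> \<in> X0}"

definition S0 :: "(real \<Rightarrow> real^'n \<Rightarrow> complex) set" where
  "S0 = {\<lambda>t. sec pm t j (\<kappa>(i := \<phi> t)) |\<kappa> \<phi>. \<phi> \<in> G0 \<and> (\<forall>a. test (\<kappa> a))}"

text \<open>A left end for the supports of all profiles that does not depend on t.\<close>

definition lmin :: real where "lmin = min (l * T0) lb"

lemma dom: "\<bar>t\<bar> \<ge> T0 \<Longrightarrow> t \<noteq> 0" using T0 by auto

lemma X0_smooth: "\<eta> \<in> X0 \<Longrightarrow> \<bar>t\<bar> \<ge> T0 \<Longrightarrow> smooth (\<eta> t)"
  unfolding X0_def by (auto intro: smooth_chirp[OF l dom] smooth_osc simp: test_on_def[of lb])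

lemma X0_test_on:
  assumes "\<eta> \<in> X0" "\<bar>t\<bar> \<ge> T0"
  shows "\<exists>R. test_on lmin R (\<eta> t)"
proof -
  consider \<psi> where "\<eta> = chirp \<psi>" "test_on l u \<psi>" | b where "\<eta> = osc \<omega> b" "test_on lb ub b"
    using assms(1) by (auto simp: X0_def)
  then show ?thesis
  proof cases
  case \<psi>: 1
  have "l * T0 \<le> l * \<bar>t\<bar>" using l assms(2) by simp
  then have "test_on lmin (u * \<bar>t\<bar>) (\<eta> t)"
    using \<psi> X0_smooth[OF assms] chirp_support[OF dom[OF assms(2)] \<psi>(2)]
    unfolding test_on_def lmin_def by (auto intro: order_trans[rotated] simp: min_le_iff_disj)
  then show ?thesis by blast
next
  case 2
  then have "test_on lmin ub (\<eta> t)"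
    using X0_smooth[OF assms] unfolding test_on_def lmin_def by (auto simp: osc_def)
  then show ?thesis by blast
qed
qed

abbreviation X where "X \<equiv> fspan T0 X0"
abbreviation G where "G \<equiv> fspan T0 G0"
abbreviation S where "S \<equiv> fspan T0 S0"

lemma chirp_X: "test_on l u \<psi> \<Longrightarrow> chirp \<psi> \<in> X" by (auto intro!: fspan.base simp: X0_def)
lemma osc_X: "test_on lb ub b \<Longrightarrow> osc \<omega> b \<in> X" by (auto intro!: fspan.base simp: X0_def)

lemma div_X: "F \<in> fspan T0 S' \<Longrightarrow> (\<lambda>t x. of_real (1 / \<bar>t\<bar>) * F t x) \<in> fspan T0 S'"
  by (rule fspan.cmult[OF _ bdd_inverse[OF T0]])

lemma quot_X: "F \<in> fspan T0 S' \<Longrightarrow> (\<lambda>t x. (\<i> * of_real (t / \<bar>t\<bar>)) * F t x) \<in> fspan T0 S'"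
  by (rule fspan.cmult[OF _ bdd_mult[OF bdd_const bdd_quotient[OF T0]]])

lemma sgn_X: "F \<in> fspan T0 S' \<Longrightarrow> (\<lambda>t x. (c * of_real (sgn t)) * F t x) \<in> fspan T0 S'"
  by (rule fspan.cmult[OF _ bdd_mult[OF bdd_const bdd_sgn]])

lemma vd_add: "smooth f \<Longrightarrow> smooth g \<Longrightarrow> vd (\<lambda>x. f x + g x) x = vd f x + vd g x"
  by (intro vd_eq has_vector_derivative_add smooth_deriv)

lemma vd_cmult: "smooth f \<Longrightarrow> vd (\<lambda>x. c * f x) x = c * vd f x"
  by (intro vd_eq has_vector_derivative_mult_right smooth_deriv)

text \<open>These are the operators on slot i that arise from Lie derivatives, divided by |t|. That
  they preserve the span of the profiles means that a derivative costs one factor |t|.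
  \<open>eul\<close> is treated as a unit: multiplied by w, its two terms are separately of order
  |t|^2 on a chirp, and only their sum is of order |t|.\<close>

definition vdop where "vdop t f w = of_real (1 / \<bar>t\<bar>) * vd f w" for t :: real and f :: "real \<Rightarrow> complex"
definition mulop where "mulop t f w = of_real (1 / \<bar>t\<bar>) * (of_real w * f w)" for t :: real and f :: "real \<Rightarrow> complex"
definition eul where "eul t f w = of_real w * vd f w + \<i> * of_real t * f w" for t :: real and f :: "real \<Rightarrow> complex"
definition eulop where "eulop t f w = of_real (1 / \<bar>t\<bar>) * eul t f w" for t :: real and f :: "real \<Rightarrow> complex"
definition meulop where "meulop t f w = of_real (1 / \<bar>t\<bar>) * (of_real w * eul t f w)" for t :: real and f :: "real \<Rightarrow> complex"
definition wvdop where "wvdop t f w = of_real (1 / \<bar>t\<bar>) * (of_real w * vd f w)" for t :: real and f :: "real \<Rightarrow> complex"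

lemmas op_defs = vdop_def mulop_def eul_def eulop_def meulop_def wvdop_def

lemma smooth_linear_X:
  assumes "\<And>\<eta>. \<eta> \<in> X0 \<Longrightarrow> (\<lambda>t. L t (\<eta> t)) \<in> fspan T0 S'"
    and "\<And>t f g x. \<bar>t\<bar> \<ge> T0 \<Longrightarrow> smooth f \<Longrightarrow> smooth g \<Longrightarrow> L t (\<lambda>x. f x + g x) x = L t f x + L t g x"
    and "\<And>t f c x. \<bar>t\<bar> \<ge> T0 \<Longrightarrow> smooth f \<Longrightarrow> L t (\<lambda>x. c * f x) x = c * L t f x"
    and "\<eta> \<in> X"
  shows "(\<lambda>t. L t (\<eta> t)) \<in> fspan T0 S'"
  using fspan_linear[OF assms(4), of L S' "\<lambda>t. smooth"] assms(1-3)
  by (simp add: X0_smooth smooth_add smooth_cmult)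

lemma vdop_X: "\<eta> \<in> X \<Longrightarrow> (\<lambda>t. vdop t (\<eta> t)) \<in> X"
proof (rule smooth_linear_X[of vdop])
  fix \<eta> assume "\<eta> \<in> X0"
  then consider \<psi> where "\<eta> = chirp \<psi>" "test_on l u \<psi>" | b where "\<eta> = osc \<omega> b" "test_on lb ub b"
    by (auto simp: X0_def)
  then show "(\<lambda>t. vdop t (\<eta> t)) \<in> X"
  proof cases
    case 1
    have "(\<lambda>t x. of_real (1 / \<bar>t\<bar>) * (of_real (1 / \<bar>t\<bar>) * chirp (vd \<psi>) t x + (- \<i> * of_real (sgn t)) * chirp (\<lambda>y. \<psi> y / of_real y) t x)) \<in> X"
      by (intro div_X sgn_X fspan.add chirp_X test_on_vd test_on_div l 1)
    then show ?thesis
      by (rule fspan.cong) (simp add: 1 vdop_def vd_eq[OF chirp_deriv[OF l dom 1(2)]])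
  next
    case 2
    then have "smooth b" by (simp add: test_on_def)
    have "(\<lambda>t x. of_real (1 / \<bar>t\<bar>) * (((- \<i> * of_real \<omega>) * of_real (sgn t)) * osc \<omega> b t x + osc \<omega> (vd b) t x)) \<in> X"
      by (intro div_X sgn_X fspan.add osc_X test_on_vd 2)
    then show ?thesis
      by (rule fspan.cong) (simp add: 2 vdop_def vd_eq[OF osc_deriv[OF \<open>smooth b\<close>]] mult_ac)
  qed
qed (simp_all add: vdop_def vd_add vd_cmult algebra_simps)

lemma mulop_X: "\<eta> \<in> X \<Longrightarrow> (\<lambda>t. mulop t (\<eta> t)) \<in> X"
proof (rule smooth_linear_X[of mulop])
  fix \<eta> assume "\<eta> \<in> X0"
  then consider \<psi> where "\<eta> = chirp \<psi>" "test_on l u \<psi>" | b where "\<eta> = osc \<omega> b" "test_on lb ub b"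
    by (auto simp: X0_def)
  then show "(\<lambda>t. mulop t (\<eta> t)) \<in> X"
  proof cases
    case 1
    have "chirp (\<lambda>y. of_real y * \<psi> y) \<in> X" by (intro chirp_X test_on_mult_id 1)
    then show ?thesis
      by (rule fspan.cong) (use dom in \<open>simp add: 1 mulop_def chirp_mult\<close>)
  next
    case 2
    have "(\<lambda>t x. of_real (1 / \<bar>t\<bar>) * osc \<omega> (\<lambda>y. of_real y * b y) t x) \<in> X"
      by (intro div_X osc_X test_on_mult_id 2)
    then show ?thesis
      by (rule fspan.cong) (simp add: 2 mulop_def osc_def)
  qed
qed (simp_all add: mulop_def algebra_simps)

lemma eulop_X: "\<eta> \<in> X \<Longrightarrow> (\<lambda>t. eulop t (\<eta> t)) \<in> X"
proof (rule smooth_linear_X[of eulop])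
  fix \<eta> assume "\<eta> \<in> X0"
  then consider \<psi> where "\<eta> = chirp \<psi>" "test_on l u \<psi>" | b where "\<eta> = osc \<omega> b" "test_on lb ub b"
    by (auto simp: X0_def)
  then show "(\<lambda>t. eulop t (\<eta> t)) \<in> X"
  proof cases
    case 1
    have "(\<lambda>t x. of_real (1 / \<bar>t\<bar>) * chirp (\<lambda>y. of_real y * vd \<psi> y) t x) \<in> X"
      by (intro div_X chirp_X test_on_mult_id test_on_vd 1)
    then show ?thesis
      by (rule fspan.cong) (simp add: 1 eulop_def eul_def chirp_euler[OF l dom 1(2)])
  next
    case 2
    then have "smooth b" by (simp add: test_on_def)
    have "(\<lambda>t x. of_real (1 / \<bar>t\<bar>) * (((- \<i> * of_real \<omega>) * of_real (sgn t)) * osc \<omega> (\<lambda>y. of_real y * b y) t x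
        + osc \<omega> (\<lambda>y. of_real y * vd b y) t x) + (\<i> * of_real (t / \<bar>t\<bar>)) * osc \<omega> b t x) \<in> X"
      by (intro div_X sgn_X quot_X fspan.add osc_X test_on_vd test_on_mult_id 2)
    then show ?thesis
      by (rule fspan.cong) (simp add: 2 eulop_def eul_def vd_eq[OF osc_deriv[OF \<open>smooth b\<close>]] osc_def algebra_simps)
  qed
qed (simp_all add: eulop_def eul_def vd_add vd_cmult algebra_simps)

lemma meulop_X: "\<eta> \<in> X \<Longrightarrow> (\<lambda>t. meulop t (\<eta> t)) \<in> X"
proof (rule smooth_linear_X[of meulop])
  fix \<eta> assume "\<eta> \<in> X0"
  then consider \<psi> where "\<eta> = chirp \<psi>" "test_on l u \<psi>" | b where "\<eta> = osc \<omega> b" "test_on lb ub b"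
    by (auto simp: X0_def)
  then show "(\<lambda>t. meulop t (\<eta> t)) \<in> X"
  proof cases
    case 1
    \<comment> \<open>On a chirp w is of order |t| and uses up the factor 1 / |t|, while
      \<open>eul\<close> costs nothing.\<close>
    have "chirp (\<lambda>y. of_real y * (of_real y * vd \<psi> y)) \<in> X"
      by (intro chirp_X test_on_mult_id test_on_vd 1)
    then show ?thesis
      by (rule fspan.cong) (use dom in \<open>simp add: 1 meulop_def eul_def chirp_euler[OF l dom 1(2)] chirp_mult\<close>)
  next
    case 2
    then have "smooth b" by (simp add: test_on_def)
    have "(\<lambda>t x. of_real (1 / \<bar>t\<bar>) * (((- \<i> * of_real \<omega>) * of_real (sgn t)) * osc \<omega> (\<lambda>y. of_real y * (of_real y * b y)) t x
        + osc \<omega> (\<lambda>y. of_real y * (of_real y * vd b y)) t x) + (\<i> * of_real (t / \<bar>t\<bar>)) * osc \<omega> (\<lambda>y. of_real y * b y) t x) \<in> X"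
      by (intro div_X sgn_X quot_X fspan.add osc_X test_on_vd test_on_mult_id 2)
    then show ?thesis
      by (rule fspan.cong) (simp add: 2 meulop_def eul_def vd_eq[OF osc_deriv[OF \<open>smooth b\<close>]] osc_def algebra_simps)
  qed
qed (simp_all add: meulop_def eul_def vd_add vd_cmult algebra_simps)

lemma wvdop_eq: "wvdop t f w = eulop t f w - (\<i> * of_real (t / \<bar>t\<bar>)) * f w"
  by (simp add: op_defs algebra_simps)

lemma fspan_diff: "F \<in> fspan T0 S' \<Longrightarrow> H \<in> fspan T0 S' \<Longrightarrow> (\<lambda>t x. F t x - H t x) \<in> fspan T0 S'"
  using fspan.add[of F T0 S' "\<lambda>t x. - 1 * H t x"] fspan_scale[of H T0 S' "- 1"] by simp

lemma wvdop_X: "\<eta> \<in> X \<Longrightarrow> (\<lambda>t. wvdop t (\<eta> t)) \<in> X"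
  unfolding wvdop_eq by (intro fspan_diff eulop_X quot_X)

lemma avg_G: "\<eta> \<in> X \<Longrightarrow> (\<lambda>t. avg \<alpha> \<omega> k (\<eta> t) t) \<in> G"
proof (rule smooth_linear_X[of "\<lambda>t f. avg \<alpha> \<omega> k f t"])
  show "(\<lambda>t. avg \<alpha> \<omega> k (\<eta> t) t) \<in> G" if "\<eta> \<in> X0" for \<eta>
    using that by (auto intro!: fspan.base simp: G0_def)
qed (simp_all add: avg_add avg_scale smooth_continuous)

lemma eul_avg:
  assumes "smooth \<eta>"
  shows "eul t (avg \<alpha> \<omega> k \<eta> t) w = avg \<alpha> \<omega> k (eul t \<eta>) t w + of_real \<alpha> * avg \<alpha> \<omega> (Suc k) (vd \<eta>) t w"
proof -
  have c: "continuous_on UNIV \<eta>" "continuous_on UNIV (vd \<eta>)" "continuous_on UNIV (\<lambda>y. of_real y * vd \<eta> y)"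
    "continuous_on UNIV (\<lambda>y. \<i> * of_real t * \<eta> y)"
    using smooth_continuous[OF assms] smooth_continuous[OF smooth_vd[OF assms]] by (auto intro!: continuous_intros)
  have "avg \<alpha> \<omega> k (eul t \<eta>) t w = avg \<alpha> \<omega> k (\<lambda>y. of_real y * vd \<eta> y) t w + \<i> * of_real t * avg \<alpha> \<omega> k \<eta> t w"
    unfolding eul_def[abs_def] avg_add[OF c(3,4)] avg_scale ..
  then show ?thesis
    by (simp add: eul_def vd_avg[OF assms] avg_mult[OF c(2)])
qed

lemma smooth_eul: "smooth \<eta> \<Longrightarrow> smooth (eul t \<eta>)"
  unfolding eul_def[abs_def] by (intro smooth_add smooth_mult smooth_of_real smooth_vd smooth_const)

text \<open>Each operator is moved under the average. The corrections are averages with larger k of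
  \<open>vdop\<close>, \<open>eulop\<close>, \<open>wvdop\<close> or of the profile over |t|, all
  covered already by \<open>avg_G\<close>.\<close>

lemma G_ops:
  assumes "\<phi> \<in> G"
  shows "(\<lambda>t. vdop t (\<phi> t)) \<in> G \<and> (\<lambda>t. mulop t (\<phi> t)) \<in> G \<and> (\<lambda>t. eulop t (\<phi> t)) \<in> G \<and> (\<lambda>t. meulop t (\<phi> t)) \<in> G"
proof -
  have sm: "smooth (\<phi> t)" if "\<phi> \<in> G0" "\<bar>t\<bar> \<ge> T0" for \<phi> t
    using that by (auto simp: G0_def intro!: smooth_avg X0_smooth)
  have lin: "(\<lambda>t. L t (\<phi> t)) \<in> G"
    if "\<And>\<phi>. \<phi> \<in> G0 \<Longrightarrow> (\<lambda>t. L t (\<phi> t)) \<in> G"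
    and "\<And>t f g x. smooth f \<Longrightarrow> smooth g \<Longrightarrow> L t (\<lambda>x. f x + g x) x = L t f x + L t g x"
    and "\<And>t f c x. smooth f \<Longrightarrow> L t (\<lambda>x. c * f x) x = c * L t f x" for L
    using fspan_linear[OF assms, of L G0 "\<lambda>t. smooth"] that sm
    by (simp add: smooth_add smooth_cmult)
  have ops: "(\<lambda>t. vdop t (\<phi> t)) \<in> G \<and> (\<lambda>t. mulop t (\<phi> t)) \<in> G \<and> (\<lambda>t. eulop t (\<phi> t)) \<in> G \<and> (\<lambda>t. meulop t (\<phi> t)) \<in> G"
    if \<phi>: "\<phi> \<in> G0" for \<phi>
  proof -
    obtain \<eta> k where \<eta>: "\<phi> = (\<lambda>t. avg \<alpha> \<omega> k (\<eta> t) t)" "\<eta> \<in> X0" using \<phi> by (auto simp: G0_def)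
    then have \<eta>X: "\<eta> \<in> X" by (intro fspan.base)
    note s = X0_smooth[OF \<eta>(2)]
    have 1: "(\<lambda>t. avg \<alpha> \<omega> m (vdop t (\<eta> t)) t) \<in> G" "(\<lambda>t. avg \<alpha> \<omega> m (mulop t (\<eta> t)) t) \<in> G"
      "(\<lambda>t. avg \<alpha> \<omega> m (eulop t (\<eta> t)) t) \<in> G" "(\<lambda>t. avg \<alpha> \<omega> m (meulop t (\<eta> t)) t) \<in> G"
      "(\<lambda>t. avg \<alpha> \<omega> m (wvdop t (\<eta> t)) t) \<in> G" "(\<lambda>t. avg \<alpha> \<omega> m (\<eta> t) t) \<in> G" for m
      by (intro avg_G vdop_X mulop_X eulop_X meulop_X wvdop_X \<eta>X)+
    have "(\<lambda>t. vdop t (\<phi> t)) \<in> G"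
      by (rule fspan.cong[OF 1(1)[of k]]) (simp only: \<eta>(1) vdop_def[abs_def] vd_avg[OF s] avg_scale)
    moreover have "(\<lambda>t. mulop t (\<phi> t)) \<in> G"
      by (rule fspan.cong[OF fspan.add[OF 1(2)[of k] fspan_scale[OF div_X[OF 1(6)[of "Suc k"]], of "of_real \<alpha>"]]])
        (simp only: \<eta>(1) mulop_def[abs_def] avg_scale avg_mult[OF smooth_continuous[OF s]], simp add: algebra_simps)
    moreover have "(\<lambda>t. eulop t (\<phi> t)) \<in> G"
      by (rule fspan.cong[OF fspan.add[OF 1(3)[of k] fspan_scale[OF 1(1)[of "Suc k"], of "of_real \<alpha>"]]])
        (simp only: \<eta>(1) eulop_def[abs_def] vdop_def[abs_def] avg_scale eul_avg[OF s], simp add: algebra_simps)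
    moreover have "(\<lambda>t. meulop t (\<phi> t)) \<in> G"
    proof (rule fspan.cong[OF fspan.add[OF fspan.add[OF 1(4)[of k] fspan_scale[OF 1(3)[of "Suc k"], of "of_real \<alpha>"]]
            fspan.add[OF fspan_scale[OF 1(5)[of "Suc k"], of "of_real \<alpha>"] fspan_scale[OF 1(1)[of "Suc (Suc k)"], of "of_real (\<alpha> * \<alpha>)"]]]])
      fix t x assume t: "\<bar>t\<bar> \<ge> T0"
      let ?\<eta> = "\<eta> t"
      \<comment> \<open>w passes under the average twice, once inside \<open>eul\<close> and once in
        front of it, so k grows by up to two.\<close>
      have e: "of_real x * eul t (avg \<alpha> \<omega> k ?\<eta> t) x =
         (avg \<alpha> \<omega> k (\<lambda>y. of_real y * eul t ?\<eta> y) t x + of_real \<alpha> * avg \<alpha> \<omega> (Suc k) (eul t ?\<eta>) t x) +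
         of_real \<alpha> * (avg \<alpha> \<omega> (Suc k) (\<lambda>y. of_real y * vd ?\<eta> y) t x + of_real \<alpha> * avg \<alpha> \<omega> (Suc (Suc k)) (vd ?\<eta>) t x)"
        using avg_mult[OF smooth_continuous[OF smooth_eul[OF s[OF t]]], of x \<alpha> \<omega> k t t]
          avg_mult[OF smooth_continuous[OF smooth_vd[OF s[OF t]]], of x \<alpha> \<omega> "Suc k" t]
        by (simp only: eul_avg[OF s[OF t]] distrib_left mult.left_commute[of "of_real x" "of_real \<alpha>"])
      have a: "avg \<alpha> \<omega> k (meulop t ?\<eta>) t x = of_real (1 / \<bar>t\<bar>) * avg \<alpha> \<omega> k (\<lambda>y. of_real y * eul t ?\<eta> y) t x"
        "avg \<alpha> \<omega> (Suc k) (eulop t ?\<eta>) t x = of_real (1 / \<bar>t\<bar>) * avg \<alpha> \<omega> (Suc k) (eul t ?\<eta>) t x"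
        "avg \<alpha> \<omega> (Suc k) (wvdop t ?\<eta>) t x = of_real (1 / \<bar>t\<bar>) * avg \<alpha> \<omega> (Suc k) (\<lambda>y. of_real y * vd ?\<eta> y) t x"
        "avg \<alpha> \<omega> (Suc (Suc k)) (vdop t ?\<eta>) t x = of_real (1 / \<bar>t\<bar>) * avg \<alpha> \<omega> (Suc (Suc k)) (vd ?\<eta>) t x"
        unfolding meulop_def[abs_def] eulop_def[abs_def] wvdop_def[abs_def] vdop_def[abs_def] by (simp_all only: avg_scale)
      show "meulop t (\<phi> t) x =
          avg \<alpha> \<omega> k (meulop t ?\<eta>) t x + of_real \<alpha> * avg \<alpha> \<omega> (Suc k) (eulop t ?\<eta>) t x +
          (of_real \<alpha> * avg \<alpha> \<omega> (Suc k) (wvdop t ?\<eta>) t x + of_real (\<alpha> * \<alpha>) * avg \<alpha> \<omega> (Suc (Suc k)) (vdop t ?\<eta>) t x)"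
        unfolding a \<eta>(1) meulop_def[of t "avg \<alpha> \<omega> k ?\<eta> t" x] e of_real_mult by (simp only: ring_distribs mult_ac)
    qed
    ultimately show ?thesis by blast
  qed
  show ?thesis
    by (rule conjI[OF lin[of vdop] conjI[OF lin[of mulop] conjI[OF lin[of eulop] lin[of meulop]]]])
      (use ops in blast | simp add: op_defs vd_add vd_cmult algebra_simps)+
qed

end

section \<open>Families of sections\<close>

lemma sec_slot_add:
  assumes "i \<noteq> j"
  shows "sec pm t j (\<kappa>(i := \<lambda>y. f y + g y)) x = sec pm t j (\<kappa>(i := f)) x + sec pm t j (\<kappa>(i := g)) x"
proof -
  have *: "(\<Prod>a\<in>UNIV - {j}. (\<kappa>(i := h)) a (x $ a / x $ j)) = h (x $ i / x $ j) * (\<Prod>a\<in>UNIV - {j} - {i}. \<kappa> a (x $ a / x $ j))" for h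
    using assms by (subst prod.remove[of _ i]) (auto intro!: prod.cong)
  show ?thesis unfolding sec_def * by (simp add: algebra_simps)
qed

lemma sec_slot_scale:
  assumes "i \<noteq> j"
  shows "sec pm t j (\<kappa>(i := \<lambda>y. c * f y)) x = c * sec pm t j (\<kappa>(i := f)) x"
proof -
  have *: "(\<Prod>a\<in>UNIV - {j}. (\<kappa>(i := h)) a (x $ a / x $ j)) = h (x $ i / x $ j) * (\<Prod>a\<in>UNIV - {j} - {i}. \<kappa> a (x $ a / x $ j))" for h
    using assms by (subst prod.remove[of _ i]) (auto intro!: prod.cong)
  show ?thesis unfolding sec_def * by simp
qed

lemma cmod_sec:
  assumes "x $ j \<noteq> 0"
  shows "cmod (sec pm t j \<Phi> (x :: real^'n::finite)) = \<bar>x $ j\<bar> powr (- real CARD('n) / 2) * (\<Prod>a\<in>UNIV - {j}. cmod (\<Phi> a (x $ a / x $ j)))"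
  using assms by (simp add: sec_def radial_char_def norm_mult prod_norm[symmetric] eps_sign_def abs_mult sgn_if)

lemma slots_half_hom: "slots i \<Phi> \<Longrightarrow> half_hom (sec pm t j \<Phi>)"
  by (rule V_half_hom[OF V.sec])

lemma test_bounded:
  assumes "test f"
  shows "\<exists>M R. M \<ge> 0 \<and> R \<ge> 0 \<and> (\<forall>x. cmod (f x) \<le> M) \<and> (\<forall>x. f x \<noteq> 0 \<longrightarrow> \<bar>x\<bar> \<le> R)"
proof -
  obtain R where R: "\<And>x. f x \<noteq> 0 \<Longrightarrow> \<bar>x\<bar> \<le> R" using assms by (auto simp: test_def)
  then have "test_on (- \<bar>R\<bar>) \<bar>R\<bar> f"
    using assms unfolding test_on_def test_def by (fastforce simp: abs_le_iff)
  then obtain M where "M \<ge> 0" "\<And>x. cmod (f x) \<le> M" by (rule test_on_bounded) blast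
  then show ?thesis using R by (intro exI[of _ M] exI[of _ "\<bar>R\<bar>"]) (auto intro: order_trans[OF _ abs_ge_self])
qed

lemma emeasure_coordinate_box:
  fixes b :: "'n::finite \<Rightarrow> real"
  assumes "\<And>a. b a \<ge> 0"
  shows "emeasure lborel {x :: real^'n. \<forall>a. \<bar>x $ a\<bar> \<le> b a} = ennreal (\<Prod>a\<in>UNIV. 2 * b a)"
proof -
  have "{x :: real^'n. \<forall>a. \<bar>x $ a\<bar> \<le> b a} = cbox (vec_lambda (\<lambda>a. - b a)) (vec_lambda b)"
    by (auto simp: mem_box_cart abs_le_iff minus_le_iff)
  moreover have "(\<Prod>k\<in>Basis. (vec_lambda b - vec_lambda (\<lambda>a. - b a) :: real^'n) \<bullet> k) = (\<Prod>a\<in>UNIV. 2 * b a)"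
    unfolding Basis_vec_def
    by (subst prod.reindex_cong[of "\<lambda>a. axis a (1::real)" UNIV]) (auto simp: inj_on_def axis_eq_axis inner_axis)
  moreover have "\<forall>k\<in>Basis. (vec_lambda (\<lambda>a. - b a) :: real^'n) \<bullet> k \<le> vec_lambda b \<bullet> k"
    using assms by (auto simp: Basis_vec_def inner_axis intro: order_trans[of _ 0])
  ultimately show ?thesis by (simp add: emeasure_lborel_cbox_eq)
qed

text \<open>On 1 \<le> |x_j| < e the radial factor is at most 1 and |x_a| is within a factor e of
  |x_a / x_j|. A bound A and a support radius R of slot i thus become a pointwise bound and a box of
  volume proportional to R. The constant depends on the other slots only; f, t and the sign are
  quantified after it.\<close>

lemma sec_pair_box:
  fixes \<kappa> :: "'n::finite \<Rightarrow> real \<Rightarrow> complex"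
  assumes ij: "i \<noteq> j" and \<kappa>: "\<And>a. test (\<kappa> a)"
  obtains C where "C \<ge> 0"
    "\<And>f A x pm t. x \<in> annulus (\<lambda>x. \<bar>x $ j\<bar>) \<Longrightarrow> A \<ge> 0 \<Longrightarrow> (\<And>w. cmod (f w) \<le> A) \<Longrightarrow>
       cmod (sec pm t j (\<kappa>(i := f)) x) \<le> C * A"
    "\<And>R. R \<ge> 0 \<Longrightarrow> \<exists>D. D \<in> sets borel \<and> emeasure lborel D \<le> ennreal (C * R) \<and>
      (\<forall>f x pm t. (\<forall>w. f w \<noteq> 0 \<longrightarrow> \<bar>w\<bar> \<le> R) \<longrightarrow> x \<in> annulus (\<lambda>x. \<bar>x $ j\<bar>) \<longrightarrow> sec pm t j (\<kappa>(i := f)) x \<noteq> 0 \<longrightarrow> x \<in> D)"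
proof -
  obtain M \<rho> where M: "M a \<ge> 0" "\<rho> a \<ge> 0" "\<And>x. cmod (\<kappa> a x) \<le> M a" "\<And>x. \<kappa> a x \<noteq> 0 \<Longrightarrow> \<bar>x\<bar> \<le> \<rho> a" for a
  proof -
    have "\<exists>M R. M \<ge> 0 \<and> R \<ge> 0 \<and> (\<forall>x. cmod (\<kappa> a x) \<le> M) \<and> (\<forall>x. \<kappa> a x \<noteq> 0 \<longrightarrow> \<bar>x\<bar> \<le> R)" for a
      by (rule test_bounded[OF \<kappa>[of a]])
    then show ?thesis using that by metis
  qed
  define C1 where "C1 = (\<Prod>a\<in>UNIV - {j} - {i}. M a)"
  define b where "b R a = (if a = j then exp 1 else if a = i then R * exp 1 else \<rho> a * exp 1)" for R a
  define C2 where "C2 = 2 * exp 1 * (2 * exp 1) * (\<Prod>a\<in>UNIV - {j} - {i}. 2 * (\<rho> a * exp 1))"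
  have C: "C1 \<ge> 0" "C2 \<ge> 0"
    unfolding C1_def C2_def using M by (auto intro!: mult_nonneg_nonneg prod_nonneg)
  show ?thesis
  proof (rule that[of "C1 + C2"])
    fix f :: "real \<Rightarrow> complex" and A :: real and x :: "real^'n" and pm t
    assume x: "x \<in> annulus (\<lambda>x. \<bar>x $ j\<bar>)" and A: "A \<ge> 0" "\<And>w. cmod (f w) \<le> A"
    have xj: "\<bar>x $ j\<bar> \<ge> 1" "x $ j \<noteq> 0" using x by (auto simp: annulus_def)
    have "\<bar>x $ j\<bar> powr (- real CARD('n) / 2) \<le> \<bar>x $ j\<bar> powr 0" using xj by (intro powr_mono) auto
    then have p: "\<bar>x $ j\<bar> powr (- real CARD('n) / 2) \<le> 1" using xj by simp
    have "(\<Prod>a\<in>UNIV - {j}. cmod ((\<kappa>(i := f)) a (x $ a / x $ j))) =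
        cmod (f (x $ i / x $ j)) * (\<Prod>a\<in>UNIV - {j} - {i}. cmod (\<kappa> a (x $ a / x $ j)))"
      using ij by (subst prod.remove[of _ i]) (auto intro!: prod.cong)
    also have "\<dots> \<le> A * C1"
      unfolding C1_def using A M by (intro mult_mono prod_mono prod_nonneg) auto
    finally have "cmod (sec pm t j (\<kappa>(i := f)) x) \<le> 1 * (A * C1)"
      unfolding cmod_sec[OF xj(2)] using p A C by (intro mult_mono) (auto intro: prod_nonneg)
    also have "\<dots> \<le> (C1 + C2) * A" using A C by (simp add: algebra_simps)
    finally show "cmod (sec pm t j (\<kappa>(i := f)) x) \<le> (C1 + C2) * A" .
  next
    fix R :: real assume R: "R \<ge> 0"
    let ?D = "{x :: real^'n. \<forall>a. \<bar>x $ a\<bar> \<le> b R a}"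
    have b: "b R a \<ge> 0" for a using R M by (simp add: b_def)
    have "(\<Prod>a\<in>UNIV. 2 * b R a) = 2 * b R j * (2 * b R i * (\<Prod>a\<in>UNIV - {j} - {i}. 2 * b R a))"
      using ij by (subst prod.remove[of _ j], simp, simp, subst prod.remove[of _ i]) auto
    also have "\<dots> = C2 * R"
      using ij by (simp add: C2_def b_def mult_ac cong: prod.cong) (auto intro!: prod.cong)
    finally have "emeasure lborel ?D = ennreal (C2 * R)"
      using emeasure_coordinate_box[of "b R", OF b] by simp
    moreover have "ennreal (C2 * R) \<le> ennreal ((C1 + C2) * R)" using R C by (intro ennreal_leI mult_right_mono) auto
    moreover have "x \<in> ?D"
      if f: "\<forall>w. f w \<noteq> 0 \<longrightarrow> \<bar>w\<bar> \<le> R" and x: "x \<in> annulus (\<lambda>x. \<bar>x $ j\<bar>)" and nz: "sec pm t j (\<kappa>(i := f)) x \<noteq> 0" for f x pm t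
    proof -
      have xj: "\<bar>x $ j\<bar> \<ge> 1" "\<bar>x $ j\<bar> < exp 1" "x $ j \<noteq> 0" using x by (auto simp: annulus_def)
      have "(\<Prod>a\<in>UNIV - {j}. (\<kappa>(i := f)) a (x $ a / x $ j)) \<noteq> 0" using nz xj by (auto simp: sec_def)
      then have n: "(\<kappa>(i := f)) a (x $ a / x $ j) \<noteq> 0" if "a \<noteq> j" for a using that by auto
      have q: "\<bar>x $ a / x $ j\<bar> \<le> c \<Longrightarrow> c \<ge> 0 \<Longrightarrow> \<bar>x $ a\<bar> \<le> c * exp 1" for a c
      proof -
        assume c: "\<bar>x $ a / x $ j\<bar> \<le> c" "c \<ge> 0"
        then have "\<bar>x $ a\<bar> \<le> c * \<bar>x $ j\<bar>" using xj by (simp add: abs_divide divide_le_eq)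
        also have "\<dots> \<le> c * exp 1" using xj c by (intro mult_left_mono) auto
        finally show ?thesis .
      qed
      have "\<bar>x $ a\<bar> \<le> b R a" for a
      proof -
        consider "a = j" | "a = i" "a \<noteq> j" | "a \<noteq> i" "a \<noteq> j" by blast
        then show ?thesis
        proof cases
          case 1 then show ?thesis using xj by (simp add: b_def)
        next
          case 2
          then have "f (x $ i / x $ j) \<noteq> 0" using n[of i] by simp
          then have "\<bar>x $ i / x $ j\<bar> \<le> R" using f by blast
          from q[OF this R] show ?thesis using 2 by (simp add: b_def)
        next
          case 3
          then have "\<kappa> a (x $ a / x $ j) \<noteq> 0" using n[of a] by simp
          from q[OF M(4)[OF this] M(2)] show ?thesis using 3 by (simp add: b_def)
        qed
      qed
      then show ?thesis by blast
    qed
    moreover have "?D \<in> sets borel"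
    proof -
      have "?D = cbox (vec_lambda (\<lambda>a. - b R a)) (vec_lambda (b R))"
        by (auto simp: mem_box_cart abs_le_iff minus_le_iff)
      then show ?thesis by simp
    qed
    ultimately show "\<exists>D. D \<in> sets borel \<and> emeasure lborel D \<le> ennreal ((C1 + C2) * R) \<and>
      (\<forall>f x pm t. (\<forall>w. f w \<noteq> 0 \<longrightarrow> \<bar>w\<bar> \<le> R) \<longrightarrow> x \<in> annulus (\<lambda>x. \<bar>x $ j\<bar>) \<longrightarrow> sec pm t j (\<kappa>(i := f)) x \<noteq> 0 \<longrightarrow> x \<in> D)"
      by (intro exI[of _ ?D]) auto
  qed (use C in simp)
qed

text \<open>Square of the height times the length of the support in direction i, with a constant
  uniform in f and t; the norm estimates of the families reduce to this.\<close>

lemma sec_hnorm2_box: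
  fixes \<kappa> :: "'n::finite \<Rightarrow> real \<Rightarrow> complex"
  assumes ij: "i \<noteq> j" and \<kappa>: "\<And>a. test (\<kappa> a)"
  obtains C where "C \<ge> 0"
    "\<And>f A R pm t. A \<ge> 0 \<Longrightarrow> R \<ge> 0 \<Longrightarrow> test_pos f \<Longrightarrow> (\<And>w. cmod (f w) \<le> A) \<Longrightarrow> (\<And>w. f w \<noteq> 0 \<Longrightarrow> \<bar>w\<bar> \<le> R) \<Longrightarrow>
       hnorm2 (sec pm t j (\<kappa>(i := f))) \<le> ennreal (C * A\<^sup>2 * R)"
proof -
  obtain C where C: "C \<ge> 0"
    "\<And>f A x pm t. x \<in> annulus (\<lambda>x. \<bar>x $ j\<bar>) \<Longrightarrow> A \<ge> 0 \<Longrightarrow> (\<And>w. cmod (f w) \<le> A) \<Longrightarrow>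
       cmod (sec pm t j (\<kappa>(i := f)) x) \<le> C * A"
    "\<And>R. R \<ge> 0 \<Longrightarrow> \<exists>D. D \<in> sets borel \<and> emeasure lborel D \<le> ennreal (C * R) \<and>
      (\<forall>f x pm t. (\<forall>w. f w \<noteq> 0 \<longrightarrow> \<bar>w\<bar> \<le> R) \<longrightarrow> x \<in> annulus (\<lambda>x. \<bar>x $ j\<bar>) \<longrightarrow> sec pm t j (\<kappa>(i := f)) x \<noteq> 0 \<longrightarrow> x \<in> D)"
    by (rule sec_pair_box[of i j \<kappa>, OF ij \<kappa>]) blast
  show ?thesis
  proof (rule that[of "C\<^sup>2 * C"])
    fix f A R pm t assume A: "A \<ge> 0" "R \<ge> 0" "test_pos f" "\<And>w. cmod (f w) \<le> A" "\<And>w. f w \<noteq> 0 \<Longrightarrow> \<bar>w\<bar> \<le> R"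
    obtain D where D: "D \<in> sets borel" "emeasure lborel D \<le> ennreal (C * R)"
      "\<And>x. x \<in> annulus (\<lambda>x. \<bar>x $ j\<bar>) \<Longrightarrow> sec pm t j (\<kappa>(i := f)) x \<noteq> 0 \<Longrightarrow> x \<in> D"
      using C(3)[OF A(2)] A(5) by blast
    have "slots i (\<kappa>(i := f))" using A(3) \<kappa> by (simp add: slots_def test_pos_test)
    then have "hnorm2 (sec pm t j (\<kappa>(i := f))) =
        (\<integral>\<^sup>+x. ennreal ((cmod (sec pm t j (\<kappa>(i := f)) x))\<^sup>2) * indicator (annulus (\<lambda>x. \<bar>x $ j\<bar>)) x \<partial>lborel)"
      by (intro hnorm2_annulus slots_half_hom radial_coordinate)
    also have "\<dots> \<le> (\<integral>\<^sup>+x. ennreal ((C * A)\<^sup>2) * indicator D x \<partial>lborel)"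
    proof (rule nn_integral_mono)
      fix x
      show "ennreal ((cmod (sec pm t j (\<kappa>(i := f)) x))\<^sup>2) * indicator (annulus (\<lambda>x. \<bar>x $ j\<bar>)) x \<le> ennreal ((C * A)\<^sup>2) * indicator D x"
        using D(3)[of x] C(2)[of x A f pm t, OF _ A(1,4)]
        by (cases "sec pm t j (\<kappa>(i := f)) x = 0") (auto simp: indicator_def intro!: ennreal_leI power_mono)
    qed
    also have "\<dots> = ennreal ((C * A)\<^sup>2) * emeasure lborel D"
      using D(1) by (simp add: nn_integral_cmult_indicator)
    also have "\<dots> \<le> ennreal ((C * A)\<^sup>2) * ennreal (C * R)" by (intro mult_left_mono D(2)) simp
    also have "\<dots> = ennreal (C\<^sup>2 * C * A\<^sup>2 * R)"
      by (subst ennreal_mult'[symmetric]) (auto simp: power_mult_distrib mult_ac)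
    finally show "hnorm2 (sec pm t j (\<kappa>(i := f))) \<le> ennreal (C\<^sup>2 * C * A\<^sup>2 * R)" .
  qed (use C(1) in simp)
qed

context chart_params begin

lemma lmin: "lmin > \<bar>\<alpha>\<bar>" using lT0 lb by (simp add: lmin_def)

lemma G0_test_pos: "\<phi> \<in> G0 \<Longrightarrow> \<bar>t\<bar> \<ge> T0 \<Longrightarrow> test_pos (\<phi> t)"
proof -
  assume "\<phi> \<in> G0" and t: "\<bar>t\<bar> \<ge> T0"
  then obtain \<eta> k where \<eta>: "\<phi> = (\<lambda>t. avg \<alpha> \<omega> k (\<eta> t) t)" "\<eta> \<in> X0" by (auto simp: G0_def)
  obtain R where R: "test_on lmin R (\<eta> t)" using X0_test_on[OF \<eta>(2) t] by blast
  have "test_on (lmin - \<bar>\<alpha>\<bar>) (R + \<bar>\<alpha>\<bar>) (\<phi> t)"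
    unfolding \<eta>(1) test_on_def
  proof (intro conjI allI impI)
    show "smooth (avg \<alpha> \<omega> k (\<eta> t) t)" using R by (intro smooth_avg) (simp add: test_on_def)
  qed (use avg_support[of "\<eta> t" lmin R] R in \<open>auto simp: test_on_def\<close>)
  then show ?thesis by (rule test_on_pos[rotated]) (use lmin in simp)
qed

lemma S0_V: "F \<in> S0 \<Longrightarrow> \<bar>t\<bar> \<ge> T0 \<Longrightarrow> F t \<in> V pm t i j"
  using G0_test_pos by (auto simp: S0_def slots_def intro!: V.sec test_pos_test)

lemma S_V: "F \<in> S \<Longrightarrow> \<bar>t\<bar> \<ge> T0 \<Longrightarrow> F t \<in> V pm t i j"
  using fspan_linear[of F T0 S0 "\<lambda>t f. f" S0 "\<lambda>t f. f \<in> V pm t i j"]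
  by (simp add: fspan.base S0_V V.add V.cmult)

lemma sec_G:
  assumes "\<phi> \<in> G" "\<And>a. test (\<kappa> a)"
  shows "(\<lambda>t. sec pm t j (\<kappa>(i := \<phi> t))) \<in> S"
proof -
  have "(\<lambda>t. sec pm t j (\<kappa>(i := \<phi> t))) \<in> S0" if "\<phi> \<in> G0" for \<phi>
    using that assms(2) unfolding S0_def by blast
  then show ?thesis
    using fspan_linear[OF assms(1), of "\<lambda>t f. sec pm t j (\<kappa>(i := f))" S0 "\<lambda>_ _. True"]
    by (simp add: fspan.base sec_slot_add[OF ij] sec_slot_scale[OF ij])
qed

lemma S_mulX:
  assumes "\<phi> \<in> G" "\<And>a. test (\<kappa> a)" "b \<noteq> i"
  shows "(\<lambda>t. sec pm t j (mulX j b (\<kappa>(i := \<phi> t)))) \<in> S"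
proof -
  have "mulX j b (\<kappa>(i := f)) = (mulX j b \<kappa>)(i := f)" for f
    using assms(3) by (auto simp: mulX_def)
  moreover have "test (mulX j b \<kappa> a)" for a
    using assms(2) by (auto simp: mulX_def intro: test_mult smooth_of_real)
  ultimately show ?thesis using sec_G[OF assms(1), of "mulX j b \<kappa>"] by simp
qed

lemma mulX_same: "mulX j i (\<kappa>(i := f)) = \<kappa>(i := \<lambda>y. of_real y * f y)"
  using ij by (simp add: mulX_def)

text \<open>The only chart coordinate that can grow with t is w itself. For b = i the factor is
  absorbed into the operators that carry a multiplication by w; for b \<noteq> i it falls on a fixed
  slot or is 1.\<close>

lemma S_slot_op:
  assumes \<kappa>: "\<And>a. test (\<kappa> a)" and \<phi>: "\<phi> \<in> G"
  shows "(\<lambda>t x. of_real (1 / \<bar>t\<bar>) * sec pm t j (mulX j b (\<kappa>(i := \<phi> t))) x) \<in> S"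
    and "(\<lambda>t x. of_real (1 / \<bar>t\<bar>) * sec pm t j (mulX j b (\<kappa>(i := vd (\<phi> t)))) x) \<in> S"
    and "(\<lambda>t x. of_real (1 / \<bar>t\<bar>) * sec pm t j (mulX j b (\<kappa>(i := eul t (\<phi> t)))) x) \<in> S"
proof -
  note ops = G_ops[OF \<phi>]
  have scale: "of_real (1 / \<bar>t\<bar>) * sec pm t j (mulX j b (\<kappa>(i := f))) x = sec pm t j (mulX j b (\<kappa>(i := \<lambda>y. of_real (1 / \<bar>t\<bar>) * f y))) x"
    for f t x
  proof (cases "x $ j = 0")
    case False
    show ?thesis unfolding sec_mulX[OF False] sec_slot_scale[OF ij] by (simp only: mult.left_commute)
  qed (simp add: sec_def)
  have wv: "(\<lambda>t. wvdop t (\<phi> t)) \<in> G"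
    unfolding wvdop_eq by (intro fspan_diff quot_X \<phi>) (use ops in simp)
  show "(\<lambda>t x. of_real (1 / \<bar>t\<bar>) * sec pm t j (mulX j b (\<kappa>(i := \<phi> t))) x) \<in> S"
  proof (cases "b = i")
    case True
    have "(\<lambda>t. sec pm t j (\<kappa>(i := mulop t (\<phi> t)))) \<in> S" by (rule sec_G) (use ops \<kappa> in auto)
    then show ?thesis
      unfolding mulop_def[abs_def] True mulX_same sec_slot_scale[OF ij, symmetric] .
  next
    case False then show ?thesis by (intro div_X S_mulX \<phi> \<kappa>)
  qed
  show "(\<lambda>t x. of_real (1 / \<bar>t\<bar>) * sec pm t j (mulX j b (\<kappa>(i := vd (\<phi> t)))) x) \<in> S"
  proof (cases "b = i")
    case True
    have "(\<lambda>t. sec pm t j (\<kappa>(i := wvdop t (\<phi> t)))) \<in> S" by (rule sec_G) (use wv \<kappa> in auto)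
    then show ?thesis
      unfolding wvdop_def[abs_def] True mulX_same sec_slot_scale[OF ij, symmetric] .
  next
    case False
    have "(\<lambda>t. sec pm t j (mulX j b (\<kappa>(i := vdop t (\<phi> t))))) \<in> S" by (rule S_mulX) (use ops \<kappa> False in auto)
    then show ?thesis unfolding scale vdop_def[abs_def] .
  qed
  show "(\<lambda>t x. of_real (1 / \<bar>t\<bar>) * sec pm t j (mulX j b (\<kappa>(i := eul t (\<phi> t)))) x) \<in> S"
  proof (cases "b = i")
    case True
    have "(\<lambda>t. sec pm t j (\<kappa>(i := meulop t (\<phi> t)))) \<in> S" by (rule sec_G) (use ops \<kappa> in auto)
    then show ?thesis
      unfolding meulop_def[abs_def] True mulX_same sec_slot_scale[OF ij, symmetric] .
  next
    case False
    have "(\<lambda>t. sec pm t j (mulX j b (\<kappa>(i := eulop t (\<phi> t))))) \<in> S" by (rule S_mulX) (use ops \<kappa> False in auto)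
    then show ?thesis unfolding scale eulop_def[abs_def] .
  qed
qed

text \<open>\<open>LY_sec\<close> with the terms a = i split off. There i t is merged with x_i / x_j
  times the derivative of slot i into \<open>eul\<close>, the combination that is small on
  chirps.\<close>

lemma LY_slot:
  assumes \<kappa>: "\<And>a. test (\<kappa> a)" and f: "test f"
  shows "LY Y (sec pm t j (\<kappa>(i := f))) x =
    (\<Sum>b\<in>UNIV. of_real (- Y$i$b) * sec pm t j (mulX j b (\<kappa>(i := vd f))) x) +
    (\<Sum>b\<in>UNIV. \<Sum>a\<in>UNIV - {j} - {i}. of_real (- Y$a$b) * sec pm t j (mulX j b ((\<kappa>(a := vd (\<kappa> a)))(i := f))) x) +
    (\<Sum>b\<in>UNIV. of_real (Y$j$b) * sec pm t j (mulX j b (\<kappa>(i := eul t f))) x) +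
    (\<Sum>b\<in>UNIV. \<Sum>a\<in>UNIV - {j} - {i}. of_real (Y$j$b) * sec pm t j (mulX j b ((\<kappa>(a := \<lambda>y. of_real y * vd (\<kappa> a) y))(i := f))) x) +
    (\<Sum>b\<in>UNIV. of_real (Y$j$b * (real CARD('n) / 2)) * sec pm t j (mulX j b (\<kappa>(i := f))) x)"
proof -
  let ?K = "\<kappa>(i := f)"
  have K: "test (?K a)" for a using \<kappa> f by simp
  have rem: "(\<Sum>a\<in>UNIV - {j}. h a) = h i + (\<Sum>a\<in>UNIV - {j} - {i}. h a)" for h :: "'n \<Rightarrow> complex"
    using ij by (subst sum.remove[of _ i]) auto
  have d: "dslot i ?K = \<kappa>(i := vd f)" by (simp add: dslot_def)
  have d': "dslot a ?K = (\<kappa>(a := vd (\<kappa> a)))(i := f)" if "a \<in> UNIV - {j} - {i}" for a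
    using that by (auto simp: dslot_def)
  have d'': "mulX j a (dslot a ?K) = (\<kappa>(a := \<lambda>y. of_real y * vd (\<kappa> a) y))(i := f)" if "a \<in> UNIV - {j} - {i}" for a
    using that by (auto simp: dslot_def mulX_def)
  have e: "sec pm t j (mulX j b (mulX j i (dslot i ?K))) x + \<i> * of_real t * sec pm t j (mulX j b ?K) x =
     sec pm t j (mulX j b (\<kappa>(i := eul t f))) x" for b
  proof (cases "x $ j = 0")
    case False
    then show ?thesis
      unfolding d mulX_same sec_mulX[OF False] eul_def[abs_def] sec_slot_add[OF ij] sec_slot_scale[OF ij, where c = "\<i> * of_real t"]
      by (simp add: algebra_simps)
  qed (simp add: sec_def)
  have "LY Y (sec pm t j ?K) x =
     (\<Sum>b\<in>UNIV. \<Sum>a\<in>UNIV - {j}. of_real (- Y$a$b) * sec pm t j (mulX j b (dslot a ?K)) x) +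
     (\<Sum>b\<in>UNIV. of_real (Y$j$b) * ((\<Sum>a\<in>UNIV - {j}. sec pm t j (mulX j b (mulX j a (dslot a ?K))) x) +
        (of_real (real CARD('n) / 2) + \<i> * of_real t) * sec pm t j (mulX j b ?K) x))"
    by (subst LY_sec[OF K]) simp
  also have "\<dots> = (\<Sum>b\<in>UNIV. of_real (- Y$i$b) * sec pm t j (mulX j b (\<kappa>(i := vd f))) x +
       (\<Sum>a\<in>UNIV - {j} - {i}. of_real (- Y$a$b) * sec pm t j (mulX j b ((\<kappa>(a := vd (\<kappa> a)))(i := f))) x)) +
     (\<Sum>b\<in>UNIV. of_real (Y$j$b) * (sec pm t j (mulX j b (\<kappa>(i := eul t f))) x +
        (\<Sum>a\<in>UNIV - {j} - {i}. sec pm t j (mulX j b ((\<kappa>(a := \<lambda>y. of_real y * vd (\<kappa> a) y))(i := f))) x) +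
        of_real (real CARD('n) / 2) * sec pm t j (mulX j b ?K) x))"
  proof -
    have 1: "(\<Sum>a\<in>UNIV - {j}. sec pm t j (mulX j b (mulX j a (dslot a ?K))) x) +
        (of_real (real CARD('n) / 2) + \<i> * of_real t) * sec pm t j (mulX j b ?K) x =
      sec pm t j (mulX j b (\<kappa>(i := eul t f))) x +
        (\<Sum>a\<in>UNIV - {j} - {i}. sec pm t j (mulX j b ((\<kappa>(a := \<lambda>y. of_real y * vd (\<kappa> a) y))(i := f))) x) +
        of_real (real CARD('n) / 2) * sec pm t j (mulX j b ?K) x" for b
    proof -
      have "(\<Sum>a\<in>UNIV - {j} - {i}. sec pm t j (mulX j b (mulX j a (dslot a ?K))) x) =
        (\<Sum>a\<in>UNIV - {j} - {i}. sec pm t j (mulX j b ((\<kappa>(a := \<lambda>y. of_real y * vd (\<kappa> a) y))(i := f))) x)"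
        by (rule sum.cong) (simp_all only: d'')
      then show ?thesis unfolding rem e[symmetric] by (simp only: distrib_right add_ac)
    qed
    have 2: "(\<Sum>a\<in>UNIV - {j}. of_real (- Y$a$b) * sec pm t j (mulX j b (dslot a ?K)) x) =
       of_real (- Y$i$b) * sec pm t j (mulX j b (\<kappa>(i := vd f))) x +
       (\<Sum>a\<in>UNIV - {j} - {i}. of_real (- Y$a$b) * sec pm t j (mulX j b ((\<kappa>(a := vd (\<kappa> a)))(i := f))) x)" for b
    proof -
      have "(\<Sum>a\<in>UNIV - {j} - {i}. of_real (- Y$a$b) * sec pm t j (mulX j b (dslot a ?K)) x) =
        (\<Sum>a\<in>UNIV - {j} - {i}. of_real (- Y$a$b) * sec pm t j (mulX j b ((\<kappa>(a := vd (\<kappa> a)))(i := f))) x)"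
        by (rule sum.cong) (simp_all only: d')
      then show ?thesis unfolding rem d by simp
    qed
    show ?thesis unfolding 1 2 ..
  qed
  finally show ?thesis
    by (simp only: sum.distrib distrib_left sum_distrib_left of_real_mult mult.assoc add_ac)
qed

lemma S0E:
  assumes "F \<in> S0"
  obtains \<kappa> \<phi> where "F = (\<lambda>t. sec pm t j (\<kappa>(i := \<phi> t)))" "\<phi> \<in> G0" "\<And>a. test (\<kappa> a)"
proof -
  from assms have "\<exists>\<kappa> \<phi>. F = (\<lambda>t. sec pm t j (\<kappa>(i := \<phi> t))) \<and> \<phi> \<in> G0 \<and> (\<forall>a. test (\<kappa> a))"
    unfolding S0_def by (rule CollectD)
  then show ?thesis using that by (elim exE conjE) simp
qed

lemma LY_S:
  assumes "F \<in> S"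
  shows "(\<lambda>t x. of_real (1 / \<bar>t\<bar>) * LY Y (F t) x) \<in> S"
proof -
  have base: "(\<lambda>t x. of_real (1 / \<bar>t\<bar>) * LY Y (F t) x) \<in> S" if F0: "F \<in> S0" for F
  proof -
    obtain \<kappa> \<phi> where F: "F = (\<lambda>t. sec pm t j (\<kappa>(i := \<phi> t)))" "\<phi> \<in> G0" and \<kappa>: "\<And>a. test (\<kappa> a)"
      by (rule S0E[OF F0]) blast
    have \<phi>: "\<phi> \<in> G" by (rule fspan.base[OF F(2)])
    have \<kappa>': "test ((\<kappa>(a := vd (\<kappa> a))) b)" "test ((\<kappa>(a := \<lambda>y. of_real y * vd (\<kappa> a) y)) b)" for a b
      using \<kappa> by (auto intro: test_vd test_mult smooth_of_real)
    note Z = fspan.base[OF F0]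
    let ?c = "\<lambda>t::real. complex_of_real (1 / \<bar>t\<bar>)"
    have "(\<lambda>t x. (\<Sum>b\<in>UNIV. of_real (- Y$i$b) * (?c t * sec pm t j (mulX j b (\<kappa>(i := vd (\<phi> t)))) x)) +
      (\<Sum>b\<in>UNIV. \<Sum>a\<in>UNIV - {j} - {i}. of_real (- Y$a$b) * (?c t * sec pm t j (mulX j b ((\<kappa>(a := vd (\<kappa> a)))(i := \<phi> t))) x)) +
      (\<Sum>b\<in>UNIV. of_real (Y$j$b) * (?c t * sec pm t j (mulX j b (\<kappa>(i := eul t (\<phi> t)))) x)) +
      (\<Sum>b\<in>UNIV. \<Sum>a\<in>UNIV - {j} - {i}. of_real (Y$j$b) * (?c t * sec pm t j (mulX j b ((\<kappa>(a := \<lambda>y. of_real y * vd (\<kappa> a) y))(i := \<phi> t))) x)) +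
      (\<Sum>b\<in>UNIV. of_real (Y$j$b * (real CARD('n) / 2)) * (?c t * sec pm t j (mulX j b (\<kappa>(i := \<phi> t))) x))) \<in> S"
      by (intro fspan.add fspan_sum[OF _ _ Z] fspan_scale S_slot_op \<kappa> \<kappa>' \<phi>) auto
    then show ?thesis
    proof (rule fspan.cong)
      fix t x assume "\<bar>t\<bar> \<ge> T0"
      then have "test (\<phi> t)" using G0_test_pos[OF F(2)] test_pos_test by blast
      then show "?c t * LY Y (F t) x = (\<Sum>b\<in>UNIV. of_real (- Y$i$b) * (?c t * sec pm t j (mulX j b (\<kappa>(i := vd (\<phi> t)))) x)) +
      (\<Sum>b\<in>UNIV. \<Sum>a\<in>UNIV - {j} - {i}. of_real (- Y$a$b) * (?c t * sec pm t j (mulX j b ((\<kappa>(a := vd (\<kappa> a)))(i := \<phi> t))) x)) +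
      (\<Sum>b\<in>UNIV. of_real (Y$j$b) * (?c t * sec pm t j (mulX j b (\<kappa>(i := eul t (\<phi> t)))) x)) +
      (\<Sum>b\<in>UNIV. \<Sum>a\<in>UNIV - {j} - {i}. of_real (Y$j$b) * (?c t * sec pm t j (mulX j b ((\<kappa>(a := \<lambda>y. of_real y * vd (\<kappa> a) y))(i := \<phi> t))) x)) +
      (\<Sum>b\<in>UNIV. of_real (Y$j$b * (real CARD('n) / 2)) * (?c t * sec pm t j (mulX j b (\<kappa>(i := \<phi> t))) x))"
        unfolding F LY_slot[of \<kappa>, OF \<kappa> \<open>test (\<phi> t)\<close>]
        by (simp only: distrib_left sum_distrib_left mult.left_commute[of "?c t"])
    qed
  qed
  show ?thesis
    using fspan_linear[OF assms, of "\<lambda>t f x. of_real (1 / \<bar>t\<bar>) * LY Y f x" S0 "\<lambda>t f. f \<in> V pm t i j"] base S0_V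
    by (simp add: V.add V.cmult LY_add LY_cmult add_divide_distrib)
qed

text \<open>Height squared times length is of order 1 for both kinds of profile: |t|^(-1) times |t|
  for a chirp, constants for a bump.\<close>

lemma S_bound:
  assumes "F \<in> S"
  shows "\<exists>C\<ge>0. \<forall>t. \<bar>t\<bar> \<ge> T0 \<longrightarrow> hnorm2 (F t) \<le> ennreal C"
  using assms
proof (induction rule: fspan.induct)
  case (base F)
  obtain \<kappa> \<phi> where F: "F = (\<lambda>t. sec pm t j (\<kappa>(i := \<phi> t)))" "\<phi> \<in> G0" and \<kappa>: "\<And>a. test (\<kappa> a)"
    by (rule S0E[OF base]) blast
  obtain \<eta> k where \<eta>: "\<phi> = (\<lambda>t. avg \<alpha> \<omega> k (\<eta> t) t)" "\<eta> \<in> X0" using F(2) by (auto simp: G0_def)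
  obtain C where C: "C \<ge> 0"
    "\<And>f A R pm t. A \<ge> 0 \<Longrightarrow> R \<ge> 0 \<Longrightarrow> test_pos f \<Longrightarrow> (\<And>w. cmod (f w) \<le> A) \<Longrightarrow> (\<And>w. f w \<noteq> 0 \<Longrightarrow> \<bar>w\<bar> \<le> R) \<Longrightarrow>
       hnorm2 (sec pm t j (\<kappa>(i := f))) \<le> ennreal (C * A\<^sup>2 * R)"
    by (rule sec_hnorm2_box[of i j \<kappa>, OF ij \<kappa>]) blast
  from \<eta>(2) consider \<psi> where "\<eta> = chirp \<psi>" "test_on l u \<psi>" | b where "\<eta> = osc \<omega> b" "test_on lb ub b"
    by (auto simp: X0_def)
  then show ?case
  proof cases
    case 1
    obtain M where M: "M \<ge> 0" "\<And>x. cmod (\<psi> x) \<le> M" by (rule test_on_bounded[OF 1(2)]) blast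
    let ?R = "\<bar>u\<bar> + \<bar>\<alpha>\<bar>"
    have "hnorm2 (F t) \<le> ennreal (C * M\<^sup>2 * ?R)" if t: "\<bar>t\<bar> \<ge> T0" for t
    proof -
      let ?T = "\<bar>t\<bar>"
      have T: "?T \<ge> 1" using t T0 by simp
      have p: "(?T powr (- 1 / 2))\<^sup>2 * ?T = 1"
        using T by (simp add: power2_eq_square powr_add[symmetric] powr_minus_divide)
      have "hnorm2 (F t) \<le> ennreal (C * (?T powr (- 1 / 2) * M)\<^sup>2 * (?R * ?T))"
        unfolding F(1)
      proof (rule C(2))
        show "test_pos (\<phi> t)" by (rule G0_test_pos[OF F(2) t])
        show "cmod (\<phi> t w) \<le> ?T powr (- 1 / 2) * M" for w
          unfolding \<eta>(1)
          by (rule avg_bound[OF smooth_continuous[OF X0_smooth[OF \<eta>(2) t]]])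
            (simp add: 1 chirp_def norm_mult M mult_left_mono)
        fix w assume "\<phi> t w \<noteq> 0"
        then have "l * ?T - \<bar>\<alpha>\<bar> \<le> w \<and> w \<le> u * ?T + \<bar>\<alpha>\<bar>"
          unfolding \<eta>(1) by (rule avg_support[rotated]) (use chirp_support[OF dom[OF t] 1(2)] 1(1) in blast)
        moreover have "l * ?T - \<bar>\<alpha>\<bar> \<ge> 0"
          using lT0 mult_left_mono[OF t, of l] l by linarith
        moreover have "u * ?T + \<bar>\<alpha>\<bar> \<le> ?R * ?T"
          using T mult_right_mono[of u "\<bar>u\<bar>" ?T] mult_left_mono[OF T, of "\<bar>\<alpha>\<bar>"] by (simp add: distrib_right add_mono)
        ultimately show "\<bar>w\<bar> \<le> ?R * ?T" by linarith
      qed (use M in auto)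
      also have "C * (?T powr (- 1 / 2) * M)\<^sup>2 * (?R * ?T) = C * M\<^sup>2 * ?R * ((?T powr (- 1 / 2))\<^sup>2 * ?T)"
        by (simp add: power_mult_distrib mult_ac)
      finally show ?thesis unfolding p by simp
    qed
    then show ?thesis using C(1) M(1) by (intro exI[of _ "C * M\<^sup>2 * ?R"]) auto
  next
    case 2
    obtain M where M: "M \<ge> 0" "\<And>x. cmod (b x) \<le> M" by (rule test_on_bounded[OF 2(2)]) blast
    let ?R = "\<bar>ub\<bar> + \<bar>lb\<bar> + \<bar>\<alpha>\<bar>"
    have "hnorm2 (F t) \<le> ennreal (C * M\<^sup>2 * ?R)" if t: "\<bar>t\<bar> \<ge> T0" for t
      unfolding F(1)
    proof (rule C(2))
      show "test_pos (\<phi> t)" by (rule G0_test_pos[OF F(2) t])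
      show "cmod (\<phi> t w) \<le> M" for w
        unfolding \<eta>(1)
        by (rule avg_bound[OF smooth_continuous[OF X0_smooth[OF \<eta>(2) t]]])
          (simp add: 2 osc_def norm_mult M)
      fix w assume "\<phi> t w \<noteq> 0"
      then have "lb - \<bar>\<alpha>\<bar> \<le> w \<and> w \<le> ub + \<bar>\<alpha>\<bar>"
        unfolding \<eta>(1) by (rule avg_support[rotated]) (use 2 in \<open>auto simp: osc_def test_on_def\<close>)
      then show "\<bar>w\<bar> \<le> ?R" by linarith
    qed (use M in auto)
    then show ?thesis using C(1) M(1) by (intro exI[of _ "C * M\<^sup>2 * ?R"]) auto
  qed
next
  case (add F H)
  then obtain C D where C: "C \<ge> 0" "\<And>t. \<bar>t\<bar> \<ge> T0 \<Longrightarrow> hnorm2 (F t) \<le> ennreal C"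
    and D: "D \<ge> 0" "\<And>t. \<bar>t\<bar> \<ge> T0 \<Longrightarrow> hnorm2 (H t) \<le> ennreal D" by metis
  have "hnorm2 (\<lambda>x. F t x + H t x) \<le> ennreal (2 * C + 2 * D)" if t: "\<bar>t\<bar> \<ge> T0" for t
  proof -
    have "hnorm2 (\<lambda>x. F t x + H t x) \<le> 2 * hnorm2 (F t) + 2 * hnorm2 (H t)"
      by (rule hnorm2_add_le) (auto intro!: V_measurable S_V add t)
    also have "\<dots> \<le> 2 * ennreal C + 2 * ennreal D" by (intro add_mono mult_left_mono C D t) auto
    finally show ?thesis using C D by (simp add: ennreal_mult')
  qed
  then show ?case using C D by (intro exI[of _ "2 * C + 2 * D"]) auto
next
  case (cmult F c)
  then obtain C M where C: "C \<ge> 0" "\<And>t. \<bar>t\<bar> \<ge> T0 \<Longrightarrow> hnorm2 (F t) \<le> ennreal C"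
    and M: "\<And>t. \<bar>t\<bar> \<ge> T0 \<Longrightarrow> cmod (c t) \<le> M" unfolding bdd_from_def by metis
  have "hnorm2 (\<lambda>x. c t * F t x) \<le> ennreal (M\<^sup>2 * C)" if t: "\<bar>t\<bar> \<ge> T0" for t
  proof -
    have "hnorm2 (\<lambda>x. c t * F t x) = ennreal ((cmod (c t))\<^sup>2) * hnorm2 (F t)"
      by (rule hnorm2_cmult) (auto intro!: V_measurable S_V cmult t)
    also have "\<dots> \<le> ennreal (M\<^sup>2) * ennreal C"
      by (intro mult_mono C t ennreal_leI power_mono M) auto
    finally show ?thesis by (simp add: ennreal_mult')
  qed
  then show ?case using C by (intro exI[of _ "M\<^sup>2 * C"]) auto
next
  case (cong F H)
  then have "H t = F t" if "\<bar>t\<bar> \<ge> T0" for t using that by blast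
  then show ?case using cong(3) by simp
qed

lemma LY_word_S:
  assumes "F \<in> S"
  shows "(\<lambda>t x. of_real ((1 / \<bar>t\<bar>) ^ length Ys) * foldr LY Ys (F t) x) \<in> S"
proof (induction Ys)
  case Nil then show ?case using assms by simp
next
  case (Cons Y Ys)
  show ?case
    by (rule fspan.cong[OF LY_S[OF Cons.IH, of Y]])
      (use LY_cmult[OF V_foldr_LY[OF ij S_V[OF assms]]] in \<open>simp add: mult.assoc\<close>)
qed

text \<open>A word of length m costs |t|^m by \<open>LY_word_S\<close>, and |t| \<ge> 1 lets the
  longest words dominate. The constants may depend on the word, since for fixed k only finitely many
  occur.\<close>

lemma sob_int2_S:
  assumes "F \<in> S" "finite B"
  shows "\<exists>A. (\<forall>k. A k \<ge> 0) \<and> (\<forall>k t. \<bar>t\<bar> \<ge> T0 \<longrightarrow> sob_int2 pm t B k (F t) \<le> ennreal (A k * \<bar>t\<bar> powr (2 * real k)))"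
proof -
  have "\<exists>C\<ge>0. \<forall>t. \<bar>t\<bar> \<ge> T0 \<longrightarrow> hnorm2 (foldr LY Ys (F t)) \<le> ennreal (C * (\<bar>t\<bar> ^ length Ys)\<^sup>2)" for Ys
  proof -
    obtain C where C: "C \<ge> 0" "\<And>t. \<bar>t\<bar> \<ge> T0 \<Longrightarrow>
        hnorm2 (\<lambda>x. of_real ((1 / \<bar>t\<bar>) ^ length Ys) * foldr LY Ys (F t) x) \<le> ennreal C"
      using S_bound[OF LY_word_S[OF assms(1), of Ys]] by blast
    have "hnorm2 (foldr LY Ys (F t)) \<le> ennreal (C * (\<bar>t\<bar> ^ length Ys)\<^sup>2)" if t: "\<bar>t\<bar> \<ge> T0" for t
    proof -
      let ?f = "foldr LY Ys (F t)"
      have m: "?f \<in> borel_measurable borel" by (rule V_measurable[OF V_foldr_LY[OF ij S_V[OF assms(1) t]]])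
      have "?f = (\<lambda>x. of_real (\<bar>t\<bar> ^ length Ys) * (of_real ((1 / \<bar>t\<bar>) ^ length Ys) * ?f x))"
        using dom[OF t] by (simp add: fun_eq_iff power_divide)
      then have "hnorm2 ?f = hnorm2 (\<lambda>x. of_real (\<bar>t\<bar> ^ length Ys) * (of_real ((1 / \<bar>t\<bar>) ^ length Ys) * ?f x))" by simp
      also have "\<dots> = ennreal ((\<bar>t\<bar> ^ length Ys)\<^sup>2) * hnorm2 (\<lambda>x. of_real ((1 / \<bar>t\<bar>) ^ length Ys) * ?f x)"
        by (subst hnorm2_cmult) (use m in \<open>auto simp: norm_power\<close>)
      also have "\<dots> \<le> ennreal ((\<bar>t\<bar> ^ length Ys)\<^sup>2) * ennreal C" by (intro mult_left_mono C t) simp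
      finally show ?thesis by (simp add: ennreal_mult' mult.commute[of C])
    qed
    then show ?thesis using C(1) by blast
  qed
  then obtain C where C: "\<And>Ys. C Ys \<ge> 0" "\<And>Ys t. \<bar>t\<bar> \<ge> T0 \<Longrightarrow> hnorm2 (foldr LY Ys (F t)) \<le> ennreal (C Ys * (\<bar>t\<bar> ^ length Ys)\<^sup>2)"
    by metis
  let ?W = "\<lambda>k. {Ys. 1 \<le> length Ys \<and> length Ys \<le> k \<and> set Ys \<subseteq> B}"
  let ?A = "\<lambda>k. C [] + (\<Sum>Ys\<in>?W k. C Ys)"
  have "sob_int2 pm t B k (F t) \<le> ennreal (?A k * \<bar>t\<bar> powr (2 * real k))" if t: "\<bar>t\<bar> \<ge> T0" for k t
  proof -
    have T: "\<bar>t\<bar> \<ge> 1" using t T0 by simp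
    have b: "hnorm2 (foldr LY Ys (F t)) \<le> ennreal (C Ys * \<bar>t\<bar> powr (2 * real k))" if "length Ys \<le> k" for Ys
    proof -
      have "(\<bar>t\<bar> ^ length Ys)\<^sup>2 \<le> (\<bar>t\<bar> ^ k)\<^sup>2" using T that by (intro power_mono power_increasing) auto
      also have "\<dots> = \<bar>t\<bar> powr (2 * real k)" using T powr_realpow[of "\<bar>t\<bar>" "2 * k"] by (simp add: power_mult mult.commute)
      finally show ?thesis using C(2)[OF t, of Ys] C(1)[of Ys]
        by (meson ennreal_leI mult_left_mono order_trans)
    qed
    have "sob_int2 pm t B k (F t) \<le> ennreal (C [] * \<bar>t\<bar> powr (2 * real k)) + (\<Sum>Ys\<in>?W k. ennreal (C Ys * \<bar>t\<bar> powr (2 * real k)))"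
      unfolding sob_int2_V[OF ij S_V[OF assms(1) t]] using b[of "[]"] by (intro add_mono sum_mono b) auto
    also have "\<dots> = ennreal (?A k * \<bar>t\<bar> powr (2 * real k))"
      using C(1) by (simp add: sum_ennreal distrib_right sum_distrib_right sum_nonneg flip: ennreal_plus)
    finally show ?thesis .
  qed
  then show ?thesis using C(1) by (intro exI[of _ ?A]) (auto intro!: add_nonneg_nonneg sum_nonneg)
qed

lemma sob2_S:
  assumes "F \<in> S" "finite B" "r \<ge> 0"
  obtains A where "A \<ge> 0" "\<And>t. \<bar>t\<bar> \<ge> T0 \<Longrightarrow> sob2 pm t B r (F t) \<le> ennreal (A * \<bar>t\<bar> powr (2 * r))"
proof -
  obtain A where A: "\<And>k. A k \<ge> 0" "\<And>k t. \<bar>t\<bar> \<ge> T0 \<Longrightarrow> sob_int2 pm t B k (F t) \<le> ennreal (A k * \<bar>t\<bar> powr (2 * real k))"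
    using sob_int2_S[OF assms(1,2)] by blast
  have "interp_const A r \<ge> 0"
  proof -
    have "r - of_int \<lfloor>r\<rfloor> \<ge> 0" "r - of_int \<lfloor>r\<rfloor> < 1" by linarith+
    then show ?thesis using A(1) by (simp add: interp_const_def Let_def)
  qed
  moreover have "sob2 pm t B r (F t) \<le> ennreal (interp_const A r * \<bar>t\<bar> powr (2 * r))" if "\<bar>t\<bar> \<ge> T0" for t
    using that dom[OF that] by (intro sob2_le[OF ij S_V[OF assms(1)]] A assms(3)) auto
  ultimately show ?thesis by (rule that)
qed

end

section \<open>The Bessel kernel on the line\<close>

definition heat :: "real \<Rightarrow> real \<Rightarrow> real" where
  "heat u = normal_density 0 (sqrt (2 * u))"

definition gamma_density :: "real \<Rightarrow> real \<Rightarrow> real" where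
  "gamma_density s u = (if u > 0 then u powr (s / 2 - 1) * exp (- u) / Gamma (s / 2) else 0)"

text \<open>The kernel as a gamma mixture of heat kernels, with values in \<open>ennreal\<close>:
  Tonelli then applies directly, and the value infinity, taken at r = 0 when s \<le> 1, is harmless.
  It agrees with \<open>bessel_kernel\<close> almost everywhere by
  \<open>bessel_enn_finite\<close>.\<close>

definition bessel_enn :: "real \<Rightarrow> real \<Rightarrow> ennreal" where
  "bessel_enn s r = (\<integral>\<^sup>+u. ennreal (gamma_density s u) * ennreal (heat u r) \<partial>lborel)"

lemma heat_measurable [measurable]: "(\<lambda>p. heat (fst p) (snd p)) \<in> borel_measurable (borel \<Otimes>\<^sub>M borel)"
  unfolding heat_def normal_density_def by measurable

lemma gamma_density_measurable [measurable]: "gamma_density s \<in> borel_measurable borel"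
  unfolding gamma_density_def by measurable

lemma gamma_density_nonneg: "s > 0 \<Longrightarrow> gamma_density s u \<ge> 0"
  by (simp add: gamma_density_def Gamma_real_pos less_imp_le)

lemma bessel_enn_measurable [measurable]: "bessel_enn s \<in> borel_measurable borel"
proof -
  have [measurable]: "(\<lambda>(r, u). heat u r) \<in> borel_measurable (borel \<Otimes>\<^sub>M lborel)"
    using measurable_compose[OF measurable_pair_swap' heat_measurable] by (simp add: case_prod_beta)
  show ?thesis unfolding bessel_enn_def by measurable
qed

lemma bessel_kernel_eq: "s > 0 \<Longrightarrow> bessel_kernel s r = enn2real (bessel_enn s r)"
proof -
  assume s: "s > 0"
  have G: "Gamma (s / 2) > 0" using s by (simp add: Gamma_real_pos)
  have "bessel_enn s r = (\<integral>\<^sup>+ u. ennreal (1 / Gamma (s / 2)) * (indicator {0<..} u *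
        ennreal (u powr (s / 2 - 1) * exp (- u) * (4 * pi * u) powr (- 1 / 2) * exp (- r\<^sup>2 / (4 * u)))) \<partial>lborel)"
    unfolding bessel_enn_def
  proof (rule nn_integral_cong)
    fix u :: real
    have "gamma_density s u * heat u r = 1 / Gamma (s / 2) * (u powr (s / 2 - 1) * exp (- u) * (4 * pi * u) powr (- 1 / 2) * exp (- r\<^sup>2 / (4 * u)))" if "u > 0"
      using that by (simp add: gamma_density_def heat_def normal_density_def powr_minus powr_half_sqrt divide_simps)
    then show "ennreal (gamma_density s u) * ennreal (heat u r) = ennreal (1 / Gamma (s / 2)) * (indicator {0<..} u *
        ennreal (u powr (s / 2 - 1) * exp (- u) * (4 * pi * u) powr (- 1 / 2) * exp (- r\<^sup>2 / (4 * u))))"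
      using G gamma_density_nonneg[OF s, of u]
      by (cases "u > 0") (simp_all add: ennreal_mult'[symmetric] heat_def gamma_density_def[of s u])
  qed
  also have "\<dots> = ennreal (1 / Gamma (s / 2)) * (\<integral>\<^sup>+ u. (indicator {0<..} u *
        ennreal (u powr (s / 2 - 1) * exp (- u) * (4 * pi * u) powr (- 1 / 2) * exp (- r\<^sup>2 / (4 * u)))) \<partial>lborel)"
    by (rule nn_integral_cmult) measurable
  finally show ?thesis using G by (simp add: bessel_kernel_def enn2real_mult)
qed

lemma nn_integral_heat: "u > 0 \<Longrightarrow> (\<integral>\<^sup>+r. ennreal (heat u r) \<partial>lborel) = 1"
  unfolding heat_def by (subst nn_integral_eq_integral) auto

lemma nn_integral_gamma_density: "s > 0 \<Longrightarrow> (\<integral>\<^sup>+u. ennreal (gamma_density s u) \<partial>lborel) = 1"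
proof -
  assume s: "s > 0"
  have G: "Gamma (s / 2) > 0" using s by (simp add: Gamma_real_pos)
  have "ennreal (Gamma (s/2)) * (\<integral>\<^sup>+u. ennreal (gamma_density s u) \<partial>lborel) =
      (\<integral>\<^sup>+u. ennreal (Gamma (s/2)) * ennreal (gamma_density s u) \<partial>lborel)"
    by (rule nn_integral_cmult[symmetric]) measurable
  also have "\<dots> = (\<integral>\<^sup>+t. ennreal (indicator {0..} t * t powr (s / 2 - 1) / exp t) \<partial>lborel)"
    using G
    by (intro nn_integral_cong)
       (auto simp: ennreal_mult'[symmetric] less_imp_neq[OF G, symmetric] gamma_density_def exp_minus divide_simps split: split_indicator)
  also have "\<dots> = ennreal (Gamma (s / 2)) * 1"
    using Gamma_conv_nn_integral_real[of "s / 2"] s by simp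
  finally show ?thesis
    using G by (subst (asm) ennreal_mult_cancel_left) auto
qed

lemma nn_integral_bessel_enn: "s > 0 \<Longrightarrow> (\<integral>\<^sup>+r. bessel_enn s r \<partial>lborel) = 1"
proof -
  assume s: "s > 0"
  have [measurable]: "(\<lambda>(r, u). heat u r) \<in> borel_measurable (lborel \<Otimes>\<^sub>M lborel)"
    using measurable_compose[OF measurable_pair_swap' heat_measurable] by (simp add: case_prod_beta)
  have "(\<integral>\<^sup>+r. bessel_enn s r \<partial>lborel) =
      (\<integral>\<^sup>+u. \<integral>\<^sup>+r. ennreal (gamma_density s u) * ennreal (heat u r) \<partial>lborel \<partial>lborel)"
    unfolding bessel_enn_def by (rule lborel_pair.Fubini') measurable
  also have "\<dots> = (\<integral>\<^sup>+u. ennreal (gamma_density s u) \<partial>lborel)"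
  proof (rule nn_integral_cong)
    fix u :: real
    have [measurable]: "heat u \<in> borel_measurable borel" unfolding heat_def by measurable
    show "(\<integral>\<^sup>+r. ennreal (gamma_density s u) * ennreal (heat u r) \<partial>lborel) = ennreal (gamma_density s u)"
      using nn_integral_heat[of u]
      by (subst nn_integral_cmult) (auto simp: gamma_density_def)
  qed
  finally show ?thesis using nn_integral_gamma_density[OF s] by simp
qed

text \<open>Put c = |r| / 2. Since the squares of sqrt u - c / sqrt u and sqrt u + c / sqrt u are u
  + c^2 / u - 2 c and u + c^2 / u + 2 c, the integrand exp (- u - c^2 / u) / (2 sqrt (pi u)) has a
  primitive F built from the distribution function E of the Gaussian exp (- z^2) / sqrt pi, and the
  integral is read off from the limits of F.\<close>

lemma bessel_enn_two: "r \<noteq> 0 \<Longrightarrow> bessel_enn 2 r = ennreal (exp (- \<bar>r\<bar>) / 2)"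
proof -
  assume r: "r \<noteq> 0"
  define c where "c = \<bar>r\<bar> / 2"
  have c: "c > 0" using r by (simp add: c_def)
  define n where "n = normal_density 0 (1 / sqrt 2)"
  have n: "n z = exp (- z\<^sup>2) / sqrt pi" for z
    by (simp add: n_def normal_density_def power_divide real_sqrt_mult)
  have n_cont: "continuous_on S n" for S unfolding n by (intro continuous_intros) auto
  define D where "D = density lborel (\<lambda>x. ennreal (n x))"
  interpret D: prob_space D unfolding D_def n_def by (rule prob_space_normal_density) simp
  interpret D: real_distribution D by unfold_locales (simp_all add: D_def)
  define E where "E = cdf D"
  have dE: "(E has_real_derivative n z) (at z)" for z
  proof -
    \<comment> \<open>E is an integral from minus infinity; comparing with its value at z - 1 leaves
      an integral over a bounded interval, to which the fundamental theorem applies.\<close>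
    have *: "E y = E (z - 1) + integral {z - 1..y} n" if "y \<ge> z - 1" for y
    proof (cases "y = z - 1")
      case False
      have "(n has_integral integral {z - 1..y} n) {z - 1..y}"
        by (intro integrable_integral integrable_continuous_interval n_cont)
      then have "(\<integral>\<^sup>+x. ennreal (indicator {z - 1..y} x * n x) \<partial>lborel) = ennreal (integral {z - 1..y} n)"
        by (intro nn_integral_has_integral_lebesgue) (simp add: n)
      moreover have "emeasure D {z - 1<..y} = (\<integral>\<^sup>+x. ennreal (indicator {z - 1..y} x * n x) \<partial>lborel)"
      proof -
        have [measurable]: "n \<in> borel_measurable borel" by (simp add: n_def)
        have "AE x in lborel. x \<noteq> z - 1" by (rule AE_lborel_singleton)
        then show ?thesis
          unfolding D_def
          by (subst emeasure_density) (auto intro!: nn_integral_cong_AE split: split_indicator)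
      qed
      moreover have "integral {z - 1..y} n \<ge> 0"
        by (intro integral_nonneg integrable_continuous_interval n_cont) (simp add: n)
      ultimately have "measure D {z - 1<..y} = integral {z - 1..y} n"
        by (simp add: measure_def)
      moreover have "E y - E (z - 1) = measure D {z - 1<..y}"
        using that False by (simp add: E_def D.cdf_diff_eq)
      ultimately show ?thesis by simp
    qed simp
    have "((\<lambda>y. E (z - 1) + integral {z - 1..y} n) has_real_derivative 0 + n z) (at z within {z - 1..z + 1})"
      by (intro DERIV_add DERIV_const integral_has_real_derivative n_cont) auto
    moreover have "((\<lambda>y. E (z - 1) + integral {z - 1..y} n) has_real_derivative D') (at z within {z - 1..z + 1}) \<longleftrightarrow>
        (E has_real_derivative D') (at z within {z - 1..z + 1})" for D'
      by (rule has_field_derivative_cong_ev) (auto simp: *[symmetric] eventually_nhds intro!: exI[of _ UNIV])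
    ultimately have "(E has_real_derivative n z) (at z within {z - 1..z + 1})" by simp
    then show ?thesis by (simp add: at_within_Icc_at)
  qed
  have E_top: "(E \<longlongrightarrow> 1) at_top" and E_bot: "(E \<longlongrightarrow> 0) at_bot"
    unfolding E_def by (rule D.cdf_lim_at_top_prob, rule D.cdf_lim_at_bot)
  define F where "F = (\<lambda>u. (exp (- 2 * c) * E (sqrt u - c / sqrt u) + exp (2 * c) * E (sqrt u + c / sqrt u)) / 2)"
  define f where "f = (\<lambda>u. exp (- u) * heat u r)"
  have f_eq: "f u = exp (- u - c\<^sup>2 / u) / (2 * sqrt pi * sqrt u)" if "u > 0" for u
  proof -
    have "exp (- u) * exp (- r\<^sup>2 / (4 * u)) = exp (- u - c\<^sup>2 / u)"
      using that by (simp add: c_def power_divide flip: exp_add)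
    moreover have "heat u r = exp (- r\<^sup>2 / (4 * u)) / (2 * sqrt pi * sqrt u)"
    proof -
      have "sqrt (2 * pi * (2 * u)) = sqrt (2\<^sup>2 * (pi * u))" by simp
      also have "\<dots> = 2 * sqrt pi * sqrt u" by (simp add: real_sqrt_mult)
      finally show ?thesis using that by (simp add: heat_def normal_density_def)
    qed
    ultimately show ?thesis by (simp add: f_def)
  qed
  have dF: "DERIV F u :> f u" if u: "0 < u" for u
  proof -
    define y where "y = sqrt u"
    have y: "y > 0" "u = y\<^sup>2" using u by (simp_all add: y_def)
    have 1: "exp (- 2 * c) * n (y - c / y) = exp (- u - c\<^sup>2 / u) / sqrt pi"
      "exp (2 * c) * n (y + c / y) = exp (- u - c\<^sup>2 / u) / sqrt pi"
      using y by (simp_all add: n power2_diff power2_sum power_divide flip: exp_add)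
    have "DERIV F u :> (exp (- 2 * c) * (n (y - c / y) * (inverse y / 2 + c * (inverse y / 2) / (y * y))) +
        exp (2 * c) * (n (y + c / y) * (inverse y / 2 - c * (inverse y / 2) / (y * y)))) / 2"
      unfolding F_def y_def using u
      by (auto intro!: derivative_eq_intros DERIV_chain2[OF dE])
    also have "(exp (- 2 * c) * (n (y - c / y) * (inverse y / 2 + c * (inverse y / 2) / (y * y))) +
        exp (2 * c) * (n (y + c / y) * (inverse y / 2 - c * (inverse y / 2) / (y * y)))) / 2 =
        ((exp (- 2 * c) * n (y - c / y)) * (inverse y / 2 + c * (inverse y / 2) / (y * y)) +
        (exp (2 * c) * n (y + c / y)) * (inverse y / 2 - c * (inverse y / 2) / (y * y))) / 2"
      by (simp add: mult.assoc)
    also have "\<dots> = f u"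
      unfolding 1 using u by (simp add: f_eq y_def[symmetric] field_simps)
    finally show ?thesis .
  qed
  \<comment> \<open>At 0 the two arguments of E tend to minus and plus infinity, at infinity both
    tend to plus infinity. The difference of the limits is exp (- 2 c) / 2.\<close>
  have lim0: "(F \<longlongrightarrow> (exp (- 2 * c) * 0 + exp (2 * c) * 1) / 2) (at_right 0)"
    unfolding F_def
    by (intro tendsto_intros filterlim_compose[OF E_bot] filterlim_compose[OF E_top])
      (use c in \<open>(simp; fail | real_asymp)+\<close>)
  have lim1: "(F \<longlongrightarrow> (exp (- 2 * c) * 1 + exp (2 * c) * 1) / 2) at_top"
    unfolding F_def
    by (intro tendsto_intros filterlim_compose[OF E_top])
      (use c in \<open>(simp; fail | real_asymp)+\<close>)
  have nonneg: "f u \<ge> 0" for u by (simp add: f_def heat_def)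
  note FTC = interval_integral_FTC_nonneg[of 0 \<infinity> F f "(exp (- 2 * c) * 0 + exp (2 * c) * 1) / 2" "(exp (- 2 * c) * 1 + exp (2 * c) * 1) / 2"]
  have cont: "isCont f u" if "0 < u" for u
    unfolding f_def heat_def normal_density_def using that by (intro continuous_intros) auto
  have "set_integrable lborel (einterval 0 \<infinity>) f" "(LBINT x=0..\<infinity>. f x) = exp (- 2 * c) / 2"
    using FTC dF cont nonneg lim0 lim1
    by (auto simp: ereal_tendsto_simps zero_ereal_def add_divide_distrib)
  then have si: "set_integrable lborel {0<..} f" and "(LBINT x:{0<..}. f x) = exp (- 2 * c) / 2"
    by (simp_all add: interval_lebesgue_integral_def zero_ereal_def)
  then have "(\<integral>\<^sup>+u. ennreal (indicator {0<..} u *\<^sub>R f u) \<partial>lborel) = ennreal (exp (- 2 * c) / 2)"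
    unfolding set_integrable_def set_lebesgue_integral_def
    by (subst nn_integral_eq_integral) (auto simp: nonneg)
  moreover have "bessel_enn 2 r = (\<integral>\<^sup>+u. ennreal (indicator {0<..} u *\<^sub>R f u) \<partial>lborel)"
    unfolding bessel_enn_def
    by (intro nn_integral_cong) (auto simp: gamma_density_def f_def ennreal_mult' split: split_indicator)
  ultimately show ?thesis by (simp add: c_def)
qed

lemma bessel_enn_minus [simp]: "bessel_enn s (- r) = bessel_enn s r"
  by (simp add: bessel_enn_def heat_def normal_density_def)

lemma heat_conv:
  assumes "u > 0" "v > 0"
  shows "(\<integral>\<^sup>+r. ennreal (heat u r) * ennreal (heat v (\<rho> - r)) \<partial>lborel) = ennreal (heat (u + v) \<rho>)"
proof -
  have "(\<integral>\<^sup>+r. ennreal (heat u r) * ennreal (heat v (\<rho> - r)) \<partial>lborel) =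
     (\<integral>\<^sup>+r. ennreal (normal_density 0 (sqrt (2 * v)) (\<rho> - r) * normal_density 0 (sqrt (2 * u)) r) \<partial>lborel)"
    by (simp add: heat_def ennreal_mult' mult.commute)
  also have "\<dots> = ennreal (heat (u + v) \<rho>)"
    using conv_normal_density_zero_mean[of "sqrt (2 * v)" "sqrt (2 * u)"] assms
    by (simp add: heat_def fun_eq_iff algebra_simps)
  finally show ?thesis .
qed

text \<open>After the substitution u = w x this is Euler's Beta integral: two gamma densities of
  unit scale convolve to one whose shapes add.\<close>

lemma gamma_density_conv:
  assumes s: "s > 0" "s' > 0" and w: "w > 0"
  shows "(\<integral>\<^sup>+u. ennreal (gamma_density s u) * ennreal (gamma_density s' (w - u)) \<partial>lborel) = ennreal (gamma_density (s + s') w)"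
proof -
  let ?a = "s / 2" and ?b = "s' / 2"
  have G: "Gamma ?a > 0" "Gamma ?b > 0" "Gamma (?a + ?b) > 0" using s by (simp_all add: Gamma_real_pos)
  have "(\<integral>\<^sup>+u. ennreal (gamma_density s u) * ennreal (gamma_density s' (w - u)) \<partial>lborel) =
      ennreal w * (\<integral>\<^sup>+x. ennreal (gamma_density s (w * x)) * ennreal (gamma_density s' (w - w * x)) \<partial>lborel)"
    using w by (subst nn_integral_real_affine[where c = w and t = 0]) (auto simp: algebra_simps)
  also have "\<dots> = ennreal w * (\<integral>\<^sup>+x. ennreal (w powr (?a + ?b - 2) * exp (- w) / (Gamma ?a * Gamma ?b)) *
      ennreal (x powr (?a - 1) * (1 - x) powr (?b - 1) * indicator {0..1} x) \<partial>lborel)"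
  proof (intro arg_cong[where f = "\<lambda>z. ennreal w * z"] nn_integral_cong_AE)
    have "AE x in lborel. x \<noteq> (0::real)" "AE x in lborel. x \<noteq> (1::real)" by (rule AE_lborel_singleton)+
    then show "AE x in lborel. ennreal (gamma_density s (w * x)) * ennreal (gamma_density s' (w - w * x)) =
      ennreal (w powr (?a + ?b - 2) * exp (- w) / (Gamma ?a * Gamma ?b)) *
      ennreal (x powr (?a - 1) * (1 - x) powr (?b - 1) * indicator {0..1} x)"
    proof eventually_elim
      fix x :: real assume x: "x \<noteq> 0" "x \<noteq> 1"
      show "ennreal (gamma_density s (w * x)) * ennreal (gamma_density s' (w - w * x)) =
        ennreal (w powr (?a + ?b - 2) * exp (- w) / (Gamma ?a * Gamma ?b)) *
        ennreal (x powr (?a - 1) * (1 - x) powr (?b - 1) * indicator {0..1} x)"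
      proof (cases "0 < x \<and> x < 1")
        case True
        have e: "w - w * x = w * (1 - x)" by (simp add: algebra_simps)
        have "w powr (?a - 1) * w powr (?b - 1) = w powr (?a + ?b - 2)"
          by (simp flip: powr_add)
        then have "gamma_density s (w * x) * gamma_density s' (w - w * x) =
          w powr (?a + ?b - 2) * exp (- w) / (Gamma ?a * Gamma ?b) * (x powr (?a - 1) * (1 - x) powr (?b - 1))"
        proof -
          assume pw: "w powr (?a - 1) * w powr (?b - 1) = w powr (?a + ?b - 2)"
          have "exp (- (w * x)) * exp (- (w * (1 - x))) = exp (- w)"
            by (simp add: algebra_simps flip: exp_add)
          moreover have "gamma_density s (w * x) = w powr (?a - 1) * x powr (?a - 1) * exp (- (w * x)) / Gamma ?a"
            "gamma_density s' (w * (1 - x)) = w powr (?b - 1) * (1 - x) powr (?b - 1) * exp (- (w * (1 - x))) / Gamma ?b"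
            using True w by (simp_all add: gamma_density_def powr_mult)
          ultimately show ?thesis
            unfolding e pw[symmetric] by (simp add: mult_ac)
        qed
        then show ?thesis using True gamma_density_nonneg[OF s(1)] G
          by (simp add: ennreal_mult'[symmetric])
      next
        case False
        then have "x < 0 \<or> x > 1" using x by auto
        then have "w * x \<le> 0 \<or> w - w * x \<le> 0"
          using w by (auto simp: mult_le_0_iff mult_le_cancel_left1)
        then have "gamma_density s (w * x) = 0 \<or> gamma_density s' (w - w * x) = 0"
          unfolding gamma_density_def by auto
        then show ?thesis using False x by (auto simp: indicator_def)
      qed
    qed
  qed
  also have "\<dots> = ennreal w * (ennreal (w powr (?a + ?b - 2) * exp (- w) / (Gamma ?a * Gamma ?b)) *
      ennreal (Beta ?a ?b))"
  proof -
    have "((\<lambda>x. x powr (?a - 1) * (1 - x) powr (?b - 1)) has_integral Beta ?a ?b) {0..1}"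
      using s by (intro has_integral_Beta_real) auto
    from nn_integral_has_integral_lebesgue[OF _ this]
    have "(\<integral>\<^sup>+x. ennreal (x powr (?a - 1) * (1 - x) powr (?b - 1) * indicator {0..1} x) \<partial>lborel) = ennreal (Beta ?a ?b)"
      by (simp add: mult.commute)
    then show ?thesis by (subst nn_integral_cmult) auto
  qed
  also have "\<dots> = ennreal (gamma_density (s + s') w)"
  proof -
    have "w * w powr (?a + ?b - 2) = w powr (?a + ?b - 1)"
      using w powr_add[of w 1 "?a + ?b - 2"] by simp
    then have "w * (w powr (?a + ?b - 2) * exp (- w) / (Gamma ?a * Gamma ?b) * Beta ?a ?b) = gamma_density (s + s') w"
      using G w by (simp add: gamma_density_def Beta_def add_divide_distrib)
    moreover have "Beta ?a ?b > 0" using G by (simp add: Beta_def)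
    ultimately show ?thesis using w G by (simp add: ennreal_mult'[symmetric])
  qed
  finally show ?thesis .
qed

text \<open>Subordination: the kernels are mixtures of heat kernels over gamma distributed times,
  and both families are convolution semigroups, in the time parameter and in the shape s /
  2.\<close>

lemma bessel_enn_conv:
  assumes s: "s > 0" "s' > 0"
  shows "(\<integral>\<^sup>+r. bessel_enn s r * bessel_enn s' (\<rho> - r) \<partial>lborel) = bessel_enn (s + s') \<rho>"
proof -
  let ?g = "\<lambda>s u. ennreal (gamma_density s u)" and ?p = "\<lambda>u r. ennreal (heat u r)"
  have m[measurable]: "(\<lambda>x. heat (f x) (g x)) \<in> borel_measurable M"
    if "f \<in> borel_measurable M" "g \<in> borel_measurable M" for f g and M :: "'z measure"
    using measurable_compose[OF measurable_Pair[OF that] heat_measurable] by simp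
  have "(\<integral>\<^sup>+r. bessel_enn s r * bessel_enn s' (\<rho> - r) \<partial>lborel) =
     (\<integral>\<^sup>+r. \<integral>\<^sup>+u. \<integral>\<^sup>+v. (?g s u * ?p u r) * (?g s' v * ?p v (\<rho> - r)) \<partial>lborel \<partial>lborel \<partial>lborel)"
    unfolding bessel_enn_def
    by (subst nn_integral_multc[symmetric], measurable, subst nn_integral_cmult[symmetric], measurable)
  also have "\<dots> = (\<integral>\<^sup>+u. \<integral>\<^sup>+r. \<integral>\<^sup>+v. (?g s u * ?p u r) * (?g s' v * ?p v (\<rho> - r)) \<partial>lborel \<partial>lborel \<partial>lborel)"
    by (rule lborel_pair.Fubini') measurable
  also have "\<dots> = (\<integral>\<^sup>+u. \<integral>\<^sup>+v. \<integral>\<^sup>+r. (?g s u * ?p u r) * (?g s' v * ?p v (\<rho> - r)) \<partial>lborel \<partial>lborel \<partial>lborel)"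
    by (intro nn_integral_cong lborel_pair.Fubini') measurable
  also have "\<dots> = (\<integral>\<^sup>+u. \<integral>\<^sup>+v. ?g s u * (?g s' v * ?p (u + v) \<rho>) \<partial>lborel \<partial>lborel)"
  proof (intro nn_integral_cong)
    fix u v :: real
    show "(\<integral>\<^sup>+r. (?g s u * ?p u r) * (?g s' v * ?p v (\<rho> - r)) \<partial>lborel) = ?g s u * (?g s' v * ?p (u + v) \<rho>)"
    proof (cases "u > 0 \<and> v > 0")
      case True
      have "(\<integral>\<^sup>+r. (?g s u * ?p u r) * (?g s' v * ?p v (\<rho> - r)) \<partial>lborel) =
          (\<integral>\<^sup>+r. (?g s u * ?g s' v) * (?p u r * ?p v (\<rho> - r)) \<partial>lborel)"
        by (simp add: mult_ac)
      also have "\<dots> = (?g s u * ?g s' v) * (\<integral>\<^sup>+r. ?p u r * ?p v (\<rho> - r) \<partial>lborel)"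
        by (rule nn_integral_cmult) measurable
      finally show ?thesis using True by (simp add: heat_conv mult_ac)
    qed (auto simp: gamma_density_def)
  qed
  also have "\<dots> = (\<integral>\<^sup>+u. \<integral>\<^sup>+w. ?g s u * (?g s' (w - u) * ?p w \<rho>) \<partial>lborel \<partial>lborel)"
  proof (rule nn_integral_cong)
    fix u :: real
    show "(\<integral>\<^sup>+v. ?g s u * (?g s' v * ?p (u + v) \<rho>) \<partial>lborel) = (\<integral>\<^sup>+w. ?g s u * (?g s' (w - u) * ?p w \<rho>) \<partial>lborel)"
      by (subst nn_integral_real_affine[where c = 1 and t = "- u"]) (auto simp: algebra_simps)
  qed
  also have "\<dots> = (\<integral>\<^sup>+w. \<integral>\<^sup>+u. ?g s u * (?g s' (w - u) * ?p w \<rho>) \<partial>lborel \<partial>lborel)"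
    by (rule lborel_pair.Fubini') measurable
  also have "\<dots> = (\<integral>\<^sup>+w. ?g (s + s') w * ?p w \<rho> \<partial>lborel)"
  proof (intro nn_integral_cong)
    fix w :: real
    show "(\<integral>\<^sup>+u. ?g s u * (?g s' (w - u) * ?p w \<rho>) \<partial>lborel) = ?g (s + s') w * ?p w \<rho>"
    proof (cases "w > 0")
      case True
      then show ?thesis
        by (subst gamma_density_conv[OF s, symmetric]) (auto simp: mult.assoc nn_integral_multc[symmetric])
    next
      case False
      then have "gamma_density s u = 0 \<or> gamma_density s' (w - u) = 0" for u
        by (auto simp: gamma_density_def)
      then have "?g s u * (?g s' (w - u) * ?p w \<rho>) = 0" for u by (metis ennreal_0 mult_zero_left mult_zero_right)
      then have "(\<lambda>u. ?g s u * (?g s' (w - u) * ?p w \<rho>)) = (\<lambda>u. 0)" by blast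
      then have "(\<integral>\<^sup>+u. ?g s u * (?g s' (w - u) * ?p w \<rho>) \<partial>lborel) = 0" by (simp only: nn_integral_const) simp
      then show ?thesis using False by (simp add: gamma_density_def[of "s + s'"])
    qed
  qed
  finally show ?thesis by (simp add: bessel_enn_def)
qed

text \<open>The Bessel operator on a single orbit, with x the time along it
  (\<open>bop_avg\<close>); this reduces its algebra to functions of one real variable.\<close>

definition bessel_avg :: "real \<Rightarrow> (real \<Rightarrow> complex) \<Rightarrow> real \<Rightarrow> complex" where
  "bessel_avg s F x = (\<integral>r. complex_of_real (bessel_kernel s r) * F (x + r) \<partial>lborel)"

lemma bessel_kernel_nonneg [simp]: "s > 0 \<Longrightarrow> bessel_kernel s r \<ge> 0"
  by (simp add: bessel_kernel_eq)

lemma bessel_kernel_minus: "bessel_kernel s (- r) = bessel_kernel s r"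
  by (simp add: bessel_kernel_def)

lemma bessel_kernel_measurable [measurable]: "s > 0 \<Longrightarrow> bessel_kernel s \<in> borel_measurable borel"
  by (simp add: bessel_kernel_eq cong: measurable_cong)

lemma bessel_enn_finite: "s > 0 \<Longrightarrow> AE r in lborel. ennreal (bessel_kernel s r) = bessel_enn s r"
proof -
  assume s: "s > 0"
  have "AE r in lborel. bessel_enn s r \<noteq> \<infinity>"
    by (rule nn_integral_PInf_AE) (use nn_integral_bessel_enn[OF s] in auto)
  then show ?thesis
    by eventually_elim (simp add: bessel_kernel_eq[OF s] less_top)
qed

lemma nn_integral_bessel_kernel: "s > 0 \<Longrightarrow> (\<integral>\<^sup>+r. ennreal (bessel_kernel s r) \<partial>lborel) = 1"
  using nn_integral_cong_AE[OF bessel_enn_finite] nn_integral_bessel_enn by metis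

lemma integrable_bessel_kernel: "s > 0 \<Longrightarrow> integrable lborel (bessel_kernel s)"
  by (rule integrableI_nonneg) (simp_all add: nn_integral_bessel_kernel)

lemma integral_bessel_kernel: "s > 0 \<Longrightarrow> (\<integral>r. bessel_kernel s r \<partial>lborel) = 1"
  by (subst integral_eq_nn_integral) (simp_all add: nn_integral_bessel_kernel)

lemma bessel_kernel_two: "AE r in lborel. bessel_kernel 2 r = exp (- \<bar>r\<bar>) / 2"
proof -
  have "AE r in lborel. r \<noteq> (0::real)" by (rule AE_lborel_singleton)
  then show ?thesis by eventually_elim (simp add: bessel_kernel_eq bessel_enn_two)
qed

lemma bessel_avg_semigroup:
  assumes s: "s > 0" "s' > 0" and F: "F \<in> borel_measurable borel" "\<And>x. cmod (F x) \<le> M"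
  shows "bessel_avg s (bessel_avg s' F) x = bessel_avg (s + s') F x"
proof -
  let ?G = bessel_kernel
  have [measurable]: "F \<in> borel_measurable borel" "?G s \<in> borel_measurable borel" "?G s' \<in> borel_measurable borel"
    "?G (s + s') \<in> borel_measurable borel"
    using assms by auto
  have M: "M \<ge> 0" using F(2)[of 0] norm_ge_zero order_trans by blast
  \<comment> \<open>F is bounded and both kernels have total mass 1, which is enough for Fubini in
    the variables r and q, where q is the total shift.\<close>
  have int: "integrable (lborel \<Otimes>\<^sub>M lborel)
      (\<lambda>(r, q). complex_of_real (?G s r * ?G s' (q - r)) * F (x + q))"
  proof (rule integrableI_bounded)
    have "(\<integral>\<^sup>+p. ennreal (norm (case p of (r, q) \<Rightarrow> complex_of_real (?G s r * ?G s' (q - r)) * F (x + q))) \<partial>(lborel \<Otimes>\<^sub>M lborel)) \<le>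
      (\<integral>\<^sup>+p. ennreal (?G s (fst p)) * (ennreal (?G s' (snd p - fst p)) * ennreal M) \<partial>(lborel \<Otimes>\<^sub>M lborel))"
    proof (rule nn_integral_mono)
      fix p :: "real \<times> real"
      have "norm (case p of (r, q) \<Rightarrow> complex_of_real (?G s r * ?G s' (q - r)) * F (x + q)) \<le>
          ?G s (fst p) * (?G s' (snd p - fst p) * M)"
        using s F(2) by (auto simp: case_prod_beta norm_mult mult.assoc intro!: mult_left_mono)
      then show "ennreal (norm (case p of (r, q) \<Rightarrow> complex_of_real (?G s r * ?G s' (q - r)) * F (x + q))) \<le>
          ennreal (?G s (fst p)) * (ennreal (?G s' (snd p - fst p)) * ennreal M)"
        using s M by (simp add: ennreal_mult[symmetric] ennreal_leI)
    qed
    also have "\<dots> = (\<integral>\<^sup>+r. \<integral>\<^sup>+q. ennreal (?G s r) * (ennreal (?G s' (q - r)) * ennreal M) \<partial>lborel \<partial>lborel)"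
      by (subst lborel.nn_integral_fst[symmetric]) auto
    also have "\<dots> = (\<integral>\<^sup>+r. ennreal (?G s r) * ennreal M \<partial>lborel)"
    proof (rule nn_integral_cong)
      fix r :: real
      have "(\<integral>\<^sup>+q. ennreal (?G s' (q - r)) \<partial>lborel) = 1"
        using nn_integral_bessel_kernel[OF s(2)]
        by (subst nn_integral_real_affine[where c = 1 and t = r]) auto
      then show "(\<integral>\<^sup>+q. ennreal (?G s r) * (ennreal (?G s' (q - r)) * ennreal M) \<partial>lborel) = ennreal (?G s r) * ennreal M"
        by (subst nn_integral_cmult, simp, subst nn_integral_multc) auto
    qed
    also have "\<dots> < \<infinity>"
      using nn_integral_bessel_kernel[OF s(1)] by (subst nn_integral_multc) auto
    finally show "(\<integral>\<^sup>+p. ennreal (norm (case p of (r, q) \<Rightarrow> complex_of_real (?G s r * ?G s' (q - r)) * F (x + q))) \<partial>(lborel \<Otimes>\<^sub>M lborel)) < \<infinity>" .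
  qed measurable
  have "bessel_avg s (bessel_avg s' F) x =
      (\<integral>r. \<integral>q. complex_of_real (?G s r * ?G s' (q - r)) * F (x + q) \<partial>lborel \<partial>lborel)"
    unfolding bessel_avg_def
  proof (rule Bochner_Integration.integral_cong[OF refl])
    fix r :: real
    have "(\<integral>t. complex_of_real (?G s' t) * F (x + r + t) \<partial>lborel) =
        (\<integral>q. complex_of_real (?G s' (q - r)) * F (x + q) \<partial>lborel)"
      by (subst lborel_integral_real_affine[where c = 1 and t = "- r"]) (auto simp: algebra_simps)
    then show "complex_of_real (?G s r) * (\<integral>t. complex_of_real (?G s' t) * F (x + r + t) \<partial>lborel) =
        (\<integral>q. complex_of_real (?G s r * ?G s' (q - r)) * F (x + q) \<partial>lborel)"
      by (simp add: mult.assoc flip: integral_mult_right_zero)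
  qed
  also have "\<dots> = (\<integral>q. \<integral>r. complex_of_real (?G s r * ?G s' (q - r)) * F (x + q) \<partial>lborel \<partial>lborel)"
    by (rule lborel_pair.Fubini_integral[OF int, symmetric])
  also have "\<dots> = bessel_avg (s + s') F x"
    unfolding bessel_avg_def
  proof (rule integral_cong_AE)
    show "AE q in lborel. (\<integral>r. complex_of_real (?G s r * ?G s' (q - r)) * F (x + q) \<partial>lborel) =
        complex_of_real (?G (s + s') q) * F (x + q)"
    proof (rule AE_I2)
      fix q :: real
      have "(\<integral>\<^sup>+r. ennreal (?G s r * ?G s' (q - r)) \<partial>lborel) = (\<integral>\<^sup>+r. bessel_enn s r * bessel_enn s' (q - r) \<partial>lborel)"
      proof (rule nn_integral_cong_AE)
        have "AE r in lborel. ennreal (?G s' (q - r)) = bessel_enn s' (q - r)"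
          using AE_borel_affine[of "-1" "\<lambda>r. ennreal (?G s' r) = bessel_enn s' r" q] bessel_enn_finite[OF s(2)] s by simp
        with bessel_enn_finite[OF s(1)]
        show "AE r in lborel. ennreal (?G s r * ?G s' (q - r)) = bessel_enn s r * bessel_enn s' (q - r)"
          by eventually_elim (use s in \<open>simp add: ennreal_mult\<close>)
      qed
      also have "\<dots> = bessel_enn (s + s') q" by (rule bessel_enn_conv[OF s])
      finally have "(\<integral>r. ?G s r * ?G s' (q - r) \<partial>lborel) = ?G (s + s') q"
        using s by (subst integral_eq_nn_integral) (auto simp: bessel_kernel_eq[of "s + s'"])
      moreover have "(\<integral>r. complex_of_real (?G s r * ?G s' (q - r)) * F (x + q) \<partial>lborel) =
          complex_of_real (\<integral>r. ?G s r * ?G s' (q - r) \<partial>lborel) * F (x + q)"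
        by (simp only: integral_mult_left_zero integral_complex_of_real)
      ultimately show "(\<integral>r. complex_of_real (?G s r * ?G s' (q - r)) * F (x + q) \<partial>lborel) =
          complex_of_real (?G (s + s') q) * F (x + q)" by simp
    qed
  qed measurable
  finally show ?thesis .
qed

text \<open>The kernel exp (- |r|) / 2 is the Green function of 1 - d^2/dr^2. On the two half lines
  the integrand has the primitives - exp (- r) (\<phi> + \<phi>') / 2 and exp r (\<phi> - \<phi>') /
  2, taken at x + r; compact support kills the outer boundary terms, and the two contributions at r
  = 0 add up to \<phi> x.\<close>

lemma bessel_avg_resolvent:
  assumes d1: "\<And>x. (\<phi> has_vector_derivative \<phi>' x) (at x)"
    and d2: "\<And>x. (\<phi>' has_vector_derivative \<phi>'' x) (at x)"
    and cont: "continuous_on UNIV \<phi>''"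
    and supp: "\<And>x. \<bar>x\<bar> > R \<Longrightarrow> \<phi> x = 0"
  shows "bessel_avg 2 (\<lambda>r. \<phi> r - \<phi>'' r) x = \<phi> x"
proof -
  \<comment> \<open>For |r| \<ge> B the point x + r lies outside [- R, R].\<close>
  define B where "B = \<bar>R\<bar> + \<bar>x\<bar> + 1"
  have far: "open {y. \<bar>y\<bar> > R}" by (intro open_Collect_less continuous_intros)
  have z1: "\<phi>' y = 0" if "\<bar>y\<bar> > R" for y
    using that supp by (intro vector_derivative_unique_at[OF d1]
      has_vector_derivative_transform_within_open[OF has_vector_derivative_const[of 0] far]) auto
  have z2: "\<phi>'' y = 0" if "\<bar>y\<bar> > R" for y
    using that z1 by (intro vector_derivative_unique_at[OF d2]
      has_vector_derivative_transform_within_open[OF has_vector_derivative_const[of 0] far]) auto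
  let ?\<psi> = "\<lambda>r. (exp (- \<bar>r\<bar>) / 2) *\<^sub>R (\<phi> (x + r) - \<phi>'' (x + r))"
  have dx: "((\<lambda>r. x + r) has_vector_derivative 1) (at r)" for r
    unfolding has_real_derivative_iff_has_vector_derivative[symmetric] by (auto intro!: derivative_eq_intros)
  have sh1: "((\<lambda>r. \<phi> (x + r)) has_vector_derivative \<phi>' (x + r)) (at r within S)" for r S
    by (rule has_vector_derivative_at_within) (use vector_diff_chain_at[OF dx d1, of r] in \<open>simp add: o_def\<close>)
  have sh2: "((\<lambda>r. \<phi>' (x + r)) has_vector_derivative \<phi>'' (x + r)) (at r within S)" for r S
    by (rule has_vector_derivative_at_within) (use vector_diff_chain_at[OF dx d2, of r] in \<open>simp add: o_def\<close>)
  have B: "B > 0" "\<bar>x + B\<bar> > R" "\<bar>x - B\<bar> > R" by (auto simp: B_def)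
  have I1: "(?\<psi> has_integral ((- (exp (- B) / 2)) *\<^sub>R (\<phi> (x + B) + \<phi>' (x + B)) - (- (exp (- 0) / 2)) *\<^sub>R (\<phi> (x + 0) + \<phi>' (x + 0)))) {0..B}"
  proof (rule fundamental_theorem_of_calculus)
    fix r assume r: "r \<in> {0..B}"
    show "((\<lambda>r. (- (exp (- r) / 2)) *\<^sub>R (\<phi> (x + r) + \<phi>' (x + r))) has_vector_derivative ?\<psi> r) (at r within {0..B})"
    proof (rule has_vector_derivative_eq_rhs[OF has_vector_derivative_scaleR[OF _ has_vector_derivative_add[OF sh1 sh2]]])
      show "((\<lambda>r. - (exp (- r) / 2)) has_real_derivative exp (- r) / 2) (at r within {0..B})"
        by (auto intro!: derivative_eq_intros)
    qed (use r in \<open>simp add: algebra_simps\<close>)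
  qed (use B in simp)
  have I2: "(?\<psi> has_integral ((exp 0 / 2) *\<^sub>R (\<phi> (x + 0) - \<phi>' (x + 0)) - (exp (- B) / 2) *\<^sub>R (\<phi> (x + - B) - \<phi>' (x + - B)))) {- B..0}"
  proof (rule fundamental_theorem_of_calculus)
    fix r assume r: "r \<in> {- B..0}"
    show "((\<lambda>r. (exp r / 2) *\<^sub>R (\<phi> (x + r) - \<phi>' (x + r))) has_vector_derivative ?\<psi> r) (at r within {- B..0})"
    proof (rule has_vector_derivative_eq_rhs[OF has_vector_derivative_scaleR[OF _ has_vector_derivative_diff[OF sh1 sh2]]])
      show "((\<lambda>r. exp r / 2) has_real_derivative exp r / 2) (at r within {- B..0})"
        by (auto intro!: derivative_eq_intros)
    qed (use r in \<open>simp add: algebra_simps\<close>)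
  qed (use B in simp)
  have "(?\<psi> has_integral \<phi> x) {- B..B}"
  proof (rule has_integral_eq_rhs[OF has_integral_combine[OF _ _ I2 I1]])
    have [simp]: "\<phi> (B + x) = 0" "\<phi>' (B + x) = 0" "\<phi> (x + B) = 0" "\<phi>' (x + B) = 0" "\<phi> (x - B) = 0" "\<phi>' (x - B) = 0"
      using B supp z1 by (auto simp: add.commute)
    show "\<phi> x = (exp 0 / 2) *\<^sub>R (\<phi> (x + 0) - \<phi>' (x + 0)) - (exp (- B) / 2) *\<^sub>R (\<phi> (x + - B) - \<phi>' (x + - B)) +
      ((- (exp (- B) / 2)) *\<^sub>R (\<phi> (x + B) + \<phi>' (x + B)) - (- (exp (- 0) / 2)) *\<^sub>R (\<phi> (x + 0) + \<phi>' (x + 0)))"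
      by (simp add: scaleR_conv_of_real field_simps)
  qed (use B in auto)
  have out: "\<phi> (x + r) = 0 \<and> \<phi>'' (x + r) = 0" if "\<not> (- B \<le> r \<and> r \<le> B)" for r
    using that supp[of "x + r"] z2[of "x + r"] by (auto simp: B_def)
  have "(?\<psi> has_integral \<phi> x) {- B..B}" by fact
  then have HK: "(?\<psi> has_integral \<phi> x) UNIV"
    by (rule has_integral_on_superset) (use out in auto)
  have c\<phi>: "continuous_on UNIV \<phi>"
    using d1 by (meson continuous_at_imp_continuous_on has_vector_derivative_continuous)
  have "continuous_on {- B..B} ?\<psi>"
    by (intro continuous_intros continuous_on_compose2[OF cont] continuous_on_compose2[OF c\<phi>]) auto
  then have "integrable lborel (\<lambda>r. indicator {- B..B} r *\<^sub>R ?\<psi> r)"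
    by (intro borel_integrable_compact) auto
  moreover have "(\<lambda>r. indicator {- B..B} r *\<^sub>R ?\<psi> r) = ?\<psi>"
  proof
    show "indicator {- B..B} r *\<^sub>R ?\<psi> r = ?\<psi> r" for r
      by (cases "- B \<le> r \<and> r \<le> B") (simp_all add: out indicator_def)
  qed
  ultimately have "integrable lborel ?\<psi>" by simp
  then have eq: "(\<integral>r. ?\<psi> r \<partial>lborel) = \<phi> x"
    using has_integral_integral_lborel HK has_integral_unique by blast
  have [measurable]: "\<phi> \<in> borel_measurable borel" "\<phi>'' \<in> borel_measurable borel"
    using c\<phi> cont by (auto intro: borel_measurable_continuous_onI)
  have "bessel_avg 2 (\<lambda>r. \<phi> r - \<phi>'' r) x = (\<integral>r. ?\<psi> r \<partial>lborel)"
    unfolding bessel_avg_def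
  proof (rule integral_cong_AE)
    show "AE r in lborel. complex_of_real (bessel_kernel 2 r) * (\<phi> (x + r) - \<phi>'' (x + r)) = ?\<psi> r"
    proof (use bessel_kernel_two in eventually_elim)
      fix r :: real assume "bessel_kernel 2 r = exp (- \<bar>r\<bar>) / 2"
      then show "complex_of_real (bessel_kernel 2 r) * (\<phi> (x + r) - \<phi>'' (x + r)) = ?\<psi> r"
        by (simp only: scaleR_conv_of_real)
    qed
  qed measurable
  with eq show ?thesis by simp
qed

section \<open>The Bessel operator along a root vector\<close>

text \<open>The orbit exp (- r a) x for a = \<beta> E_ji. Only x_j moves, with velocity - \<beta>
  x_i, and x_i is constant, so the annulus of |x_i| is invariant.\<close>

definition flow :: "'n::finite \<Rightarrow> 'n \<Rightarrow> real \<Rightarrow> real \<Rightarrow> real^'n \<Rightarrow> real^'n" where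
  "flow i j \<beta> r x = shear i j (- (r * \<beta>)) x"

definition bop :: "'n::finite \<Rightarrow> 'n \<Rightarrow> real \<Rightarrow> real \<Rightarrow> (real^'n \<Rightarrow> complex) \<Rightarrow> real^'n \<Rightarrow> complex" where
  "bop i j \<beta> s h x = (\<integral>r. complex_of_real (bessel_kernel s r) * h (flow i j \<beta> r x) \<partial>lborel)"

lemma mexp_flow: "i \<noteq> j \<Longrightarrow> mexp (- (r *\<^sub>R (\<beta> *\<^sub>R eunit j i))) *v x = flow i j \<beta> r x"
  using mexp_nilpotent[of j i "- (r * \<beta>)" x] by (simp add: flow_def shear_def)

lemma bessel_op_bop: "i \<noteq> j \<Longrightarrow> bessel_op s (\<beta> *\<^sub>R eunit j i) h = bop i j \<beta> s h"
  by (rule ext) (simp only: bessel_op_def bop_def pi_exp_def mexp_flow not_False_eq_True)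

lemma flow_flow: "i \<noteq> j \<Longrightarrow> flow i j \<beta> r (flow i j \<beta> q x) = flow i j \<beta> (q + r) x"
  by (simp add: flow_def shear_shear algebra_simps)

lemma flow_0 [simp]: "flow i j \<beta> 0 x = x" by (simp add: flow_def)

lemma flow_coordinate: "i \<noteq> j \<Longrightarrow> flow i j \<beta> r x $ i = x $ i"
  by (simp add: flow_def shear_nth)

lemma flow_zero_iff: "i \<noteq> j \<Longrightarrow> flow i j \<beta> r x = 0 \<longleftrightarrow> x = 0"
proof -
  assume "i \<noteq> j"
  then have "flow i j \<beta> (- r) (flow i j \<beta> r x) = x" by (simp add: flow_flow)
  moreover have "flow i j \<beta> q 0 = 0" for q by (simp add: flow_def shear_def)
  ultimately show ?thesis by metis
qed

lemma flow_scale: "flow i j \<beta> r (c *\<^sub>R x) = c *\<^sub>R flow i j \<beta> r x"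
  by (simp add: flow_def shear_def algebra_simps)

lemma flow_measurable [measurable]:
  "f \<in> borel_measurable M \<Longrightarrow> g \<in> borel_measurable M \<Longrightarrow> (\<lambda>x. flow i j \<beta> (f x) (g x)) \<in> borel_measurable M"
proof -
  assume [measurable]: "f \<in> borel_measurable M" "g \<in> borel_measurable M"
  show ?thesis unfolding flow_def by measurable
qed

lemma bop_avg: "i \<noteq> j \<Longrightarrow> bop i j \<beta> s h (flow i j \<beta> q x) = bessel_avg s (\<lambda>r. h (flow i j \<beta> r x)) q"
  by (simp add: bop_def bessel_avg_def flow_flow)

text \<open>x_j runs linearly in r while x_i is fixed. On the support of slot i the ratio x_i / x_j
  is at least c, which confines |x_j| to at most |x_i| / c and hence r to a bounded
  interval.\<close>

lemma V_flow_support: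
  assumes "f \<in> V pm t i j" "i \<noteq> j" "\<beta> \<noteq> 0" "x $ i \<noteq> 0"
  shows "\<exists>R. \<forall>r. \<bar>r\<bar> > R \<longrightarrow> f (flow i j \<beta> r x) = 0"
  using assms(1)
proof (induction rule: V.induct)
  case (sec \<Phi>)
  then obtain c R where c: "c > 0" "\<And>y. \<Phi> i y \<noteq> 0 \<Longrightarrow> c \<le> y" by (auto simp: slots_def test_pos_def)
  have "\<bar>r\<bar> \<le> (\<bar>x $ j\<bar> + \<bar>x $ i\<bar> / c) / (\<bar>\<beta>\<bar> * \<bar>x $ i\<bar>)" if nz: "sec pm t j \<Phi> (flow i j \<beta> r x) \<noteq> 0" for r
  proof -
    let ?y = "flow i j \<beta> r x"
    have yj: "?y $ j \<noteq> 0" "?y $ j = x $ j - r * \<beta> * x $ i"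
      using nz by (auto simp: sec_def flow_def shear_nth)
    have "(\<Prod>a\<in>UNIV - {j}. \<Phi> a (?y $ a / ?y $ j)) \<noteq> 0"
      using nz unfolding sec_def by (metis mult_zero_right)
    then have "\<forall>a\<in>UNIV - {j}. \<Phi> a (?y $ a / ?y $ j) \<noteq> 0" by simp
    then have "\<Phi> i (?y $ i / ?y $ j) \<noteq> 0"
      using assms(2) by auto
    then have "c \<le> \<bar>x $ i / ?y $ j\<bar>" using c(2) flow_coordinate[OF assms(2)] by (metis abs_ge_self order_trans)
    then have "c * \<bar>?y $ j\<bar> \<le> \<bar>x $ i\<bar>" using yj(1) by (simp add: abs_divide field_simps)
    then have "\<bar>x $ j - r * \<beta> * x $ i\<bar> \<le> \<bar>x $ i\<bar> / c" unfolding yj(2) using c(1) by (simp add: field_simps)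
    then have "\<bar>r * \<beta> * x $ i\<bar> \<le> \<bar>x $ j\<bar> + \<bar>x $ i\<bar> / c" by linarith
    then show ?thesis using assms(3,4) by (simp add: abs_mult field_simps)
  qed
  then show ?case by (intro exI[of _ "(\<bar>x $ j\<bar> + \<bar>x $ i\<bar> / c) / (\<bar>\<beta>\<bar> * \<bar>x $ i\<bar>)"]) force
next
  case (add f g)
  then obtain R S where "\<And>r. \<bar>r\<bar> > R \<Longrightarrow> f (flow i j \<beta> r x) = 0" "\<And>r. \<bar>r\<bar> > S \<Longrightarrow> g (flow i j \<beta> r x) = 0" by blast
  then show ?case by (intro exI[of _ "max R S"]) auto
qed auto

lemma V_flow_deriv:
  assumes "f \<in> V pm t i j" "i \<noteq> j" "x \<noteq> 0"
  shows "((\<lambda>r. f (flow i j \<beta> r x)) has_vector_derivative LY (\<beta> *\<^sub>R eunit j i) f (flow i j \<beta> r x)) (at r)"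
  using V_curve_deriv[OF assms(1), of r "\<beta> *\<^sub>R eunit j i" x] assms(2,3)
  by (simp only: mexp_flow flow_zero_iff not_False_eq_True simp_thms)

lemma V_flow_continuous:
  assumes "f \<in> V pm t i j" "i \<noteq> j" "x \<noteq> 0"
  shows "continuous_on UNIV (\<lambda>r. f (flow i j \<beta> r x))"
  using V_flow_deriv[OF assms] by (meson continuous_at_imp_continuous_on has_vector_derivative_continuous)

lemma V_flow_bounded:
  assumes "f \<in> V pm t i j" "i \<noteq> j" "\<beta> \<noteq> 0"
  shows "\<exists>M. \<forall>r. cmod (f (flow i j \<beta> r x)) \<le> M"
proof (cases "x $ i = 0")
  case True
  then have "f (flow i j \<beta> r x) = 0" for r
    using V_coordinate_zero[OF assms(1,2)] flow_coordinate[OF assms(2)] by metis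
  then show ?thesis by (intro exI[of _ 0]) simp
next
  case False
  then have x: "x \<noteq> 0" by auto
  obtain R where R: "\<And>r. \<bar>r\<bar> > R \<Longrightarrow> f (flow i j \<beta> r x) = 0" using V_flow_support[OF assms False] by blast
  have "compact ((\<lambda>r. f (flow i j \<beta> r x)) ` {-\<bar>R\<bar>..\<bar>R\<bar>})"
    by (intro compact_continuous_image continuous_on_subset[OF V_flow_continuous[OF assms(1,2) x]]) auto
  then have "bounded ((\<lambda>r. f (flow i j \<beta> r x)) ` {-\<bar>R\<bar>..\<bar>R\<bar>})" by (rule compact_imp_bounded)
  then obtain M where M: "M > 0" "\<And>r. r \<in> {-\<bar>R\<bar>..\<bar>R\<bar>} \<Longrightarrow> cmod (f (flow i j \<beta> r x)) \<le> M"
    by (auto simp: bounded_pos)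
  have "cmod (f (flow i j \<beta> r x)) \<le> M" for r
  proof (cases "\<bar>r\<bar> > R")
    case False
    then have "r \<in> {-\<bar>R\<bar>..\<bar>R\<bar>}" by auto
    then show ?thesis by (rule M(2))
  qed (use R M in simp)
  then show ?thesis by blast
qed

text \<open>Valid at every point, because f is bounded on each orbit; the exact identity lets Bessel
  operators be composed without passing to classes of functions.\<close>

lemma bop_semigroup:
  assumes "f \<in> V pm t i j" "i \<noteq> j" "\<beta> \<noteq> 0" "s > 0" "s' > 0"
  shows "bop i j \<beta> s (bop i j \<beta> s' f) x = bop i j \<beta> (s + s') f x"
proof -
  obtain M where M: "\<And>r. cmod (f (flow i j \<beta> r x)) \<le> M" using V_flow_bounded[OF assms(1-3)] by blast
  have m: "(\<lambda>r. f (flow i j \<beta> r x)) \<in> borel_measurable borel"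
    using V_measurable[OF assms(1)] by measurable
  have "bop i j \<beta> s (bop i j \<beta> s' f) x = bessel_avg s (\<lambda>r. bop i j \<beta> s' f (flow i j \<beta> r x)) 0"
    using bop_avg[OF assms(2), of \<beta> s "bop i j \<beta> s' f" 0 x] by simp
  also have "\<dots> = bessel_avg s (bessel_avg s' (\<lambda>r. f (flow i j \<beta> r x))) 0"
    unfolding bop_avg[OF assms(2)] ..
  also have "\<dots> = bessel_avg (s + s') (\<lambda>r. f (flow i j \<beta> r x)) 0"
    by (rule bessel_avg_semigroup[OF assms(4,5) m M])
  also have "\<dots> = bop i j \<beta> (s + s') f x"
    using bop_avg[OF assms(2), of \<beta> "s + s'" f 0 x] by simp
  finally show ?thesis .
qed

text \<open>The operator I - a^2 on smooth sections; by \<open>bop_resolv\<close> it is undone by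
  \<open>bop i j \<beta> 2\<close>.\<close>

definition resolv :: "'n::finite mat \<Rightarrow> (real^'n \<Rightarrow> complex) \<Rightarrow> real^'n \<Rightarrow> complex" where
  "resolv a f x = f x - LY a (LY a f) x"

lemma V_resolv: "i \<noteq> j \<Longrightarrow> f \<in> V pm t i j \<Longrightarrow> resolv a f \<in> V pm t i j"
  unfolding resolv_def[abs_def] by (intro V_diff V_LY)

lemma V_resolv_pow: "i \<noteq> j \<Longrightarrow> f \<in> V pm t i j \<Longrightarrow> (resolv a ^^ m) f \<in> V pm t i j"
  by (induction m) (auto intro: V_resolv)

lemma bop_resolv:
  assumes f: "f \<in> V pm t i j" and ij: "i \<noteq> j" and \<beta>: "\<beta> \<noteq> 0"
  shows "bop i j \<beta> 2 (resolv (\<beta> *\<^sub>R eunit j i) f) x = f x"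
proof (cases "x $ i = 0")
  case True
  have "h (flow i j \<beta> r x) = 0" if "h \<in> V pm t i j" for h r
    using V_coordinate_zero[OF that ij] flow_coordinate[OF ij] True by metis
  from this[OF V_resolv[OF ij f]] this[OF f, of 0] show ?thesis by (simp add: bop_def)
next
  case False
  then have x: "x \<noteq> 0" by auto
  let ?a = "\<beta> *\<^sub>R eunit j i"
  obtain R where R: "\<And>r. \<bar>r\<bar> > R \<Longrightarrow> f (flow i j \<beta> r x) = 0" using V_flow_support[OF f ij \<beta> False] by blast
  have "bop i j \<beta> 2 (resolv ?a f) x = bessel_avg 2 (\<lambda>r. resolv ?a f (flow i j \<beta> r x)) 0"
    using bop_avg[OF ij, of \<beta> 2 "resolv ?a f" 0 x] by simp
  also have "\<dots> = f (flow i j \<beta> 0 x)"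
    unfolding resolv_def
    by (rule bessel_avg_resolvent[OF V_flow_deriv[OF f ij x] V_flow_deriv[OF V_LY[OF ij f] ij x]
          V_flow_continuous[OF V_LY[OF ij V_LY[OF ij f]] ij x] R])
  finally show ?thesis by simp
qed

lemma bop_resolv_pow:
  assumes f: "f \<in> V pm t i j" and ij: "i \<noteq> j" and \<beta>: "\<beta> \<noteq> 0"
  shows "bop i j \<beta> (2 * real (Suc m)) ((resolv (\<beta> *\<^sub>R eunit j i) ^^ Suc m) f) = f"
proof (induction m)
  case 0
  then show ?case by (simp add: fun_eq_iff bop_resolv[OF f ij \<beta>])
next
  case (Suc m)
  let ?R = "resolv (\<beta> *\<^sub>R eunit j i)"
  have "bop i j \<beta> (2 * real (Suc (Suc m))) ((?R ^^ Suc (Suc m)) f) = bop i j \<beta> (2 * real (Suc m)) (bop i j \<beta> 2 ((?R ^^ Suc (Suc m)) f))"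
  proof
    fix x
    have "2 * real (Suc m) + 2 = 2 * real (Suc (Suc m))" by simp
    then show "bop i j \<beta> (2 * real (Suc (Suc m))) ((?R ^^ Suc (Suc m)) f) x =
        bop i j \<beta> (2 * real (Suc m)) (bop i j \<beta> 2 ((?R ^^ Suc (Suc m)) f)) x"
      using bop_semigroup[OF V_resolv_pow[OF ij f] ij \<beta>, of "2 * real (Suc m)" 2] by (metis of_nat_0_less_iff zero_less_Suc zero_less_mult_iff zero_less_numeral)
  qed
  also have "bop i j \<beta> 2 ((?R ^^ Suc (Suc m)) f) = (?R ^^ Suc m) f"
    unfolding funpow.simps(2)[of "Suc m"] o_apply by (rule ext) (rule bop_resolv[OF V_resolv_pow[OF ij f] ij \<beta>])
  finally show ?case using Suc by simp
qed

text \<open>Jensen for the probability density \<open>bessel_kernel s\<close>: the variance of |g|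
  under it is nonnegative. If the right side is infinite there is nothing to show.\<close>

lemma norm_square_integral_le:
  assumes s: "s > 0" and g: "g \<in> borel_measurable borel"
  shows "ennreal ((cmod (\<integral>r. complex_of_real (bessel_kernel s r) * g r \<partial>lborel))\<^sup>2) \<le>
     (\<integral>\<^sup>+r. ennreal (bessel_kernel s r) * ennreal ((cmod (g r))\<^sup>2) \<partial>lborel)"
proof -
  let ?G = "bessel_kernel s"
  have [measurable]: "g \<in> borel_measurable borel" "?G \<in> borel_measurable borel" using assms by auto
  have G: "?G r \<ge> 0" for r using s by simp
  show ?thesis
  proof (cases "(\<integral>\<^sup>+r. ennreal (?G r) * ennreal ((cmod (g r))\<^sup>2) \<partial>lborel) = \<infinity>")
    case False
    have i2: "integrable lborel (\<lambda>r. ?G r * (cmod (g r))\<^sup>2)"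
      by (rule integrableI_nonneg) (use False G in \<open>auto simp: ennreal_mult less_top\<close>)
    have i0: "integrable lborel ?G" by (rule integrable_bessel_kernel[OF s])
    have i1: "integrable lborel (\<lambda>r. ?G r * cmod (g r))"
    proof (rule Bochner_Integration.integrable_bound)
      show "integrable lborel (\<lambda>r. ?G r + ?G r * (cmod (g r))\<^sup>2)" using i0 i2 by simp
      have y: "y \<le> 1 + y\<^sup>2" if "y \<ge> 0" for y :: real
        using that zero_le_power2[of "y - 1"] by (simp add: power2_diff)
      have "norm (?G r * cmod (g r)) \<le> norm (?G r + ?G r * (cmod (g r))\<^sup>2)" for r
      proof -
        have "?G r * cmod (g r) \<le> ?G r * (1 + (cmod (g r))\<^sup>2)"
          by (intro mult_left_mono y G norm_ge_zero)
        moreover have "0 \<le> ?G r * cmod (g r)" using G[of r] by simp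
        ultimately show ?thesis unfolding real_norm_def by (simp add: distrib_left)
      qed
      then show "AE r in lborel. norm (?G r * cmod (g r)) \<le> norm (?G r + ?G r * (cmod (g r))\<^sup>2)"
        by (intro AE_I2)
    qed measurable
    define m where "m = (\<integral>r. ?G r * cmod (g r) \<partial>lborel)"
    have "cmod (\<integral>r. complex_of_real (?G r) * g r \<partial>lborel) \<le> (\<integral>r. norm (complex_of_real (?G r) * g r) \<partial>lborel)"
      by (rule integral_norm_bound)
    also have "\<dots> = m" using G by (simp add: m_def norm_mult)
    finally have 1: "cmod (\<integral>r. complex_of_real (?G r) * g r \<partial>lborel) \<le> m" .
    have "0 \<le> (\<integral>r. ?G r * (cmod (g r) - m)\<^sup>2 \<partial>lborel)" using G by (intro Bochner_Integration.integral_nonneg) auto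
    also have "(\<lambda>r. ?G r * (cmod (g r) - m)\<^sup>2) = (\<lambda>r. ?G r * (cmod (g r))\<^sup>2 + (m\<^sup>2 * ?G r - 2 * m * (?G r * cmod (g r))))"
      by (simp add: fun_eq_iff power2_diff algebra_simps)
    also have "(\<integral>r. ?G r * (cmod (g r))\<^sup>2 + (m\<^sup>2 * ?G r - 2 * m * (?G r * cmod (g r))) \<partial>lborel) =
        (\<integral>r. ?G r * (cmod (g r))\<^sup>2 \<partial>lborel) - m\<^sup>2"
      using i0 i1 i2 by (simp add: integral_bessel_kernel[OF s] m_def[symmetric] power2_eq_square)
    finally have "m\<^sup>2 \<le> (\<integral>r. ?G r * (cmod (g r))\<^sup>2 \<partial>lborel)" by simp
    then have "(cmod (\<integral>r. complex_of_real (?G r) * g r \<partial>lborel))\<^sup>2 \<le> (\<integral>r. ?G r * (cmod (g r))\<^sup>2 \<partial>lborel)"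
      using power_mono[OF 1, of 2] by simp
    then have "ennreal ((cmod (\<integral>r. complex_of_real (?G r) * g r \<partial>lborel))\<^sup>2) \<le> (\<integral>\<^sup>+r. ennreal (?G r * (cmod (g r))\<^sup>2) \<partial>lborel)"
      using G by (subst nn_integral_eq_integral[OF i2]) (auto intro: ennreal_leI)
    then show ?thesis using G by (simp add: ennreal_mult)
  qed simp
qed

lemma bop_measurable [measurable]:
  assumes "s > 0" "h \<in> borel_measurable borel"
  shows "bop i j \<beta> s h \<in> borel_measurable borel"
proof -
  have [measurable]: "h \<in> borel_measurable borel" "bessel_kernel s \<in> borel_measurable borel" using assms by auto
  show ?thesis unfolding bop_def[abs_def] by measurable
qed

lemma annulus_flow: "i \<noteq> j \<Longrightarrow> indicator (annulus (\<lambda>x. \<bar>x $ i\<bar>)) (flow i j \<beta> r x) = indicator (annulus (\<lambda>x. \<bar>x $ i\<bar>)) x"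
  by (simp add: indicator_def annulus_def flow_coordinate)

text \<open>A contraction because each shift along the flow is an isometry: it preserves Lebesgue
  measure and the annulus of |x_i|, on which the norm can be computed. Jensen and Tonelli then
  average over the shifts.\<close>

lemma bop_ind_space:
  assumes h: "h \<in> ind_space pm t" and ij: "i \<noteq> j" and s: "s > 0"
  shows "bop i j \<beta> s h \<in> ind_space pm t \<and> hnorm2 (bop i j \<beta> s h) \<le> hnorm2 h"
proof -
  let ?G = "bessel_kernel s" and ?A = "annulus (\<lambda>x :: real^'a. \<bar>x $ i\<bar>)"
  let ?B = "bop i j \<beta> s h"
  have [measurable]: "h \<in> borel_measurable borel" "?G \<in> borel_measurable borel" "?A \<in> sets borel"
    using h s annulus_measurable[OF radial_coordinate] by (auto simp: ind_space_def)
  have hom: "?B (c *\<^sub>R x) = complex_of_real (eps_sign pm c * \<bar>c\<bar> powr (- real CARD('a) / 2)) * cis (- t * ln \<bar>c\<bar>) * ?B x"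
    if "c \<noteq> 0" "x \<noteq> 0" for c x
  proof -
    let ?k = "complex_of_real (eps_sign pm c * \<bar>c\<bar> powr (- real CARD('a) / 2)) * cis (- t * ln \<bar>c\<bar>)"
    have "h (flow i j \<beta> r (c *\<^sub>R x)) = ?k * h (flow i j \<beta> r x)" for r
      using h that flow_zero_iff[OF ij] unfolding flow_scale ind_space_def by blast
    then have "?B (c *\<^sub>R x) = (\<integral>r. ?k * (complex_of_real (?G r) * h (flow i j \<beta> r x)) \<partial>lborel)"
      unfolding bop_def by (simp only: mult.left_commute)
    then show ?thesis unfolding bop_def by (simp only: integral_mult_right_zero)
  qed
  have m: "?B \<in> borel_measurable borel" using s by measurable
  have hh: "half_hom ?B"
    unfolding half_hom_def using m hom by (auto simp: norm_mult eps_sign_def)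
  have "hnorm2 ?B = (\<integral>\<^sup>+x. ennreal ((cmod (?B x))\<^sup>2) * indicator ?A x \<partial>lborel)"
    by (rule hnorm2_annulus[OF hh radial_coordinate])
  also have "\<dots> \<le> (\<integral>\<^sup>+x. (\<integral>\<^sup>+r. ennreal (?G r) * ennreal ((cmod (h (flow i j \<beta> r x)))\<^sup>2) \<partial>lborel) * indicator ?A x \<partial>lborel)"
  proof (intro nn_integral_mono mult_right_mono)
    show "ennreal ((cmod (?B x))\<^sup>2) \<le> (\<integral>\<^sup>+r. ennreal (?G r) * ennreal ((cmod (h (flow i j \<beta> r x)))\<^sup>2) \<partial>lborel)" for x
      unfolding bop_def by (rule norm_square_integral_le[OF s]) measurable
  qed simp
  also have "\<dots> = (\<integral>\<^sup>+x. \<integral>\<^sup>+r. ennreal (?G r) * (ennreal ((cmod (h (flow i j \<beta> r x)))\<^sup>2) * indicator ?A (flow i j \<beta> r x)) \<partial>lborel \<partial>lborel)"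
    unfolding annulus_flow[OF ij] by (subst nn_integral_multc[symmetric]) (auto simp: mult.assoc)
  also have "\<dots> = (\<integral>\<^sup>+r. \<integral>\<^sup>+x. ennreal (?G r) * (ennreal ((cmod (h (flow i j \<beta> r x)))\<^sup>2) * indicator ?A (flow i j \<beta> r x)) \<partial>lborel \<partial>lborel)"
    by (rule lborel_pair.Fubini') measurable
  also have "\<dots> = (\<integral>\<^sup>+r. ennreal (?G r) * hnorm2 h \<partial>lborel)"
  proof (rule nn_integral_cong)
    fix r
    have "(\<integral>\<^sup>+x. ennreal ((cmod (h (flow i j \<beta> r x)))\<^sup>2) * indicator ?A (flow i j \<beta> r x) \<partial>lborel) =
        (\<integral>\<^sup>+x. ennreal ((cmod (h x))\<^sup>2) * indicator ?A x \<partial>lborel)"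
      unfolding flow_def
      by (rule nn_integral_shear[OF ij, of "\<lambda>x. ennreal ((cmod (h x))\<^sup>2) * indicator ?A x"]) measurable
    also have "\<dots> = hnorm2 h" by (rule hnorm2_annulus[OF ind_space_half_hom[OF h] radial_coordinate, symmetric])
    finally show "(\<integral>\<^sup>+x. ennreal (?G r) * (ennreal ((cmod (h (flow i j \<beta> r x)))\<^sup>2) * indicator ?A (flow i j \<beta> r x)) \<partial>lborel) = ennreal (?G r) * hnorm2 h"
      by (subst nn_integral_cmult) auto
  qed
  also have "\<dots> = hnorm2 h" using nn_integral_bessel_kernel[OF s] by (subst nn_integral_multc) auto
  finally have le: "hnorm2 ?B \<le> hnorm2 h" .
  then have "hnorm2 ?B < \<infinity>" using h unfolding ind_space_def using le_less_trans by blast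
  then show ?thesis using le m hom by (simp add: ind_space_def)
qed

section \<open>Duality and fractional powers\<close>

lemma cnj_measurable [measurable (raw)]: "f \<in> borel_measurable M \<Longrightarrow> (\<lambda>x. cnj (f x)) \<in> borel_measurable M"
  by (rule measurable_compose[OF _ borel_measurable_continuous_onI]) (auto intro: continuous_intros)

definition l2norm :: "(real^'n::finite \<Rightarrow> complex) \<Rightarrow> real" where
  "l2norm f = sqrt (enn2real (hnorm2 f))"

text \<open>The inner product of the representation space, taken on the annulus of |x_i| because
  this domain is invariant under the flow.\<close>

definition pairing :: "'n::finite \<Rightarrow> (real^'n \<Rightarrow> complex) \<Rightarrow> (real^'n \<Rightarrow> complex) \<Rightarrow> complex" where
  "pairing i h k = (\<integral>x. h x * cnj (k x) * indicator (annulus (\<lambda>x. \<bar>x $ i\<bar>)) x \<partial>lborel)"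

lemma l2norm_nonneg [simp]: "l2norm f \<ge> 0" by (simp add: l2norm_def)

lemma ind_space_hnorm2:
  assumes "f \<in> ind_space pm t"
  shows "hnorm2 f = (\<integral>\<^sup>+x. ennreal ((cmod (f x))\<^sup>2) * indicator (annulus (\<lambda>x. \<bar>x $ i\<bar>)) x \<partial>lborel)"
    and "hnorm2 f = ennreal ((l2norm f)\<^sup>2)"
  using hnorm2_annulus[OF ind_space_half_hom[OF assms] radial_coordinate] assms
  by (auto simp: l2norm_def ind_space_def less_top)

lemma l2norm_mono:
  assumes "g \<in> ind_space pm t" "hnorm2 f \<le> hnorm2 g"
  shows "l2norm f \<le> l2norm g"
  using assms by (auto simp: l2norm_def ind_space_def intro!: enn2real_mono)

text \<open>Cauchy-Schwarz from f g \<le> r f^2 / 2 + g^2 / (2 r) with r = b / a; the shifts by e,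
  removed in the limit, keep r defined and positive when a or b is 0.\<close>

lemma nn_integral_mult_le:
  assumes [measurable]: "f \<in> borel_measurable M" "g \<in> borel_measurable M"
    and "a \<ge> 0" "b \<ge> 0"
    and f: "(\<integral>\<^sup>+x. ennreal ((f x)\<^sup>2) \<partial>M) \<le> ennreal (a\<^sup>2)" and g: "(\<integral>\<^sup>+x. ennreal ((g x)\<^sup>2) \<partial>M) \<le> ennreal (b\<^sup>2)"
    and nonneg: "\<And>x. f x \<ge> 0" "\<And>x. g x \<ge> (0::real)"
  shows "(\<integral>\<^sup>+x. ennreal (f x * g x) \<partial>M) \<le> ennreal (a * b)"
proof -
  have main: "(\<integral>\<^sup>+x. ennreal (f x * g x) \<partial>M) \<le> ennreal ((a + e) * (b + e))" if e: "e > 0" for e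
  proof -
    define r where "r = (b + e) / (a + e)"
    have pos: "a + e > 0" "b + e > 0" using assms(3,4) e by auto
    then have r: "r > 0" by (simp add: r_def)
    have "(\<integral>\<^sup>+x. ennreal (f x * g x) \<partial>M) \<le> (\<integral>\<^sup>+x. ennreal (r / 2) * ennreal ((f x)\<^sup>2) + ennreal (1 / (2 * r)) * ennreal ((g x)\<^sup>2) \<partial>M)"
    proof (rule nn_integral_mono)
      fix x
      have "0 \<le> (r * f x - g x)\<^sup>2" by simp
      then have "2 * r * (f x * g x) \<le> r\<^sup>2 * (f x)\<^sup>2 + (g x)\<^sup>2" by (simp add: power2_diff power_mult_distrib)
      then have "f x * g x \<le> (r\<^sup>2 * (f x)\<^sup>2 + (g x)\<^sup>2) / (2 * r)" using r by (simp add: pos_le_divide_eq mult.commute)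
      also have "\<dots> = r / 2 * (f x)\<^sup>2 + 1 / (2 * r) * (g x)\<^sup>2" using r by (simp add: field_simps power2_eq_square)
      finally show "ennreal (f x * g x) \<le> ennreal (r / 2) * ennreal ((f x)\<^sup>2) + ennreal (1 / (2 * r)) * ennreal ((g x)\<^sup>2)"
        using r by (simp add: ennreal_mult'[symmetric] ennreal_plus[symmetric] ennreal_leI del: ennreal_plus)
    qed
    also have "\<dots> = ennreal (r / 2) * (\<integral>\<^sup>+x. ennreal ((f x)\<^sup>2) \<partial>M) + ennreal (1 / (2 * r)) * (\<integral>\<^sup>+x. ennreal ((g x)\<^sup>2) \<partial>M)"
      by (subst nn_integral_add) (auto simp: nn_integral_cmult)
    also have "\<dots> \<le> ennreal (r / 2) * ennreal ((a + e)\<^sup>2) + ennreal (1 / (2 * r)) * ennreal ((b + e)\<^sup>2)"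
    proof (intro add_mono mult_left_mono)
      show "(\<integral>\<^sup>+x. ennreal ((f x)\<^sup>2) \<partial>M) \<le> ennreal ((a + e)\<^sup>2)"
        using e assms(3) by (intro order_trans[OF f] ennreal_leI power_mono) auto
      show "(\<integral>\<^sup>+x. ennreal ((g x)\<^sup>2) \<partial>M) \<le> ennreal ((b + e)\<^sup>2)"
        using e assms(4) by (intro order_trans[OF g] ennreal_leI power_mono) auto
    qed auto
    also have "\<dots> = ennreal (r / 2 * (a + e)\<^sup>2 + 1 / (2 * r) * (b + e)\<^sup>2)"
      using r by (simp add: ennreal_mult'[symmetric] ennreal_plus[symmetric] del: ennreal_plus)
    also have "r / 2 * (a + e)\<^sup>2 + 1 / (2 * r) * (b + e)\<^sup>2 = (a + e) * (b + e)"
    proof -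
      have "B / A / 2 * A\<^sup>2 + 1 / (2 * (B / A)) * B\<^sup>2 = A * B" if "A > 0" "B > 0" for A B :: real
        using that by (simp add: field_simps power2_eq_square)
      from this[OF pos] show ?thesis by (simp only: r_def)
    qed
    finally show ?thesis .
  qed
  have "((\<lambda>e. ennreal ((a + e) * (b + e))) \<longlongrightarrow> ennreal ((a + 0) * (b + 0))) (at_right 0)"
    by (intro tendsto_ennrealI tendsto_intros)
  then have "(\<integral>\<^sup>+x. ennreal (f x * g x) \<partial>M) \<le> ennreal ((a + 0) * (b + 0))"
    by (rule tendsto_lowerbound) (auto simp: eventually_at_right_less intro!: eventually_at_rightI[of 0 1] main)
  then show ?thesis by simp
qed

lemma pairing_nn:
  fixes i :: "'n::finite"
  assumes h: "h \<in> ind_space pm t" and k: "k \<in> ind_space pm t'"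
  shows "(\<integral>\<^sup>+x. ennreal (cmod (h x) * cmod (k x)) * indicator (annulus (\<lambda>x. \<bar>x $ i\<bar>)) x \<partial>lborel) \<le> ennreal (l2norm h * l2norm k)"
proof -
  let ?A = "annulus (\<lambda>x :: real^'n. \<bar>x $ i\<bar>)"
  have [measurable]: "h \<in> borel_measurable borel" "k \<in> borel_measurable borel" "?A \<in> sets borel"
    using h k annulus_measurable[OF radial_coordinate] by (auto simp: ind_space_def)
  have "(\<integral>\<^sup>+x. ennreal (cmod (h x) * cmod (k x)) * indicator ?A x \<partial>lborel) =
     (\<integral>\<^sup>+x. ennreal ((cmod (h x) * indicator ?A x) * (cmod (k x) * indicator ?A x)) \<partial>lborel)"
    by (intro nn_integral_cong) (auto simp: indicator_def)
  also have "\<dots> \<le> ennreal (l2norm h * l2norm k)"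
  proof (rule nn_integral_mult_le)
    have e: "ennreal ((cmod (h x) * indicator ?A x)\<^sup>2) = ennreal ((cmod (h x))\<^sup>2) * indicator ?A x" for h x
      by (auto simp: indicator_def)
    show "(\<integral>\<^sup>+x. ennreal ((cmod (h x) * indicator ?A x)\<^sup>2) \<partial>lborel) \<le> ennreal ((l2norm h)\<^sup>2)"
      unfolding e using ind_space_hnorm2(1)[OF h, of i] ind_space_hnorm2(2)[OF h] by simp
    show "(\<integral>\<^sup>+x. ennreal ((cmod (k x) * indicator ?A x)\<^sup>2) \<partial>lborel) \<le> ennreal ((l2norm k)\<^sup>2)"
      unfolding e using ind_space_hnorm2(1)[OF k, of i] ind_space_hnorm2(2)[OF k] by simp
  qed auto
  finally show ?thesis .
qed

lemma pairing_integrable: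
  fixes i :: "'n::finite"
  assumes h: "h \<in> ind_space pm t" and k: "k \<in> ind_space pm t'"
  shows "integrable lborel (\<lambda>x. h x * cnj (k x) * indicator (annulus (\<lambda>x. \<bar>x $ i\<bar>)) x)"
proof (rule integrableI_bounded)
  let ?A = "annulus (\<lambda>x :: real^'n. \<bar>x $ i\<bar>)"
  have [measurable]: "h \<in> borel_measurable borel" "k \<in> borel_measurable borel" "?A \<in> sets borel"
    using h k annulus_measurable[OF radial_coordinate] by (auto simp: ind_space_def)
  show "(\<lambda>x. h x * cnj (k x) * indicator ?A x) \<in> borel_measurable lborel" by measurable
  have "(\<integral>\<^sup>+x. ennreal (norm (h x * cnj (k x) * indicator ?A x)) \<partial>lborel) =
      (\<integral>\<^sup>+x. ennreal (cmod (h x) * cmod (k x)) * indicator ?A x \<partial>lborel)"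
    by (intro nn_integral_cong) (auto simp: indicator_def norm_mult)
  also have "\<dots> < \<infinity>" using pairing_nn[OF h k, of i] le_less_trans by fastforce
  finally show "(\<integral>\<^sup>+x. ennreal (norm (h x * cnj (k x) * indicator ?A x)) \<partial>lborel) < \<infinity>" .
qed

lemma pairing_le:
  assumes h: "h \<in> ind_space pm t" and k: "k \<in> ind_space pm t'"
  shows "cmod (pairing i h k) \<le> l2norm h * l2norm k"
proof -
  let ?A = "annulus (\<lambda>x :: real^'a. \<bar>x $ i\<bar>)"
  let ?N = "\<integral>x. norm (h x * cnj (k x) * indicator ?A x) \<partial>lborel"
  have N: "cmod (pairing i h k) \<le> ?N"
    unfolding pairing_def by (rule integral_norm_bound)
  have "ennreal ?N = (\<integral>\<^sup>+x. ennreal (norm (h x * cnj (k x) * indicator ?A x)) \<partial>lborel)"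
    by (rule nn_integral_eq_integral[symmetric]) (use pairing_integrable[OF h k, of i] in auto)
  also have "\<dots> = (\<integral>\<^sup>+x. ennreal (cmod (h x) * cmod (k x)) * indicator ?A x \<partial>lborel)"
    by (intro nn_integral_cong) (auto simp: indicator_def norm_mult)
  also have "\<dots> \<le> ennreal (l2norm h * l2norm k)" by (rule pairing_nn[OF h k])
  finally have "?N \<le> l2norm h * l2norm k"
    by (subst (asm) ennreal_le_iff) auto
  with N show ?thesis by linarith
qed

lemma pairing_self:
  assumes h: "h \<in> ind_space pm t"
  shows "pairing i h h = of_real ((l2norm h)\<^sup>2)"
proof -
  let ?A = "annulus (\<lambda>x :: real^'a. \<bar>x $ i\<bar>)"
  let ?q = "\<lambda>x. (cmod (h x))\<^sup>2 * indicator ?A x"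
  have [measurable]: "h \<in> borel_measurable borel" "?A \<in> sets borel"
    using h annulus_measurable[OF radial_coordinate] by (auto simp: ind_space_def)
  have "(\<integral>\<^sup>+x. ennreal (?q x) \<partial>lborel) = ennreal ((l2norm h)\<^sup>2)"
    using ind_space_hnorm2(1)[OF h, of i] ind_space_hnorm2(2)[OF h] by (simp add: ennreal_mult' ennreal_indicator)
  then have "(\<integral>x. ?q x \<partial>lborel) = (l2norm h)\<^sup>2"
    by (subst integral_eq_nn_integral) auto
  moreover have "h x * cnj (h x) * indicator ?A x = of_real (?q x)" for x
    by (simp add: indicator_def complex_norm_square[symmetric] del: of_real_power)
  ultimately show ?thesis by (simp only: pairing_def integral_complex_of_real)
qed

text \<open>The estimate |h| |k| \<le> |h|^2 + |k|^2 suffices, since by invariance the first square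
  integrates to the same value for every r and the kernel has mass 1.\<close>

lemma bop_pairing_integrable:
  fixes i j :: "'n::finite"
  assumes h: "h \<in> ind_space pm t" and k: "k \<in> ind_space pm t'" and ij: "i \<noteq> j" and s: "s > 0"
  shows "integrable (lborel \<Otimes>\<^sub>M lborel) (\<lambda>(x, r). complex_of_real (bessel_kernel s r) *
    (h (flow i j \<beta> r x) * cnj (k x) * indicator (annulus (\<lambda>x. \<bar>x $ i\<bar>)) x))"
proof -
  let ?A = "annulus (\<lambda>x :: real^'n. \<bar>x $ i\<bar>)" and ?G = "bessel_kernel s"
  let ?I = "indicator ?A :: real^'n \<Rightarrow> complex"
  have [measurable]: "h \<in> borel_measurable borel" "k \<in> borel_measurable borel" "?A \<in> sets borel" "?G \<in> borel_measurable borel"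
    using h k s annulus_measurable[OF radial_coordinate] by (auto simp: ind_space_def)
  let ?F = "\<lambda>x r. complex_of_real (?G r) * (h (flow i j \<beta> r x) * cnj (k x) * ?I x)"
  have Gnn: "?G r \<ge> 0" for r using s by simp
  show "integrable (lborel \<Otimes>\<^sub>M lborel) (\<lambda>(x, r). ?F x r)"
  proof (rule integrableI_bounded)
    show "(\<lambda>(x, r). ?F x r) \<in> borel_measurable (lborel \<Otimes>\<^sub>M lborel)" by measurable
    have sh: "(\<integral>\<^sup>+x. ennreal ((cmod (h (flow i j \<beta> r x)))\<^sup>2) * indicator ?A x \<partial>lborel) = hnorm2 h" for r
    proof -
      have "(\<integral>\<^sup>+x. ennreal ((cmod (h (flow i j \<beta> r x)))\<^sup>2) * indicator ?A (flow i j \<beta> r x) \<partial>lborel) =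
        (\<integral>\<^sup>+x. ennreal ((cmod (h x))\<^sup>2) * indicator ?A x \<partial>lborel)"
        unfolding flow_def
        by (rule nn_integral_shear[OF ij, of "\<lambda>x. ennreal ((cmod (h x))\<^sup>2) * indicator ?A x"]) measurable
      then show ?thesis using ind_space_hnorm2(1)[OF h, of i] by (simp add: annulus_flow[OF ij])
    qed
    have "(\<integral>\<^sup>+p. ennreal (norm (case p of (x, r) \<Rightarrow> ?F x r)) \<partial>(lborel \<Otimes>\<^sub>M lborel)) =
      (\<integral>\<^sup>+r. \<integral>\<^sup>+x. ennreal (norm (?F x r)) \<partial>lborel \<partial>lborel)"
      by (subst lborel_pair.nn_integral_snd[symmetric]) auto
    also have "\<dots> \<le> (\<integral>\<^sup>+r. ennreal (?G r) * (hnorm2 h + hnorm2 k) \<partial>lborel)"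
    proof (rule nn_integral_mono)
      fix r
      have "(\<integral>\<^sup>+x. ennreal (norm (?F x r)) \<partial>lborel) \<le>
        (\<integral>\<^sup>+x. ennreal (?G r) * (ennreal ((cmod (h (flow i j \<beta> r x)))\<^sup>2) * indicator ?A x + ennreal ((cmod (k x))\<^sup>2) * indicator ?A x) \<partial>lborel)"
      proof (rule nn_integral_mono)
        fix x
        have "cmod (h (flow i j \<beta> r x)) * cmod (k x) \<le> (cmod (h (flow i j \<beta> r x)))\<^sup>2 + (cmod (k x))\<^sup>2"
          using zero_le_power2[of "cmod (h (flow i j \<beta> r x)) - cmod (k x)"]
            mult_nonneg_nonneg[OF norm_ge_zero norm_ge_zero, of "h (flow i j \<beta> r x)" "k x"]
          unfolding power2_diff by linarith
        then have "ennreal (cmod (h (flow i j \<beta> r x)) * cmod (k x)) \<le> ennreal ((cmod (h (flow i j \<beta> r x)))\<^sup>2) + ennreal ((cmod (k x))\<^sup>2)"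
          using ennreal_leI by (fastforce simp flip: ennreal_plus)
        then show "ennreal (norm (?F x r)) \<le> ennreal (?G r) * (ennreal ((cmod (h (flow i j \<beta> r x)))\<^sup>2) * indicator ?A x + ennreal ((cmod (k x))\<^sup>2) * indicator ?A x)"
          using Gnn by (cases "x \<in> ?A") (auto simp: norm_mult ennreal_mult intro!: mult_left_mono)
      qed
      also have "\<dots> = ennreal (?G r) * (hnorm2 h + hnorm2 k)"
        by (subst nn_integral_cmult, measurable, subst nn_integral_add)
          (auto simp: sh ind_space_hnorm2(1)[OF k, of i, symmetric])
      finally show "(\<integral>\<^sup>+x. ennreal (norm (?F x r)) \<partial>lborel) \<le> ennreal (?G r) * (hnorm2 h + hnorm2 k)" .
    qed
    also have "\<dots> = hnorm2 h + hnorm2 k"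
      using nn_integral_bessel_kernel[OF s] by (subst nn_integral_multc) auto
    also have "\<dots> < \<infinity>" using h k by (auto simp: ind_space_def)
    finally show "(\<integral>\<^sup>+p. ennreal (norm (case p of (x, r) \<Rightarrow> ?F x r)) \<partial>(lborel \<Otimes>\<^sub>M lborel)) < \<infinity>" .
  qed
qed

text \<open>Self-adjointness: translating the integration variable along the flow moves the shift
  from h to k with the time reversed, and the kernel is even.\<close>

lemma pairing_bop:
  assumes h: "h \<in> ind_space pm t" and k: "k \<in> ind_space pm t'" and ij: "i \<noteq> j" and s: "s > 0"
  shows "pairing i (bop i j \<beta> s h) k = pairing i h (bop i j \<beta> s k)"
proof -
  let ?A = "annulus (\<lambda>x :: real^'a. \<bar>x $ i\<bar>)" and ?G = "bessel_kernel s"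
  let ?I = "indicator ?A :: real^'a \<Rightarrow> complex"
  have [measurable]: "h \<in> borel_measurable borel" "k \<in> borel_measurable borel" "?A \<in> sets borel" "?G \<in> borel_measurable borel"
    using h k s annulus_measurable[OF radial_coordinate] by (auto simp: ind_space_def)
  let ?F = "\<lambda>x r. complex_of_real (?G r) * (h (flow i j \<beta> r x) * cnj (k x) * ?I x)"
  have Gnn: "?G r \<ge> 0" for r using s by simp
  have "pairing i (bop i j \<beta> s h) k = (\<integral>x. \<integral>r. ?F x r \<partial>lborel \<partial>lborel)"
    unfolding pairing_def bop_def by (simp only: mult.assoc[symmetric] integral_mult_left_zero)
  also have "\<dots> = (\<integral>r. \<integral>x. ?F x r \<partial>lborel \<partial>lborel)"
    by (rule lborel_pair.Fubini_integral[OF bop_pairing_integrable[OF h k ij s], symmetric])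
  also have "\<dots> = (\<integral>r. \<integral>x. complex_of_real (?G r) * (h x * cnj (k (flow i j \<beta> (- r) x)) * ?I x) \<partial>lborel \<partial>lborel)"
  proof (rule Bochner_Integration.integral_cong[OF refl])
    fix r
    let ?H = "\<lambda>x. complex_of_real (?G r) * (h x * cnj (k (flow i j \<beta> (- r) x)) * ?I x)"
    have "(\<integral>x. ?H (shear i j (- (r * \<beta>)) x) \<partial>lborel) = (\<integral>x. ?H x \<partial>lborel)"
      by (rule integral_shear[OF ij]) measurable
    then show "(\<integral>x. ?F x r \<partial>lborel) = (\<integral>x. ?H x \<partial>lborel)"
      unfolding flow_def[symmetric] flow_flow[OF ij] annulus_flow[OF ij] by simp
  qed
  also have "\<dots> = (\<integral>r. \<integral>x. complex_of_real (?G r) * (h x * cnj (k (flow i j \<beta> r x)) * ?I x) \<partial>lborel \<partial>lborel)"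
    by (subst lborel_integral_real_affine[where c = "-1" and t = 0]) (auto simp: bessel_kernel_minus)
  also have "\<dots> = (\<integral>x. \<integral>r. complex_of_real (?G r) * (h x * cnj (k (flow i j \<beta> r x)) * ?I x) \<partial>lborel \<partial>lborel)"
  proof -
    have "integrable (lborel \<Otimes>\<^sub>M lborel) (\<lambda>p. cnj (case p of (x, r) \<Rightarrow> complex_of_real (?G r) * (k (flow i j \<beta> r x) * cnj (h x) * ?I x)))"
      using bop_pairing_integrable[OF k h ij s, of \<beta>] by simp
    moreover have "(\<lambda>p. cnj (case p of (x, r) \<Rightarrow> complex_of_real (?G r) * (k (flow i j \<beta> r x) * cnj (h x) * ?I x))) =
      (\<lambda>(x, r). complex_of_real (?G r) * (h x * cnj (k (flow i j \<beta> r x)) * ?I x))"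
      by (auto simp: fun_eq_iff indicator_def)
    ultimately have "integrable (lborel \<Otimes>\<^sub>M lborel) (\<lambda>(x, r). complex_of_real (?G r) * (h x * cnj (k (flow i j \<beta> r x)) * ?I x))"
      by simp
    then show ?thesis by (rule lborel_pair.Fubini_integral)
  qed
  also have "\<dots> = pairing i h (bop i j \<beta> s k)"
  proof -
    have "(\<integral>r. complex_of_real (?G r) * (h x * cnj (k (flow i j \<beta> r x)) * ?I x) \<partial>lborel) = h x * cnj (bop i j \<beta> s k x) * ?I x" for x
    proof -
      have "(\<integral>r. complex_of_real (?G r) * (h x * cnj (k (flow i j \<beta> r x)) * ?I x) \<partial>lborel) =
          (\<integral>r. (h x * ?I x) * cnj (complex_of_real (?G r) * k (flow i j \<beta> r x)) \<partial>lborel)"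
        by (rule Bochner_Integration.integral_cong) (simp_all add: mult_ac)
      also have "\<dots> = (h x * ?I x) * cnj (bop i j \<beta> s k x)"
        unfolding bop_def by (simp only: integral_mult_right_zero Bochner_Integration.integral_cnj)
      finally show ?thesis by (simp add: mult_ac)
    qed
    then show ?thesis unfolding pairing_def by simp
  qed
  finally show ?thesis .
qed

text \<open>With B_s for the Bessel operator of order s, self-adjointness turns the squared norm of
  B_s K into the pairing of B_s (B_s K) = B_(2s) K with K; Cauchy-Schwarz does the rest.\<close>

lemma l2norm_bop_double:
  assumes K: "K \<in> V pm t i j" and ij: "i \<noteq> j" and \<beta>: "\<beta> \<noteq> 0" and s: "s > 0"
  shows "(l2norm (bop i j \<beta> s K))\<^sup>2 \<le> l2norm (bop i j \<beta> (2 * s) K) * l2norm K"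
proof -
  note KI = V_ind_space[OF K]
  have B: "bop i j \<beta> s' K \<in> ind_space pm t" if "s' > 0" for s' using bop_ind_space[OF KI ij that] by blast
  have "of_real ((l2norm (bop i j \<beta> s K))\<^sup>2) = pairing i (bop i j \<beta> s K) (bop i j \<beta> s K)"
    by (rule pairing_self[OF B[OF s], symmetric])
  also have "\<dots> = pairing i (bop i j \<beta> s (bop i j \<beta> s K)) K"
    by (rule pairing_bop[OF B[OF s] KI ij s, symmetric])
  also have "bop i j \<beta> s (bop i j \<beta> s K) = bop i j \<beta> (2 * s) K"
    using bop_semigroup[OF K ij \<beta> s s] by (simp add: fun_eq_iff)
  finally have "cmod (of_real ((l2norm (bop i j \<beta> s K))\<^sup>2)) \<le> l2norm (bop i j \<beta> (2 * s) K) * l2norm K"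
    using pairing_le[OF B KI, of "2 * s" i] s by (simp del: of_real_power norm_of_real)
  then show ?thesis by (simp only: norm_of_real abs_power2)
qed

text \<open>An interpolation inequality between the orders 0, s and 2^m s, obtained by repeated
  doubling. It replaces a fractional order by one so large that p factors I - a^2 can be
  cancelled.\<close>

lemma l2norm_bop_power:
  assumes K: "K \<in> V pm t i j" and ij: "i \<noteq> j" and \<beta>: "\<beta> \<noteq> 0" and s: "s > 0"
  shows "l2norm (bop i j \<beta> s K) ^ (2 ^ m) \<le> l2norm (bop i j \<beta> (2 ^ m * s) K) * l2norm K ^ (2 ^ m - 1)"
proof (induction m)
  case (Suc m)
  let ?b = "\<lambda>s. l2norm (bop i j \<beta> s K)"
  have "?b s ^ (2 ^ Suc m) = (?b s ^ (2 ^ m))\<^sup>2" by (simp add: power_mult[symmetric] mult.commute)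
  also have "\<dots> \<le> (?b (2 ^ m * s) * l2norm K ^ (2 ^ m - 1))\<^sup>2"
    by (intro power_mono Suc) simp
  also have "\<dots> = (?b (2 ^ m * s))\<^sup>2 * l2norm K ^ (2 * (2 ^ m - 1))"
    by (simp add: power_mult_distrib power_mult[symmetric] mult.commute)
  also have "\<dots> \<le> (?b (2 * (2 ^ m * s)) * l2norm K) * l2norm K ^ (2 * (2 ^ m - 1))"
    using s by (intro mult_right_mono l2norm_bop_double[OF K ij \<beta>]) auto
  also have "\<dots> = ?b (2 ^ Suc m * s) * l2norm K ^ Suc (2 * (2 ^ m - 1))" by (simp add: mult_ac)
  also have "Suc (2 * (2 ^ m - 1)) = 2 ^ Suc m - 1"
  proof -
    obtain k where "2 ^ m = Suc k" by (metis Suc_pred zero_less_numeral zero_less_power)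
    then show ?thesis by simp
  qed
  finally show ?case .
qed simp

lemma l2norm_bop_le:
  "h \<in> ind_space pm t \<Longrightarrow> i \<noteq> j \<Longrightarrow> s > 0 \<Longrightarrow> l2norm (bop i j \<beta> s h) \<le> l2norm h"
  by (rule l2norm_mono) (auto simp: bop_ind_space)

text \<open>Completes s to the even integer 2 (m + 1): if s + s' equals it, the Bessel operator of
  order s' applied to (I - a^2)^(m + 1) f plays the role of (I - a^2)^(s/2) f. Hence f is in the
  domain described by \<open>apow_norm\<close>.\<close>

lemma fractional_power:
  assumes f: "f \<in> V pm t i j" and ij: "i \<noteq> j" and \<beta>: "\<beta> \<noteq> 0" and s: "s > 0"
  obtains h where "h \<in> ind_space pm t" "bop i j \<beta> s h = f"
proof -
  obtain m where m: "s < 2 * real (Suc m)"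
  proof -
    obtain n :: nat where "s < real n" using reals_Archimedean2 by blast
    then show thesis by (intro that[of n]) auto
  qed
  define s' where "s' = 2 * real (Suc m) - s"
  let ?F = "(resolv (\<beta> *\<^sub>R eunit j i) ^^ Suc m) f"
  have F: "?F \<in> V pm t i j" by (rule V_resolv_pow[OF ij f])
  have s': "s' > 0" using m by (simp add: s'_def)
  show thesis
  proof (rule that)
    show "bop i j \<beta> s' ?F \<in> ind_space pm t" using bop_ind_space[OF V_ind_space[OF F] ij s'] by blast
    have "bop i j \<beta> s (bop i j \<beta> s' ?F) = bop i j \<beta> (s + s') ?F"
      using bop_semigroup[OF F ij \<beta> s s'] by blast
    also have "\<dots> = f" using bop_resolv_pow[OF f ij \<beta>, of m] by (simp add: s'_def)
    finally show "bop i j \<beta> s (bop i j \<beta> s' ?F) = f" .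
  qed
qed

text \<open>With B_s for the Bessel operator of order s, the pairing of B_s h with K' is that of h
  with B_s K'. By the doubling inequality the norm of B_s K' is controlled by the operator of order
  2^m s applied to K' = (I - a^2)^p K, and this is the operator of the remaining positive order 2^m
  s - 2 p applied to K, of norm at most that of K.\<close>

lemma fractional_power_lower:
  assumes h: "h \<in> ind_space pm t" and K: "K \<in> V pm t i j" and ij: "i \<noteq> j" and \<beta>: "\<beta> \<noteq> 0" and s: "s > 0"
    and p: "2 * real p < 2 ^ m * s"
  defines "K' \<equiv> (resolv (\<beta> *\<^sub>R eunit j i) ^^ p) K"
  shows "cmod (pairing i (bop i j \<beta> s h) K') ^ (2 ^ m) \<le> l2norm h ^ (2 ^ m) * (l2norm K * l2norm K' ^ (2 ^ m - 1))"
proof -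
  have K': "K' \<in> V pm t i j" unfolding K'_def by (rule V_resolv_pow[OF ij K])
  note KI = V_ind_space[OF K] and KI' = V_ind_space[OF K']
  have "cmod (pairing i (bop i j \<beta> s h) K') = cmod (pairing i h (bop i j \<beta> s K'))"
    by (simp add: pairing_bop[OF h KI' ij s])
  also have "\<dots> \<le> l2norm h * l2norm (bop i j \<beta> s K')"
    using bop_ind_space[OF KI' ij s] by (intro pairing_le[OF h]) blast
  finally have "cmod (pairing i (bop i j \<beta> s h) K') ^ (2 ^ m) \<le> (l2norm h * l2norm (bop i j \<beta> s K')) ^ (2 ^ m)"
    by (intro power_mono) auto
  also have "\<dots> = l2norm h ^ (2 ^ m) * l2norm (bop i j \<beta> s K') ^ (2 ^ m)" by (rule power_mult_distrib)
  also have "\<dots> \<le> l2norm h ^ (2 ^ m) * (l2norm (bop i j \<beta> (2 ^ m * s) K') * l2norm K' ^ (2 ^ m - 1))"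
    by (intro mult_left_mono l2norm_bop_power[OF K' ij \<beta> s]) simp
  also have "\<dots> \<le> l2norm h ^ (2 ^ m) * (l2norm K * l2norm K' ^ (2 ^ m - 1))"
  proof (intro mult_left_mono mult_right_mono)
    show "l2norm (bop i j \<beta> (2 ^ m * s) K') \<le> l2norm K"
    \<comment> \<open>For p = 0 nothing is cancelled and the contraction property is used directly;
      \<open>bop_resolv_pow\<close> starts with the first power.\<close>
    proof (cases p)
      case 0
      then show ?thesis using l2norm_bop_le[OF KI' ij, of "2 ^ m * s" \<beta>] s by (simp add: K'_def)
    next
      case (Suc q)
      define s' where "s' = 2 ^ m * s - 2 * real (Suc q)"
      have s': "s' > 0" using p Suc by (simp add: s'_def)
      have "bop i j \<beta> s' (bop i j \<beta> (2 * real (Suc q)) K') = bop i j \<beta> (2 ^ m * s) K'"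
        using bop_semigroup[OF K' ij \<beta> s', of "2 * real (Suc q)"] by (simp add: fun_eq_iff s'_def)
      moreover have "bop i j \<beta> (2 * real (Suc q)) K' = K"
        unfolding K'_def Suc by (rule bop_resolv_pow[OF K ij \<beta>])
      ultimately show ?thesis using l2norm_bop_le[OF KI ij s', of \<beta>] by simp
    qed
  qed auto
  finally show ?thesis .
qed

section \<open>Bump functions and an oscillatory integral\<close>

text \<open>With powers of 1 / x as extra factors the span of the family is closed under
  differentiation, which makes the smoothness of exp (- 1/x) an induction with m arbitrary.\<close>

definition flat :: "nat \<Rightarrow> real \<Rightarrow> real" where
  "flat m x = (if x > 0 then (1 / x) ^ m * exp (- (1 / x)) else 0)"

lemma flat_tendsto: "(flat m \<longlongrightarrow> 0) (at 0)"
proof -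
  have "((\<lambda>x. (inverse x) ^ m / exp (inverse x)) \<longlongrightarrow> (0::real)) (at_right 0)"
    by (rule filterlim_compose[OF tendsto_power_div_exp_0 filterlim_inverse_at_top_right])
  then have r: "(flat m \<longlongrightarrow> 0) (at_right 0)"
    by (rule Lim_transform_eventually)
      (auto simp: flat_def eventually_at_right_field exp_minus divide_inverse power_inverse intro!: exI[of _ 1])
  have "((\<lambda>x. 0) \<longlongrightarrow> (0::real)) (at_left 0)" by simp
  then have "(flat m \<longlongrightarrow> 0) (at_left 0)"
    by (rule Lim_transform_eventually) (auto simp: flat_def eventually_at_left_field intro!: exI[of _ "-1"])
  with r show ?thesis by (simp add: filterlim_split_at)
qed

lemma flat_deriv: "(flat m has_real_derivative - real m * flat (Suc m) x + flat (Suc (Suc m)) x) (at x)"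
proof -
  consider "x > 0" | "x < 0" | "x = 0" by linarith
  then show ?thesis
  proof cases
    case 1
    have p: "((\<lambda>x. (1 / x) ^ m) has_real_derivative - real m * (1 / x) ^ Suc m) (at x)"
      by (rule DERIV_cong[OF DERIV_power[OF DERIV_divide[OF DERIV_const DERIV_ident]]])
        (use 1 in \<open>cases m; simp add: field_simps\<close>)+
    have e: "((\<lambda>x. exp (- (1 / x))) has_real_derivative exp (- (1 / x)) * (1 / x)\<^sup>2) (at x)"
      by (rule DERIV_cong[OF DERIV_chain2[OF DERIV_exp DERIV_minus[OF DERIV_divide[OF DERIV_const DERIV_ident]]]])
        (use 1 in \<open>simp_all add: power2_eq_square\<close>)
    have "((\<lambda>x. (1 / x) ^ m * exp (- (1 / x))) has_real_derivative - real m * flat (Suc m) x + flat (Suc (Suc m)) x) (at x)"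
      by (rule DERIV_cong[OF DERIV_mult[OF p e]]) (use 1 in \<open>simp add: flat_def power2_eq_square algebra_simps\<close>)
    then show ?thesis
      by (rule has_field_derivative_transform_within_open[where S = "{0<..}"]) (use 1 in \<open>auto simp: flat_def\<close>)
  next
    case 2
    have "((\<lambda>_. 0) has_real_derivative - real m * flat (Suc m) x + flat (Suc (Suc m)) x) (at x)"
      using 2 by (simp add: flat_def)
    then show ?thesis
      by (rule has_field_derivative_transform_within_open[where S = "{..<0}"]) (use 2 in \<open>auto simp: flat_def\<close>)
  next
    case 3
    have "((\<lambda>h. (flat m (0 + h) - flat m 0) / h) \<longlongrightarrow> 0) (at 0)"
      by (rule Lim_transform_eventually[OF flat_tendsto[of "Suc m"]]) (simp add: flat_def eventually_at_filter)
    then have "(flat m has_real_derivative 0) (at 0)" by (simp add: DERIV_def)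
    then show ?thesis using 3 by (simp add: flat_def)
  qed
qed

lemma smooth_flat: "smooth (\<lambda>x. of_real (flat m x))"
proof -
  have "Ck k (\<lambda>x. of_real (flat m x))" for k
  proof (induction k arbitrary: m)
    case 0
    have "continuous_on UNIV (flat m)" using flat_deriv by (meson DERIV_isCont continuous_at_imp_continuous_on)
    then show ?case by (auto intro: continuous_intros)
  next
    case (Suc k)
    show ?case
    proof (rule Ck_SucI)
      show "((\<lambda>x. complex_of_real (flat m x)) has_vector_derivative
          of_real (- real m) * of_real (flat (Suc m) x) + of_real (flat (Suc (Suc m)) x)) (at x)" for x
        using has_vector_derivative_of_real[OF flat_deriv[of m x]] by simp
      show "Ck k (\<lambda>x. of_real (- real m) * of_real (flat (Suc m) x) + of_real (flat (Suc (Suc m)) x))"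
        by (intro Ck_add Ck_mult[OF Ck_const] Suc)
    qed
  qed
  then show ?thesis by (simp add: smooth_def)
qed

section \<open>Bump functions with explicit logarithmic derivative\<close>

definition bump :: "real \<Rightarrow> real \<Rightarrow> real \<Rightarrow> real" where
  "bump l u x = flat 0 (x - l) * flat 0 (u - x)"

lemma bump_nonneg: "bump l u x \<ge> 0" by (simp add: bump_def flat_def)
lemma bump_pos: "l < x \<Longrightarrow> x < u \<Longrightarrow> bump l u x > 0" by (simp add: bump_def flat_def)
lemma bump_zero: "\<not> (l < x \<and> x < u) \<Longrightarrow> bump l u x = 0" by (auto simp: bump_def flat_def)

lemma bump_continuous: "continuous_on S (bump l u)"
proof -
  have "continuous_on UNIV (flat 0)" using flat_deriv by (meson DERIV_isCont continuous_at_imp_continuous_on)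
  then have "continuous_on S (\<lambda>x. flat 0 (h x))" if "continuous_on S h" for h
    using continuous_on_compose2[of UNIV "flat 0" S h] that by simp
  note c = this
  have "continuous_on S (\<lambda>x. flat 0 (x - l))" "continuous_on S (\<lambda>x. flat 0 (u - x))"
    by (rule c; intro continuous_intros)+
  then show ?thesis unfolding bump_def[abs_def] by (rule continuous_on_mult)
qed

lemma test_on_bump: "test_on l u (\<lambda>x. of_real (bump l u x))"
proof -
  have "smooth (\<lambda>x. of_real (flat 0 (1 * x + - l)) * of_real (flat 0 (- 1 * x + u)))"
    by (intro smooth_mult smooth_affine[OF smooth_flat])
  then have "smooth (\<lambda>x. of_real (bump l u x))" by (simp add: bump_def algebra_simps)
  moreover have "l \<le> x \<and> x \<le> u" if "bump l u x \<noteq> 0" for x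
    using bump_zero[of l x u] that by linarith
  ultimately show ?thesis unfolding test_on_def by simp
qed

lemma bump_lower:
  assumes "l < p" "q < u"
  obtains b where "b > 0" "\<And>x. x \<in> {p..q} \<Longrightarrow> bump l u x \<ge> b"
proof (cases "{p..q} = {}")
  case False
  then obtain y where y: "y \<in> {p..q}" "\<And>x. x \<in> {p..q} \<Longrightarrow> bump l u y \<le> bump l u x"
    using continuous_attains_inf[OF compact_Icc _ bump_continuous] by metis
  moreover have "bump l u y > 0" using y(1) assms by (intro bump_pos) auto
  ultimately show ?thesis using that by blast
qed (use that[of 1] in auto)

lemma bump_deriv:
  assumes "l < x" "x < u"
  shows "(bump l u has_real_derivative bump l u x * ((1 / (x - l))\<^sup>2 - (1 / (u - x))\<^sup>2)) (at x)"
proof -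
  have "((\<lambda>x. flat 0 (x - l)) has_real_derivative (- real 0 * flat (Suc 0) (x - l) + flat (Suc (Suc 0)) (x - l)) * 1) (at x)"
    by (rule DERIV_chain2[OF flat_deriv]) (auto intro!: derivative_eq_intros)
  moreover have "((\<lambda>x. flat 0 (u - x)) has_real_derivative (- real 0 * flat (Suc 0) (u - x) + flat (Suc (Suc 0)) (u - x)) * - 1) (at x)"
    by (rule DERIV_chain2[OF flat_deriv]) (auto intro!: derivative_eq_intros)
  ultimately show ?thesis
    unfolding bump_def[abs_def]
    by (rule DERIV_cong[OF DERIV_mult]) (use assms in \<open>simp add: flat_def power2_eq_square algebra_simps\<close>)
qed

text \<open>Each reciprocal square dominates on its own side of the midpoint, so the bump increases
  up to it and decreases afterwards. The midpoint is later the critical point of the phase, and this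
  sign makes the integrand after integration by parts nonnegative.\<close>

lemma bump_deriv_sign:
  assumes "l < x" "x < u"
  shows "bump l u x * ((1 / (x - l))\<^sup>2 - (1 / (u - x))\<^sup>2) * (x - (l + u) / 2) \<le> 0"
proof -
  have "((1 / (x - l))\<^sup>2 - (1 / (u - x))\<^sup>2) * (x - (l + u) / 2) \<le> 0"
  proof (cases "x \<le> (l + u) / 2")
    case True
    then have "1 / (u - x) \<le> 1 / (x - l)" using assms by (intro divide_left_mono) auto
    then have "(1 / (u - x))\<^sup>2 \<le> (1 / (x - l))\<^sup>2" using assms by (intro power_mono) auto
    then show ?thesis using True by (intro mult_nonneg_nonpos) auto
  next
    case False
    then have "1 / (x - l) \<le> 1 / (u - x)" using assms by (intro divide_left_mono) auto
    then have "(1 / (x - l))\<^sup>2 \<le> (1 / (u - x))\<^sup>2" using assms by (intro power_mono) auto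
    then show ?thesis using False by (intro mult_nonpos_nonneg) auto
  qed
  then show ?thesis using bump_nonneg[of l u x] by (simp add: mult.assoc mult_nonneg_nonpos)
qed

section \<open>An oscillatory integral with one critical point\<close>

lemma ln_one_plus_bounds:
  fixes d :: real
  assumes "0 < d" "d \<le> 3 / 10"
  shows "d - ln (1 + d) \<le> d\<^sup>2 / 2" "d\<^sup>2 / 2 * (8 / 10) \<le> d - ln (1 + d)"
proof -
  have "ln (1 + 0) - 0 + 0\<^sup>2 / 2 \<le> ln (1 + d) - d + d\<^sup>2 / 2"
  proof (rule DERIV_nonneg_imp_nondecreasing[of 0 d "\<lambda>x. ln (1 + x) - x + x\<^sup>2 / 2"])
    fix x assume "0 \<le> x" "x \<le> d"
    then have "((\<lambda>x. ln (1 + x) - x + x\<^sup>2 / 2) has_real_derivative x\<^sup>2 / (1 + x)) (at x)" "x\<^sup>2 / (1 + x) \<ge> 0"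
      by (auto intro!: derivative_eq_intros simp: field_simps power2_eq_square)
    then show "\<exists>y. ((\<lambda>x. ln (1 + x) - x + x\<^sup>2 / 2) has_real_derivative y) (at x) \<and> 0 \<le> y" by blast
  qed (use assms in auto)
  then show "d - ln (1 + d) \<le> d\<^sup>2 / 2" by simp
  have "0 - 0\<^sup>2 / 2 + 0 ^ 3 / 3 - ln (1 + 0) \<le> d - d\<^sup>2 / 2 + d ^ 3 / 3 - ln (1 + d)"
  proof (rule DERIV_nonneg_imp_nondecreasing[of 0 d "\<lambda>x. x - x\<^sup>2 / 2 + x ^ 3 / 3 - ln (1 + x)"])
    fix x assume "0 \<le> x" "x \<le> d"
    then have "((\<lambda>x. x - x\<^sup>2 / 2 + x ^ 3 / 3 - ln (1 + x)) has_real_derivative x ^ 3 / (1 + x)) (at x)" "x ^ 3 / (1 + x) \<ge> 0"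
      by (auto intro!: derivative_eq_intros simp: field_simps power2_eq_square power3_eq_cube)
    then show "\<exists>y. ((\<lambda>x. x - x\<^sup>2 / 2 + x ^ 3 / 3 - ln (1 + x)) has_real_derivative y) (at x) \<and> 0 \<le> y" by blast
  qed (use assms in auto)
  \<comment> \<open>The cubic term d^3 / 3 is at most one fifth of d^2 / 2 in this range; hence the
    factor 8 / 10.\<close>
  moreover have "d ^ 3 \<le> 3 / 10 * d\<^sup>2" using assms by (simp add: power3_eq_cube power2_eq_square)
  ultimately show "d\<^sup>2 / 2 * (8 / 10) \<le> d - ln (1 + d)" by simp
qed

text \<open>With \<open>\<Theta>\<close> the phase, \<open>w0\<close> its critical point and \<open>m = B / \<Theta>'\<close>, integration by parts against
  \<open>1 - cos \<Theta>\<close> (which vanishes to fourth order at \<open>w0\<close>) turns the oscillatory integral into one with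
  a nonnegative integrand, because \<open>m\<close> is decreasing on both sides of \<open>w0\<close>.\<close>

lemma oscillatory_lower:
  fixes \<omega> :: real
  assumes \<omega>: "\<omega> > 0"
  defines "B \<equiv> \<lambda>T w. bump (1 / (2 * \<omega>)) (3 / (2 * \<omega>)) (w / T)"
    and "\<Theta> \<equiv> \<lambda>T w. \<omega> * w - T * ln w - (T - T * ln (T / \<omega>))"
  obtains c T1 where "c > 0" "T1 \<ge> 1"
    "\<And>T. T \<ge> T1 \<Longrightarrow> integral {T / (2 * \<omega>)..3 * T / (2 * \<omega>)} (\<lambda>w. sin (\<Theta> T w) * B T w) \<ge> c * sqrt T"
proof -
  \<comment> \<open>At w = w0 (1 + \<delta>) the phase lies between 0.4 and 0.5 times T \<delta>^2.
    Values of T \<delta>^2 from A1^2 = 5 pi / 4 to A2^2 = 3 pi therefore keep it in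
    [pi / 2, 3 pi / 2], where 1 - cos is at least 1.\<close>
  define A1 where "A1 = sqrt (5 * pi / 4)"
  define A2 where "A2 = sqrt (3 * pi)"
  have A: "0 < A1" "A1 < A2" by (simp_all add: A1_def A2_def)
  obtain b where b: "b > 0" "\<And>y. y \<in> {1 / \<omega>..13 / 10 / \<omega>} \<Longrightarrow> bump (1 / (2 * \<omega>)) (3 / (2 * \<omega>)) y \<ge> b"
    by (rule bump_lower[of "1 / (2 * \<omega>)" "1 / \<omega>" "13 / 10 / \<omega>" "3 / (2 * \<omega>)"]) (use \<omega> in \<open>auto simp: field_simps\<close>)
  \<comment> \<open>Keeps the window within \<delta> \<le> 3 / 10, the range of
    \<open>ln_one_plus_bounds\<close>.\<close>
  define T1 where "T1 = max 1 ((A2 * 10 / 3)\<^sup>2)"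
  \<comment> \<open>The lower bound b / (3 pi) of the integrand on the window times the length of
    the window, which is (A2 - A1) / \<omega> times sqrt T.\<close>
  define c where "c = b / (3 * pi) * ((A2 - A1) / \<omega>)"
  have c: "c > 0" using b A \<omega> by (simp add: c_def)
  have main: "integral {T / (2 * \<omega>)..3 * T / (2 * \<omega>)} (\<lambda>w. sin (\<Theta> T w) * B T w) \<ge> c * sqrt T" if T: "T \<ge> T1" for T
  proof -
    have T0: "T \<ge> 1" "T > 0" using T by (auto simp: T1_def)
    have sT: "A2 * 10 / 3 \<le> sqrt T" using T A by (intro real_le_rsqrt) (auto simp: T1_def)
    define w0 l u where "w0 = T / \<omega>" and "l = T / (2 * \<omega>)" and "u = 3 * T / (2 * \<omega>)"
    have w0: "w0 > 0" "l = w0 / 2" "u = 3 * w0 / 2" "0 < l" "l < w0" "w0 < u" "\<omega> * w0 = T"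
      using \<omega> T0 by (simp_all add: w0_def l_def u_def field_simps)
    let ?B = "B T" and ?\<Theta> = "\<Theta> T"
    define B' where "B' w = bump (1 / (2 * \<omega>)) (3 / (2 * \<omega>)) (w / T) * ((1 / (w / T - 1 / (2 * \<omega>)))\<^sup>2 - (1 / (3 / (2 * \<omega>) - w / T))\<^sup>2) / T" for w
    have in_bump: "1 / (2 * \<omega>) < w / T" "w / T < 3 / (2 * \<omega>)" if "l < w" "w < u" for w
      using that T0 \<omega> by (simp_all add: l_def u_def field_simps)
    have dB: "(?B has_real_derivative B' w) (at w)" if "l < w" "w < u" for w
      unfolding B_def B'_def
      by (rule DERIV_cong[OF DERIV_chain2[OF bump_deriv[OF in_bump[OF that]] DERIV_cdivide[OF DERIV_ident]]]) simp
    have sB: "B' w * (w - w0) \<le> 0" if "l < w" "w < u" for w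
    proof -
      have "w / T - (1 / (2 * \<omega>) + 3 / (2 * \<omega>)) / 2 = (w - w0) / T" using T0 \<omega> by (simp add: w0_def field_simps)
      then have "w - w0 = T * (w / T - (1 / (2 * \<omega>) + 3 / (2 * \<omega>)) / 2)" using T0 by simp
      then have "B' w * (w - w0) = bump (1 / (2 * \<omega>)) (3 / (2 * \<omega>)) (w / T) *
          ((1 / (w / T - 1 / (2 * \<omega>)))\<^sup>2 - (1 / (3 / (2 * \<omega>) - w / T))\<^sup>2) * (w / T - (1 / (2 * \<omega>) + 3 / (2 * \<omega>)) / 2)"
        using T0 by (simp only: B'_def times_divide_eq_left times_divide_eq_right mult.assoc mult.left_commute[of _ T]) simp
      also have "\<dots> \<le> 0" by (rule bump_deriv_sign[OF in_bump[OF that]])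
      finally show ?thesis .
    qed
    have B0: "?B w \<ge> 0" for w unfolding B_def by (rule bump_nonneg)
    have cB: "continuous_on S ?B" for S
      unfolding B_def by (rule continuous_on_compose2[OF bump_continuous[of UNIV]]) (use T0 in \<open>auto intro: continuous_intros\<close>)
    have d\<Theta>: "(?\<Theta> has_real_derivative \<omega> * (w - w0) / w) (at w)" if "w > 0" for w
      unfolding \<Theta>_def using that w0 by (auto intro!: derivative_eq_intros simp: field_simps)
    have \<Theta>0: "?\<Theta> w0 = 0" unfolding \<Theta>_def using w0 by (simp add: w0_def)
    \<comment> \<open>At w0 division by zero gives q the value 0, which is also its limit; so the
      function P below is continuous across the critical point.\<close>
    define q where "q w = (1 - cos (?\<Theta> w)) / (w - w0)" for w
    have q0: "isCont q w0"
    proof -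
      have "((\<lambda>w. 1 - cos (?\<Theta> w)) has_real_derivative 0) (at w0)"
        using d\<Theta>[OF w0(1)] by (auto intro!: derivative_eq_intros)
      then have "((\<lambda>w. (1 - cos (?\<Theta> w) - (1 - cos (?\<Theta> w0))) / (w - w0)) \<longlongrightarrow> 0) (at w0)"
        by (simp add: has_field_derivative_iff)
      then show ?thesis by (simp add: isCont_def q_def[abs_def] \<Theta>0)
    qed
    define P where "P w = q w * (?B w * w / \<omega>)" for w
    define D where "D w = (1 - cos (?\<Theta> w)) * (?B w * w0 / (\<omega> * (w - w0)\<^sup>2) - B' w * w / (\<omega> * (w - w0)))" for w
    have cP: "continuous_on {l..u} P"
    proof -
      have "continuous_on {l..u} q"
      proof (intro continuous_at_imp_continuous_on ballI)
        fix w assume w: "w \<in> {l..u}"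
        show "isCont q w"
        proof (cases "w = w0")
          case False
          have "isCont ?\<Theta> w" using d\<Theta>[of w] w w0 by (intro DERIV_isCont) auto
          then show ?thesis unfolding q_def[abs_def] using False by (intro continuous_intros) auto
        qed (use q0 in simp)
      qed
      then show ?thesis unfolding P_def[abs_def] using \<omega> by (intro continuous_intros cB) auto
    qed
    have dP: "(P has_vector_derivative (sin (?\<Theta> w) * ?B w - D w)) (at w)" if w: "w \<in> {l<..<u} - {w0}" for w
    proof -
      have w': "l < w" "w < u" "w \<noteq> w0" "w > 0" using w w0 by auto
      have "(P has_real_derivative
        ((0 - - sin (?\<Theta> w) * (\<omega> * (w - w0) / w)) * (w - w0) - (1 - cos (?\<Theta> w)) * (1 - 0)) / ((w - w0) * (w - w0)) * (?B w * w / \<omega>)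
          + (B' w * w + 1 * ?B w) / \<omega> * q w) (at w)"
        unfolding P_def[abs_def] q_def[abs_def]
        by (rule DERIV_mult[OF DERIV_divide[OF DERIV_diff[OF DERIV_const DERIV_chain2[OF DERIV_cos d\<Theta>[OF w'(4)]]] DERIV_diff[OF DERIV_ident DERIV_const]]
            DERIV_cdivide[OF DERIV_mult[OF dB[OF w'(1,2)] DERIV_ident]]]) (use w' in simp)
      moreover have "((0 - - sin (?\<Theta> w) * (\<omega> * (w - w0) / w)) * (w - w0) - (1 - cos (?\<Theta> w)) * (1 - 0)) / ((w - w0) * (w - w0)) * (?B w * w / \<omega>)
          + (B' w * w + 1 * ?B w) / \<omega> * q w = sin (?\<Theta> w) * ?B w - D w"
      proof -
        have "X \<noteq> 0 \<Longrightarrow> ((0 - - s * (\<omega> * X / w)) * X - C * (1 - 0)) / (X * X) * (b * w / \<omega>) + (b' * w + 1 * b) / \<omega> * (C / X) =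
            s * b - C * (b * (w - X) / (\<omega> * X\<^sup>2) - b' * w / (\<omega> * X))" for X s C b b'
          using w'(4) \<omega> by (simp add: field_simps power2_eq_square)
        from this[of "w - w0" "sin (?\<Theta> w)" "1 - cos (?\<Theta> w)" "?B w" "B' w"] w'(3) show ?thesis
          unfolding q_def D_def by simp
      qed
      ultimately show ?thesis by (simp add: has_real_derivative_iff_has_vector_derivative)
    qed
    \<comment> \<open>The amplitude vanishes at both ends, hence P leaves no boundary terms, and the
      integral of D equals the one to be bounded.\<close>
    have "?B u = 0" "?B l = 0" unfolding B_def l_def u_def using T0 by (auto intro!: bump_zero)
    then have "((\<lambda>w. sin (?\<Theta> w) * ?B w - D w) has_integral 0) {l..u}"
      using fundamental_theorem_of_calculus_interior_strong[OF _ _ dP cP, of "{w0}"] order_less_trans[OF w0(5,6)]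
      by (simp only: P_def mult_zero_left mult_zero_right div_0 finite.intros less_imp_le diff_zero simp_thms)
    note FTC = this
    have sint: "(\<lambda>w. sin (?\<Theta> w) * ?B w) integrable_on {l..u}"
    proof (rule integrable_continuous_interval)
      have "continuous_on {l..u} ?\<Theta>"
        using w0(4) by (intro continuous_at_imp_continuous_on ballI DERIV_isCont[OF d\<Theta>]) auto
      then show "continuous_on {l..u} (\<lambda>w. sin (?\<Theta> w) * ?B w)" by (intro continuous_intros cB)
    qed
    have Dint: "(D has_integral integral {l..u} (\<lambda>w. sin (?\<Theta> w) * ?B w)) {l..u}"
      using has_integral_diff[OF integrable_integral[OF sint] FTC] by simp
    \<comment> \<open>The term with \<open>B'\<close> has the favourable sign on both sides of w0
      and is dropped.\<close>
    have Dlow: "D w \<ge> (1 - cos (?\<Theta> w)) * (?B w * w0 / (\<omega> * (w - w0)\<^sup>2))" if "l < w" "w < u" for w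
    proof -
      have "B' w * w / (\<omega> * (w - w0)) \<le> 0"
      proof (cases "w = w0")
        case False
        have "B' w * w / (\<omega> * (w - w0)) = (B' w * (w - w0)) * (w / (\<omega> * (w - w0)\<^sup>2))"
          using False \<omega> by (simp add: power2_eq_square)
        also have "\<dots> \<le> 0" using \<omega> w0 that
          by (intro mult_nonpos_nonneg[OF sB[OF that]] divide_nonneg_nonneg mult_nonneg_nonneg) auto
        finally show ?thesis .
      qed simp
      then show ?thesis unfolding D_def by (intro mult_left_mono) auto
    qed
    have D0: "D w \<ge> 0" if "w \<in> {l..u}" for w
    proof (cases "w = l \<or> w = u")
      case True
      then have "?B w = 0" using \<open>?B u = 0\<close> \<open>?B l = 0\<close> by auto
      moreover have "B' w = 0" using \<open>?B w = 0\<close> by (simp add: B'_def B_def)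
      ultimately show ?thesis by (simp add: D_def)
    next
      case False
      have "0 \<le> (1 - cos (?\<Theta> w)) * (?B w * w0 / (\<omega> * (w - w0)\<^sup>2))"
        using B0 \<omega> w0 by (intro mult_nonneg_nonneg divide_nonneg_nonneg) auto
      then show ?thesis using Dlow[of w] False that by auto
    qed
    define v1 v2 where "v1 = w0 + A1 * sqrt T / \<omega>" and "v2 = w0 + A2 * sqrt T / \<omega>"
    have small: "A2 * sqrt T \<le> 3 / 10 * T"
    proof -
      have "A2 * 10 / 3 * sqrt T \<le> sqrt T * sqrt T" using sT T0 by (intro mult_right_mono) auto
      then show ?thesis using T0 by simp
    qed
    have v: "w0 < v1" "v1 < v2" "v2 \<le> w0 + 3 / 10 * w0"
    proof -
      show "w0 < v1" "v1 < v2" using A \<omega> T0 by (simp_all add: v1_def v2_def divide_strict_right_mono)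
      have "A2 * sqrt T / \<omega> \<le> 3 / 10 * T / \<omega>" using small \<omega> by (intro divide_right_mono) auto
      then show "v2 \<le> w0 + 3 / 10 * w0" by (simp add: v2_def w0_def)
    qed
    have win: "D w \<ge> b / (3 * pi)" if w: "w \<in> {v1..v2}" for w
    proof -
      have lw: "l < w" "w < u" using w v w0 by auto
      define \<delta> where "\<delta> = (w - w0) / w0"
      have \<delta>: "0 < \<delta>" "\<delta> \<le> 3 / 10" "w = w0 * (1 + \<delta>)" "w - w0 = w0 * \<delta>"
        using w v w0 by (auto simp: \<delta>_def field_simps)
      have \<delta>T: "5 * pi / 4 \<le> T * \<delta>\<^sup>2" "T * \<delta>\<^sup>2 \<le> 3 * pi"
      proof -
        have "\<delta> = \<omega> * (w - w0) / T" using w0 \<omega> by (simp add: \<delta>_def w0_def)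
        moreover have "A1 * sqrt T \<le> \<omega> * (w - w0)" "\<omega> * (w - w0) \<le> A2 * sqrt T"
          using w \<omega> by (auto simp: v1_def v2_def field_simps)
        ultimately have "A1 * sqrt T \<le> T * \<delta>" "T * \<delta> \<le> A2 * sqrt T" using T0 by simp_all
        then have "(A1 * sqrt T)\<^sup>2 \<le> (T * \<delta>)\<^sup>2" "(T * \<delta>)\<^sup>2 \<le> (A2 * sqrt T)\<^sup>2"
          using A T0 \<delta>(1) by (auto intro!: power_mono)
        then have "5 * pi / 4 * T \<le> T * \<delta>\<^sup>2 * T" "T * \<delta>\<^sup>2 * T \<le> 3 * pi * T"
          using T0 by (simp_all add: power_mult_distrib A1_def A2_def power2_eq_square[of T] power2_eq_square[of \<delta>] mult_ac)
        then show "5 * pi / 4 \<le> T * \<delta>\<^sup>2" "T * \<delta>\<^sup>2 \<le> 3 * pi" using T0 by (simp_all add: mult_ac)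
      qed
      have \<Theta>w: "?\<Theta> w = T * (\<delta> - ln (1 + \<delta>))"
      proof -
        have "ln w = ln w0 + ln (1 + \<delta>)" unfolding \<delta>(3) using w0 \<delta> by (intro ln_mult_pos) auto
        moreover have "\<omega> * w = T + T * \<delta>" unfolding \<delta>(3) using w0(7) by (simp add: distrib_left flip: mult.assoc)
        ultimately show ?thesis unfolding \<Theta>_def by (simp add: w0_def[symmetric] algebra_simps)
      qed
      have "\<delta> - ln (1 + \<delta>) \<le> \<delta>\<^sup>2 / 2" "\<delta>\<^sup>2 / 2 * (8 / 10) \<le> \<delta> - ln (1 + \<delta>)"
        using ln_one_plus_bounds[OF \<delta>(1,2)] by auto
      then have "?\<Theta> w \<le> T * (\<delta>\<^sup>2 / 2)" "T * (\<delta>\<^sup>2 / 2 * (8 / 10)) \<le> ?\<Theta> w"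
        unfolding \<Theta>w using T0 by (auto intro!: mult_left_mono)
      then have "pi / 2 \<le> ?\<Theta> w" "?\<Theta> w \<le> 3 * pi / 2" using \<delta>T by auto
      then have "cos (?\<Theta> w - pi) \<ge> 0" by (intro cos_ge_zero) auto
      then have "1 - cos (?\<Theta> w) \<ge> 1" by (simp add: cos_diff)
      moreover have "?B w * w0 / (\<omega> * (w - w0)\<^sup>2) \<ge> b / (3 * pi)"
      proof -
        have "w0 / (\<omega> * (w - w0)\<^sup>2) = 1 / (T * \<delta>\<^sup>2)" unfolding \<delta>(4) using w0 by (simp add: power_mult_distrib power2_eq_square)
        moreover have "1 / (T * \<delta>\<^sup>2) \<ge> 1 / (3 * pi)" using \<delta>T T0 \<delta>(1) by (intro divide_left_mono) auto
        moreover have "?B w \<ge> b" unfolding B_def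
        proof (rule b(2))
          have "w / T = (1 + \<delta>) / \<omega>" unfolding \<delta>(3) w0_def using T0 by simp
          then show "w / T \<in> {1 / \<omega>..13 / 10 / \<omega>}"
            unfolding atLeastAtMost_iff by (simp only:) (intro conjI divide_right_mono; use \<delta>(1,2) \<omega> in linarith)
        qed
        ultimately have "b * (1 / (3 * pi)) \<le> ?B w * (w0 / (\<omega> * (w - w0)\<^sup>2))"
          using b(1) B0 by (intro mult_mono) auto
        then show ?thesis by simp
      qed
      ultimately have "1 * (b / (3 * pi)) \<le> (1 - cos (?\<Theta> w)) * (?B w * w0 / (\<omega> * (w - w0)\<^sup>2))"
        using b(1) by (intro mult_mono) auto
      then show ?thesis using Dlow[OF lw] by simp
    qed
    have sub: "{v1..v2} \<subseteq> {l..u}" using v w0 by auto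
    have Di: "D integrable_on {l..u}" using Dint by blast
    then have Di': "D integrable_on {v1..v2}" using sub integrable_on_subinterval by blast
    have "c * sqrt T = integral {v1..v2} (\<lambda>w. b / (3 * pi))"
    proof -
      have "v2 - v1 = (A2 - A1) / \<omega> * sqrt T" by (simp add: v1_def v2_def diff_divide_distrib left_diff_distrib)
      then show ?thesis using v(2) by (simp add: c_def mult_ac)
    qed
    also have "\<dots> \<le> integral {v1..v2} D" by (rule integral_le) (use Di' win in auto)
    also have "\<dots> \<le> integral {l..u} D" by (rule integral_subset_le[OF sub Di' Di]) (use D0 in auto)
    also have "\<dots> = integral {l..u} (\<lambda>w. sin (?\<Theta> w) * ?B w)" using Dint by (rule integral_unique)
    finally show ?thesis by (simp only: l_def u_def)
  qed
  show thesis by (rule that[of c T1]) (use c main in \<open>auto simp: T1_def\<close>)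
qed

section \<open>Iterating the resolvent on test sections\<close>

text \<open>The oscillation of \<open>osc\<close> with an amplitude spread over the scale |t|, like
  f on its plateau. On sections with such a slot, a acts to leading order as multiplication by a
  function of size |t|^2.\<close>

definition osc2 :: "real \<Rightarrow> (real \<Rightarrow> complex) \<Rightarrow> real \<Rightarrow> real \<Rightarrow> complex" where
  "osc2 \<omega> \<psi> t w = cis (- (sgn t * \<omega>) * w) * \<psi> (w / \<bar>t\<bar>)"

lemma osc2_deriv:
  assumes "smooth \<psi>"
  shows "(osc2 \<omega> \<psi> t has_vector_derivative
    (- \<i> * of_real (sgn t * \<omega>)) * osc2 \<omega> \<psi> t w + of_real (1 / \<bar>t\<bar>) * osc2 \<omega> (vd \<psi>) t w) (at w)"
proof -
  have "((\<lambda>w. \<psi> ((1 / \<bar>t\<bar>) * w + 0)) has_vector_derivative of_real (1 / \<bar>t\<bar>) * vd \<psi> ((1 / \<bar>t\<bar>) * w + 0)) (at w)"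
    by (rule affine_deriv[OF smooth_deriv[OF assms]])
  then have "((\<lambda>w. \<psi> (w / \<bar>t\<bar>)) has_vector_derivative of_real (1 / \<bar>t\<bar>) * vd \<psi> (w / \<bar>t\<bar>)) (at w)" by simp
  then show ?thesis
    unfolding osc2_def[abs_def]
    by (rule has_vector_derivative_eq_rhs[OF has_vector_derivative_mult[OF cis_deriv]]) (simp add: algebra_simps)
qed

lemma smooth_osc2: "smooth \<psi> \<Longrightarrow> smooth (osc2 \<omega> \<psi> t)"
  using smooth_mult[OF smooth_cis smooth_affine[of \<psi> "1 / \<bar>t\<bar>" 0], of "- (sgn t * \<omega>)"]
  unfolding osc2_def[abs_def] by simp

lemma test_on_osc2:
  assumes "t \<noteq> 0" "test_on l u \<psi>"
  shows "test_on (l * \<bar>t\<bar>) (u * \<bar>t\<bar>) (osc2 \<omega> \<psi> t)"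
  using assms by (auto simp: test_on_def smooth_osc2 osc2_def field_simps)

lemma resolv_linear:
  assumes "i \<noteq> j" "f \<in> V pm t i j" "g \<in> V pm t i j"
  shows "resolv Y (\<lambda>x. f x + g x) x = resolv Y f x + resolv Y g x"
    and "resolv Y (\<lambda>x. c * f x) x = c * resolv Y f x"
proof -
  have 1: "LY Y (\<lambda>x. f x + g x) = (\<lambda>x. LY Y f x + LY Y g x)" "LY Y (\<lambda>x. c * f x) = (\<lambda>x. c * LY Y f x)"
    by (rule LY_add[OF assms(2,3)]) (rule LY_cmult[OF assms(2)])
  note V = V_LY[OF assms(1,2), of Y] V_LY[OF assms(1,3), of Y]
  show "resolv Y (\<lambda>x. f x + g x) x = resolv Y f x + resolv Y g x"
    unfolding resolv_def 1 LY_add[OF V] by simp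
  show "resolv Y (\<lambda>x. c * f x) x = c * resolv Y f x"
    unfolding resolv_def 1 LY_cmult[OF V(1)] by (simp add: right_diff_distrib)
qed

lemma fspan_hnorm2_bound:
  assumes "F \<in> fspan T0 S"
    and "\<And>F. F \<in> S \<Longrightarrow> \<exists>C\<ge>0. \<forall>t. \<bar>t\<bar> \<ge> T0 \<longrightarrow> F t \<in> borel_measurable borel \<and> hnorm2 (F t) \<le> ennreal (C * w t)"
    and w: "\<And>t. w t \<ge> 0"
  shows "\<exists>C\<ge>0. \<forall>t. \<bar>t\<bar> \<ge> T0 \<longrightarrow> F t \<in> borel_measurable borel \<and> hnorm2 (F t) \<le> ennreal (C * w t)"
  using assms(1)
proof (induction rule: fspan.induct)
  case (add F H)
  then obtain C D where C: "C \<ge> 0" "\<And>t. \<bar>t\<bar> \<ge> T0 \<Longrightarrow> F t \<in> borel_measurable borel" "\<And>t. \<bar>t\<bar> \<ge> T0 \<Longrightarrow> hnorm2 (F t) \<le> ennreal (C * w t)"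
    and D: "D \<ge> 0" "\<And>t. \<bar>t\<bar> \<ge> T0 \<Longrightarrow> H t \<in> borel_measurable borel" "\<And>t. \<bar>t\<bar> \<ge> T0 \<Longrightarrow> hnorm2 (H t) \<le> ennreal (D * w t)" by metis
  have "hnorm2 (\<lambda>x. F t x + H t x) \<le> ennreal ((2 * C + 2 * D) * w t)" if t: "\<bar>t\<bar> \<ge> T0" for t
  proof -
    have "hnorm2 (\<lambda>x. F t x + H t x) \<le> 2 * hnorm2 (F t) + 2 * hnorm2 (H t)"
      by (rule hnorm2_add_le) (auto intro!: C D t)
    also have "\<dots> \<le> 2 * ennreal (C * w t) + 2 * ennreal (D * w t)" by (intro add_mono mult_left_mono C D t) auto
    also have "\<dots> = ennreal ((2 * C + 2 * D) * w t)"
      using C D w[of t] by (simp add: distrib_right ennreal_mult' mult.assoc)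
    finally show ?thesis .
  qed
  then show ?case using C D by (intro exI[of _ "2 * C + 2 * D"]) auto
next
  case (cmult F c)
  then obtain C M where C: "C \<ge> 0" "\<And>t. \<bar>t\<bar> \<ge> T0 \<Longrightarrow> F t \<in> borel_measurable borel" "\<And>t. \<bar>t\<bar> \<ge> T0 \<Longrightarrow> hnorm2 (F t) \<le> ennreal (C * w t)"
    and M: "\<And>t. \<bar>t\<bar> \<ge> T0 \<Longrightarrow> cmod (c t) \<le> M" unfolding bdd_from_def by metis
  have "hnorm2 (\<lambda>x. c t * F t x) \<le> ennreal (M\<^sup>2 * C * w t)" if t: "\<bar>t\<bar> \<ge> T0" for t
  proof -
    have "hnorm2 (\<lambda>x. c t * F t x) = ennreal ((cmod (c t))\<^sup>2) * hnorm2 (F t)"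
      by (rule hnorm2_cmult) (auto intro!: C t)
    also have "\<dots> \<le> ennreal (M\<^sup>2) * ennreal (C * w t)"
      by (intro mult_mono C t ennreal_leI power_mono M) auto
    finally show ?thesis by (simp add: ennreal_mult' mult.assoc)
  qed
  then show ?case using C by (intro exI[of _ "M\<^sup>2 * C"]) auto
next
  case (cong F H)
  then have "H t = F t" if "\<bar>t\<bar> \<ge> T0" for t using that by blast
  then show ?case using cong(3) by simp
qed (use assms(2) in blast)

section \<open>Sections oscillating on the scale of t\<close>

context chart_params begin

definition Q0 :: "(real \<Rightarrow> real^'n \<Rightarrow> complex) set" where
  "Q0 = {\<lambda>t. sec pm t j (\<kappa>(i := osc2 \<omega> \<psi> t)) |\<kappa> \<psi> p q. p > 0 \<and> test_on p q \<psi> \<and> (\<forall>a. test (\<kappa> a))}"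

abbreviation Q where "Q \<equiv> fspan T0 Q0"

definition osec :: "('n \<Rightarrow> real \<Rightarrow> complex) \<Rightarrow> (real \<Rightarrow> complex) \<Rightarrow> real \<Rightarrow> real^'n \<Rightarrow> complex" where
  "osec \<kappa> \<psi> t = sec pm t j (\<kappa>(i := osc2 \<omega> \<psi> t))"

lemma osec_Q: "p > 0 \<Longrightarrow> test_on p q \<psi> \<Longrightarrow> (\<And>a. test (\<kappa> a)) \<Longrightarrow> osec \<kappa> \<psi> \<in> Q"
  unfolding osec_def[abs_def] by (rule fspan.base) (auto simp: Q0_def)

lemma Q0E:
  assumes "F \<in> Q0"
  obtains \<kappa> \<psi> p q where "F = osec \<kappa> \<psi>" "p > 0" "test_on p q \<psi>" "\<And>a. test (\<kappa> a)"
  using assms unfolding Q0_def osec_def[abs_def] by blast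

lemma test_pos_osc2: "p > 0 \<Longrightarrow> test_on p q \<psi> \<Longrightarrow> \<bar>t\<bar> \<ge> T0 \<Longrightarrow> test_pos (osc2 \<omega> \<psi> t)"
  by (rule test_on_pos[OF _ test_on_osc2]) (use dom in auto)

lemma Q0_V: "F \<in> Q0 \<Longrightarrow> \<bar>t\<bar> \<ge> T0 \<Longrightarrow> F t \<in> V pm t i j"
  by (auto elim!: Q0E simp: osec_def slots_def intro!: V.sec test_pos_test test_pos_osc2)

lemma Q_V: "F \<in> Q \<Longrightarrow> \<bar>t\<bar> \<ge> T0 \<Longrightarrow> F t \<in> V pm t i j"
  using fspan_linear[of F T0 Q0 "\<lambda>t f. f" Q0 "\<lambda>t f. f \<in> V pm t i j"]
  by (simp add: fspan.base Q0_V V.add V.cmult)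

lemma Q_bound:
  assumes "F \<in> Q"
  shows "\<exists>C\<ge>0. \<forall>t. \<bar>t\<bar> \<ge> T0 \<longrightarrow> F t \<in> borel_measurable borel \<and> hnorm2 (F t) \<le> ennreal (C * \<bar>t\<bar>)"
proof (rule fspan_hnorm2_bound[OF assms])
  fix F assume F0: "F \<in> Q0"
  obtain \<kappa> \<psi> p q where F: "F = osec \<kappa> \<psi>" "p > 0" "test_on p q \<psi>" and \<kappa>: "\<And>a. test (\<kappa> a)"
    by (rule Q0E[OF F0]) blast
  obtain C where C: "C \<ge> 0"
    "\<And>f A R pm t. A \<ge> 0 \<Longrightarrow> R \<ge> 0 \<Longrightarrow> test_pos f \<Longrightarrow> (\<And>w. cmod (f w) \<le> A) \<Longrightarrow> (\<And>w. f w \<noteq> 0 \<Longrightarrow> \<bar>w\<bar> \<le> R) \<Longrightarrow>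
       hnorm2 (sec pm t j (\<kappa>(i := f))) \<le> ennreal (C * A\<^sup>2 * R)"
    by (rule sec_hnorm2_box[of i j \<kappa>, OF ij \<kappa>]) blast
  obtain M where M: "M \<ge> 0" "\<And>x. cmod (\<psi> x) \<le> M" by (rule test_on_bounded[OF F(3)]) blast
  have "hnorm2 (F t) \<le> ennreal (C * M\<^sup>2 * \<bar>q\<bar> * \<bar>t\<bar>)" if t: "\<bar>t\<bar> \<ge> T0" for t
  proof -
    have "hnorm2 (F t) \<le> ennreal (C * M\<^sup>2 * (\<bar>q\<bar> * \<bar>t\<bar>))"
      unfolding F(1) osec_def
    proof (rule C(2))
      show "test_pos (osc2 \<omega> \<psi> t)" by (rule test_pos_osc2[OF F(2,3) t])
      show "cmod (osc2 \<omega> \<psi> t w) \<le> M" for w by (simp add: osc2_def norm_mult M)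
      fix w assume "osc2 \<omega> \<psi> t w \<noteq> 0"
      then have "p * \<bar>t\<bar> \<le> w" "w \<le> q * \<bar>t\<bar>"
        using test_on_osc2[OF dom[OF t] F(3), of \<omega>] by (auto simp: test_on_def)
      moreover have "p * \<bar>t\<bar> \<ge> 0" "q * \<bar>t\<bar> \<le> \<bar>q\<bar> * \<bar>t\<bar>" using F(2) by (auto intro: mult_right_mono)
      ultimately show "\<bar>w\<bar> \<le> \<bar>q\<bar> * \<bar>t\<bar>" by linarith
    qed (use M in auto)
    then show ?thesis by (simp only: mult.assoc)
  qed
  then show "\<exists>C\<ge>0. \<forall>t. \<bar>t\<bar> \<ge> T0 \<longrightarrow> F t \<in> borel_measurable borel \<and> hnorm2 (F t) \<le> ennreal (C * \<bar>t\<bar>)"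
    using C(1) M(1) Q0_V[OF F0] by (intro exI[of _ "C * M\<^sup>2 * \<bar>q\<bar>"]) (auto intro: V_measurable)
qed simp

text \<open>The symbol of a on the scale w = |t| y: the operator w (w d/dw + i t) multiplies
  \<open>osc2\<close> to leading order by i sgn t |t|^2 (y - \<omega> y^2). It is positive between
  its zeros 0 and 1 / \<omega>, the latter being the resonance of the chirp.\<close>

definition phase :: "real \<Rightarrow> complex" where
  "phase y = of_real y - of_real \<omega> * (of_real y * of_real y)"

lemma smooth_phase: "smooth phase"
  unfolding phase_def[abs_def] diff_conv_add_uminus mult_minus_left[symmetric]
  by (intro smooth_add smooth_mult smooth_const smooth_of_real)

lemma smooth_power: "smooth f \<Longrightarrow> smooth (\<lambda>x. f x ^ n)"
  by (induction n) (auto intro: smooth_const smooth_mult)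

context
  fixes \<beta> :: real
begin

abbreviation "Y \<equiv> \<beta> *\<^sub>R eunit j i"

text \<open>The part of \<open>LY Y\<close> of order |t|: the derivative of the amplitude, the
  derivatives of the other slots, and the constant n / 2.\<close>

definition osec_err :: "('n \<Rightarrow> real \<Rightarrow> complex) \<Rightarrow> (real \<Rightarrow> complex) \<Rightarrow> real \<Rightarrow> real^'n \<Rightarrow> complex" where
  "osec_err \<kappa> \<psi> t x = osec \<kappa> (\<lambda>y. of_real y * (of_real y * vd \<psi> y)) t x +
     (\<Sum>a\<in>UNIV - {j} - {i}. osec (\<kappa>(a := \<lambda>y. of_real y * vd (\<kappa> a) y)) (\<lambda>y. of_real y * \<psi> y) t x) +
     of_real (real CARD('n) / 2) * osec \<kappa> (\<lambda>y. of_real y * \<psi> y) t x"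

lemma osec_err_Q:
  assumes "p > 0" "test_on p q \<psi>" "\<And>a. test (\<kappa> a)"
  shows "osec_err \<kappa> \<psi> \<in> Q"
  unfolding osec_err_def[abs_def]
  by (intro fspan.add fspan_sum[OF _ _ osec_Q[OF assms]] fspan_scale osec_Q[OF assms(1)] test_on_mult_id test_on_vd assms)
    (use assms in \<open>auto intro: test_vd test_mult smooth_of_real\<close>)

lemma LY_osec:
  assumes "p > 0" "test_on p q \<psi>" "\<And>a. test (\<kappa> a)" "\<bar>t\<bar> \<ge> T0"
  shows "LY Y (osec \<kappa> \<psi> t) x =
    of_real \<beta> * (of_real (\<bar>t\<bar>\<^sup>2) * (\<i> * of_real (sgn t)) * osec \<kappa> (\<lambda>y. phase y * \<psi> y) t x + of_real \<bar>t\<bar> * osec_err \<kappa> \<psi> t x)"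
proof -
  have t: "t \<noteq> 0" using dom assms by blast
  have ts: "complex_of_real t = of_real (sgn t) * of_real \<bar>t\<bar>"
    by (metis of_real_mult sgn_mult_abs)
  have test: "test (osc2 \<omega> \<psi> t)" by (rule test_pos_test[OF test_pos_osc2[OF assms(1,2,4)]])
  have sm: "smooth \<psi>" using assms by (simp add: test_on_def)
  \<comment> \<open>Y has no entry other than (j, i). Of the five sums in \<open>LY_slot\<close> the
    first two vanish and the others keep only b = i.\<close>
  have Yij: "Y $ a $ b = (if a = j \<and> b = i then \<beta> else 0)" for a b by (simp add: eunit_def)
  have sum1: "(\<Sum>b\<in>UNIV. of_real (Y$j$b) * h b) = of_real \<beta> * h i" for h :: "'n \<Rightarrow> complex"
    by (subst sum.remove[of _ i]) (auto simp: Yij)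
  have sum2: "(\<Sum>b\<in>UNIV. of_real (Y$j$b * c) * h b) = of_real (\<beta> * c) * h i" for h :: "'n \<Rightarrow> complex" and c
    by (subst sum.remove[of _ i]) (auto simp: Yij)
  have sum3: "(\<Sum>b\<in>UNIV. \<Sum>a\<in>A. of_real (Y$j$b) * h a b) = of_real \<beta> * (\<Sum>a\<in>A. h a i)" for h :: "'n \<Rightarrow> 'n \<Rightarrow> complex" and A
    by (subst sum.remove[of _ i]) (auto simp: Yij sum_distrib_left)
  have sum4: "(\<Sum>b\<in>UNIV. \<Sum>a\<in>UNIV - {j} - {i}. of_real (- Y$a$b) * h a b) = 0" for h :: "'n \<Rightarrow> 'n \<Rightarrow> complex"
    by (intro sum.neutral ballI) (simp add: Yij)
  have sum5: "(\<Sum>b\<in>UNIV. of_real (- Y$i$b) * h b) = 0" for h :: "'n \<Rightarrow> complex"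
    using ij by (simp add: Yij)
  have mul: "(\<lambda>w. of_real w * osc2 \<omega> f t w) = (\<lambda>w. of_real \<bar>t\<bar> * osc2 \<omega> (\<lambda>y. of_real y * f y) t w)" for f
    using t by (simp add: osc2_def fun_eq_iff)
  have eul: "(\<lambda>w. of_real w * eul t (osc2 \<omega> \<psi> t) w) = (\<lambda>w. (of_real (\<bar>t\<bar>\<^sup>2) * (\<i> * of_real (sgn t))) * osc2 \<omega> (\<lambda>y. phase y * \<psi> y) t w +
      of_real \<bar>t\<bar> * osc2 \<omega> (\<lambda>y. of_real y * (of_real y * vd \<psi> y)) t w)"
  proof
    fix w
    define y where "y = w / \<bar>t\<bar>"
    have wy: "w / \<bar>t\<bar> = y" by (simp add: y_def)
    have ww: "complex_of_real w = of_real \<bar>t\<bar> * of_real y" using t by (simp add: y_def)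
    have alg: "T * y * (T * y * (- \<i> * (s * o') * (c * p) + 1 / T * (c * d)) + \<i> * (s * T) * (c * p)) =
      T\<^sup>2 * (\<i> * s) * (c * ((y - o' * (y * y)) * p)) + T * (c * (y * (y * d)))"
      if "T \<noteq> 0" for T y s o' c p d :: complex
      using that by (simp add: field_simps power2_eq_square)
    show "of_real w * eul t (osc2 \<omega> \<psi> t) w = (of_real (\<bar>t\<bar>\<^sup>2) * (\<i> * of_real (sgn t))) * osc2 \<omega> (\<lambda>y. phase y * \<psi> y) t w +
      of_real \<bar>t\<bar> * osc2 \<omega> (\<lambda>y. of_real y * (of_real y * vd \<psi> y)) t w"
      unfolding eul_def vd_eq[OF osc2_deriv[OF sm]] osc2_def phase_def wy ww ts of_real_mult of_real_divide of_real_1 of_real_power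
      by (rule alg) (use t in simp)
  qed
  have e: "sec pm t j (\<kappa>(i := \<lambda>w. of_real w * osc2 \<omega> \<psi> t w)) x = of_real \<bar>t\<bar> * osec \<kappa> (\<lambda>y. of_real y * \<psi> y) t x" for \<kappa>
    unfolding mul sec_slot_scale[OF ij] osec_def ..
  show ?thesis
    unfolding osec_def[of \<kappa> \<psi>] LY_slot[of \<kappa>, OF assms(3) test] sum1 sum2 sum3 sum4 sum5 mulX_same eul e
      sec_slot_add[OF ij] sec_slot_scale[OF ij] osec_err_def
    by (simp add: osec_def algebra_simps flip: sum_distrib_left)
qed

lemma LY_Q:
  assumes "F \<in> Q"
  shows "(\<lambda>t x. of_real (1 / \<bar>t\<bar>\<^sup>2) * LY Y (F t) x) \<in> Q"
proof -
  have base: "(\<lambda>t x. of_real (1 / \<bar>t\<bar>\<^sup>2) * LY Y (F t) x) \<in> Q" if F0: "F \<in> Q0" for F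
  proof -
    obtain \<kappa> \<psi> p q where F: "F = osec \<kappa> \<psi>" "p > 0" "test_on p q \<psi>" and \<kappa>: "\<And>a. test (\<kappa> a)"
      by (rule Q0E[OF F0]) blast
    have "(\<lambda>t x. of_real \<beta> * ((\<i> * of_real (sgn t)) * osec \<kappa> (\<lambda>y. phase y * \<psi> y) t x + of_real (1 / \<bar>t\<bar>) * osec_err \<kappa> \<psi> t x)) \<in> Q"
      by (intro fspan_scale fspan.add sgn_X div_X osec_err_Q[OF F(2,3) \<kappa>] osec_Q[OF F(2) test_on_mult[OF F(3) smooth_phase] \<kappa>])
    then show ?thesis
    proof (rule fspan.cong)
      fix t x assume t: "\<bar>t\<bar> \<ge> T0"
      have alg: "1 / T\<^sup>2 * (b * (T\<^sup>2 * s * m + T * e)) = b * (s * m + 1 / T * e)" if "T \<noteq> 0" for T b s m e :: complex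
        using that by (simp add: field_simps power2_eq_square)
      show "of_real (1 / \<bar>t\<bar>\<^sup>2) * LY Y (F t) x =
          of_real \<beta> * ((\<i> * of_real (sgn t)) * osec \<kappa> (\<lambda>y. phase y * \<psi> y) t x + of_real (1 / \<bar>t\<bar>) * osec_err \<kappa> \<psi> t x)"
        unfolding F(1) LY_osec[OF F(2,3) \<kappa> t] of_real_divide of_real_power of_real_1
        by (rule alg) (use dom[OF t] in simp)
    qed
  qed
  show ?thesis
    using fspan_linear[OF assms, of "\<lambda>t f x. of_real (1 / \<bar>t\<bar>\<^sup>2) * LY Y f x" Q0 "\<lambda>t f. f \<in> V pm t i j"] base Q0_V
    by (simp add: V.add V.cmult LY_add LY_cmult add_divide_distrib)
qed

lemma osec_V: "p > 0 \<Longrightarrow> test_on p q \<psi> \<Longrightarrow> (\<And>a. test (\<kappa> a)) \<Longrightarrow> \<bar>t\<bar> \<ge> T0 \<Longrightarrow> osec \<kappa> \<psi> t \<in> V pm t i j"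
  by (rule Q_V[OF osec_Q])

lemma pow_X: "F \<in> fspan T0 S' \<Longrightarrow> (\<lambda>t x. of_real ((1 / \<bar>t\<bar>) ^ n) * F t x) \<in> fspan T0 S'"
proof (induction n)
  case (Suc n)
  then have "(\<lambda>t x. of_real ((1 / \<bar>t\<bar>) ^ n) * F t x) \<in> fspan T0 S'" by blast
  from div_X[OF this] show ?case by (simp add: mult.assoc)
qed simp

lemma resolv_Q:
  assumes "F \<in> Q"
  shows "(\<lambda>t x. of_real ((1 / \<bar>t\<bar>) ^ 4) * resolv Y (F t) x) \<in> Q"
proof (rule fspan.cong[OF fspan_diff[OF pow_X[OF assms, of 4] LY_Q[OF LY_Q[OF assms]]]])
  fix t x assume t: "\<bar>t\<bar> \<ge> T0"
  have "LY Y (\<lambda>x. of_real (1 / \<bar>t\<bar>\<^sup>2) * LY Y (F t) x) x = of_real (1 / \<bar>t\<bar>\<^sup>2) * LY Y (LY Y (F t)) x"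
    by (simp only: LY_cmult[OF V_LY[OF ij Q_V[OF assms t]]])
  then show "of_real ((1 / \<bar>t\<bar>) ^ 4) * resolv Y (F t) x =
      of_real ((1 / \<bar>t\<bar>) ^ 4) * F t x - of_real (1 / \<bar>t\<bar>\<^sup>2) * LY Y (\<lambda>x. of_real (1 / \<bar>t\<bar>\<^sup>2) * LY Y (F t) x) x"
    unfolding resolv_def by (simp add: power_divide right_diff_distrib flip: power_add)
qed

text \<open>Applying the leading part of \<open>LY Y\<close> twice gives - \<beta>^2 |t|^4 times the
  square of \<open>phase\<close>, and the sign turns in I - a^2. The factor |t| in front expresses
  that all other terms, the identity among them, are smaller by 1 / |t|.\<close>

lemma resolv_osec:
  assumes "p > 0" "test_on p q \<psi>" and \<kappa>: "\<And>a. test (\<kappa> a)"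
  shows "(\<lambda>t x. of_real \<bar>t\<bar> * (of_real ((1 / \<bar>t\<bar>) ^ 4) * resolv Y (osec \<kappa> \<psi> t) x -
      of_real (\<beta>\<^sup>2) * osec \<kappa> (\<lambda>y. phase y ^ 2 * \<psi> y) t x)) \<in> Q"
proof -
  have \<psi>1: "test_on p q (\<lambda>y. phase y * \<psi> y)" by (rule test_on_mult[OF assms(2) smooth_phase])
  have "(\<lambda>t x. of_real ((1 / \<bar>t\<bar>) ^ 3) * osec \<kappa> \<psi> t x - (of_real (\<beta> * \<beta>) * ((\<i> * of_real (sgn t)) * osec_err \<kappa> (\<lambda>y. phase y * \<psi> y) t x) +
      of_real \<beta> * (of_real (1 / \<bar>t\<bar>\<^sup>2) * LY Y (osec_err \<kappa> \<psi> t) x))) \<in> Q"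
    by (intro fspan_diff pow_X fspan.add fspan_scale sgn_X LY_Q osec_err_Q[OF assms] osec_err_Q[OF assms(1) \<psi>1 \<kappa>] osec_Q[OF assms])
  then show ?thesis
  proof (rule fspan.cong)
    fix t x assume t: "\<bar>t\<bar> \<ge> T0"
    note t0 = dom[OF t]
    let ?f = "osec \<kappa> (\<lambda>y. phase y * \<psi> y) t" and ?e = "osec_err \<kappa> \<psi> t"
    have V: "?f \<in> V pm t i j" "?e \<in> V pm t i j"
      by (rule osec_V[OF assms(1) \<psi>1 \<kappa> t]) (rule Q_V[OF osec_err_Q[OF assms] t])
    have L1: "LY Y (osec \<kappa> \<psi> t) = (\<lambda>x. of_real \<beta> * (of_real (\<bar>t\<bar>\<^sup>2) * (\<i> * of_real (sgn t)) * ?f x + of_real \<bar>t\<bar> * ?e x))"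
      by (rule ext) (rule LY_osec[OF assms t])
    have "LY Y (LY Y (osec \<kappa> \<psi> t)) x =
       of_real \<beta> * (of_real (\<bar>t\<bar>\<^sup>2) * (\<i> * of_real (sgn t)) * LY Y ?f x + of_real \<bar>t\<bar> * LY Y ?e x)"
      unfolding L1
      by (simp only: LY_cmult[OF V.add[OF V.cmult[OF V(1)] V.cmult[OF V(2)]]] LY_add[OF V.cmult[OF V(1)] V.cmult[OF V(2)]] LY_cmult[OF V(1)] LY_cmult[OF V(2)])
    also have "LY Y ?f x = of_real \<beta> * (of_real (\<bar>t\<bar>\<^sup>2) * (\<i> * of_real (sgn t)) * osec \<kappa> (\<lambda>y. phase y ^ 2 * \<psi> y) t x
        + of_real \<bar>t\<bar> * osec_err \<kappa> (\<lambda>y. phase y * \<psi> y) t x)"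
      using LY_osec[OF assms(1) \<psi>1 \<kappa> t] by (simp add: power2_eq_square mult.assoc)
    finally have L2: "LY Y (LY Y (osec \<kappa> \<psi> t)) x = of_real \<beta> * (of_real (\<bar>t\<bar>\<^sup>2) * (\<i> * of_real (sgn t)) *
        (of_real \<beta> * (of_real (\<bar>t\<bar>\<^sup>2) * (\<i> * of_real (sgn t)) * osec \<kappa> (\<lambda>y. phase y ^ 2 * \<psi> y) t x
        + of_real \<bar>t\<bar> * osec_err \<kappa> (\<lambda>y. phase y * \<psi> y) t x)) + of_real \<bar>t\<bar> * LY Y ?e x)" .
    have alg: "T \<noteq> 0 \<Longrightarrow> s * s = 1 \<Longrightarrow> T * ((1 / T) ^ 4 * (n - b * (T\<^sup>2 * (\<i> * s) * (b * (T\<^sup>2 * (\<i> * s) * m + T * e)) + T * l)) - b\<^sup>2 * m) =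
       (1 / T) ^ 3 * n - (b * b * ((\<i> * s) * e) + b * (1 / T\<^sup>2 * l))" for T s n b m e l :: complex
    proof -
      assume T: "T \<noteq> 0" and s: "s * s = 1"
      \<comment> \<open>The identity is true modulo s * s - 1, which vanishes because s is a
        sign.\<close>
      have "T * ((1 / T) ^ 4 * (n - b * (T\<^sup>2 * (\<i> * s) * (b * (T\<^sup>2 * (\<i> * s) * m + T * e)) + T * l)) - b\<^sup>2 * m) =
        (1 / T) ^ 3 * n - (b * b * ((\<i> * s) * e) + b * (1 / T\<^sup>2 * l)) + T * b\<^sup>2 * m * (s * s - 1)"
        using T by (simp add: field_simps power2_eq_square power3_eq_cube power4_eq_xxxx)
      then show ?thesis using s by simp
    qed
    have s: "complex_of_real (sgn t) * of_real (sgn t) = 1" using t0 by (simp add: sgn_if)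
    show "of_real \<bar>t\<bar> * (of_real ((1 / \<bar>t\<bar>) ^ 4) * resolv Y (osec \<kappa> \<psi> t) x - of_real (\<beta>\<^sup>2) * osec \<kappa> (\<lambda>y. phase y ^ 2 * \<psi> y) t x) =
       of_real ((1 / \<bar>t\<bar>) ^ 3) * osec \<kappa> \<psi> t x - (of_real (\<beta> * \<beta>) * ((\<i> * of_real (sgn t)) * osec_err \<kappa> (\<lambda>y. phase y * \<psi> y) t x) +
      of_real \<beta> * (of_real (1 / \<bar>t\<bar>\<^sup>2) * LY Y (osec_err \<kappa> \<psi> t) x))"
      unfolding resolv_def L2 of_real_power of_real_mult of_real_divide of_real_1
      by (rule alg[OF _ s]) (use t0 in simp)
  qed
qed

text \<open>Induction on n. The previous error is hit by |t|^(-4) (I - a^2), harmless by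
  \<open>resolv_Q\<close>; the leading part passes through one more factor I - a^2 at the price of
  the error in \<open>resolv_osec\<close>.\<close>

lemma resolv_power_osec:
  assumes "p > 0" "test_on p q \<psi>" and \<kappa>: "\<And>a. test (\<kappa> a)"
  shows "(\<lambda>t x. of_real \<bar>t\<bar> * (of_real ((1 / \<bar>t\<bar>) ^ (4 * n)) * (resolv Y ^^ n) (osec \<kappa> \<psi> t) x -
      of_real (\<beta> ^ (2 * n)) * osec \<kappa> (\<lambda>y. phase y ^ (2 * n) * \<psi> y) t x)) \<in> Q" (is "?E n \<in> Q")
proof (induction n)
  case 0
  have "(\<lambda>t x. 0) \<in> Q" by (rule fspan_zero[OF osec_Q[OF assms]])
  then show ?case by simp
next
  case (Suc n)
  let ?\<psi> = "\<lambda>y. phase y ^ (2 * n) * \<psi> y"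
  have \<psi>: "test_on p q ?\<psi>" by (rule test_on_mult[OF assms(2) smooth_power[OF smooth_phase]])
  show ?case
  proof (rule fspan.cong[OF fspan.add[OF fspan_scale[OF resolv_osec[OF assms(1) \<psi> \<kappa>], of "of_real (\<beta> ^ (2 * n))"] resolv_Q[OF Suc]]])
    fix t x assume t: "\<bar>t\<bar> \<ge> T0"
    note t0 = dom[OF t]
    let ?R = "(resolv Y ^^ n) (osec \<kappa> \<psi> t)" and ?f = "osec \<kappa> ?\<psi> t"
    have V: "?R \<in> V pm t i j" "?f \<in> V pm t i j" "(\<lambda>x. ?E n t x) \<in> V pm t i j"
      by (rule V_resolv_pow[OF ij osec_V[OF assms t]]) (rule osec_V[OF assms(1) \<psi> \<kappa> t], rule Q_V[OF Suc t])
    have "?R = (\<lambda>x. of_real (\<bar>t\<bar> ^ (4 * n)) * (of_real (\<beta> ^ (2 * n)) * ?f x + of_real (1 / \<bar>t\<bar>) * ?E n t x))"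
      using t0 by (simp add: fun_eq_iff power_divide)
    then have "resolv Y ?R x = resolv Y (\<lambda>x. of_real (\<bar>t\<bar> ^ (4 * n)) * (of_real (\<beta> ^ (2 * n)) * ?f x + of_real (1 / \<bar>t\<bar>) * ?E n t x)) x"
      by metis
    also have "\<dots> = of_real (\<bar>t\<bar> ^ (4 * n)) * (of_real (\<beta> ^ (2 * n)) * resolv Y ?f x + of_real (1 / \<bar>t\<bar>) * resolv Y (?E n t) x)"
      by (simp only: resolv_linear[OF ij V.add[OF V.cmult[OF V(2)] V.cmult[OF V(3)]] V(2)]
          resolv_linear[OF ij V.cmult[OF V(2)] V.cmult[OF V(3)]] resolv_linear[OF ij V(2) V(2)] resolv_linear[OF ij V(3) V(2)])
    finally have R: "(resolv Y ^^ Suc n) (osec \<kappa> \<psi> t) x = \<dots>" by simp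
    have \<psi>': "(\<lambda>y. phase y ^ 2 * ?\<psi> y) = (\<lambda>y. phase y ^ (2 * Suc n) * \<psi> y)"
      by (simp add: fun_eq_iff power2_eq_square mult_ac)
    have alg: "T \<noteq> 0 \<Longrightarrow> T * ((1 / T) ^ (4 * Suc n) * (T ^ (4 * n) * (B * r + 1 / T * e)) - B * b\<^sup>2 * m) =
       B * (T * ((1 / T) ^ 4 * r - b\<^sup>2 * m)) + (1 / T) ^ 4 * e" for T B r e b m :: complex
      by (simp add: field_simps power_add power4_eq_xxxx)
    have b: "complex_of_real \<beta> ^ (2 * Suc n) = of_real \<beta> ^ (2 * n) * (of_real \<beta>)\<^sup>2"
      by (simp add: power2_eq_square mult_ac)
    show "?E (Suc n) t x = of_real (\<beta> ^ (2 * n)) * (of_real \<bar>t\<bar> * (of_real ((1 / \<bar>t\<bar>) ^ 4) * resolv Y ?f x -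
        of_real (\<beta>\<^sup>2) * osec \<kappa> (\<lambda>y. phase y ^ 2 * ?\<psi> y) t x)) + of_real ((1 / \<bar>t\<bar>) ^ 4) * resolv Y (\<lambda>x. ?E n t x) x"
      unfolding R \<psi>' of_real_power of_real_divide of_real_1 b
      by (rule alg) (use t0 in simp)
  qed
qed

end

end

section \<open>Construction of the coboundaries\<close>

lemma integral_support:
  fixes h :: "real \<Rightarrow> 'a::euclidean_space"
  assumes "\<And>x. h x \<noteq> 0 \<Longrightarrow> p \<le> x \<and> x \<le> q"
  shows "integral {a..w} h = integral {max a p..min w q} h"
proof -
  have "integral {a..w} h = integral {a..w} (\<lambda>x. if x \<in> {p..q} then h x else 0)"
    by (rule Henstock_Kurzweil_Integration.integral_cong) (use assms in auto)
  then show ?thesis by (simp only: Henstock_Kurzweil_Integration.integral_restrict_Int Int_atLeastAtMost max.commute[of a] min.commute[of w])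
qed

lemma integral_bound_support:
  fixes h :: "real \<Rightarrow> complex"
  assumes c: "continuous_on UNIV h" and s: "\<And>x. h x \<noteq> 0 \<Longrightarrow> p \<le> x \<and> x \<le> q" and M: "\<And>x. cmod (h x) \<le> M" and pq: "p \<le> q"
  shows "cmod (integral {a..w} h) \<le> M * (q - p)"
proof -
  have M0: "M \<ge> 0" using M norm_ge_zero order_trans by blast
  have eq: "integral {a..w} h = integral {max a p..min w q} h" by (rule integral_support[OF s])
  show ?thesis unfolding eq
  proof (cases "max a p \<le> min w q")
    case True
    have "cmod (integral {max a p..min w q} h) \<le> M * (min w q - max a p)"
      by (rule integral_bound[OF True continuous_on_subset[OF c]]) (use M in auto)
    also have "\<dots> \<le> M * (q - p)" using M0 by (intro mult_left_mono) auto
    finally show "cmod (integral {max a p..min w q} h) \<le> M * (q - p)" .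
  next
    case False
    then have "{max a p..min w q} = {}" by auto
    then show "cmod (integral {max a p..min w q} h) \<le> M * (q - p)" using M0 pq by simp
  qed
qed

text \<open>The lower limit p - 1 lies to the left of the support, so the formula is a primitive on
  the whole line: it is 0 before p, and every w \<ge> p is interior to [p - 1, w + 1].\<close>

lemma antiderivative:
  fixes h :: "real \<Rightarrow> complex"
  assumes "smooth h" "\<And>x. h x \<noteq> 0 \<Longrightarrow> p \<le> x"
  shows "((\<lambda>w. integral {p - 1..w} h) has_vector_derivative h w) (at w)"
proof (cases "w < p")
  case True
  have h0: "h x = 0" if "x < p" for x using assms(2)[of x] that by linarith
  have z: "integral {p - 1..x} h = 0" if "x < p" for x
    by (rule integral_unique[OF has_integral_is_0]) (use h0 that in auto)
  have "((\<lambda>w. integral {p - 1..w} h) has_vector_derivative 0) (at w)"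
    by (rule has_vector_derivative_transform_within_open[OF has_vector_derivative_const[of 0], of "{..<p}"])
      (use True z in auto)
  then show ?thesis using h0[OF True] by simp
next
  case False
  have "((\<lambda>w. integral {p - 1..w} h) has_vector_derivative h w) (at w within {p - 1..w + 1})"
    by (rule integral_has_vector_derivative[OF continuous_on_subset[OF smooth_continuous[OF assms(1)]]]) (use False in auto)
  then show ?thesis using False by (simp add: at_within_Icc_at)
qed

lemma pi_exp_sec:
  fixes i j :: "'n::finite"
  assumes "i \<noteq> j"
  shows "pi_exp (\<alpha> *\<^sub>R eunit i j) (sec pm t j (\<kappa>(i := \<phi>))) x = sec pm t j (\<kappa>(i := \<lambda>w. \<phi> (w - \<alpha>))) x"
proof -
  let ?y = "mexp (- (\<alpha> *\<^sub>R eunit i j)) *v x"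
  have "?y = x + (- \<alpha> * x $ j) *\<^sub>R axis i 1"
    using mexp_nilpotent[OF assms, of "- \<alpha>" x] by simp
  then have y: "?y $ a = (if a = i then x $ i - \<alpha> * x $ j else x $ a)" for a
    using assms by (simp add: axis_def)
  have "x $ j \<noteq> 0 \<Longrightarrow> (\<kappa>(i := \<phi>)) a (?y $ a / x $ j) = (\<kappa>(i := \<lambda>w. \<phi> (w - \<alpha>))) a (x $ a / x $ j)" for a
    by (simp add: y diff_divide_distrib)
  then show ?thesis
    unfolding pi_exp_def sec_def using y[of j] assms by simp
qed

text \<open>\<omega> makes the step \<alpha> one full period. l and u centre the chirp at its
  resonance |t| / \<omega>, and \<open>T0ub\<close> reserves the range from l * |t| / 8 to l * |t|
  for the plateau of H.\<close>

locale cohomology = chart_params i j \<alpha> \<omega> l u lb ub T0 pm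
  for i j :: "'n::finite" and \<alpha> \<omega> l u lb ub T0 :: real and pm :: bool +
  fixes c0 :: real
  assumes \<alpha>: "\<alpha> \<noteq> 0" and \<omega>: "\<omega> = 2 * pi / \<bar>\<alpha>\<bar>" and lu: "l = 1 / (2 * \<omega>)" "u = 3 / (2 * \<omega>)"
    and ub: "lb < ub" and T0ub: "8 * ub \<le> l * T0" and c0: "c0 > 0"
    and osc_lower: "\<And>T. T \<ge> T0 \<Longrightarrow> integral {T / (2 * \<omega>)..3 * T / (2 * \<omega>)}
        (\<lambda>w. sin (\<omega> * w - T * ln w - (T - T * ln (T / \<omega>))) * bump (1 / (2 * \<omega>)) (3 / (2 * \<omega>)) (w / T)) \<ge> c0 * sqrt T"
begin

lemma \<omega>_pos: "\<omega> > 0" using \<alpha> by (simp add: \<omega>)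
lemma lb_pos: "lb > 0" using lb by linarith
lemma lu_less: "l < u" using \<omega>_pos by (simp add: lu divide_strict_right_mono)

definition \<psi> where "\<psi> x = complex_of_real (bump l u x)"
definition b where "b x = complex_of_real (1 / integral {lb..ub} (bump lb ub)) * of_real (bump lb ub x)"
text \<open>The chirp stripped of the phase that \<open>osc\<close> restores. What remains is sgn t
  times \<omega> w - |t| ln w, the phase of \<open>oscillatory_lower\<close> up to a
  constant.\<close>

definition kf where "kf t w = cis (sgn t * \<omega> * w) * chirp \<psi> t w"
definition ct where "ct t = integral {l * \<bar>t\<bar>..u * \<bar>t\<bar>} (kf t)"
text \<open>Both terms have total integral \<open>ct t\<close>, so the primitive H returns to 0
  behind the chirp.\<close>

definition hf where "hf t w = ct t * b w - kf t w"
definition H where "H t w = integral {lb - 1..w} (hf t)"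
text \<open>A normalisation that keeps the coefficients \<open>dt\<close> and \<open>dt * ct\<close>
  of g bounded by 1 without an upper bound for \<open>ct\<close>, while the height of the plateau
  stays at least c0 / (1 + c0).\<close>

definition dt where "dt t = 1 / (1 + cmod (ct t))"

lemma test_\<psi>: "test_on l u \<psi>" unfolding \<psi>_def[abs_def] by (rule test_on_bump)
lemma test_b: "test_on lb ub b" unfolding b_def[abs_def] by (intro test_on_mult test_on_bump smooth_const)

lemma ct_range: "\<bar>t\<bar> \<ge> T0 \<Longrightarrow> 8 * ub \<le> l * \<bar>t\<bar>"
  using T0ub mult_left_mono[of T0 "\<bar>t\<bar>" l] l by linarith

lemma smooth_kf: "\<bar>t\<bar> \<ge> T0 \<Longrightarrow> smooth (kf t)"
  unfolding kf_def[abs_def] by (intro smooth_mult smooth_cis smooth_chirp[OF l dom test_\<psi>])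

lemma kf_support: "\<bar>t\<bar> \<ge> T0 \<Longrightarrow> kf t w \<noteq> 0 \<Longrightarrow> l * \<bar>t\<bar> \<le> w \<and> w \<le> u * \<bar>t\<bar>"
  using chirp_support[OF dom test_\<psi>, of t w] by (auto simp: kf_def)

lemma b_support: "b w \<noteq> 0 \<Longrightarrow> lb \<le> w \<and> w \<le> ub" using test_b by (auto simp: test_on_def)

lemma smooth_b: "smooth b" using test_b by (simp add: test_on_def)

lemma integral_b: "integral {lb..ub} b = 1"
proof -
  have c: "continuous_on {lb..ub} (bump lb ub)" by (rule bump_continuous)
  have "integral {lb..ub} (bump lb ub) \<noteq> 0"
  proof
    assume "integral {lb..ub} (bump lb ub) = 0"
    then have "\<forall>x\<in>{lb..ub}. bump lb ub x = 0"
      using integral_eq_0_iff[OF c] ub bump_nonneg by blast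
    moreover have "bump lb ub ((lb + ub) / 2) > 0" using ub by (intro bump_pos) auto
    moreover have "(lb + ub) / 2 \<in> {lb..ub}" using ub by auto
    ultimately show False by (metis less_irrefl)
  qed
  moreover have "integral {lb..ub} (\<lambda>x. complex_of_real (bump lb ub x)) = of_real (integral {lb..ub} (bump lb ub))"
    using integral_linear[OF integrable_continuous_interval[OF c] bounded_linear_of_real] by (simp add: o_def)
  ultimately show ?thesis unfolding b_def[abs_def] by simp
qed

lemma hf_support: "\<bar>t\<bar> \<ge> T0 \<Longrightarrow> hf t w \<noteq> 0 \<Longrightarrow> lb \<le> w"
  using b_support[of w] kf_support[of t w] ct_range[of t] ub lb_pos by (cases "b w = 0") (auto simp: hf_def)

lemma smooth_hf: "\<bar>t\<bar> \<ge> T0 \<Longrightarrow> smooth (hf t)"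
  using smooth_add[OF smooth_cmult[OF smooth_b] smooth_cmult[OF smooth_kf, of t "- 1"], of "ct t"]
  by (simp add: hf_def[abs_def])

lemma H_deriv: "\<bar>t\<bar> \<ge> T0 \<Longrightarrow> (H t has_vector_derivative hf t w) (at w)"
  unfolding H_def[abs_def] by (rule antiderivative[OF smooth_hf hf_support])

lemma smooth_H: "\<bar>t\<bar> \<ge> T0 \<Longrightarrow> smooth (H t)"
  by (rule smoothI[OF H_deriv smooth_hf])

lemma H_split:
  assumes "\<bar>t\<bar> \<ge> T0"
  shows "H t w = ct t * integral {lb - 1..w} b - integral {lb - 1..w} (kf t)"
proof -
  have i: "smooth h \<Longrightarrow> h integrable_on {lb - 1..w}" for h
    by (rule integrable_continuous_interval[OF continuous_on_subset[OF smooth_continuous]]) auto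
  show ?thesis
    unfolding H_def hf_def[abs_def]
    by (subst Henstock_Kurzweil_Integration.integral_diff) (use i[OF smooth_cmult[OF smooth_b]] i[OF smooth_kf[OF assms]] in auto)
qed

lemma H_mid:
  assumes "\<bar>t\<bar> \<ge> T0" "ub \<le> w" "w \<le> l * \<bar>t\<bar>"
  shows "H t w = ct t"
proof -
  have "integral {lb - 1..w} b = 1"
    using assms ub by (subst integral_support[of b lb ub, OF b_support]) (auto simp: integral_b max_def min_def)
  moreover have "integral {lb - 1..w} (kf t) = 0"
  proof -
    have "integral {max (lb - 1) (l * \<bar>t\<bar>)..min w (u * \<bar>t\<bar>)} (kf t) = 0"
    proof -
      have "q \<le> p \<Longrightarrow> integral {p..q} (kf t) = 0" for p q :: real by (cases "q = p") auto
      then show ?thesis by (simp only: le_max_iff_disj min_le_iff_disj assms(3) simp_thms)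
    qed
    moreover have "integral {lb - 1..w} (kf t) = integral {max (lb - 1) (l * \<bar>t\<bar>)..min w (u * \<bar>t\<bar>)} (kf t)"
      by (rule integral_support[OF kf_support[OF assms(1)]])
    ultimately show ?thesis by simp
  qed
  ultimately show ?thesis by (simp add: H_split[OF assms(1)])
qed

lemma H_support:
  assumes t: "\<bar>t\<bar> \<ge> T0" and "H t w \<noteq> 0"
  shows "lb \<le> w \<and> w \<le> u * \<bar>t\<bar>"
proof (rule ccontr)
  assume n: "\<not> (lb \<le> w \<and> w \<le> u * \<bar>t\<bar>)"
  have lut: "l * \<bar>t\<bar> \<le> u * \<bar>t\<bar>" using lu_less by (intro mult_right_mono) auto
  have "H t w = 0"
  proof (cases "w < lb")
    case True
    show ?thesis unfolding H_def
      by (rule integral_unique[OF has_integral_is_0]) (use hf_support[OF t] True in force)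
  next
    case False
    then have w: "w > u * \<bar>t\<bar>" using n by auto
    have r: "lb < ub" "8 * ub \<le> l * \<bar>t\<bar>" "lb > 0" using ub ct_range[OF t] lb_pos by auto
    have "integral {lb - 1..w} b = 1"
      using w lut r by (subst integral_support[of b lb ub, OF b_support]) (auto simp: integral_b max_def min_def)
    moreover have "integral {lb - 1..w} (kf t) = ct t"
      using w lut r by (subst integral_support[of "kf t", OF kf_support[OF t]]) (auto simp: ct_def max_def min_def)
    ultimately show ?thesis by (simp add: H_split[OF t])
  qed
  then show False using assms(2) by simp
qed

text \<open>Height |t|^(-1/2) times length of order |t|, without regard to cancellation. This crude
  bound enters only the error term of \<open>pairing_lower\<close>, where it is sufficient.\<close>

lemma H_bound:
  obtains C where "C \<ge> 0" "\<And>t w. \<bar>t\<bar> \<ge> T0 \<Longrightarrow> cmod (H t w) \<le> C * sqrt \<bar>t\<bar>"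
proof -
  obtain M where M: "M \<ge> 0" "\<And>x. cmod (\<psi> x) \<le> M" by (rule test_on_bounded[OF test_\<psi>]) blast
  obtain M' where M': "M' \<ge> 0" "\<And>x. cmod (b x) \<le> M'" by (rule test_on_bounded[OF test_b]) blast
  let ?A = "M * (u - l)"
  have A: "?A \<ge> 0" using M lu_less by simp
  have k: "cmod (integral {a..w} (kf t)) \<le> ?A * sqrt \<bar>t\<bar>" if t: "\<bar>t\<bar> \<ge> T0" for a w t
  proof -
    have t0: "t \<noteq> 0" by (rule dom[OF t])
    have Kb: "cmod (kf t x) \<le> M / sqrt \<bar>t\<bar>" for x
      using t0 M by (simp add: kf_def chirp_def norm_mult norm_divide powr_minus_divide powr_half_sqrt divide_right_mono)
    have "cmod (integral {a..w} (kf t)) \<le> M / sqrt \<bar>t\<bar> * (u * \<bar>t\<bar> - l * \<bar>t\<bar>)"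
      by (rule integral_bound_support[OF smooth_continuous[OF smooth_kf[OF t]] kf_support[OF t] Kb])
        (use lu_less in \<open>auto intro: mult_right_mono\<close>)
    also have "M / sqrt \<bar>t\<bar> * (u * \<bar>t\<bar> - l * \<bar>t\<bar>) = ?A * (\<bar>t\<bar> / sqrt \<bar>t\<bar>)" by (simp add: algebra_simps diff_divide_distrib)
    also have "\<bar>t\<bar> / sqrt \<bar>t\<bar> = sqrt \<bar>t\<bar>" by (simp add: real_div_sqrt)
    finally show ?thesis .
  qed
  have "cmod (H t w) \<le> (?A * (M' * (ub - lb)) + ?A) * sqrt \<bar>t\<bar>" if t: "\<bar>t\<bar> \<ge> T0" for t w
  proof -
    have "cmod (integral {lb - 1..w} b) \<le> M' * (ub - lb)"
      by (rule integral_bound_support[OF smooth_continuous[OF smooth_b] b_support M'(2)]) (use ub in auto)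
    then have "cmod (ct t * integral {lb - 1..w} b) \<le> ?A * sqrt \<bar>t\<bar> * (M' * (ub - lb))"
      unfolding norm_mult using k[OF t] A by (intro mult_mono) (auto simp: ct_def)
    moreover have "cmod (integral {lb - 1..w} (kf t)) \<le> ?A * sqrt \<bar>t\<bar>" by (rule k[OF t])
    ultimately show ?thesis
      unfolding H_split[OF t] using norm_triangle_ineq4[of "ct t * integral {lb - 1..w} b" "integral {lb - 1..w} (kf t)"]
      by (simp add: algebra_simps)
  qed
  then show ?thesis using that[of "?A * (M' * (ub - lb)) + ?A"] A M'(1) ub by auto
qed

text \<open>The unimodular z shifts the phase so that it vanishes at the critical point, and the
  imaginary part becomes the integral of \<open>oscillatory_lower\<close>, up to sign and scale. Its
  growth sqrt |t| is exactly offset by the amplitude |t|^(-1/2).\<close>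

lemma ct_lower:
  assumes t: "\<bar>t\<bar> \<ge> T0"
  shows "cmod (ct t) \<ge> c0"
proof -
  let ?T = "\<bar>t\<bar>"
  let ?\<Theta> = "\<lambda>w. \<omega> * w - ?T * ln w - (?T - ?T * ln (?T / \<omega>))"
  have t0: "t \<noteq> 0" "?T > 0" using dom[OF t] by auto
  define z where "z = cis (- (sgn t * (?T - ?T * ln (?T / \<omega>))))"
  have e: "Im (z * kf t w) = sgn t * ?T powr (- 1 / 2) * (sin (?\<Theta> w) * bump l u (w / ?T))" for w
  proof -
    have "z * kf t w = of_real (?T powr (- 1 / 2) * bump l u (w / ?T)) *
        cis (- (sgn t * (?T - ?T * ln (?T / \<omega>))) + (sgn t * \<omega> * w + - t * ln w))"
      by (simp only: z_def kf_def chirp_def \<psi>_def cis_mult[symmetric] of_real_mult mult_ac)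
    also have "- (sgn t * (?T - ?T * ln (?T / \<omega>))) + (sgn t * \<omega> * w + - t * ln w) = sgn t * ?\<Theta> w"
    proof -
      have "t * ln w = sgn t * ?T * ln w" by (simp only: sgn_mult_abs)
      then have "x = t * ln w \<Longrightarrow> - (sgn t * (?T - L)) + (sgn t * \<omega> * w + - x) = sgn t * (\<omega> * w - ?T * ln w - (?T - L))" for x L
        by (simp add: right_diff_distrib mult.assoc)
      from this[OF refl] show ?thesis by (simp only: mult_minus_left)
    qed
    also have "Im (of_real (?T powr (- 1 / 2) * bump l u (w / ?T)) * cis (sgn t * ?\<Theta> w)) =
        ?T powr (- 1 / 2) * bump l u (w / ?T) * sin (sgn t * ?\<Theta> w)" by simp
    also have "sin (sgn t * ?\<Theta> w) = sgn t * sin (?\<Theta> w)"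
      using t0(1) sin_minus[of "?\<Theta> w"] by (cases "t > 0") (auto simp: sgn_if)
    finally show ?thesis by (simp add: mult_ac)
  qed
  have i: "kf t integrable_on {l * ?T..u * ?T}"
    by (rule integrable_continuous_interval[OF continuous_on_subset[OF smooth_continuous[OF smooth_kf[OF t]]]]) auto
  have "Im (z * ct t) = integral {l * ?T..u * ?T} (\<lambda>w. Im (z * kf t w))"
    unfolding ct_def integral_mult_right[symmetric]
    using integral_linear[OF integrable_on_mult_right[OF i, of z] bounded_linear_Im] by (simp add: o_def)
  also have "\<dots> = sgn t * ?T powr (- 1 / 2) * integral {l * ?T..u * ?T} (\<lambda>w. sin (?\<Theta> w) * bump l u (w / ?T))"
    unfolding e by (rule integral_mult_right)
  finally have "\<bar>Im (z * ct t)\<bar> = ?T powr (- 1 / 2) * \<bar>integral {l * ?T..u * ?T} (\<lambda>w. sin (?\<Theta> w) * bump l u (w / ?T))\<bar>"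
    using t0 by (simp add: abs_mult abs_sgn_eq)
  also have "\<dots> \<ge> ?T powr (- 1 / 2) * (c0 * sqrt ?T)"
    using osc_lower[OF t] by (intro mult_left_mono order_trans[OF _ abs_ge_self]) (simp_all add: lu mult.commute)
  also have "?T powr (- 1 / 2) * (c0 * sqrt ?T) = c0"
    using t0 by (simp add: powr_minus_divide powr_half_sqrt)
  finally have "c0 \<le> cmod (z * ct t)" using abs_Im_le_cmod order_trans by blast
  then show ?thesis by (simp add: norm_mult z_def)
qed

text \<open>Since \<omega> \<alpha> is 2 pi up to sign, the factor \<open>cis\<close> takes the same
  value at w - \<alpha> and at w, so no term with H itself survives. The increment of H is the
  integral of \<open>hf\<close> along w - \<alpha> \<tau>, and the constant outer phase splits into
  the one at w - \<alpha> \<tau>, which turns \<open>kf\<close> into the chirp, and the weight of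
  \<open>avg\<close>.\<close>

lemma osc_H_diff:
  assumes t: "\<bar>t\<bar> \<ge> T0"
  shows "osc \<omega> (H t) t (w - \<alpha>) - osc \<omega> (H t) t w =
    of_real (- \<alpha>) * (ct t * avg \<alpha> \<omega> 0 (osc \<omega> b t) t w + (- 1) * avg \<alpha> \<omega> 0 (chirp \<psi> t) t w)"
proof -
  have t0: "t \<noteq> 0" by (rule dom[OF t])
  define e where "e = cis (- (sgn t * \<omega>) * w)"
  let ?\<eta> = "\<lambda>x. ct t * osc \<omega> b t x + (- 1) * chirp \<psi> t x"
  have k: "cis (- (sgn t * \<omega>) * x) * hf t x = ?\<eta> x" for x
  proof -
    have "cis (- (sgn t * \<omega>) * x) * kf t x = chirp \<psi> t x"
      by (simp add: kf_def cis_mult flip: mult.assoc)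
    then show ?thesis by (simp add: hf_def osc_def right_diff_distrib mult_ac)
  qed
  have ee: "e * hf t (w - \<alpha> * \<tau>) = cis (- (sgn t * \<omega>) * (\<alpha> * \<tau>)) * of_real \<tau> ^ 0 * ?\<eta> (w - \<alpha> * \<tau>)" for \<tau>
  proof -
    have "e = cis (- (sgn t * \<omega>) * (\<alpha> * \<tau>)) * cis (- (sgn t * \<omega>) * (w - \<alpha> * \<tau>))"
      by (simp add: e_def cis_mult algebra_simps)
    then show ?thesis unfolding k[symmetric] by (simp add: mult.assoc)
  qed
  have d: "((\<lambda>\<tau>. e * H t (- \<alpha> * \<tau> + w)) has_vector_derivative of_real (- \<alpha>) * (e * hf t (- \<alpha> * \<tau> + w))) (at \<tau>)" for \<tau>
    by (rule has_vector_derivative_eq_rhs[OF has_vector_derivative_mult_right[OF affine_deriv[OF H_deriv[OF t]]]]) simp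
  have "((\<lambda>\<tau>. of_real (- \<alpha>) * (e * hf t (- \<alpha> * \<tau> + w))) has_integral e * H t (- \<alpha> * 1 + w) - e * H t (- \<alpha> * 0 + w)) {0..1}"
    by (rule fundamental_theorem_of_calculus[OF _ has_vector_derivative_at_within[OF d]]) simp
  note FTC = this
  have sw: "- \<alpha> * \<tau> + w = w - \<alpha> * \<tau>" for \<tau> by simp
  have "integral {0..1} (\<lambda>\<tau>. of_real (- \<alpha>) * (e * hf t (w - \<alpha> * \<tau>))) = e * H t (w - \<alpha>) - e * H t w"
    using integral_unique[OF FTC] by (simp only: sw mult_1_right mult_zero_right diff_zero uminus_add_conv_diff add_0_left)
  then have "e * H t (w - \<alpha>) - e * H t w = of_real (- \<alpha>) * avg \<alpha> \<omega> 0 ?\<eta> t w"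
    unfolding avg_def ee by (simp only: integral_mult_right)
  also have "avg \<alpha> \<omega> 0 ?\<eta> t w = ct t * avg \<alpha> \<omega> 0 (osc \<omega> b t) t w + (- 1) * avg \<alpha> \<omega> 0 (chirp \<psi> t) t w"
    unfolding avg_scale[symmetric]
    by (rule avg_add) (intro smooth_continuous smooth_cmult smooth_osc smooth_b smooth_chirp[OF l t0 test_\<psi>])+
  finally have "e * H t (w - \<alpha>) - e * H t w = of_real (- \<alpha>) * (ct t * avg \<alpha> \<omega> 0 (osc \<omega> b t) t w + (- 1) * avg \<alpha> \<omega> 0 (chirp \<psi> t) t w)" .
  moreover have "cis (- (sgn t * \<omega>) * (w - \<alpha>)) = e"
  proof -
    have "sgn t * \<omega> * \<alpha> = 2 * pi * (sgn t * sgn \<alpha>)" unfolding \<omega> real_sgn_eq[of \<alpha>] by simp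
    moreover have "sgn t * sgn \<alpha> = 1 \<or> sgn t * sgn \<alpha> = - 1" using t0 \<alpha> by (simp add: sgn_if)
    moreover have "A = 2 * pi * z \<Longrightarrow> z = 1 \<or> z = - 1 \<Longrightarrow> A = 2 * pi \<or> A = - (2 * pi)" for A z :: real by auto
    ultimately have "sgn t * \<omega> * \<alpha> = 2 * pi \<or> sgn t * \<omega> * \<alpha> = - (2 * pi)" by blast
    then have "cis (sgn t * \<omega> * \<alpha>) = 1" by (auto simp: cis_conv_exp complex_eq_iff Re_exp Im_exp)
    moreover have "cis (- (sgn t * \<omega>) * (w - \<alpha>)) = e * cis (sgn t * \<omega> * \<alpha>)"
      by (simp add: e_def cis_mult algebra_simps)
    ultimately show ?thesis by simp
  qed
  ultimately show ?thesis by (simp add: osc_def e_def)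
qed

section \<open>The sections f and g\<close>

definition \<kappa> where "\<kappa> = (\<lambda>a::'n. \<lambda>x. complex_of_real (bump (- 1) 1 x))"

lemma test_\<kappa>: "test (\<kappa> a)" unfolding \<kappa>_def by (rule test_on_test[OF test_on_bump])

definition f where "f t x = of_real (dt t) * sec pm t j (\<kappa>(i := osc \<omega> (H t) t)) x"
definition g where "g t x = of_real (- \<alpha>) * ((of_real (dt t) * ct t) * sec pm t j (\<kappa>(i := avg \<alpha> \<omega> 0 (osc \<omega> b t) t)) x
     + (- of_real (dt t)) * sec pm t j (\<kappa>(i := avg \<alpha> \<omega> 0 (chirp \<psi> t) t)) x)"

lemma dt_bounds: "0 < dt t" "dt t \<le> 1" "dt t * cmod (ct t) \<le> 1"
  by (simp_all add: dt_def divide_simps add_pos_nonneg)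

lemma test_osc_H: "\<bar>t\<bar> \<ge> T0 \<Longrightarrow> test_on lb (u * \<bar>t\<bar>) (osc \<omega> (H t) t)"
  using smooth_osc[OF smooth_H] H_support by (auto simp: test_on_def osc_def)

lemma f_V: "\<bar>t\<bar> \<ge> T0 \<Longrightarrow> f t \<in> V pm t i j"
  unfolding f_def[abs_def]
  by (intro V.cmult V.sec) (use test_on_pos[OF lb_pos test_osc_H] test_\<kappa> in \<open>auto simp: slots_def test_pos_test\<close>)

lemma g_S: "g \<in> S"
proof -
  have "(\<lambda>t. sec pm t j (\<kappa>(i := avg \<alpha> \<omega> 0 (osc \<omega> b t) t))) \<in> S" "(\<lambda>t. sec pm t j (\<kappa>(i := avg \<alpha> \<omega> 0 (chirp \<psi> t) t))) \<in> S"
    by (intro sec_G avg_G osc_X chirp_X test_b test_\<psi> test_\<kappa>)+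
  moreover have "bdd_from T0 (\<lambda>t. of_real (dt t) * ct t)" "bdd_from T0 (\<lambda>t. - of_real (dt t))"
    unfolding bdd_from_def using dt_bounds by (auto intro!: exI[of _ 1] simp: norm_mult less_imp_le)
  ultimately show ?thesis unfolding g_def[abs_def] by (intro fspan_scale fspan.add fspan.cmult)
qed

lemma cohomological_equation:
  assumes t: "\<bar>t\<bar> \<ge> T0"
  shows "pi_exp (\<alpha> *\<^sub>R eunit i j) (f t) x - f t x = g t x"
proof -
  have "pi_exp (\<alpha> *\<^sub>R eunit i j) (f t) x = of_real (dt t) * pi_exp (\<alpha> *\<^sub>R eunit i j) (sec pm t j (\<kappa>(i := osc \<omega> (H t) t))) x"
    by (simp add: pi_exp_def f_def)
  also have "\<dots> = of_real (dt t) * sec pm t j (\<kappa>(i := \<lambda>w. osc \<omega> (H t) t w +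
      of_real (- \<alpha>) * (ct t * avg \<alpha> \<omega> 0 (osc \<omega> b t) t w + (- 1) * avg \<alpha> \<omega> 0 (chirp \<psi> t) t w))) x"
    unfolding pi_exp_sec[OF ij] osc_H_diff[OF t, symmetric] by simp
  also have "\<dots> = f t x + g t x"
    unfolding sec_slot_add[OF ij] sec_slot_scale[OF ij] f_def g_def by (simp add: algebra_simps)
  finally show ?thesis by simp
qed

end

section \<open>Lower bounds\<close>

lemma emeasure_box:
  fixes lo hi :: "'n::finite \<Rightarrow> real"
  assumes "\<And>a. lo a \<le> hi a"
  shows "{x :: real^'n. \<forall>a. lo a \<le> x $ a \<and> x $ a \<le> hi a} \<in> sets borel"
    and "emeasure lborel {x :: real^'n. \<forall>a. lo a \<le> x $ a \<and> x $ a \<le> hi a} = ennreal (\<Prod>a\<in>UNIV. hi a - lo a)"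
proof -
  have eq: "{x :: real^'n. \<forall>a. lo a \<le> x $ a \<and> x $ a \<le> hi a} = cbox (vec_lambda lo) (vec_lambda hi)"
    by (auto simp: mem_box_cart)
  show "{x :: real^'n. \<forall>a. lo a \<le> x $ a \<and> x $ a \<le> hi a} \<in> sets borel" unfolding eq by simp
  have "(\<Prod>k\<in>Basis. (vec_lambda hi - vec_lambda lo :: real^'n) \<bullet> k) = (\<Prod>a\<in>UNIV. hi a - lo a)"
    unfolding Basis_vec_def
    by (subst prod.reindex_cong[of "\<lambda>a. axis a (1::real)" UNIV]) (auto simp: inj_on_def axis_eq_axis inner_axis)
  moreover have "\<forall>k\<in>Basis. (vec_lambda lo :: real^'n) \<bullet> k \<le> vec_lambda hi \<bullet> k"
    using assms by (auto simp: Basis_vec_def inner_axis)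
  ultimately show "emeasure lborel {x :: real^'n. \<forall>a. lo a \<le> x $ a \<and> x $ a \<le> hi a} = ennreal (\<Prod>a\<in>UNIV. hi a - lo a)"
    unfolding eq by (simp add: emeasure_lborel_cbox_eq)
qed

lemma sec_lower:
  fixes x :: "real^'n::finite"
  assumes ij: "i \<noteq> j" and x: "1 \<le> x $ j" "x $ j \<le> 2"
    and k: "\<And>a. a \<noteq> j \<Longrightarrow> a \<noteq> i \<Longrightarrow> cmod (\<kappa> a (x $ a / x $ j)) \<ge> k0" and k0: "k0 \<ge> 0"
    and A: "cmod (\<phi> (x $ i / x $ j)) \<ge> A" "A \<ge> 0"
  shows "2 powr (- real CARD('n) / 2) * (k0 ^ card (UNIV - {j} - {i}) * A) \<le> cmod (sec pm t j (\<kappa>(i := \<phi>)) x)"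
proof -
  have 1: "(\<Prod>a\<in>UNIV - {j}. cmod ((\<kappa>(i := \<phi>)) a (x $ a / x $ j))) =
      (\<Prod>a\<in>UNIV - {j} - {i}. cmod (\<kappa> a (x $ a / x $ j))) * cmod (\<phi> (x $ i / x $ j))"
    using ij by (subst prod.remove[of _ i]) (auto intro!: prod.cong)
  have 2: "(\<Prod>a\<in>UNIV - {j} - {i}. k0) \<le> (\<Prod>a\<in>UNIV - {j} - {i}. cmod (\<kappa> a (x $ a / x $ j)))"
    by (rule prod_mono) (use k k0 in auto)
  have 3: "2 powr (- real CARD('n) / 2) \<le> \<bar>x $ j\<bar> powr (- real CARD('n) / 2)"
    by (rule powr_mono2') (use x in auto)
  have xj: "x $ j \<noteq> 0" using x by auto
  have 4: "k0 ^ card (UNIV - {j} - {i}) * A \<le> (\<Prod>a\<in>UNIV - {j} - {i}. cmod (\<kappa> a (x $ a / x $ j))) * cmod (\<phi> (x $ i / x $ j))"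
    by (rule mult_mono) (use 2 A k0 in \<open>auto intro: prod_nonneg\<close>)
  show ?thesis unfolding cmod_sec[OF xj] 1
    by (rule mult_mono[OF 3 4]) (use A k0 in auto)
qed

lemma sec_split:
  assumes "i \<noteq> j"
  shows "sec pm t j (\<kappa>(i := \<phi>)) x = \<phi> (x $ i / x $ j) * sec pm t j (\<kappa>(i := \<lambda>_. 1)) x"
proof -
  have *: "(\<Prod>a\<in>UNIV - {j}. (\<kappa>(i := h)) a (x $ a / x $ j)) = h (x $ i / x $ j) * (\<Prod>a\<in>UNIV - {j} - {i}. \<kappa> a (x $ a / x $ j))" for h
    using assms by (subst prod.remove[of _ i]) (auto intro!: prod.cong)
  show ?thesis unfolding sec_def * by simp
qed

text \<open>If F times the conjugate of M has constant argument there is no cancellation, and the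
  mass on any part D of a fundamental domain bounds the pairing from below. D lies in the annulus of
  |x_j| while the pairing uses the one of |x_i|; both integrals agree because the product of the
  moduli has degree - n.\<close>

lemma pairing_aligned:
  fixes F M :: "real^'n::finite \<Rightarrow> complex"
  assumes F: "F \<in> V pm t i j" and M: "M \<in> V pm t i j" and z: "cmod z = 1"
    and al: "\<And>x. F x * cnj (M x) = z * of_real (cmod (F x) * cmod (M x))"
    and D: "D \<in> sets borel" "D \<subseteq> annulus (\<lambda>x. \<bar>x $ j\<bar>)" "\<And>x. x \<in> D \<Longrightarrow> e \<le> cmod (F x) * cmod (M x)" "e \<ge> 0"
    and v: "emeasure lborel D = ennreal v" "v \<ge> 0"
  shows "e * v \<le> cmod (pairing i F M)"
proof -
  let ?A = "annulus (\<lambda>x :: real^'n. \<bar>x $ i\<bar>)"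
  let ?p = "\<lambda>x. cmod (F x) * cmod (M x) * indicator ?A x"
  note int = pairing_integrable[OF V_ind_space[OF F] V_ind_space[OF M], of i]
  have "norm (F x * cnj (M x) * indicator ?A x) = ?p x" for x by (simp add: norm_mult indicator_def)
  then have p: "integrable lborel ?p" using integrable_norm[OF int] by simp
  have eq: "F x * cnj (M x) * indicator ?A x = z * of_real (?p x)" for x
    unfolding al by (simp add: indicator_def)
  have "pairing i F M = z * of_real (\<integral>x. ?p x \<partial>lborel)"
    unfolding pairing_def eq by (simp only: integral_mult_right_zero integral_complex_of_real)
  moreover have nn: "(\<integral>x. ?p x \<partial>lborel) \<ge> 0" by simp
  ultimately have P: "cmod (pairing i F M) = (\<integral>x. ?p x \<partial>lborel)" using z by (simp add: norm_mult)
  note dh = density_hom_mult[OF V_half_hom[OF F] V_half_hom[OF M]]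
  have "ennreal (e * v) = (\<integral>\<^sup>+x. ennreal e * indicator D x \<partial>lborel)"
    using D v by (simp add: nn_integral_cmult_indicator ennreal_mult)
  also have "\<dots> \<le> (\<integral>\<^sup>+x. ennreal (cmod (F x) * cmod (M x)) * indicator (annulus (\<lambda>x. \<bar>x $ j\<bar>)) x \<partial>lborel)"
    by (rule nn_integral_mono) (use D in \<open>auto simp: indicator_def intro!: ennreal_leI\<close>)
  also have "\<dots> = (\<integral>\<^sup>+x. ennreal (cmod (F x) * cmod (M x)) * indicator ?A x \<partial>lborel)"
    by (simp only: annulus_wt[OF dh radial_coordinate])
  also have "\<dots> = (\<integral>\<^sup>+x. ennreal (?p x) \<partial>lborel)"
    by (rule nn_integral_cong) (simp add: indicator_def)
  also have "\<dots> = ennreal (\<integral>x. ?p x \<partial>lborel)"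
    by (rule nn_integral_eq_integral[OF p]) simp
  finally show ?thesis unfolding P using nn by (simp add: ennreal_le_iff)
qed

lemma pairing_comb:
  assumes h: "h \<in> V pm t i j" and k: "k \<in> V pm t i j" "k' \<in> V pm t i j"
  shows "pairing i h (\<lambda>x. of_real p * k x + of_real q * k' x) = of_real p * pairing i h k + of_real q * pairing i h k'"
proof -
  let ?I = "indicator (annulus (\<lambda>x. \<bar>x $ i\<bar>))"
  note i1 = pairing_integrable[OF V_ind_space[OF h] V_ind_space[OF k(1)], of i]
  note i2 = pairing_integrable[OF V_ind_space[OF h] V_ind_space[OF k(2)], of i]
  have "h x * cnj (of_real p * k x + of_real q * k' x) * ?I x =
      of_real p * (h x * cnj (k x) * ?I x) + of_real q * (h x * cnj (k' x) * ?I x)" for x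
    by (simp add: algebra_simps)
  then show ?thesis
    unfolding pairing_def
    by (simp only: Bochner_Integration.integral_add[OF integrable_mult_right[OF i1] integrable_mult_right[OF i2]] integral_mult_right_zero)
qed

lemma l2norm_le:
  assumes "hnorm2 F \<le> ennreal (c\<^sup>2)" "c \<ge> 0"
  shows "l2norm F \<le> c"
proof -
  have "enn2real (hnorm2 F) \<le> c\<^sup>2" using assms(1) by (intro enn2real_leI) auto
  then have "l2norm F \<le> sqrt (c\<^sup>2)" unfolding l2norm_def by (rule real_sqrt_le_mono)
  then show ?thesis using assms(2) by simp
qed

lemma l2norm_cmult:
  assumes "F \<in> borel_measurable borel"
  shows "l2norm (\<lambda>x. c * F x) = cmod c * l2norm F"
  by (simp add: l2norm_def hnorm2_cmult[OF assms] enn2real_mult real_sqrt_mult)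

context cohomology begin

lemma f_norm:
  obtains C where "C \<ge> 0" "\<And>t. \<bar>t\<bar> \<ge> T0 \<Longrightarrow> l2norm (f t) \<le> C * \<bar>t\<bar>"
proof -
  obtain C1 where C1: "C1 \<ge> 0" "\<And>t w. \<bar>t\<bar> \<ge> T0 \<Longrightarrow> cmod (H t w) \<le> C1 * sqrt \<bar>t\<bar>" by (rule H_bound) blast
  obtain C where C: "C \<ge> 0"
    "\<And>f A R pm t. A \<ge> 0 \<Longrightarrow> R \<ge> 0 \<Longrightarrow> test_pos f \<Longrightarrow> (\<And>w. cmod (f w) \<le> A) \<Longrightarrow> (\<And>w. f w \<noteq> 0 \<Longrightarrow> \<bar>w\<bar> \<le> R) \<Longrightarrow>
       hnorm2 (sec pm t j (\<kappa>(i := f))) \<le> ennreal (C * A\<^sup>2 * R)"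
    by (rule sec_hnorm2_box[of i j \<kappa>, OF ij test_\<kappa>]) blast
  have u0: "u > 0" using \<omega>_pos lu by simp
  have "l2norm (f t) \<le> sqrt (C * C1\<^sup>2 * u) * \<bar>t\<bar>" if t: "\<bar>t\<bar> \<ge> T0" for t
  proof (rule l2norm_le)
    let ?F = "sec pm t j (\<kappa>(i := osc \<omega> (H t) t))"
    have tp: "test_pos (osc \<omega> (H t) t)" by (rule test_on_pos[OF lb_pos test_osc_H[OF t]])
    have "?F \<in> V pm t i j" by (rule V.sec) (use tp test_\<kappa> in \<open>auto simp: slots_def test_pos_test\<close>)
    then have "hnorm2 (f t) = ennreal ((dt t)\<^sup>2) * hnorm2 ?F"
      unfolding f_def[abs_def] by (subst hnorm2_cmult[OF V_measurable]) auto
    also have "\<dots> \<le> ennreal (1\<^sup>2) * ennreal (C * (C1 * sqrt \<bar>t\<bar>)\<^sup>2 * (u * \<bar>t\<bar>))"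
    proof (intro mult_mono ennreal_leI power_mono)
      show "hnorm2 ?F \<le> ennreal (C * (C1 * sqrt \<bar>t\<bar>)\<^sup>2 * (u * \<bar>t\<bar>))"
      proof (rule C(2)[OF _ _ tp])
        show "cmod (osc \<omega> (H t) t w) \<le> C1 * sqrt \<bar>t\<bar>" for w using C1(2)[OF t] by (simp add: osc_def norm_mult)
        fix w assume "osc \<omega> (H t) t w \<noteq> 0"
        then show "\<bar>w\<bar> \<le> u * \<bar>t\<bar>" using test_osc_H[OF t] lb_pos unfolding test_on_def by force
      qed (use C1 u0 in auto)
    qed (use dt_bounds[of t] in auto)
    also have "\<dots> = ennreal ((sqrt (C * C1\<^sup>2 * u) * \<bar>t\<bar>)\<^sup>2)"
    proof -
      have "C * (C1 * sqrt T)\<^sup>2 * (u * T) = (sqrt (C * C1\<^sup>2 * u) * T)\<^sup>2" if "T \<ge> 0" for T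
        using that C(1) u0 by (simp add: power_mult_distrib power2_eq_square[of T] mult_ac)
      from this[OF abs_ge_zero] show ?thesis by (simp only: power_one ennreal_1 mult_1)
    qed
    finally show "hnorm2 (f t) \<le> ennreal ((sqrt (C * C1\<^sup>2 * u) * \<bar>t\<bar>)\<^sup>2)" .
  qed (use C(1) u0 in simp)
  moreover have "sqrt (C * C1\<^sup>2 * u) \<ge> 0"
    by (intro real_sqrt_ge_zero mult_nonneg_nonneg) (use C(1) u0 in auto)
  ultimately show ?thesis using that by blast
qed

lemma Q_norm:
  assumes "F \<in> Q"
  obtains C where "C > 0" "\<And>t. \<bar>t\<bar> \<ge> T0 \<Longrightarrow> l2norm (F t) \<le> C * sqrt \<bar>t\<bar>"
proof -
  obtain C where C: "C \<ge> 0" "\<And>t. \<bar>t\<bar> \<ge> T0 \<Longrightarrow> hnorm2 (F t) \<le> ennreal (C * \<bar>t\<bar>)"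
    using Q_bound[OF assms] by blast
  have "l2norm (F t) \<le> (sqrt C + 1) * sqrt \<bar>t\<bar>" if t: "\<bar>t\<bar> \<ge> T0" for t
  proof -
    have "l2norm (F t) \<le> sqrt C * sqrt \<bar>t\<bar>"
      using C t by (intro l2norm_le) (auto simp: power_mult_distrib)
    also have "\<dots> \<le> (sqrt C + 1) * sqrt \<bar>t\<bar>" by (intro mult_right_mono) auto
    finally show ?thesis .
  qed
  moreover have "sqrt C + 1 > 0" using C(1) by (simp add: add_nonneg_pos)
  ultimately show ?thesis using that by blast
qed

text \<open>In terms of y = w / |t| the support is [l / 8, 7 l / 8], inside the plateau of
  H.\<close>

definition cutf where "cutf x = complex_of_real (bump (1 / (16 * \<omega>)) (7 / (16 * \<omega>)) x)"
definition cutp where "cutp p y = phase y ^ (2 * p) * cutf y"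

lemma test_cutf: "test_on (1 / (16 * \<omega>)) (7 / (16 * \<omega>)) cutf" unfolding cutf_def[abs_def] by (rule test_on_bump)

lemma test_cutp: "test_on (1 / (16 * \<omega>)) (7 / (16 * \<omega>)) (cutp p)"
  unfolding cutp_def[abs_def] by (rule test_on_mult[OF test_cutf smooth_power[OF smooth_phase]])

lemma phase_real: "phase y = of_real (y - \<omega> * (y * y))" by (simp add: phase_def)

lemma cutp_real: "cutp p y = of_real ((y - \<omega> * (y * y)) ^ (2 * p) * bump (1 / (16 * \<omega>)) (7 / (16 * \<omega>)) y)"
  by (simp add: cutp_def cutf_def phase_real)

text \<open>On the support of \<open>cutp\<close> the function H is the constant \<open>ct\<close>
  and both sections carry the same oscillation. Apart from \<open>ct\<close> they differ by the
  factor dt / r, which is nonnegative because the real symbol is raised to an even power.\<close>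

lemma aligned:
  assumes t: "\<bar>t\<bar> \<ge> T0"
  shows "f t x * cnj (osec \<kappa> (cutp p) t x) = (ct t / of_real (cmod (ct t))) * of_real (cmod (f t x) * cmod (osec \<kappa> (cutp p) t x))"
proof -
  let ?M = "osec \<kappa> (cutp p) t x" and ?w = "x $ i / x $ j"
  define y where "y = ?w / \<bar>t\<bar>"
  define r where "r = (y - \<omega> * (y * y)) ^ (2 * p) * bump (1 / (16 * \<omega>)) (7 / (16 * \<omega>)) y"
  have T: "\<bar>t\<bar> > 0" using dom[OF t] by simp
  have r: "cutp p y = of_real r" "r \<ge> 0" by (simp_all add: cutp_real r_def bump_nonneg)
  have ct0: "cmod (ct t) > 0" using ct_lower[OF t] c0 by linarith
  have M: "?M = cis (- (sgn t * \<omega>) * ?w) * of_real r * sec pm t j (\<kappa>(i := \<lambda>_. 1)) x"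
    unfolding osec_def by (subst sec_split[OF ij]) (simp only: osc2_def r(1) y_def[symmetric])
  show ?thesis
  proof (cases "r = 0")
    case True then show ?thesis by (simp add: M)
  next
    case False
    then have y: "1 / (16 * \<omega>) \<le> y" "y \<le> 7 / (16 * \<omega>)" using test_cutp[of p] r by (auto simp: test_on_def)
    define Z where "Z = \<bar>t\<bar> / (2 * \<omega>)"
    have "Z / 8 \<le> ?w" "?w \<le> 7 / 8 * Z"
      using mult_right_mono[OF y(1), of "\<bar>t\<bar>"] mult_right_mono[OF y(2), of "\<bar>t\<bar>"] T by (simp_all add: y_def Z_def)
    moreover have "Z > 0" "l * \<bar>t\<bar> = Z" using T \<omega>_pos by (simp_all add: Z_def lu)
    ultimately have "H t ?w = ct t" using ct_range[OF t] by (intro H_mid[OF t]) linarith+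
    then have "f t x = of_real (dt t) * (cis (- (sgn t * \<omega>) * ?w) * ct t * sec pm t j (\<kappa>(i := \<lambda>_. 1)) x)"
      unfolding f_def by (subst sec_split[OF ij]) (simp only: osc_def)
    then have F: "f t x = ct t * of_real (dt t / r) * ?M" unfolding M using False by simp
    have "dt t / r \<ge> 0" using dt_bounds(1)[of t] r(2) by simp
    then have "cmod (f t x) = cmod (ct t) * (dt t / r) * cmod ?M"
      using abs_of_nonneg[of "dt t / r"] by (simp only: F norm_mult norm_of_real)
    then have "(ct t / of_real (cmod (ct t))) * of_real (cmod (f t x) * cmod ?M) = ct t * of_real (dt t / r) * (of_real (cmod ?M) * of_real (cmod ?M))"
      using ct0 by simp
    also have "of_real (cmod ?M) * of_real (cmod ?M) = ?M * cnj ?M"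
      by (simp only: complex_norm_square[symmetric] power2_eq_square of_real_mult)
    finally show ?thesis unfolding F by (simp only: mult.assoc)
  qed
qed

text \<open>By \<open>aligned\<close> there is no cancellation, so it suffices to bound both factors
  from below on a box of volume proportional to |t| inside the plateau.\<close>

lemma pairing_bound_below:
  obtains e where "e > 0" "\<And>t. \<bar>t\<bar> \<ge> T0 \<Longrightarrow> cmod (pairing i (f t) (osec \<kappa> (cutp p) t)) \<ge> e * \<bar>t\<bar>"
proof -
  obtain k0 where k0: "k0 > 0" "\<And>x. x \<in> {0..1/2} \<Longrightarrow> bump (- 1) 1 x \<ge> k0"
    by (rule bump_lower[of "- 1" 0 "1/2" 1]) auto
  obtain b0 where b0: "b0 > 0" "\<And>x. x \<in> {1 / (8 * \<omega>)..3 / (8 * \<omega>)} \<Longrightarrow> bump (1 / (16 * \<omega>)) (7 / (16 * \<omega>)) x \<ge> b0"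
    by (rule bump_lower[of "1 / (16 * \<omega>)" "1 / (8 * \<omega>)" "3 / (8 * \<omega>)" "7 / (16 * \<omega>)"]) (use \<omega>_pos in \<open>auto simp: field_simps\<close>)
  define s0 where "s0 = 2 powr (- real CARD('n) / 2) * k0 ^ card (UNIV - {j} - {i})"
  \<comment> \<open>For \<omega> y between 1/8 and 3/8 the symbol y (1 - \<omega> y) is at least 1 /
    (8 \<omega>) times 5 / 8.\<close>
  define r0 where "r0 = (5 / (64 * \<omega>)) ^ (2 * p) * b0"
  \<comment> \<open>x / (1 + x) is increasing, so this bounds the plateau height dt * |ct| from
    below.\<close>
  define d0 where "d0 = c0 / (1 + c0)"
  define e0 where "e0 = d0 * s0 * (s0 * r0)"
  define v0 where "v0 = (1 / 2) ^ card (UNIV - {j} - {i}) / (8 * \<omega>)"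
  have pos: "s0 > 0" "r0 > 0" "d0 > 0" "v0 > 0" "e0 > 0"
    using k0 b0 \<omega>_pos c0 by (simp_all add: s0_def r0_def d0_def v0_def e0_def)
  have main: "e0 * (v0 * \<bar>t\<bar>) \<le> cmod (pairing i (f t) (osec \<kappa> (cutp p) t))" if t: "\<bar>t\<bar> \<ge> T0" for t
  proof -
    let ?T = "\<bar>t\<bar>" and ?M = "osec \<kappa> (cutp p) t"
    have T: "?T > 0" using dom[OF t] by simp
    have ct0: "cmod (ct t) \<ge> c0" "cmod (ct t) > 0" using ct_lower[OF t] c0 by linarith+
    have dc: "d0 \<le> dt t * cmod (ct t)"
      using ct0 c0 by (simp add: d0_def dt_def divide_simps add_pos_nonneg) (simp add: algebra_simps)
    \<comment> \<open>The bounds 1 \<le> x_j \<le> 2 < e stay inside the annulus and put x_i / x_j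
      between |t| / (8 \<omega>) and 3 |t| / (8 \<omega>); the other ratios lie in [0, 1/2], where
      their bump is at least k0.\<close>
    define lo where "lo a = (if a = j then 1 else if a = i then ?T / (4 * \<omega>) else 0)" for a
    define hi where "hi a = (if a = j then 2 else if a = i then 3 * ?T / (8 * \<omega>) else 1 / 2)" for a
    have lohi: "lo a \<le> hi a" for a using T \<omega>_pos by (simp add: lo_def hi_def field_simps)
    let ?D = "{x :: real^'n. \<forall>a. lo a \<le> x $ a \<and> x $ a \<le> hi a}"
    have vol: "(\<Prod>a\<in>UNIV. hi a - lo a) = v0 * ?T"
    proof -
      have "(\<Prod>a\<in>UNIV. hi a - lo a) = (hi j - lo j) * ((hi i - lo i) * (\<Prod>a\<in>UNIV - {j} - {i}. hi a - lo a))"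
        using ij by (subst prod.remove[of _ j], simp, simp, subst prod.remove[of _ i]) auto
      also have "(\<Prod>a\<in>UNIV - {j} - {i}. hi a - lo a) = (\<Prod>a\<in>UNIV - {j} - {i}. 1 / 2)"
        by (rule prod.cong) (auto simp: lo_def hi_def)
      also have "(hi j - lo j) * ((hi i - lo i) * (\<Prod>a\<in>UNIV - {j} - {i}. 1 / 2)) = v0 * ?T"
        using ij \<omega>_pos by (simp add: lo_def hi_def v0_def field_simps)
      finally show ?thesis .
    qed
    show ?thesis
    proof (rule pairing_aligned[of "f t" pm t i j ?M "ct t / of_real (cmod (ct t))" ?D])
      show "f t \<in> V pm t i j" by (rule f_V[OF t])
      show "?M \<in> V pm t i j" by (rule osec_V[OF _ test_cutp test_\<kappa> t]) (use \<omega>_pos in simp)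
      show "cmod (ct t / of_real (cmod (ct t))) = 1" using ct0 by (simp add: norm_divide)
      show "f t x * cnj (?M x) = ct t / of_real (cmod (ct t)) * of_real (cmod (f t x) * cmod (?M x))" for x
        by (rule aligned[OF t])
      show "?D \<in> sets borel" by (rule emeasure_box[OF lohi])
      show "emeasure lborel ?D = ennreal (v0 * ?T)" by (simp only: emeasure_box(2)[of lo hi, OF lohi] vol)
      show "?D \<subseteq> annulus (\<lambda>x. \<bar>x $ j\<bar>)"
      proof
        fix x assume x: "x \<in> ?D"
        have "lo j \<le> x $ j" "x $ j \<le> hi j" using x by blast+
        then show "x \<in> annulus (\<lambda>x. \<bar>x $ j\<bar>)" using exp_lower_Taylor_quadratic[of 1]
          by (auto simp: annulus_def lo_def hi_def abs_if)
      qed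
      show "e0 \<le> cmod (f t x) * cmod (?M x)" if x: "x \<in> ?D" for x
      proof -
        let ?w = "x $ i / x $ j"
        define y where "y = ?w / ?T"
        have X: "lo a \<le> x $ a \<and> x $ a \<le> hi a" for a using x by blast
        have xj: "1 \<le> x $ j" "x $ j \<le> 2" using X[of j] by (auto simp: lo_def hi_def)
        have xi: "?T / (4 * \<omega>) \<le> x $ i" "x $ i \<le> 3 * ?T / (8 * \<omega>)" using X[of i] ij by (auto simp: lo_def hi_def)
        have pi: "?T / (4 * \<omega>) > 0" using T \<omega>_pos by simp
        have w: "?T / (8 * \<omega>) \<le> ?w" "?w \<le> 3 * ?T / (8 * \<omega>)"
        proof -
          have "?T / (8 * \<omega>) * x $ j \<le> ?T / (8 * \<omega>) * 2" using xj T \<omega>_pos by (intro mult_left_mono) auto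
          also have "\<dots> \<le> x $ i" using xi by simp
          finally show "?T / (8 * \<omega>) \<le> ?w" using xj by (simp add: le_divide_eq)
          have "?w \<le> x $ i / 1" using xj xi pi by (intro divide_left_mono) auto
          then show "?w \<le> 3 * ?T / (8 * \<omega>)" using xi by simp
        qed
        have y: "1 / (8 * \<omega>) \<le> y" "y \<le> 3 / (8 * \<omega>)"
          using divide_right_mono[OF w(1), of ?T] divide_right_mono[OF w(2), of ?T] T by (simp_all add: y_def)
        have kap: "k0 \<le> cmod (\<kappa> a (x $ a / x $ j))" if "a \<noteq> j" "a \<noteq> i" for a
        proof -
          have xa: "0 \<le> x $ a" "x $ a \<le> 1 / 2" using X[of a] that by (auto simp: lo_def hi_def)
          have "x $ a / x $ j \<le> x $ a / 1" using xj xa by (intro divide_left_mono) auto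
          then have "x $ a / x $ j \<in> {0..1/2}" using xa xj by auto
          from k0(2)[OF this] show ?thesis by (simp add: \<kappa>_def bump_nonneg)
        qed
        have "H t ?w = ct t"
        proof (rule H_mid[OF t])
          define Z where "Z = ?T / (2 * \<omega>)"
          have "Z / 4 \<le> ?w" "?w \<le> 3 / 4 * Z" using w by (simp_all add: Z_def)
          moreover have "Z > 0" "l * ?T = Z" "ub > 0" using T \<omega>_pos ub lb_pos by (simp_all add: Z_def lu)
          ultimately show "ub \<le> ?w" "?w \<le> l * ?T" using ct_range[OF t] by linarith+
        qed
        then have o1: "cmod (osc \<omega> (H t) t ?w) \<ge> cmod (ct t)" by (simp add: osc_def norm_mult)
        have o2: "cmod (osc2 \<omega> (cutp p) t ?w) \<ge> r0"
        proof -
          have "\<omega> * y \<le> \<omega> * (3 / (8 * \<omega>))" using y \<omega>_pos by (intro mult_left_mono) auto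
          then have "1 - \<omega> * y \<ge> 5 / 8" using \<omega>_pos by simp
          then have "1 / (8 * \<omega>) * (5 / 8) \<le> y * (1 - \<omega> * y)" using y \<omega>_pos by (intro mult_mono) (auto intro: order_trans[of 0 "1 / (8 * \<omega>)"])
          then have "5 / (64 * \<omega>) \<le> y - \<omega> * (y * y)" by (simp add: algebra_simps)
          then have "(5 / (64 * \<omega>)) ^ (2 * p) \<le> (y - \<omega> * (y * y)) ^ (2 * p)" using \<omega>_pos by (intro power_mono) auto
          then have "r0 \<le> (y - \<omega> * (y * y)) ^ (2 * p) * bump (1 / (16 * \<omega>)) (7 / (16 * \<omega>)) y"
            unfolding r0_def using b0 y \<omega>_pos by (intro mult_mono) auto
          also have "\<dots> \<le> cmod (cutp p y)" unfolding cutp_real norm_of_real by (rule abs_ge_self)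
          finally show ?thesis by (simp add: osc2_def norm_mult y_def)
        qed
        have "s0 * cmod (ct t) \<le> cmod (sec pm t j (\<kappa>(i := osc \<omega> (H t) t)) x)"
          unfolding s0_def mult.assoc by (rule sec_lower[OF ij xj]) (use kap k0(1) o1 in auto)
        then have F: "dt t * (s0 * cmod (ct t)) \<le> cmod (f t x)"
          using dt_bounds(1)[of t] by (simp add: f_def norm_mult)
        have M: "s0 * r0 \<le> cmod (?M x)"
          unfolding osec_def s0_def mult.assoc by (rule sec_lower[OF ij xj]) (use kap k0(1) o2 pos in auto)
        have "d0 * s0 \<le> dt t * cmod (ct t) * s0" using dc pos by (intro mult_right_mono) auto
        then have "d0 * s0 \<le> cmod (f t x)" using F by (simp add: mult_ac)
        then show ?thesis unfolding e0_def using M pos by (intro mult_mono) auto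
      qed
    qed (use pos T in auto)
  qed
  show ?thesis by (rule that[of "e0 * v0"]) (use pos main in \<open>auto simp: mult.assoc\<close>)
qed

text \<open>W is (I - a^2)^p K divided by its size |t|^(4 p): a multiple of the section with slot
  \<open>cutp p\<close>, which is aligned with f, plus R / |t|. The norms of order |t| for f and
  sqrt |t| for R give an error of order sqrt |t| against a main term of order |t|.\<close>

lemma pairing_lower:
  assumes \<beta>: "\<beta> \<noteq> 0"
  obtains K W c T1 where "K \<in> Q" "W \<in> Q" "c > 0" "T1 \<ge> T0"
    "\<And>t. \<bar>t\<bar> \<ge> T0 \<Longrightarrow> (resolv (\<beta> *\<^sub>R eunit j i) ^^ p) (K t) = (\<lambda>x. of_real (\<bar>t\<bar> ^ (4 * p)) * W t x)"
    "\<And>t. \<bar>t\<bar> \<ge> T1 \<Longrightarrow> cmod (pairing i (f t) (W t)) \<ge> c * \<bar>t\<bar>"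
proof -
  have w0: "1 / (16 * \<omega>) > 0" using \<omega>_pos by simp
  let ?K = "osec \<kappa> cutf" and ?M = "osec \<kappa> (cutp p)" and ?B = "\<beta> ^ (2 * p)"
  define R where "R = (\<lambda>t x. of_real \<bar>t\<bar> * (of_real ((1 / \<bar>t\<bar>) ^ (4 * p)) * (resolv (\<beta> *\<^sub>R eunit j i) ^^ p) (?K t) x -
      of_real ?B * osec \<kappa> (\<lambda>y. phase y ^ (2 * p) * cutf y) t x))"
  have RQ: "R \<in> Q" unfolding R_def by (rule resolv_power_osec[OF w0 test_cutf test_\<kappa>])
  define W where "W = (\<lambda>t x. of_real ?B * ?M t x + of_real (1 / \<bar>t\<bar>) * R t x)"
  have KQ: "?K \<in> Q" by (rule osec_Q[OF w0 test_cutf test_\<kappa>])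
  have MQ: "?M \<in> Q" by (rule osec_Q[OF w0 test_cutp test_\<kappa>])
  have WQ: "W \<in> Q" unfolding W_def by (intro fspan.add fspan_scale div_X MQ RQ)
  have B: "?B > 0" using \<beta> by (simp add: power_mult)
  have res: "(resolv (\<beta> *\<^sub>R eunit j i) ^^ p) (?K t) = (\<lambda>x. of_real (\<bar>t\<bar> ^ (4 * p)) * W t x)" if "\<bar>t\<bar> \<ge> T0" for t
  proof
    fix x
    have alg: "Z ^ n * (B * m + 1 / Z * (Z * ((1 / Z) ^ n * y - B * m))) = y" if "Z \<noteq> 0" for Z B m y :: complex and n
    proof -
      have "Z ^ n * ((1 / Z) ^ n * y) = y" using that by (simp add: power_one_over)
      moreover have "1 / Z * (Z * ((1 / Z) ^ n * y - B * m)) = (1 / Z) ^ n * y - B * m" using that by simp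
      ultimately show ?thesis by simp
    qed
    show "(resolv (\<beta> *\<^sub>R eunit j i) ^^ p) (?K t) x = of_real (\<bar>t\<bar> ^ (4 * p)) * W t x"
      unfolding W_def R_def cutp_def[abs_def] of_real_power[of "\<bar>t\<bar>"] of_real_power[of "1 / \<bar>t\<bar>"] of_real_divide of_real_1
      by (rule alg[symmetric]) (use dom[OF that] in simp)
  qed
  obtain e where e: "e > 0" "\<And>t. \<bar>t\<bar> \<ge> T0 \<Longrightarrow> cmod (pairing i (f t) (?M t)) \<ge> e * \<bar>t\<bar>" by (rule pairing_bound_below) blast
  obtain Cf where Cf: "Cf \<ge> 0" "\<And>t. \<bar>t\<bar> \<ge> T0 \<Longrightarrow> l2norm (f t) \<le> Cf * \<bar>t\<bar>" by (rule f_norm) blast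
  obtain CR where CR: "CR > 0" "\<And>t. \<bar>t\<bar> \<ge> T0 \<Longrightarrow> l2norm (R t) \<le> CR * sqrt \<bar>t\<bar>" by (rule Q_norm[OF RQ]) blast
  define c where "c = ?B * e / 2"
  have c: "c > 0" using B e by (simp add: c_def)
  \<comment> \<open>From here on the error is at most c |t|, half of the main term.\<close>
  define T1 where "T1 = max T0 ((Cf * CR / c)\<^sup>2)"
  have low: "cmod (pairing i (f t) (W t)) \<ge> c * \<bar>t\<bar>" if T: "\<bar>t\<bar> \<ge> T1" for t
  proof -
    let ?T = "\<bar>t\<bar>"
    have t: "?T \<ge> T0" "Cf * CR / c \<le> sqrt ?T" using T real_le_rsqrt by (auto simp: T1_def)
    have T0': "?T > 0" using dom[OF t(1)] by simp
    have "pairing i (f t) (W t) = of_real ?B * pairing i (f t) (?M t) + of_real (1 / ?T) * pairing i (f t) (R t)"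
      unfolding W_def by (rule pairing_comb[OF f_V[OF t(1)] Q_V[OF MQ t(1)] Q_V[OF RQ t(1)]])
    then have "cmod (pairing i (f t) (W t)) \<ge> cmod (of_real ?B * pairing i (f t) (?M t)) - cmod (of_real (1 / ?T) * pairing i (f t) (R t))"
      using norm_diff_ineq by metis
    moreover have "cmod (of_real ?B * pairing i (f t) (?M t)) \<ge> ?B * (e * ?T)"
      unfolding norm_mult norm_of_real using B e(1) e(2)[OF t(1)] T0' by (intro mult_mono) auto
    moreover have "cmod (of_real (1 / ?T) * pairing i (f t) (R t)) \<le> c * ?T"
    proof -
      have "cmod (pairing i (f t) (R t)) \<le> l2norm (f t) * l2norm (R t)"
        by (rule pairing_le[OF V_ind_space[OF f_V[OF t(1)]] V_ind_space[OF Q_V[OF RQ t(1)]]])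
      also have "\<dots> \<le> Cf * ?T * (CR * sqrt ?T)" using Cf(1) by (intro mult_mono Cf(2) CR(2) t) auto
      finally have "cmod (of_real (1 / ?T) * pairing i (f t) (R t)) \<le> 1 / ?T * (Cf * ?T * (CR * sqrt ?T))"
        unfolding norm_mult norm_of_real using T0' by (intro mult_mono) auto
      also have "\<dots> = Cf * CR * sqrt ?T" using T0' by simp
      also have "\<dots> \<le> c * sqrt ?T * sqrt ?T"
        using t(2) c by (intro mult_right_mono) (auto simp: divide_le_eq mult.commute)
      finally show ?thesis by (simp add: mult.assoc)
    qed
    ultimately show ?thesis by (simp add: c_def)
  qed
  show ?thesis by (rule that[of ?K W c T1, OF KQ WQ c _ res low]) (simp_all add: T1_def)
qed

text \<open>Inserts the sizes of f paired with K', of K and of K' into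
  \<open>fractional_power_lower\<close> and solves for N. For s = 0 the norm is that of f itself,
  and the square of Cauchy-Schwarz is the same inequality with m = 1 and p = 0.\<close>

lemma apow_lower:
  assumes \<beta>: "\<beta> \<noteq> 0" and s: "(s = 0 \<and> p = 0 \<and> m = 1) \<or> (s > 0 \<and> 2 * real p < 2 ^ m * s)"
  obtains c T1 where "c > 0" "T1 \<ge> T0"
    "\<And>t. \<bar>t\<bar> \<ge> T1 \<Longrightarrow> \<exists>N\<ge>0. apow_norm pm t s (\<beta> *\<^sub>R eunit j i) (f t) N \<and> c * \<bar>t\<bar> powr (4 * real p + 2 ^ m / 2) \<le> N ^ (2 ^ m)"
proof -
  obtain K W c T1 where K: "K \<in> Q" "W \<in> Q" "c > 0" "T1 \<ge> T0"
    and res: "\<And>t. \<bar>t\<bar> \<ge> T0 \<Longrightarrow> (resolv (\<beta> *\<^sub>R eunit j i) ^^ p) (K t) = (\<lambda>x. of_real (\<bar>t\<bar> ^ (4 * p)) * W t x)"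
    and low: "\<And>t. \<bar>t\<bar> \<ge> T1 \<Longrightarrow> cmod (pairing i (f t) (W t)) \<ge> c * \<bar>t\<bar>"
    by (rule pairing_lower[OF \<beta>, of p]) blast
  obtain CK where CK: "CK > 0" "\<And>t. \<bar>t\<bar> \<ge> T0 \<Longrightarrow> l2norm (K t) \<le> CK * sqrt \<bar>t\<bar>" by (rule Q_norm[OF K(1)]) blast
  obtain CW where CW: "CW > 0" "\<And>t. \<bar>t\<bar> \<ge> T0 \<Longrightarrow> l2norm (W t) \<le> CW * sqrt \<bar>t\<bar>" by (rule Q_norm[OF K(2)]) blast
  define n where "n = (2::nat) ^ m - 1"
  have n: "2 ^ m = Suc n" by (simp add: n_def)
  \<comment> \<open>Chosen so that the upper bounds for the norms of K and K' appear as a common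
    factor on both sides and can be cancelled.\<close>
  define c' where "c' = c ^ Suc n / (CK * CW ^ n)"
  have c': "c' > 0" using K CK CW by (simp add: c'_def)
  have "\<exists>N\<ge>0. apow_norm pm t s (\<beta> *\<^sub>R eunit j i) (f t) N \<and> c' * \<bar>t\<bar> powr (4 * real p + 2 ^ m / 2) \<le> N ^ (2 ^ m)" if T: "\<bar>t\<bar> \<ge> T1" for t
  proof -
    let ?T = "\<bar>t\<bar>" and ?a = "\<beta> *\<^sub>R eunit j i"
    let ?K' = "(resolv ?a ^^ p) (K t)"
    have t: "?T \<ge> T0" using T K(4) by simp
    have T0': "?T > 0" using dom[OF t] by simp
    note fV = f_V[OF t] and KV = Q_V[OF K(1) t] and WV = Q_V[OF K(2) t]
    have "\<exists>N\<ge>0. apow_norm pm t s ?a (f t) N \<and> cmod (pairing i (f t) ?K') ^ (2 ^ m) \<le> N ^ (2 ^ m) * (l2norm (K t) * l2norm ?K' ^ (2 ^ m - 1))"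
      using s
    proof (elim disjE conjE)
      assume s0: "s = 0" "p = 0" "m = 1"
      have "cmod (pairing i (f t) (K t)) \<le> l2norm (f t) * l2norm (K t)"
        by (rule pairing_le[OF V_ind_space[OF fV] V_ind_space[OF KV]])
      then have "cmod (pairing i (f t) (K t)) ^ 2 \<le> (l2norm (f t) * l2norm (K t)) ^ 2" by (rule power_mono) simp
      then show ?thesis using s0 ind_space_hnorm2(2)[OF V_ind_space[OF fV]]
        by (intro exI[of _ "l2norm (f t)"]) (simp add: apow_norm_def power_mult_distrib power2_eq_square mult_ac)
    next
      assume s0: "s > 0" "2 * real p < 2 ^ m * s"
      obtain h where h: "h \<in> ind_space pm t" "bop i j \<beta> s h = f t"
        by (rule fractional_power[OF fV ij \<beta> s0(1)]) blast
      have "apow_norm pm t s ?a (f t) (l2norm h)"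
        unfolding apow_norm_def using s0(1) ind_space_hnorm2(2)[OF h(1)] h
        by (auto simp: bessel_op_bop[OF ij] hnorm2_def intro!: bexI[of _ h])
      moreover have "cmod (pairing i (f t) ?K') ^ (2 ^ m) \<le> l2norm h ^ (2 ^ m) * (l2norm (K t) * l2norm ?K' ^ (2 ^ m - 1))"
        using fractional_power_lower[OF h(1) KV ij \<beta> s0] unfolding h(2) .
      ultimately show ?thesis by (intro exI[of _ "l2norm h"]) simp
    qed
    then obtain N where N: "N \<ge> 0" "apow_norm pm t s ?a (f t) N"
      "cmod (pairing i (f t) ?K') ^ Suc n \<le> N ^ Suc n * (l2norm (K t) * l2norm ?K' ^ n)" unfolding n by auto
    define E q where "E = ?T ^ (4 * p)" and "q = sqrt ?T"
    have Eq: "E > 0" "q > 0" "q * q = ?T" using T0' by (simp_all add: E_def q_def)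
    have K': "?K' = (\<lambda>x. of_real E * W t x)" unfolding E_def by (rule res[OF t])
    have lK': "l2norm ?K' = E * l2norm (W t)"
      unfolding K' using Eq by (subst l2norm_cmult[OF V_measurable[OF WV]]) simp
    have pK': "pairing i (f t) ?K' = of_real E * pairing i (f t) (W t)"
      unfolding K' using pairing_comb[OF fV WV WV, of E 0] by simp
    have "E * (c * (q * q)) \<le> cmod (pairing i (f t) ?K')"
      unfolding pK' norm_mult norm_of_real Eq(3) using low[OF T] Eq(1) by simp
    then have "(E * (c * (q * q))) ^ Suc n \<le> cmod (pairing i (f t) ?K') ^ Suc n"
      using Eq K(3) by (intro power_mono) auto
    also have "\<dots> \<le> N ^ Suc n * (l2norm (K t) * l2norm ?K' ^ n)" by (rule N(3))
    also have "\<dots> \<le> N ^ Suc n * (CK * q * (E * (CW * q)) ^ n)"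
      unfolding lK' q_def using N(1) Eq(1) CK CW t by (intro mult_mono power_mono mult_nonneg_nonneg) auto
    finally have "c' * (E * q ^ Suc n) * (CK * q * (E * (CW * q)) ^ n) \<le> N ^ Suc n * (CK * q * (E * (CW * q)) ^ n)"
      using CK CW by (simp add: c'_def power_mult_distrib field_simps)
    then have "c' * (E * q ^ Suc n) \<le> N ^ Suc n"
      by (rule mult_right_le_imp_le) (use CK CW Eq in simp)
    moreover have "E * q ^ Suc n = ?T powr (4 * real p + 2 ^ m / 2)"
    proof -
      have "q ^ Suc n = q powr real (Suc n)" using Eq by (simp only: powr_realpow)
      also have "\<dots> = ?T powr (2 ^ m / 2)"
        unfolding q_def powr_half_sqrt[of ?T, OF less_imp_le[OF T0'], symmetric] powr_powr using n by (simp flip: n)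
      finally have "q ^ Suc n = ?T powr (2 ^ m / 2)" .
      moreover have "E = ?T powr (4 * real p)" unfolding E_def using powr_realpow[OF T0', of "4 * p"] by simp
      ultimately show ?thesis by (simp add: powr_add)
    qed
    ultimately show ?thesis using N n by (intro exI[of _ N]) simp
  qed
  then show ?thesis using that[of c' T1] c' K(4) by blast
qed

end

text \<open>With L = 2^m and 2 p \<ge> L s - 2, the exponent is at least L (s + 1/2 - \<sigma>) - 4,
  which is positive once L exceeds 4 / \<epsilon>: the rounding of p costs a constant, the gap is
  multiplied by L.\<close>

lemma exponent_choice:
  fixes s \<sigma> :: real
  assumes "s \<ge> 0" "\<sigma> < s + 1 / 2"
  obtains m p :: nat where "m \<ge> 1" "(s = 0 \<and> p = 0 \<and> m = 1) \<or> (s > 0 \<and> 2 * real p < 2 ^ m * s)"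
    "4 * real p + 2 ^ m / 2 - (s + \<sigma>) * 2 ^ m > 0"
proof (cases "s = 0")
  case True
  then show ?thesis using assms by (intro that[of 1 0]) auto
next
  case False
  define \<epsilon> where "\<epsilon> = s + 1 / 2 - \<sigma>"
  have \<epsilon>: "\<epsilon> > 0" using assms by (simp add: \<epsilon>_def)
  obtain m0 where m0: "4 / \<epsilon> < 2 ^ m0" using real_arch_pow[of 2 "4 / \<epsilon>"] by auto
  define m where "m = Suc m0"
  define L :: real where "L = 2 ^ m"
  have "(2::real) ^ m0 \<le> L" by (simp add: L_def m_def)
  then have L: "4 / \<epsilon> < L" using m0 by linarith
  have "L > 0" by (simp add: L_def)
  note L = L this
  \<comment> \<open>The largest integer strictly below L s / 2. Strictness leaves a Bessel operator
    of positive order after p cancellations.\<close>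
  define p where "p = nat (\<lceil>L * s / 2\<rceil> - 1)"
  have "L * s / 2 > 0" using False assms L by simp
  then have "\<lceil>L * s / 2\<rceil> \<ge> 1" by linarith
  then have "real p = of_int \<lceil>L * s / 2\<rceil> - 1" by (simp add: p_def)
  then have p: "real p < L * s / 2" "L * s / 2 \<le> real p + 1" by linarith+
  have "4 < L * \<epsilon>" using L \<epsilon> by (simp add: divide_less_eq)
  then have "4 * real p + L / 2 - (s + \<sigma>) * L > 0"
    using p(2) unfolding \<epsilon>_def by (simp add: algebra_simps)
  then show ?thesis
    using p(1) False assms by (intro that[of m p]) (auto simp: L_def m_def field_simps)
qed

text \<open>The comparison is made between 2^m-th powers: |t| has the exponent 4 p + 2^m / 2 for f
  and (s + \<sigma>) 2^m for g. The difference \<gamma> is positive by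
  \<open>exponent_choice\<close>, so large |t| absorb C and all constants.\<close>

lemma coboundary_estimate:
  fixes i j :: "'n::finite" and B :: "'n mat set"
  assumes ij: "i \<noteq> j" and \<alpha>: "\<alpha> \<noteq> 0" and \<beta>: "\<beta> \<noteq> 0" and B: "finite B"
    and s: "s \<ge> 0" and \<sigma>: "0 \<le> \<sigma>" "\<sigma> < s + 1 / 2"
  shows "\<exists>\<delta>>0. \<forall>t. \<bar>t\<bar> \<ge> \<delta> \<longrightarrow> (\<exists>f g. smooth_vec pm t B f \<and> smooth_vec pm t B g \<and>
     hnorm2 (\<lambda>x. pi_exp (\<alpha> *\<^sub>R eunit i j) f x - f x - g x) = 0 \<and>
     (\<exists>N. apow_norm pm t s (\<beta> *\<^sub>R eunit j i) f N \<and> ennreal (N\<^sup>2) > ennreal (C\<^sup>2) * sob2 pm t B (s + \<sigma>) g))"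
proof -
  define \<omega> where "\<omega> = 2 * pi / \<bar>\<alpha>\<bar>"
  have \<omega>: "\<omega> > 0" using \<alpha> by (simp add: \<omega>_def)
  define l u where "l = 1 / (2 * \<omega>)" and "u = 3 / (2 * \<omega>)"
  have l: "l > 0" using \<omega> by (simp add: l_def)
  obtain c0 T1 where c0: "c0 > 0" "T1 \<ge> 1"
    "\<And>T. T \<ge> T1 \<Longrightarrow> integral {T / (2 * \<omega>)..3 * T / (2 * \<omega>)}
        (\<lambda>w. sin (\<omega> * w - T * ln w - (T - T * ln (T / \<omega>))) * bump (1 / (2 * \<omega>)) (3 / (2 * \<omega>)) (w / T)) \<ge> c0 * sqrt T"
    by (rule oscillatory_lower[OF \<omega>]) blast
  \<comment> \<open>T1 serves the oscillatory integral; the second term makes room for the bump on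
    [|\<alpha>| + 1, |\<alpha>| + 2] to the left of l * |t| / 8.\<close>
  define T0 where "T0 = max T1 (8 * (\<bar>\<alpha>\<bar> + 2) / l)"
  have T0: "T0 \<ge> T1" "T0 \<ge> 1" "8 * (\<bar>\<alpha>\<bar> + 2) \<le> l * T0"
    using c0(2) l by (auto simp: T0_def le_max_iff_disj mult.commute[of l] simp flip: pos_divide_le_eq)
  interpret C: cohomology i j \<alpha> \<omega> l u "\<bar>\<alpha>\<bar> + 1" "\<bar>\<alpha>\<bar> + 2" T0 pm c0
  proof
    show "\<bar>\<alpha>\<bar> < l * T0" using T0(3) abs_ge_zero[of \<alpha>] by argo
    show "c0 * sqrt T \<le> integral {T / (2 * \<omega>)..3 * T / (2 * \<omega>)}
        (\<lambda>w. sin (\<omega> * w - T * ln w - (T - T * ln (T / \<omega>))) * bump (1 / (2 * \<omega>)) (3 / (2 * \<omega>)) (w / T))" if "T0 \<le> T" for T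
      using c0(3)[of T] T0(1) that by linarith
  qed (use ij l T0 \<alpha> c0 in \<open>auto simp: \<omega>_def l_def u_def\<close>)
  obtain m p where mp: "m \<ge> 1" "(s = 0 \<and> p = 0 \<and> m = 1) \<or> (s > 0 \<and> 2 * real p < 2 ^ m * s)"
    "4 * real p + 2 ^ m / 2 - (s + \<sigma>) * 2 ^ m > 0"
    by (rule exponent_choice[OF s \<sigma>(2)]) blast
  define \<gamma> where "\<gamma> = 4 * real p + 2 ^ m / 2 - (s + \<sigma>) * 2 ^ m"
  have \<gamma>: "\<gamma> > 0" using mp(3) by (simp add: \<gamma>_def)
  obtain A where A: "A \<ge> 0" "\<And>t. \<bar>t\<bar> \<ge> T0 \<Longrightarrow> sob2 pm t B (s + \<sigma>) (C.g t) \<le> ennreal (A * \<bar>t\<bar> powr (2 * (s + \<sigma>)))"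
    by (rule C.sob2_S[OF C.g_S B, of "s + \<sigma>"]) (use s \<sigma> in auto)
  obtain c T2 where c: "c > 0" "T2 \<ge> T0" "\<And>t. \<bar>t\<bar> \<ge> T2 \<Longrightarrow> \<exists>N\<ge>0. apow_norm pm t s (\<beta> *\<^sub>R eunit j i) (C.f t) N \<and>
      c * \<bar>t\<bar> powr (4 * real p + 2 ^ m / 2) \<le> N ^ (2 ^ m)"
    by (rule C.apow_lower[OF \<beta> mp(2)]) blast
  \<comment> \<open>\<open>apow_lower\<close> controls N^(2^m) while the claim concerns N^2; m \<ge>
    1 makes 2^m = 2 k even.\<close>
  define k where "k = (2::nat) ^ (m - 1)"
  have k: "2 ^ m = 2 * k" using mp(1) by (cases m) (auto simp: k_def)
  have kr: "(2::real) ^ m = 2 * real k" using mp(1) by (cases m) (auto simp: k_def)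
  define Z where "Z = (C\<^sup>2 * A) ^ k"
  have Z: "Z \<ge> 0" using A by (simp add: Z_def)
  \<comment> \<open>Beyond this value c |t|^\<gamma> is at least Z + 1, which contradicts the bound
    Z that the negated claim would give.\<close>
  define \<delta> where "\<delta> = max T2 (((Z + 1) / c) powr (1 / \<gamma>))"
  have "\<delta> > 0" using T0 c(2) by (simp add: \<delta>_def less_max_iff_disj)
  moreover have "\<exists>f g. smooth_vec pm t B f \<and> smooth_vec pm t B g \<and>
     hnorm2 (\<lambda>x. pi_exp (\<alpha> *\<^sub>R eunit i j) f x - f x - g x) = 0 \<and>
     (\<exists>N. apow_norm pm t s (\<beta> *\<^sub>R eunit j i) f N \<and> ennreal (N\<^sup>2) > ennreal (C\<^sup>2) * sob2 pm t B (s + \<sigma>) g)" if t: "\<bar>t\<bar> \<ge> \<delta>" for t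
  proof -
    let ?T = "\<bar>t\<bar>"
    have tT: "?T \<ge> T2" "?T \<ge> T0" "?T > 0" using t c(2) T0 by (auto simp: \<delta>_def)
    obtain N where N: "N \<ge> 0" "apow_norm pm t s (\<beta> *\<^sub>R eunit j i) (C.f t) N"
      "c * ?T powr (4 * real p + 2 ^ m / 2) \<le> N ^ (2 ^ m)" using c(3)[OF tT(1)] by blast
    have "C\<^sup>2 * (A * ?T powr (2 * (s + \<sigma>))) < N\<^sup>2"
    proof (rule ccontr)
      assume "\<not> C\<^sup>2 * (A * ?T powr (2 * (s + \<sigma>))) < N\<^sup>2"
      then have "(N\<^sup>2) ^ k \<le> (C\<^sup>2 * (A * ?T powr (2 * (s + \<sigma>)))) ^ k" by (intro power_mono) auto
      also have "\<dots> = Z * ?T powr ((s + \<sigma>) * 2 ^ m)"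
      proof -
        have "(?T powr (2 * (s + \<sigma>))) ^ k = ?T powr ((s + \<sigma>) * 2 ^ m)"
          using tT(3) by (subst powr_realpow[symmetric]) (auto simp: powr_powr kr mult_ac)
        then show ?thesis by (simp add: Z_def power_mult_distrib mult.assoc)
      qed
      finally have "c * ?T powr (4 * real p + 2 ^ m / 2) \<le> Z * ?T powr ((s + \<sigma>) * 2 ^ m)"
        using N(3) by (simp add: k power_mult)
      moreover have "?T powr (4 * real p + 2 ^ m / 2) = ?T powr \<gamma> * ?T powr ((s + \<sigma>) * 2 ^ m)"
        by (simp add: \<gamma>_def flip: powr_add)
      ultimately have "c * ?T powr \<gamma> \<le> Z" using tT(3) by (simp flip: mult.assoc)
      moreover have "(Z + 1) / c \<le> ?T powr \<gamma>"
      proof -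
        have "(Z + 1) / c = (((Z + 1) / c) powr (1 / \<gamma>)) powr \<gamma>" using Z c(1) \<gamma> by (simp add: powr_powr)
        also have "\<dots> \<le> ?T powr \<gamma>" using t \<gamma> by (intro powr_mono2) (auto simp: \<delta>_def)
        finally show ?thesis .
      qed
      ultimately show False using c(1) by (simp add: divide_le_eq mult.commute)
    qed
    moreover have "0 \<le> C\<^sup>2 * (A * ?T powr (2 * (s + \<sigma>)))" by (intro mult_nonneg_nonneg) (use A(1) in auto)
    ultimately have "ennreal (C\<^sup>2 * (A * ?T powr (2 * (s + \<sigma>)))) < ennreal (N\<^sup>2)"
      by (intro ennreal_lessI) linarith+
    moreover have "ennreal (C\<^sup>2) * sob2 pm t B (s + \<sigma>) (C.g t) \<le> ennreal (C\<^sup>2 * (A * ?T powr (2 * (s + \<sigma>))))"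
      using mult_left_mono[OF A(2)[OF tT(2)], of "ennreal (C\<^sup>2)"] by (simp add: ennreal_mult')
    ultimately have "ennreal (C\<^sup>2) * sob2 pm t B (s + \<sigma>) (C.g t) < ennreal (N\<^sup>2)" by (rule le_less_trans[rotated])
    moreover have "hnorm2 (\<lambda>x. pi_exp (\<alpha> *\<^sub>R eunit i j) (C.f t) x - C.f t x - C.g t x) = 0"
      by (simp add: C.cohomological_equation[OF tT(2)] hnorm2_def)
    moreover have "smooth_vec pm t B (C.f t)" "smooth_vec pm t B (C.g t)"
      by (rule V_smooth_vec[OF ij C.f_V[OF tT(2)]], rule V_smooth_vec[OF ij C.S_V[OF C.g_S tT(2)]])
    ultimately show ?thesis using N(2) by blast
  qed
  ultimately show ?thesis by blast
qed

theorem theorem2p2: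
  fixes ip :: "'n::finite mat \<Rightarrow> 'n mat \<Rightarrow> real"
    and B :: "'n mat set"
    and \<phi> :: "'n mat \<Rightarrow> real"
    and v a :: "'n mat"
    and s \<sigma> C :: real
  assumes "CARD('n) \<ge> 2"
    and "sl_inner ip"
    and "sl_basis B"
    and "is_root \<phi>"
    and "v \<in> root_space \<phi>" and "ip v v = 1"
    and "a \<in> root_space (\<lambda>H. - \<phi> H)" and "ip a a = 1"
    and "s \<ge> 0" and "0 \<le> \<sigma>" and "\<sigma> < s + 1 / 2"
    and "C > 0"
  shows "\<exists>\<delta>>0. \<forall>t. \<bar>t\<bar> \<ge> \<delta> \<longrightarrow> (\<forall>pm::bool.
           \<exists>f g. smooth_vec pm t B f \<and> smooth_vec pm t B g \<and>
             hnorm2 (\<lambda>x. pi_exp v f x - f x - g x) = 0 \<and>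
             (\<exists>N. apow_norm pm t s a f N \<and>
                  ennreal (N\<^sup>2) > ennreal (C\<^sup>2) * sob2 pm t B (s + \<sigma>) g))"
proof -
  have "v \<noteq> 0" "a \<noteq> 0"
    using sl_inner_unit_nonzero[OF assms(2)] assms(5-8) by (auto simp: root_space_def)
  then obtain i j \<alpha> \<beta> where r: "i \<noteq> j" "\<alpha> \<noteq> 0" "\<beta> \<noteq> 0" "v = \<alpha> *\<^sub>R eunit i j" "a = \<beta> *\<^sub>R eunit j i"
    using root_vectors[OF assms(4,5) _ assms(7)] by metis
  have "finite B" using assms(3) by (simp add: sl_basis_def independent_bound_general)
  define P where "P pm t \<longleftrightarrow> (\<exists>f g. smooth_vec pm t B f \<and> smooth_vec pm t B g \<and>
      hnorm2 (\<lambda>x. pi_exp v f x - f x - g x) = 0 \<and>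
      (\<exists>N. apow_norm pm t s a f N \<and> ennreal (N\<^sup>2) > ennreal (C\<^sup>2) * sob2 pm t B (s + \<sigma>) g))" for pm t
  have "\<exists>\<delta>>0. \<forall>t. \<bar>t\<bar> \<ge> \<delta> \<longrightarrow> P pm t" for pm
    unfolding P_def using coboundary_estimate[OF r(1-3) \<open>finite B\<close> assms(9-11), of pm C] unfolding r(4,5) .
  \<comment> \<open>The estimate is available for one sign at a time, while a single threshold has
    to serve both; hence the maximum.\<close>
  then obtain \<delta>1 \<delta>2 where "\<delta>1 > 0" "\<forall>t. \<bar>t\<bar> \<ge> \<delta>1 \<longrightarrow> P True t" "\<delta>2 > 0" "\<forall>t. \<bar>t\<bar> \<ge> \<delta>2 \<longrightarrow> P False t"
    by blast
  then have "max \<delta>1 \<delta>2 > 0 \<and> (\<forall>t. \<bar>t\<bar> \<ge> max \<delta>1 \<delta>2 \<longrightarrow> (\<forall>pm. P pm t))"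
    by (simp add: all_bool_eq)
  then show ?thesis unfolding P_def by blast
qed

end
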